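(* Cohomological dimension is not a profinite property; that is, there exist finitely generated residually finite groups $\Gamma_1$ and $\Gamma_2$ with $\hat\Gamma_1 \simeq \hat\Gamma_2$ and $\mathrm{cd}(\Gamma_1) \ne \mathrm{cd}(\Gamma_2)$.
   Context: A property $P$ of groups is called a profinite property if whenever $\Gamma_1$ and $\Gamma_2$ are finitely generated residually finite groups with $\hat\Gamma_1 \simeq \hat\Gamma_2$ and $\Gamma_1$ has $P$, so does $\Gamma_2$. A numerical invariant of groups is a profinite property if it takes equal values on any two finitely generated residually finite groups with isomorphic profinite completions. Here $\hat\Gamma$ denotes the profinite completion of $\Gamma$ (the inverse limit of its finite quotients), $\simeq$ is isomorphism of topological groups, and $\mathrm{cd}(\Gamma)$ denotes the cohomological dimension of the discrete group $\Gamma$ (over $\mathbb{Z}$). *)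

theory Defs
  imports
    "HOL-Analysis.Function_Topology"
    "HOL-Algebra.FiniteProduct"
    "HOL-Algebra.Product_Groups"
    "HOL-Algebra.Generated_Groups"
    "HOL-Algebra.Bij"
    "HOL-Library.Extended_Nat"
begin

section \<open>Finitely generated and residually finite groups\<close>

definition finitely_generated :: "('g, 'b) monoid_scheme \<Rightarrow> bool"
  where "finitely_generated G \<longleftrightarrow>
    (\<exists>S. finite S \<and> S \<subseteq> carrier G \<and> generate G S = carrier G)"

definition finite_index_normal :: "('g, 'b) monoid_scheme \<Rightarrow> 'g set set"
  where "finite_index_normal G = {N. N \<lhd> G \<and> finite (carrier (G Mod N))}"

definition residually_finite :: "('g, 'b) monoid_scheme \<Rightarrow> bool"
  where "residually_finite G \<longleftrightarrow>
    (\<forall>g \<in> carrier G. g \<noteq> \<one>\<^bsub>G\<^esub> \<longrightarrow> (\<exists>N \<in> finite_index_normal G. g \<notin> N))"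


section \<open>Profinite completion\<close>

text \<open>For normal subgroups N and K with N contained in K, the projection from G/N to G/K sends a
  coset of N to the unique coset of K that contains it. So a family of cosets, one for each N, lies
  in the inverse limit iff \<open>x N \<subseteq> x K\<close> whenever \<open>N \<subseteq> K\<close>.\<close>

definition profinite_completion :: "('g, 'b) monoid_scheme \<Rightarrow> ('g set \<Rightarrow> 'g set) monoid"
  where "profinite_completion G =
    (product_group (finite_index_normal G) (\<lambda>N. G Mod N))
      \<lparr>carrier := {x \<in> carrier (product_group (finite_index_normal G) (\<lambda>N. G Mod N)).
          \<forall>N \<in> finite_index_normal G. \<forall>K \<in> finite_index_normal G. N \<subseteq> K \<longrightarrow> x N \<subseteq> x K}\<rparr>"

definition profinite_topology :: "('g, 'b) monoid_scheme \<Rightarrow> ('g set \<Rightarrow> 'g set) topology"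
  where "profinite_topology G =
    subtopology
      (product_topology (\<lambda>N. discrete_topology (carrier (G Mod N))) (finite_index_normal G))
      (carrier (profinite_completion G))"

definition isomorphic_profinite_completions ::
    "('g, 'b) monoid_scheme \<Rightarrow> ('h, 'c) monoid_scheme \<Rightarrow> bool"
  where "isomorphic_profinite_completions G H \<longleftrightarrow>
    (\<exists>h \<in> iso (profinite_completion G) (profinite_completion H).
       homeomorphic_map (profinite_topology G) (profinite_topology H) h)"


section \<open>Group cohomology and cohomological dimension\<close>

text \<open>A G-module is an abelian group M (written multiplicatively, as a commutative group of
  HOL-Algebra) with a homomorphism from G to the automorphism group of M.\<close>

definition g_module :: "'g monoid \<Rightarrow> 'm monoid \<Rightarrow> ('g \<Rightarrow> 'm \<Rightarrow> 'm) \<Rightarrow> bool"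
  where "g_module G M \<phi> \<longleftrightarrow> Group.group G \<and> comm_group M \<and> \<phi> \<in> hom G (AutoGroup M)"

definition tuples :: "'g monoid \<Rightarrow> nat \<Rightarrow> 'g list set"
  where "tuples G n = {xs. set xs \<subseteq> carrier G \<and> length xs = n}"

text \<open>The group of inhomogeneous n-cochains, that is, all functions from the n-tuples over G to M.\<close>

definition cochains :: "'g monoid \<Rightarrow> 'm monoid \<Rightarrow> nat \<Rightarrow> ('g list \<Rightarrow> 'm) monoid"
  where "cochains G M n = product_group (tuples G n) (\<lambda>_. M)"

definition merge_at :: "'g monoid \<Rightarrow> nat \<Rightarrow> 'g list \<Rightarrow> 'g list"
  where "merge_at G i xs = take i xs @ (xs ! i \<otimes>\<^bsub>G\<^esub> xs ! Suc i) # drop (i + 2) xs"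

text \<open>In additive notation, with list positions counted from 0, the following is
  \[ (d f)(g_0, \ldots, g_n) = g_0 f(g_1, \ldots, g_n)
      + \sum_{i<n} (-1)^{i+1} f(g_0, \ldots, g_i g_{i+1}, \ldots, g_n)
      + (-1)^{n+1} f(g_0, \ldots, g_{n-1}). \]\<close>

definition coboundary ::
    "'g monoid \<Rightarrow> 'm monoid \<Rightarrow> ('g \<Rightarrow> 'm \<Rightarrow> 'm) \<Rightarrow> nat \<Rightarrow> ('g list \<Rightarrow> 'm) \<Rightarrow> ('g list \<Rightarrow> 'm)"
  where "coboundary G M \<phi> n f =
    (\<lambda>xs \<in> tuples G (Suc n).
       \<phi> (hd xs) (f (tl xs))
       \<otimes>\<^bsub>M\<^esub> (\<Otimes>\<^bsub>M\<^esub>i\<in>{..<n}. f (merge_at G i xs) [^]\<^bsub>M\<^esub> ((- 1) ^ Suc i :: int))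
       \<otimes>\<^bsub>M\<^esub> f (butlast xs) [^]\<^bsub>M\<^esub> ((- 1) ^ Suc n :: int))"

definition cocycles ::
    "'g monoid \<Rightarrow> 'm monoid \<Rightarrow> ('g \<Rightarrow> 'm \<Rightarrow> 'm) \<Rightarrow> nat \<Rightarrow> ('g list \<Rightarrow> 'm) set"
  where "cocycles G M \<phi> n =
    kernel (cochains G M n) (cochains G M (Suc n)) (coboundary G M \<phi> n)"

definition coboundaries ::
    "'g monoid \<Rightarrow> 'm monoid \<Rightarrow> ('g \<Rightarrow> 'm \<Rightarrow> 'm) \<Rightarrow> nat \<Rightarrow> ('g list \<Rightarrow> 'm) set"
  where "coboundaries G M \<phi> n =
    (case n of
       0 \<Rightarrow> {\<one>\<^bsub>cochains G M 0\<^esub>}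
     | Suc k \<Rightarrow> coboundary G M \<phi> k ` carrier (cochains G M k))"

definition cohomology ::
    "'g monoid \<Rightarrow> 'm monoid \<Rightarrow> ('g \<Rightarrow> 'm \<Rightarrow> 'm) \<Rightarrow> nat \<Rightarrow> ('g list \<Rightarrow> 'm) set monoid"
  where "cohomology G M \<phi> n =
    ((cochains G M n)\<lparr>carrier := cocycles G M \<phi> n\<rparr>) Mod (coboundaries G M \<phi> n)"

definition nonzero_cohomology ::
    "'g monoid \<Rightarrow> 'm monoid \<Rightarrow> ('g \<Rightarrow> 'm \<Rightarrow> 'm) \<Rightarrow> nat \<Rightarrow> bool"
  where "nonzero_cohomology G M \<phi> n \<longleftrightarrow>
    carrier (cohomology G M \<phi> n) \<noteq> {\<one>\<^bsub>cohomology G M \<phi> n\<^esub>}"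

text \<open>The cohomological dimension of G is the supremum of all n such that the n-th cohomology of G
  is nonzero for some G-module. A definition cannot quantify over the carrier type of that module,
  so a type has to be chosen that is large enough for every G on the type of group elements. The
  type \<open>'g list \<Rightarrow> int\<close> is: the lemma \<open>le_cohomological_dimension\<close> below shows that modules over
  any other type do not lead to a larger supremum.\<close>

definition cohomological_dimension :: "'g monoid \<Rightarrow> enat"
  where "cohomological_dimension G =
    Sup {enat n | n. \<exists>(M :: ('g list \<Rightarrow> int) monoid) \<phi>.
                       g_module G M \<phi> \<and> nonzero_cohomology G M \<phi> n}"


subsection \<open>Independence of the type of the coefficient modules\<close>

lemma g_moduleD:
  assumes "g_module G M \<phi>"
  shows "Group.group G" "comm_group M" "Group.group M"
    "\<And>g. g \<in> carrier G \<Longrightarrow> \<phi> g \<in> hom M M"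
    "\<And>g u. g \<in> carrier G \<Longrightarrow> u \<in> carrier M \<Longrightarrow> \<phi> g u \<in> carrier M"
    "\<And>g u v. g \<in> carrier G \<Longrightarrow> u \<in> carrier M \<Longrightarrow> v \<in> carrier M
       \<Longrightarrow> \<phi> g (u \<otimes>\<^bsub>M\<^esub> v) = \<phi> g u \<otimes>\<^bsub>M\<^esub> \<phi> g v"
    "\<And>g h u. g \<in> carrier G \<Longrightarrow> h \<in> carrier G \<Longrightarrow> u \<in> carrier M
       \<Longrightarrow> \<phi> (g \<otimes>\<^bsub>G\<^esub> h) u = \<phi> g (\<phi> h u)"
    "\<And>u. u \<in> carrier M \<Longrightarrow> \<phi> \<one>\<^bsub>G\<^esub> u = u"
    "\<And>g. g \<in> carrier G \<Longrightarrow> \<phi> g \<one>\<^bsub>M\<^esub> = \<one>\<^bsub>M\<^esub>"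
    "\<And>g u. g \<in> carrier G \<Longrightarrow> u \<in> carrier M \<Longrightarrow> \<phi> g (inv\<^bsub>M\<^esub> u) = inv\<^bsub>M\<^esub> (\<phi> g u)"
proof -
  show G: "Group.group G" and M: "comm_group M" using assms by (auto simp: g_module_def)
  then show M': "Group.group M" by (simp add: comm_group.axioms(2))
  have \<phi>: "\<phi> \<in> hom G (AutoGroup M)" using assms by (auto simp: g_module_def)
  have aut: "\<phi> g \<in> auto M" if "g \<in> carrier G" for g
    using hom_in_carrier[OF \<phi> that] by (simp add: AutoGroup_def)
  then show hm: "\<phi> g \<in> hom M M" if "g \<in> carrier G" for g using that by (auto simp: auto_def)
  then show "\<phi> g u \<in> carrier M" if "g \<in> carrier G" "u \<in> carrier M" for g u
    using that by (auto simp: hom_def)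
  show "\<phi> g (u \<otimes>\<^bsub>M\<^esub> v) = \<phi> g u \<otimes>\<^bsub>M\<^esub> \<phi> g v"
    if "g \<in> carrier G" "u \<in> carrier M" "v \<in> carrier M" for g u v
    using hm[OF that(1)] that by (simp add: hom_mult)
  show "\<phi> (g \<otimes>\<^bsub>G\<^esub> h) u = \<phi> g (\<phi> h u)"
    if "g \<in> carrier G" "h \<in> carrier G" "u \<in> carrier M" for g h u
    using hom_mult[OF \<phi> that(1,2)] aut that
    by (auto simp: AutoGroup_def BijGroup_def auto_def compose_def)
  have "\<phi> \<one>\<^bsub>G\<^esub> = \<one>\<^bsub>AutoGroup M\<^esub>"
    using hom_one[OF \<phi> G group.AutoGroup[OF M']] .
  then show "\<phi> \<one>\<^bsub>G\<^esub> u = u" if "u \<in> carrier M" for u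
    using that by (simp add: AutoGroup_def BijGroup_def)
  show "\<phi> g \<one>\<^bsub>M\<^esub> = \<one>\<^bsub>M\<^esub>" if "g \<in> carrier G" for g
    using hom_one[OF hm[OF that] M' M'] .
  show "\<phi> g (inv\<^bsub>M\<^esub> u) = inv\<^bsub>M\<^esub> (\<phi> g u)" if "g \<in> carrier G" "u \<in> carrier M" for g u
    using group_hom.hom_inv[of M M "\<phi> g" u] hm[OF that(1)] M' that
    by (simp add: group_hom_def group_hom_axioms_def)
qed

lemma g_moduleI:
  assumes G: "Group.group G" and M: "comm_group M"
    and ext: "\<And>g. g \<in> carrier G \<Longrightarrow> \<phi> g \<in> extensional (carrier M)"
    and cl: "\<And>g u. g \<in> carrier G \<Longrightarrow> u \<in> carrier M \<Longrightarrow> \<phi> g u \<in> carrier M"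
    and mult: "\<And>g u v. g \<in> carrier G \<Longrightarrow> u \<in> carrier M \<Longrightarrow> v \<in> carrier M
       \<Longrightarrow> \<phi> g (u \<otimes>\<^bsub>M\<^esub> v) = \<phi> g u \<otimes>\<^bsub>M\<^esub> \<phi> g v"
    and comp: "\<And>g h u. g \<in> carrier G \<Longrightarrow> h \<in> carrier G \<Longrightarrow> u \<in> carrier M
       \<Longrightarrow> \<phi> (g \<otimes>\<^bsub>G\<^esub> h) u = \<phi> g (\<phi> h u)"
    and one: "\<And>u. u \<in> carrier M \<Longrightarrow> \<phi> \<one>\<^bsub>G\<^esub> u = u"
  shows "g_module G M \<phi>"
proof -
  interpret G: Group.group G by fact
  have inv: "\<phi> (inv\<^bsub>G\<^esub> g) (\<phi> g u) = u" "\<phi> g (\<phi> (inv\<^bsub>G\<^esub> g) u) = u"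
    if "g \<in> carrier G" "u \<in> carrier M" for g u
    using that comp[of "inv\<^bsub>G\<^esub> g" g u] comp[of g "inv\<^bsub>G\<^esub> g" u] one by auto
  have bij: "bij_betw (\<phi> g) (carrier M) (carrier M)" if "g \<in> carrier G" for g
    using that by (intro bij_betwI[where g = "\<phi> (inv\<^bsub>G\<^esub> g)"]) (auto simp: cl inv)
  have aut: "\<phi> g \<in> auto M" if "g \<in> carrier G" for g
    using that bij ext cl mult by (auto simp: auto_def Bij_def hom_def)
  have "\<phi> (g \<otimes>\<^bsub>G\<^esub> h) = \<phi> g \<otimes>\<^bsub>AutoGroup M\<^esub> \<phi> h" if "g \<in> carrier G" "h \<in> carrier G" for g h
  proof -
    have "\<phi> (g \<otimes>\<^bsub>G\<^esub> h) = compose (carrier M) (\<phi> g) (\<phi> h)"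
      by (rule extensionalityI[of _ "carrier M"]) (use that ext comp in \<open>auto simp: compose_def\<close>)
    then show ?thesis
      using aut that by (simp add: AutoGroup_def BijGroup_def auto_def)
  qed
  then have "\<phi> \<in> hom G (AutoGroup M)"
    using aut by (auto simp: hom_def AutoGroup_def)
  with G M show ?thesis by (simp add: g_module_def)
qed

lemma tuples_simps:
  assumes "Group.group G" "xs \<in> tuples G (Suc n)"
  shows "hd xs \<in> carrier G" "tl xs \<in> tuples G n" "butlast xs \<in> tuples G n"
    "i < n \<Longrightarrow> merge_at G i xs \<in> tuples G n"
proof -
  interpret Group.group G by fact
  have ne: "xs \<noteq> []" and s: "set xs \<subseteq> carrier G" and l: "length xs = Suc n"
    using assms(2) by (auto simp: tuples_def)
  show "hd xs \<in> carrier G" using ne s by auto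
  show "tl xs \<in> tuples G n" using ne s l by (auto simp: tuples_def dest: list.set_sel(2))
  show "butlast xs \<in> tuples G n" using ne s l by (auto simp: tuples_def dest: in_set_butlastD)
  assume i: "i < n"
  have "set (take i xs) \<subseteq> carrier G" "set (drop (i + 2) xs) \<subseteq> carrier G"
    using s set_take_subset[of i xs] set_drop_subset[of "i+2" xs] by auto
  moreover have "xs ! i \<in> carrier G" "xs ! Suc i \<in> carrier G"
    using s l i by (auto simp: subset_iff)
  ultimately show "merge_at G i xs \<in> tuples G n"
    using i l by (auto simp: merge_at_def tuples_def)
qed

lemma hom_finprod:
  assumes "comm_group M" "comm_group N" "h \<in> hom M N" "f \<in> A \<rightarrow> carrier M"
  shows "h (\<Otimes>\<^bsub>M\<^esub>i\<in>A. f i) = (\<Otimes>\<^bsub>N\<^esub>i\<in>A. h (f i))"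
proof -
  interpret M: comm_group M by fact
  interpret N: comm_group N by fact
  have one: "h \<one>\<^bsub>M\<^esub> = \<one>\<^bsub>N\<^esub>" using hom_one[OF assms(3)] M.is_group N.is_group by blast
  from assms(4) show ?thesis
  proof (induct A rule: infinite_finite_induct)
    case (insert a A)
    then have "(\<lambda>i. h (f i)) \<in> A \<rightarrow> carrier N" "h (f a) \<in> carrier N"
      using assms(3) by (auto simp: hom_def)
    with insert show ?case using hom_mult[OF assms(3)] by (simp add: Pi_def)
  qed (auto simp: one)
qed

lemma cochains_simps [simp]:
  "carrier (cochains G M n) = tuples G n \<rightarrow>\<^sub>E carrier M"
  "\<one>\<^bsub>cochains G M n\<^esub> = (\<lambda>xs\<in>tuples G n. \<one>\<^bsub>M\<^esub>)"
  "f \<otimes>\<^bsub>cochains G M n\<^esub> g = (\<lambda>xs\<in>tuples G n. f xs \<otimes>\<^bsub>M\<^esub> g xs)"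
  by (auto simp: cochains_def)

lemma group_cochains: "Group.group M \<Longrightarrow> Group.group (cochains G M n)"
  by (simp add: cochains_def)

lemma coboundary_hom:
  assumes "g_module G M \<phi>"
  shows "coboundary G M \<phi> n \<in> hom (cochains G M n) (cochains G M (Suc n))"
proof -
  note D = g_moduleD[OF assms]
  interpret M: comm_group M by (rule D(2))
  note T = tuples_simps[OF D(1)]
  let ?p = "\<lambda>f xs i. f (merge_at G i xs) [^]\<^bsub>M\<^esub> ((- 1) ^ Suc i :: int)"
  have mc: "f (merge_at G i xs) \<in> carrier M"
    if "f \<in> tuples G n \<rightarrow>\<^sub>E carrier M" "xs \<in> tuples G (Suc n)" "i \<in> {..<n}" for f xs i
    using PiE_mem[OF that(1) T(4)[OF that(2)]] that(3) by blast
  have pc: "?p f xs \<in> {..<n} \<rightarrow> carrier M"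
    if "f \<in> tuples G n \<rightarrow>\<^sub>E carrier M" "xs \<in> tuples G (Suc n)" for f xs
    by (rule Pi_I, rule M.int_pow_closed, rule mc[OF that])
  have ends: "f (tl xs) \<in> carrier M" "f (butlast xs) \<in> carrier M"
    "\<phi> (hd xs) (f (tl xs)) \<in> carrier M"
    if "f \<in> tuples G n \<rightarrow>\<^sub>E carrier M" "xs \<in> tuples G (Suc n)" for f xs
    using PiE_mem[OF that(1) T(2)[OF that(2)]] PiE_mem[OF that(1) T(3)[OF that(2)]]
      D(5)[OF T(1)[OF that(2)]] by blast+
  show ?thesis
  proof (rule homI)
    fix f assume "f \<in> carrier (cochains G M n)"
    then have f: "f \<in> tuples G n \<rightarrow>\<^sub>E carrier M" by simp
    have "coboundary G M \<phi> n f \<in> tuples G (Suc n) \<rightarrow>\<^sub>E carrier M"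
      unfolding coboundary_def restrict_PiE_iff
      by (intro ballI M.m_closed M.int_pow_closed M.finprod_closed pc[OF f] ends[OF f])
    then show "coboundary G M \<phi> n f \<in> carrier (cochains G M (Suc n))" by simp
  next
    fix f g assume "f \<in> carrier (cochains G M n)" "g \<in> carrier (cochains G M n)"
    then have f: "f \<in> tuples G n \<rightarrow>\<^sub>E carrier M" and g: "g \<in> tuples G n \<rightarrow>\<^sub>E carrier M" by simp_all
    define fg where "fg = f \<otimes>\<^bsub>cochains G M n\<^esub> g"
    have fg: "fg ys = f ys \<otimes>\<^bsub>M\<^esub> g ys" if "ys \<in> tuples G n" for ys
      using that by (simp add: fg_def)
    have eq: "coboundary G M \<phi> n fg xs = coboundary G M \<phi> n f xs \<otimes>\<^bsub>M\<^esub> coboundary G M \<phi> n g xs"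
      if xs: "xs \<in> tuples G (Suc n)" for xs
    proof -
      have "finprod M (?p fg xs) {..<n} = finprod M (\<lambda>i. ?p f xs i \<otimes>\<^bsub>M\<^esub> ?p g xs i) {..<n}"
      proof (rule M.finprod_cong')
        show "(\<lambda>i. ?p f xs i \<otimes>\<^bsub>M\<^esub> ?p g xs i) \<in> {..<n} \<rightarrow> carrier M"
          using pc[OF f xs] pc[OF g xs] by blast
        fix i assume i: "i \<in> {..<n}"
        then have "merge_at G i xs \<in> tuples G n" using T(4)[OF xs] by blast
        then show "?p fg xs i = ?p f xs i \<otimes>\<^bsub>M\<^esub> ?p g xs i"
          unfolding fg[OF \<open>merge_at G i xs \<in> tuples G n\<close>]
          by (intro M.int_pow_distrib mc[OF f xs i] mc[OF g xs i])
      qed simp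
      also have "\<dots> = finprod M (?p f xs) {..<n} \<otimes>\<^bsub>M\<^esub> finprod M (?p g xs) {..<n}"
        by (rule M.finprod_multf[OF pc[OF f xs] pc[OF g xs]])
      finally have 1: "finprod M (?p fg xs) {..<n}
        = finprod M (?p f xs) {..<n} \<otimes>\<^bsub>M\<^esub> finprod M (?p g xs) {..<n}" .
      have 2: "\<phi> (hd xs) (fg (tl xs)) = \<phi> (hd xs) (f (tl xs)) \<otimes>\<^bsub>M\<^esub> \<phi> (hd xs) (g (tl xs))"
        unfolding fg[OF T(2)[OF xs]] by (intro D(6) T(1)[OF xs] ends[OF f xs] ends[OF g xs])
      have 3: "fg (butlast xs) [^]\<^bsub>M\<^esub> k = f (butlast xs) [^]\<^bsub>M\<^esub> k \<otimes>\<^bsub>M\<^esub> g (butlast xs) [^]\<^bsub>M\<^esub> k"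
        for k :: int
        unfolding fg[OF T(3)[OF xs]] by (intro M.int_pow_distrib ends[OF f xs] ends[OF g xs])
      have 4: "(a \<otimes>\<^bsub>M\<^esub> a') \<otimes>\<^bsub>M\<^esub> (b \<otimes>\<^bsub>M\<^esub> b') \<otimes>\<^bsub>M\<^esub> (c \<otimes>\<^bsub>M\<^esub> c') = (a \<otimes>\<^bsub>M\<^esub> b \<otimes>\<^bsub>M\<^esub> c) \<otimes>\<^bsub>M\<^esub> (a' \<otimes>\<^bsub>M\<^esub> b' \<otimes>\<^bsub>M\<^esub> c')"
        if "a \<in> carrier M" "a' \<in> carrier M" "b \<in> carrier M" "b' \<in> carrier M" "c \<in> carrier M" "c' \<in> carrier M"
        for a a' b b' c c'
        using that by (simp add: M.m_ac)
      show ?thesis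
        unfolding coboundary_def restrict_apply'[OF xs] 1 2 3
        by (rule 4) (intro M.int_pow_closed M.finprod_closed pc[OF f xs] pc[OF g xs]
            ends[OF f xs] ends[OF g xs])+
    qed
    then show "coboundary G M \<phi> n (f \<otimes>\<^bsub>cochains G M n\<^esub> g) =
      coboundary G M \<phi> n f \<otimes>\<^bsub>cochains G M (Suc n)\<^esub> coboundary G M \<phi> n g"
      unfolding fg_def[symmetric]
      by (intro extensionalityI[of _ "tuples G (Suc n)"]) (simp_all add: coboundary_def)
  qed
qed

lemma subgroup_coboundaries:
  assumes "g_module G M \<phi>"
  shows "subgroup (coboundaries G M \<phi> n) (cochains G M n)"
proof (cases n)
  case 0
  interpret C: Group.group "cochains G M 0"
    using group_cochains g_moduleD(3)[OF assms] by blast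
  show ?thesis using C.triv_subgroup by (simp add: 0 coboundaries_def)
next
  case (Suc k)
  have "group_hom (cochains G M k) (cochains G M (Suc k)) (coboundary G M \<phi> k)"
    unfolding group_hom_def group_hom_axioms_def
    by (intro conjI coboundary_hom[OF assms] group_cochains[OF g_moduleD(3)[OF assms]])
  then show ?thesis
    by (simp only: Suc coboundaries_def nat.case group_hom.img_is_subgroup)
qed

lemma one_cocycle:
  assumes "g_module G M \<phi>"
  shows "\<one>\<^bsub>cochains G M n\<^esub> \<in> cocycles G M \<phi> n"
proof -
  note C = group_cochains[OF g_moduleD(3)[OF assms]]
  show ?thesis
    unfolding cocycles_def kernel_def
    using hom_one[OF coboundary_hom[OF assms] C C] monoid.one_closed[OF group.is_monoid[OF C]]
    by blast
qed

lemma nonzero_cohomology_iff: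
  assumes "g_module G M \<phi>"
  shows "nonzero_cohomology G M \<phi> n \<longleftrightarrow> (\<exists>z \<in> cocycles G M \<phi> n. z \<notin> coboundaries G M \<phi> n)"
proof -
  let ?C = "cochains G M n" and ?Z = "cocycles G M \<phi> n" and ?B = "coboundaries G M \<phi> n"
  interpret C: Group.group ?C using group_cochains g_moduleD(3)[OF assms] by blast
  interpret B: subgroup ?B ?C by (rule subgroup_coboundaries[OF assms])
  have Z: "?Z \<subseteq> carrier ?C" by (auto simp: cocycles_def kernel_def)
  have car: "carrier (cohomology G M \<phi> n) = (\<lambda>z. ?B #>\<^bsub>?C\<^esub> z) ` ?Z"
    and one: "\<one>\<^bsub>cohomology G M \<phi> n\<^esub> = ?B"
    by (auto simp: cohomology_def FactGroup_def RCOSETS_def r_coset_def)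
  have "?B #>\<^bsub>?C\<^esub> z = ?B \<longleftrightarrow> z \<in> ?B" if "z \<in> ?Z" for z
    using that Z C.coset_join1[of ?B z] C.coset_join2[of z ?B] B.subgroup_axioms B.subset by auto
  then show ?thesis
    unfolding nonzero_cohomology_def car one using one_cocycle[OF assms, of n] by blast
qed

lemma coboundary_natural:
  assumes M: "g_module G M \<phi>" and N: "g_module G N \<psi>" and h: "h \<in> hom N M"
    and eq: "\<And>g u. g \<in> carrier G \<Longrightarrow> u \<in> carrier N \<Longrightarrow> h (\<psi> g u) = \<phi> g (h u)"
    and f: "f \<in> tuples G n \<rightarrow> carrier N" and xs: "xs \<in> tuples G (Suc n)"
    and f': "\<And>ys. ys \<in> tuples G n \<Longrightarrow> f' ys = h (f ys)"
  shows "h (coboundary G N \<psi> n f xs) = coboundary G M \<phi> n f' xs"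
proof -
  note D = g_moduleD[OF M] and E = g_moduleD[OF N]
  interpret M: comm_group M by (rule D(2))
  interpret N: comm_group N by (rule E(2))
  note T = tuples_simps[OF D(1) xs]
  have cl: "f ys \<in> carrier N" "h (f ys) \<in> carrier M" if "ys \<in> tuples G n" for ys
    using that f h by (auto simp: hom_def)
  have pw: "h (u [^]\<^bsub>N\<^esub> (k::int)) = h u [^]\<^bsub>M\<^esub> k" if "u \<in> carrier N" for u k
    using hom_int_pow[OF h that] M.is_group N.is_group by blast
  have "h (\<Otimes>\<^bsub>N\<^esub>i\<in>{..<n}. f (merge_at G i xs) [^]\<^bsub>N\<^esub> ((- 1) ^ Suc i :: int))
    = (\<Otimes>\<^bsub>M\<^esub>i\<in>{..<n}. h (f (merge_at G i xs) [^]\<^bsub>N\<^esub> ((- 1) ^ Suc i :: int)))"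
    by (rule hom_finprod[OF E(2) D(2) h], rule Pi_I, rule N.int_pow_closed, rule cl(1), rule T(4)) simp
  also have "\<dots> = (\<Otimes>\<^bsub>M\<^esub>i\<in>{..<n}. f' (merge_at G i xs) [^]\<^bsub>M\<^esub> ((- 1) ^ Suc i :: int))"
  proof (rule M.finprod_cong')
    fix i assume "i \<in> {..<n}"
    then have m: "merge_at G i xs \<in> tuples G n" using T(4) by blast
    show "h (f (merge_at G i xs) [^]\<^bsub>N\<^esub> ((- 1) ^ Suc i :: int))
      = f' (merge_at G i xs) [^]\<^bsub>M\<^esub> ((- 1) ^ Suc i :: int)"
      unfolding f'[OF m] by (rule pw[OF cl(1)[OF m]])
  next
    show "(\<lambda>i. f' (merge_at G i xs) [^]\<^bsub>M\<^esub> ((- 1) ^ Suc i :: int)) \<in> {..<n} \<rightarrow> carrier M"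
      by (rule Pi_I, rule M.int_pow_closed) (metis T(4) cl(2) f' lessThan_iff)
  qed simp
  finally have 1: "h (\<Otimes>\<^bsub>N\<^esub>i\<in>{..<n}. f (merge_at G i xs) [^]\<^bsub>N\<^esub> ((- 1) ^ Suc i :: int)) = \<dots>" .
  have 2: "(\<Otimes>\<^bsub>N\<^esub>i\<in>{..<n}. f (merge_at G i xs) [^]\<^bsub>N\<^esub> ((- 1) ^ Suc i :: int)) \<in> carrier N"
    by (rule N.finprod_closed, rule Pi_I, rule N.int_pow_closed, rule cl(1), rule T(4)) simp
  show ?thesis
    using xs T(1-3) cl[OF T(2)] cl[OF T(3)] 2 E(5)[OF T(1) cl(1)[OF T(2)]]
    unfolding coboundary_def
    by (simp add: hom_mult[OF h] 1 eq f' pw del: power_Suc)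
qed

lemma nonzero_cohomology_transfer:
  assumes M: "g_module G M \<phi>" and N: "g_module G N \<psi>" and h: "h \<in> hom N M"
    and inj: "inj_on h (carrier N)"
    and eq: "\<And>g u. g \<in> carrier G \<Longrightarrow> u \<in> carrier N \<Longrightarrow> h (\<psi> g u) = \<phi> g (h u)"
    and z: "z \<in> cocycles G M \<phi> n" "z \<notin> coboundaries G M \<phi> n"
    and im: "z ` tuples G n \<subseteq> h ` carrier N"
  shows "nonzero_cohomology G N \<psi> n"
proof -
  note D = g_moduleD[OF M] and E = g_moduleD[OF N]
  have h1: "h \<one>\<^bsub>N\<^esub> = \<one>\<^bsub>M\<^esub>" by (rule hom_one[OF h E(3) D(3)])
  have hc: "h u \<in> carrier M" if "u \<in> carrier N" for u using that h by (auto simp: hom_def)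
  have zc: "z \<in> tuples G n \<rightarrow>\<^sub>E carrier M"
    and dz: "coboundary G M \<phi> n z = (\<lambda>xs\<in>tuples G (Suc n). \<one>\<^bsub>M\<^esub>)"
    using z(1) by (auto simp: cocycles_def kernel_def)
  define y where "y = (\<lambda>xs\<in>tuples G n. inv_into (carrier N) h (z xs))"
  have hy: "z xs = h (y xs)" and yc: "y xs \<in> carrier N" if "xs \<in> tuples G n" for xs
  proof -
    have "z xs \<in> h ` carrier N" using im that by auto
    then show "z xs = h (y xs)" "y xs \<in> carrier N"
      using that by (simp_all add: y_def f_inv_into_f inv_into_into)
  qed
  have yC: "y \<in> tuples G n \<rightarrow>\<^sub>E carrier N" using yc by (auto simp: y_def)
  have dyC: "coboundary G N \<psi> n y \<in> tuples G (Suc n) \<rightarrow>\<^sub>E carrier N"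
    using hom_in_carrier[OF coboundary_hom[OF N]] yC by auto
  have "coboundary G N \<psi> n y xs = \<one>\<^bsub>N\<^esub>" if xs: "xs \<in> tuples G (Suc n)" for xs
  proof -
    have "h (coboundary G N \<psi> n y xs) = coboundary G M \<phi> n z xs"
      by (rule coboundary_natural[OF M N h eq _ xs hy]) (use yc in auto)
    also have "\<dots> = h \<one>\<^bsub>N\<^esub>" using xs by (simp add: dz h1)
    finally show ?thesis
      using inj dyC xs group.is_monoid[OF E(3)]
      by (meson PiE_mem inj_onD monoid.one_closed)
  qed
  then have "coboundary G N \<psi> n y = (\<lambda>xs\<in>tuples G (Suc n). \<one>\<^bsub>N\<^esub>)"
    using dyC by (intro extensionalityI[of _ "tuples G (Suc n)"]) (auto simp: PiE_def)
  then have yZ: "y \<in> cocycles G N \<psi> n" using yC by (simp add: cocycles_def kernel_def)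
  moreover have "y \<notin> coboundaries G N \<psi> n"
  proof
    assume yB: "y \<in> coboundaries G N \<psi> n"
    show False
    proof (cases n)
      case 0
      then have "y = (\<lambda>xs\<in>tuples G n. \<one>\<^bsub>N\<^esub>)" using yB by (simp add: coboundaries_def)
      then have "z xs = \<one>\<^bsub>M\<^esub>" if "xs \<in> tuples G n" for xs using hy that h1 by simp
      then have "z = (\<lambda>xs\<in>tuples G n. \<one>\<^bsub>M\<^esub>)"
        using zc by (intro extensionalityI[of _ "tuples G n"]) (auto simp: PiE_def)
      then show False using z(2) 0 by (simp add: coboundaries_def)
    next
      case (Suc k)
      then obtain b where b: "b \<in> tuples G k \<rightarrow>\<^sub>E carrier N" and yb: "y = coboundary G N \<psi> k b"
        using yB by (auto simp: coboundaries_def)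
      define b' where "b' = (\<lambda>xs\<in>tuples G k. h (b xs))"
      have b': "b' \<in> tuples G k \<rightarrow>\<^sub>E carrier M" using b hc by (auto simp: b'_def)
      have "z xs = coboundary G M \<phi> k b' xs" if xs: "xs \<in> tuples G (Suc k)" for xs
      proof -
        have bc: "b \<in> tuples G k \<rightarrow> carrier N" using b by (simp add: PiE_def)
        have hb: "b' ys = h (b ys)" if "ys \<in> tuples G k" for ys using that by (simp add: b'_def)
        have nat: "h (coboundary G N \<psi> k b xs) = coboundary G M \<phi> k b' xs"
          by (rule coboundary_natural[OF M N h eq bc xs hb])
        have "z xs = h (y xs)" by (rule hy) (simp add: Suc xs)
        then show ?thesis by (simp only: yb nat)
      qed
      moreover have "coboundary G M \<phi> k b' \<in> extensional (tuples G (Suc k))"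
        by (simp add: coboundary_def)
      moreover have "z \<in> extensional (tuples G (Suc k))"
        using zc unfolding Suc by (simp add: PiE_def)
      ultimately have "z = coboundary G M \<phi> k b'"
        by (intro extensionalityI[of _ "tuples G (Suc k)"])
      then show False using z(2) b' Suc by (auto simp: coboundaries_def)
    qed
  qed
  ultimately show ?thesis using nonzero_cohomology_iff[OF N] by blast
qed

text \<open>Every element of the submodule generated by the values of a cochain z is a combination with
  integer coefficients of elements \<open>\<phi> g (z xs)\<close>, which are indexed by the lists \<open>g # xs\<close>.\<close>

lemma generate_combination:
  fixes M :: "'m monoid" and s :: "'i \<Rightarrow> 'm"
  assumes M: "comm_group M" and s: "s \<in> I \<rightarrow> carrier M"
    and u: "u \<in> generate M (s ` I)"
  shows "\<exists>c :: 'i \<Rightarrow> int. finite {i. c i \<noteq> 0} \<and> {i. c i \<noteq> 0} \<subseteq> I \<and>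
           u = (\<Otimes>\<^bsub>M\<^esub>i\<in>{i. c i \<noteq> 0}. s i [^]\<^bsub>M\<^esub> c i)"
proof -
  interpret M: comm_group M by fact
  have sc: "s i \<in> carrier M" if "i \<in> I" for i using that s by auto
  show ?thesis using u
  proof (induct rule: generate.induct)
    case one
    show ?case by (rule exI[of _ "\<lambda>_. 0"]) simp
  next
    case (incl v)
    then obtain i where i: "i \<in> I" "v = s i" by auto
    then have "{j. (if j = i then 1 else (0::int)) \<noteq> 0} = {i}" by auto
    with i sc show ?case
      by (intro exI[of _ "\<lambda>j. if j = i then 1 else 0"]) (auto simp: M.int_pow_1)
  next
    case (inv v)
    then obtain i where i: "i \<in> I" "v = s i" by auto
    then have "{j. (if j = i then -1 else (0::int)) \<noteq> 0} = {i}" by auto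
    with i sc show ?case
      by (intro exI[of _ "\<lambda>j. if j = i then -1 else 0"]) (auto simp: M.int_pow_neg)
  next
    case (eng v w)
    then obtain c d :: "'i \<Rightarrow> int" where
      c: "finite {i. c i \<noteq> 0}" "{i. c i \<noteq> 0} \<subseteq> I" "v = (\<Otimes>\<^bsub>M\<^esub>i\<in>{i. c i \<noteq> 0}. s i [^]\<^bsub>M\<^esub> c i)"
      and d: "finite {i. d i \<noteq> 0}" "{i. d i \<noteq> 0} \<subseteq> I" "w = (\<Otimes>\<^bsub>M\<^esub>i\<in>{i. d i \<noteq> 0}. s i [^]\<^bsub>M\<^esub> d i)"
      by blast
    define L where "L = {i. c i \<noteq> 0} \<union> {i. d i \<noteq> 0}"
    have L: "finite L" "L \<subseteq> I" using c d by (auto simp: L_def)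
    have ext: "(\<Otimes>\<^bsub>M\<^esub>i\<in>{i. e i \<noteq> 0}. s i [^]\<^bsub>M\<^esub> e i) = (\<Otimes>\<^bsub>M\<^esub>i\<in>L. s i [^]\<^bsub>M\<^esub> e i)"
      if "{i. e i \<noteq> 0} \<subseteq> L" for e :: "'i \<Rightarrow> int"
      using that L by (intro M.finprod_mono_neutral_cong_left) (auto intro!: M.int_pow_closed sc)
    have "v \<otimes>\<^bsub>M\<^esub> w = (\<Otimes>\<^bsub>M\<^esub>i\<in>L. s i [^]\<^bsub>M\<^esub> c i) \<otimes>\<^bsub>M\<^esub> (\<Otimes>\<^bsub>M\<^esub>i\<in>L. s i [^]\<^bsub>M\<^esub> d i)"
      using c d ext by (auto simp: L_def)
    also have "\<dots> = (\<Otimes>\<^bsub>M\<^esub>i\<in>L. s i [^]\<^bsub>M\<^esub> c i \<otimes>\<^bsub>M\<^esub> s i [^]\<^bsub>M\<^esub> d i)"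
      by (rule M.finprod_multf[symmetric]) (use L in \<open>auto intro!: M.int_pow_closed sc\<close>)
    also have "\<dots> = (\<Otimes>\<^bsub>M\<^esub>i\<in>L. s i [^]\<^bsub>M\<^esub> (c i + d i))"
      by (rule M.finprod_cong')
        (use L in \<open>auto intro!: M.int_pow_closed M.int_pow_mult[symmetric] sc\<close>)
    also have "\<dots> = (\<Otimes>\<^bsub>M\<^esub>i\<in>{i. c i + d i \<noteq> 0}. s i [^]\<^bsub>M\<^esub> (c i + d i))"
      by (rule ext[symmetric]) (auto simp: L_def)
    finally have vw: "v \<otimes>\<^bsub>M\<^esub> w = \<dots>" .
    have "{i. c i + d i \<noteq> 0} \<subseteq> L" by (auto simp: L_def)
    with vw L show ?case
      by (intro exI[of _ "\<lambda>i. c i + d i"]) (blast intro: finite_subset)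
  qed
qed

lemma nonzero_cohomology_list_int_module:
  fixes G :: "'g monoid" and M :: "'m monoid"
  assumes M: "g_module G M \<phi>" and nz: "nonzero_cohomology G M \<phi> n"
  shows "\<exists>(N :: ('g list \<Rightarrow> int) monoid) \<psi>. g_module G N \<psi> \<and> nonzero_cohomology G N \<psi> n"
proof -
  note D = g_moduleD[OF M]
  interpret G: Group.group G by (rule D(1))
  interpret M: comm_group M by (rule D(2))
  obtain z where z: "z \<in> cocycles G M \<phi> n" "z \<notin> coboundaries G M \<phi> n"
    using nz nonzero_cohomology_iff[OF M] by blast
  have zc: "z \<in> tuples G n \<rightarrow> carrier M" using z(1) by (auto simp: cocycles_def kernel_def)
  define I where "I = tuples G (Suc n)"
  define s where "s = (\<lambda>l. \<phi> (hd l) (z (tl l)))"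
  define K where "K = generate M (s ` I)"
  have sI: "s \<in> I \<rightarrow> carrier M"
  proof
    fix l assume "l \<in> I"
    then have "hd l \<in> carrier G" "tl l \<in> tuples G n"
      using tuples_simps(1,2)[OF D(1)] by (simp_all add: I_def)
    then show "s l \<in> carrier M" unfolding s_def using D(5) zc by blast
  qed
  have KM: "K \<subseteq> carrier M" unfolding K_def by (rule M.generate_incl) (use sI in auto)
  have K: "subgroup K M" unfolding K_def by (rule M.generate_is_subgroup) (use sI in auto)
  interpret K: subgroup K M by (rule K)
  have Kst: "\<phi> g u \<in> K" if g: "g \<in> carrier G" and u: "u \<in> K" for g u
  proof -
    have si: "\<phi> g v \<in> s ` I" if v: "v \<in> s ` I" for v
    proof -
      obtain l where l: "l \<in> I" "v = s l" using v by blast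
      have t: "hd l \<in> carrier G" "tl l \<in> tuples G n"
        using tuples_simps(1,2)[OF D(1)] l by (simp_all add: I_def)
      then have "z (tl l) \<in> carrier M" using zc by blast
      then have "\<phi> g v = s ((g \<otimes>\<^bsub>G\<^esub> hd l) # tl l)"
        using D(7)[OF g t(1)] by (simp add: s_def l)
      moreover have "(g \<otimes>\<^bsub>G\<^esub> hd l) # tl l \<in> I" using t g by (auto simp: I_def tuples_def)
      ultimately show ?thesis by blast
    qed
    have sc: "v \<in> carrier M" if "v \<in> s ` I" for v using that sI by blast
    show ?thesis using u unfolding K_def
    proof (induct rule: generate.induct)
      case one
      then show ?case using D(9) g by (simp add: generate.one)
    next
      case (incl v)
      then show ?case using si by (simp add: generate.incl)
    next
      case (inv v)
      then show ?case using si sc D(10) g by (simp add: generate.inv)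
    next
      case (eng v w)
      then have "v \<in> carrier M" "w \<in> carrier M" using KM by (auto simp: K_def)
      with eng show ?case using D(6) g by (simp add: generate.eng)
    qed
  qed
  have zK: "z xs \<in> K" if xs: "xs \<in> tuples G n" for xs
  proof -
    have "\<one>\<^bsub>G\<^esub> # xs \<in> I" using xs by (auto simp: I_def tuples_def)
    moreover have "z xs \<in> carrier M" using xs zc by blast
    then have "s (\<one>\<^bsub>G\<^esub> # xs) = z xs" using D(8) by (simp add: s_def)
    ultimately show ?thesis unfolding K_def by (metis generate.incl imageI)
  qed
  define ev where "ev = (\<lambda>c :: 'g list \<Rightarrow> int. \<Otimes>\<^bsub>M\<^esub>i\<in>{i. c i \<noteq> 0}. s i [^]\<^bsub>M\<^esub> c i)"
  define \<sigma> where "\<sigma> = inv_into UNIV ev"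
  have ev\<sigma>: "ev (\<sigma> u) = u" if "u \<in> K" for u
  proof -
    have "u \<in> range ev"
      using generate_combination[OF D(2) sI] that by (force simp: K_def ev_def)
    then show ?thesis by (simp add: \<sigma>_def f_inv_into_f)
  qed
  define N where "N = \<lparr>carrier = \<sigma> ` K, monoid.mult = (\<lambda>a b. \<sigma> (ev a \<otimes>\<^bsub>M\<^esub> ev b)), one = \<sigma> \<one>\<^bsub>M\<^esub>\<rparr>"
  define \<psi> where "\<psi> = (\<lambda>g. \<lambda>a\<in>\<sigma> ` K. \<sigma> (\<phi> g (ev a)))"
  have "comm_group N"
  proof (rule comm_groupI)
    fix a assume "a \<in> carrier N"
    then obtain u where u: "u \<in> K" "a = \<sigma> u" by (auto simp: N_def)
    then have "\<sigma> (inv\<^bsub>M\<^esub> u) \<in> carrier N" "\<sigma> (inv\<^bsub>M\<^esub> u) \<otimes>\<^bsub>N\<^esub> a = \<one>\<^bsub>N\<^esub>"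
      using ev\<sigma> K.mem_carrier by (auto simp: N_def)
    then show "\<exists>b\<in>carrier N. b \<otimes>\<^bsub>N\<^esub> a = \<one>\<^bsub>N\<^esub>" by blast
  qed (auto simp: N_def ev\<sigma> M.m_ac)
  then have N: "g_module G N \<psi>"
  proof (rule g_moduleI[OF D(1)])
    fix g assume g: "g \<in> carrier G"
    show "\<psi> g \<in> extensional (carrier N)" by (simp add: \<psi>_def N_def)
    fix a assume "a \<in> carrier N"
    then obtain u where u: "u \<in> K" "a = \<sigma> u" by (auto simp: N_def)
    show "\<psi> g a \<in> carrier N"
      using Kst[OF g u(1)] u by (simp add: \<psi>_def N_def ev\<sigma>)
    fix h assume h: "h \<in> carrier G"
    show "\<psi> (g \<otimes>\<^bsub>G\<^esub> h) a = \<psi> g (\<psi> h a)"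
      using Kst[OF h u(1)] u D(7)[OF g h] by (simp add: \<psi>_def ev\<sigma>)
  next
    fix g a b assume g: "g \<in> carrier G" and "a \<in> carrier N" "b \<in> carrier N"
    then obtain u v where u: "u \<in> K" "a = \<sigma> u" and v: "v \<in> K" "b = \<sigma> v" by (auto simp: N_def)
    show "\<psi> g (a \<otimes>\<^bsub>N\<^esub> b) = \<psi> g a \<otimes>\<^bsub>N\<^esub> \<psi> g b"
      using Kst[OF g u(1)] Kst[OF g v(1)] u v D(6)[OF g] by (simp add: \<psi>_def N_def ev\<sigma>)
  next
    fix a assume "a \<in> carrier N"
    then obtain u where u: "u \<in> K" "a = \<sigma> u" by (auto simp: N_def)
    then show "\<psi> \<one>\<^bsub>G\<^esub> a = a" using D(8) by (simp add: \<psi>_def ev\<sigma>)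
  qed
  have "nonzero_cohomology G N \<psi> n"
  proof (rule nonzero_cohomology_transfer[OF M N _ _ _ z])
    show "ev \<in> hom N M" by (auto simp: hom_def N_def ev\<sigma> K.mem_carrier)
    show "inj_on ev (carrier N)" by (rule inj_onI) (auto simp: N_def ev\<sigma>)
    show "ev (\<psi> g a) = \<phi> g (ev a)" if "g \<in> carrier G" "a \<in> carrier N" for g a
      using that by (auto simp: N_def \<psi>_def ev\<sigma> Kst)
    show "z ` tuples G n \<subseteq> ev ` carrier N"
      using zK ev\<sigma> by (force simp: N_def image_iff)
  qed
  with N show ?thesis by blast
qed

theorem le_cohomological_dimension:
  fixes G :: "'g monoid" and M :: "'m monoid"
  assumes "g_module G M \<phi>" "nonzero_cohomology G M \<phi> n"
  shows "enat n \<le> cohomological_dimension G"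
  unfolding cohomological_dimension_def
  by (rule Sup_upper, rule CollectI, rule exI[of _ n])
    (simp add: nonzero_cohomology_list_int_module[OF assms])

end

theory Submission
  imports
    Defs
    "HOL-Algebra.Elementary_Groups"
    "HOL-Algebra.Zassenhaus"
    "HOL-Number_Theory.Residues"
begin

text \<open>Let F be a free group and \<open>\<pi> : F \<rightarrow> Q\<close> a surjection whose kernel N is the normal closure of a
  finite set, and let z be a central element of infinite order in Q. Then
  \<open>P = {(x, y, j). \<pi> y = \<pi> x z\<^sup>j}\<close> is a finitely generated subgroup of \<open>F \<times> F \<times> \<int>\<close>. It meets the
  third factor trivially, so it acts freely on a product of two trees, and its cohomological
  dimension is at most 2. The whole group contains \<open>\<int>\<^sup>3\<close>, which is detected by a 3-cocycle.

  The inclusion of P induces an isomorphism of profinite completions (as in the constructions of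
  Platonov and Tavgen) if Q has no finite quotients and if every finite quotient of N that is
  invariant under F extends to F. Both hold for \<open>N = \<langle>\<langle>a\<^sup>-\<^sup>1 [p a, q a], [r, a]\<rangle>\<rangle>\<close>, where a runs over
  the letters and r over a finite set of words, provided that the relations \<open>a = [p a, q a]\<close> and
  \<open>r = 1\<close> leave no finite quotients: the words r become central in Q, and z can be taken from
  them. Here the relations \<open>a = [p a, q a]\<close> are those of the elementary matrices
  \<open>e\<^sub>i\<^sub>j = [e\<^sub>i\<^sub>k, e\<^sub>k\<^sub>j]\<close> in two copies of \<open>SL\<^sub>3(\<int>)\<close>, and the words r express a Baumslag relation
  between them. The order of z is infinite since Q acts on a countable set on which z acts as a
  translation.\<close>

section \<open>Function modules\<close>

text \<open>The fibre product inside F \<times> F would not do, since it has the same dimension as F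
  \<times> F. The factor Z raises the dimension of the whole group, and the twist by z hides it from
  P, while finite quotients cannot notice z. The obstacle is Q: it must have no finite quotients,
  contain a central element of infinite order, and leave control over the finite quotients of N.
  Relations that hold only up to central elements provide the centre. Writing each letter as a
  commutator of letters takes the role that the vanishing of second homology has in similar
  constructions: commutators do not see central ambiguities, so they give canonical lifts. The two
  copies of SL_3(Z) share e_12 up to the element z. The Baumslag relation says that one element
  conjugates another to its square; two nontrivial elements of the same finite order cannot satisfy
  it, elements of infinite order can. For the infinite order of z no normal forms of amalgams are
  needed: all free actions of Z^3 on countable sets with infinitely many orbits are isomorphic, so
  the permutations of both copies can be arranged on one set.\<close>

definition g_set :: "'g monoid \<Rightarrow> 's set \<Rightarrow> ('g \<Rightarrow> 's \<Rightarrow> 's) \<Rightarrow> bool"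
  where "g_set G S \<sigma> \<longleftrightarrow> Group.group G \<and>
    (\<forall>g \<in> carrier G. \<forall>s \<in> S. \<sigma> g s \<in> S) \<and>
    (\<forall>g \<in> carrier G. \<forall>h \<in> carrier G. \<forall>s \<in> S. \<sigma> (g \<otimes>\<^bsub>G\<^esub> h) s = \<sigma> g (\<sigma> h s)) \<and>
    (\<forall>s \<in> S. \<sigma> \<one>\<^bsub>G\<^esub> s = s)"

lemma g_setD:
  assumes "g_set G S \<sigma>"
  shows "Group.group G"
    "\<And>g s. g \<in> carrier G \<Longrightarrow> s \<in> S \<Longrightarrow> \<sigma> g s \<in> S"
    "\<And>g h s. g \<in> carrier G \<Longrightarrow> h \<in> carrier G \<Longrightarrow> s \<in> S \<Longrightarrow> \<sigma> (g \<otimes>\<^bsub>G\<^esub> h) s = \<sigma> g (\<sigma> h s)"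
    "\<And>s. s \<in> S \<Longrightarrow> \<sigma> \<one>\<^bsub>G\<^esub> s = s"
    "\<And>g s. g \<in> carrier G \<Longrightarrow> s \<in> S \<Longrightarrow> \<sigma> g (\<sigma> (inv\<^bsub>G\<^esub> g) s) = s"
    "\<And>g s. g \<in> carrier G \<Longrightarrow> s \<in> S \<Longrightarrow> \<sigma> (inv\<^bsub>G\<^esub> g) (\<sigma> g s) = s"
proof -
  show G: "Group.group G" using assms by (simp add: g_set_def)
  interpret Group.group G by (rule G)
  show 1: "\<And>g s. g \<in> carrier G \<Longrightarrow> s \<in> S \<Longrightarrow> \<sigma> g s \<in> S"
    and 2: "\<And>g h s. g \<in> carrier G \<Longrightarrow> h \<in> carrier G \<Longrightarrow> s \<in> S \<Longrightarrow> \<sigma> (g \<otimes>\<^bsub>G\<^esub> h) s = \<sigma> g (\<sigma> h s)"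
    and 3: "\<And>s. s \<in> S \<Longrightarrow> \<sigma> \<one>\<^bsub>G\<^esub> s = s"
    using assms by (simp_all add: g_set_def)
  show "\<And>g s. g \<in> carrier G \<Longrightarrow> s \<in> S \<Longrightarrow> \<sigma> g (\<sigma> (inv\<^bsub>G\<^esub> g) s) = s"
    "\<And>g s. g \<in> carrier G \<Longrightarrow> s \<in> S \<Longrightarrow> \<sigma> (inv\<^bsub>G\<^esub> g) (\<sigma> g s) = s"
    by (simp_all flip: 2 add: 3)
qed

definition fun_module :: "'s set \<Rightarrow> 'm monoid \<Rightarrow> ('s \<Rightarrow> 'm) monoid"
  where "fun_module S M = product_group S (\<lambda>_. M)"

text \<open>The outer restriction to the carrier is there because the elements of
  \<open>AutoGroup\<close> are extensional functions.\<close>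

definition fun_action ::
    "'g monoid \<Rightarrow> 's set \<Rightarrow> ('g \<Rightarrow> 's \<Rightarrow> 's) \<Rightarrow> 'm monoid \<Rightarrow> ('g \<Rightarrow> 'm \<Rightarrow> 'm) \<Rightarrow> 'g \<Rightarrow> ('s \<Rightarrow> 'm) \<Rightarrow> 's \<Rightarrow> 'm"
  where "fun_action G S \<sigma> M \<phi> g = (\<lambda>f \<in> S \<rightarrow>\<^sub>E carrier M. \<lambda>s \<in> S. \<phi> g (f (\<sigma> (inv\<^bsub>G\<^esub> g) s)))"

lemma fun_module_simps [simp]:
  "carrier (fun_module S M) = S \<rightarrow>\<^sub>E carrier M"
  "\<one>\<^bsub>fun_module S M\<^esub> = (\<lambda>s\<in>S. \<one>\<^bsub>M\<^esub>)"
  "f \<otimes>\<^bsub>fun_module S M\<^esub> g = (\<lambda>s\<in>S. f s \<otimes>\<^bsub>M\<^esub> g s)"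
  by (auto simp: fun_module_def)

lemma comm_group_fun_module:
  assumes "comm_group M" shows "comm_group (fun_module S M)"
proof -
  interpret comm_group M by fact
  show ?thesis
  proof (rule group.group_comm_groupI)
    show "Group.group (fun_module S M)" by (simp add: fun_module_def)
  qed (auto intro!: restrict_ext m_comm elim: PiE_mem)
qed

lemma eval_hom:
  assumes "s \<in> S" shows "(\<lambda>f. f s) \<in> hom (fun_module S M) M"
  using assms by (auto simp: hom_def PiE_mem)

lemma g_module_fun:
  assumes M: "g_module G M \<phi>" and S: "g_set G S \<sigma>"
  shows "g_module G (fun_module S M) (fun_action G S \<sigma> M \<phi>)"
proof (rule g_moduleI)
  note D = g_moduleD[OF M] and E = g_setD[OF S]
  interpret Group.group G by (rule D(1))
  show "Group.group G" by (rule D(1))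
  show "comm_group (fun_module S M)" by (rule comm_group_fun_module[OF D(2)])
  fix g assume g: "g \<in> carrier G"
  show "fun_action G S \<sigma> M \<phi> g \<in> extensional (carrier (fun_module S M))"
    by (simp add: fun_action_def)
  have m: "\<And>f s h. f \<in> S \<rightarrow>\<^sub>E carrier M \<Longrightarrow> s \<in> S \<Longrightarrow> h \<in> carrier G \<Longrightarrow> f (\<sigma> (inv\<^bsub>G\<^esub> h) s) \<in> carrier M"
    by (rule PiE_mem, assumption, rule E(2)) auto
  fix f assume f: "f \<in> carrier (fun_module S M)"
  then show "fun_action G S \<sigma> M \<phi> g f \<in> carrier (fun_module S M)"
    using m D(5) g by (simp add: fun_action_def)
  show "fun_action G S \<sigma> M \<phi> g (f \<otimes>\<^bsub>fun_module S M\<^esub> f') =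
      fun_action G S \<sigma> M \<phi> g f \<otimes>\<^bsub>fun_module S M\<^esub> fun_action G S \<sigma> M \<phi> g f'"
    if "f' \<in> carrier (fun_module S M)" for f'
  proof -
    interpret M: comm_group M by (rule D(2))
    have "(\<lambda>s\<in>S. f s \<otimes>\<^bsub>M\<^esub> f' s) \<in> S \<rightarrow>\<^sub>E carrier M"
      using f that by (auto simp: PiE_mem)
    then show ?thesis
      using f that g m D(6) E(2) by (auto simp: fun_action_def intro!: restrict_ext)
  qed
  show "fun_action G S \<sigma> M \<phi> (g \<otimes>\<^bsub>G\<^esub> h) f = fun_action G S \<sigma> M \<phi> g (fun_action G S \<sigma> M \<phi> h f)"
    if h: "h \<in> carrier G" for h
  proof -
    have "(\<lambda>s\<in>S. \<phi> h (f (\<sigma> (inv\<^bsub>G\<^esub> h) s))) \<in> S \<rightarrow>\<^sub>E carrier M"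
      using f h m D(5) by simp
    then show ?thesis
      using f g h m D(7) E(2,3) by (auto simp: fun_action_def inv_mult_group intro!: restrict_ext)
  qed
next
  fix f assume f: "f \<in> carrier (fun_module S M)"
  note D = g_moduleD[OF M] and E = g_setD[OF S]
  interpret Group.group G by (rule D(1))
  show "fun_action G S \<sigma> M \<phi> \<one>\<^bsub>G\<^esub> f = f"
    using f D(8) E(4) by (intro extensionalityI[of _ S]) (auto simp: fun_action_def PiE_mem PiE_def)
qed

lemma fun_action_apply:
  assumes "f \<in> S \<rightarrow>\<^sub>E carrier M" "s \<in> S"
  shows "fun_action G S \<sigma> M \<phi> g f s = \<phi> g (f (\<sigma> (inv\<^bsub>G\<^esub> g) s))"
  using assms by (simp add: fun_action_def)

section \<open>Contracting homotopy for functions on a G-set\<close>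

lemma coboundary_apply:
  assumes "xs \<in> tuples G (Suc n)"
  shows "coboundary G M \<phi> n f xs = \<phi> (hd xs) (f (tl xs))
       \<otimes>\<^bsub>M\<^esub> (\<Otimes>\<^bsub>M\<^esub>i\<in>{..<n}. f (merge_at G i xs) [^]\<^bsub>M\<^esub> ((- 1) ^ Suc i :: int))
       \<otimes>\<^bsub>M\<^esub> f (butlast xs) [^]\<^bsub>M\<^esub> ((- 1) ^ Suc n :: int)"
  unfolding coboundary_def by (rule restrict_apply'[OF assms])


text \<open>Evaluation at s is a homomorphism of groups but not of G-modules. So every term is
  evaluated at s except the first, where the action moves s by the inverse of the first
  entry.\<close>

lemma coboundary_fun_apply:
  assumes M: "g_module G M \<phi>" and S: "g_set G S \<sigma>"
    and f: "f \<in> tuples G n \<rightarrow>\<^sub>E (S \<rightarrow>\<^sub>E carrier M)" and xs: "xs \<in> tuples G (Suc n)" and s: "s \<in> S"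
  shows "coboundary G (fun_module S M) (fun_action G S \<sigma> M \<phi>) n f xs s =
       \<phi> (hd xs) (f (tl xs) (\<sigma> (inv\<^bsub>G\<^esub> (hd xs)) s))
       \<otimes>\<^bsub>M\<^esub> (\<Otimes>\<^bsub>M\<^esub>i\<in>{..<n}. f (merge_at G i xs) s [^]\<^bsub>M\<^esub> ((- 1) ^ Suc i :: int))
       \<otimes>\<^bsub>M\<^esub> f (butlast xs) s [^]\<^bsub>M\<^esub> ((- 1) ^ Suc n :: int)"
proof -
  let ?A = "fun_module S M" let ?\<psi> = "fun_action G S \<sigma> M \<phi>"
  note D = g_moduleD[OF M] and A = g_module_fun[OF M S]
  interpret A: comm_group ?A using g_moduleD(2)[OF A] .
  interpret M: comm_group M by (rule D(2))
  note T = tuples_simps[OF D(1) xs]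
  note ev = eval_hom[OF s, of M]
  have fc: "f ys \<in> carrier ?A" if "ys \<in> tuples G n" for ys using f that by auto
  have pw: "(u [^]\<^bsub>?A\<^esub> (k::int)) s = u s [^]\<^bsub>M\<^esub> k" if "u \<in> carrier ?A" for u k
    using hom_int_pow[OF ev that] A.is_group M.is_group by blast
  let ?p = "\<lambda>i. f (merge_at G i xs) [^]\<^bsub>?A\<^esub> ((- 1) ^ Suc i :: int)"
  have pc: "?p \<in> {..<n} \<rightarrow> carrier ?A"
    by (rule Pi_I, rule A.int_pow_closed, rule fc, rule T(4)) simp
  have "finprod ?A ?p {..<n} s = (\<Otimes>\<^bsub>M\<^esub>i\<in>{..<n}. ?p i s)"
    by (rule hom_finprod[OF g_moduleD(2)[OF A] D(2) ev pc])
  also have "\<dots> = (\<Otimes>\<^bsub>M\<^esub>i\<in>{..<n}. f (merge_at G i xs) s [^]\<^bsub>M\<^esub> ((- 1) ^ Suc i :: int))"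
  proof (rule M.finprod_cong')
    fix i assume "i \<in> {..<n}"
    then have m: "merge_at G i xs \<in> tuples G n" using T(4) by blast
    show "?p i s = f (merge_at G i xs) s [^]\<^bsub>M\<^esub> ((- 1) ^ Suc i :: int)"
      by (rule pw[OF fc[OF m]])
  next
    show "(\<lambda>i. f (merge_at G i xs) s [^]\<^bsub>M\<^esub> ((- 1) ^ Suc i :: int)) \<in> {..<n} \<rightarrow> carrier M"
    proof (rule Pi_I, rule M.int_pow_closed)
      fix i assume "i \<in> {..<n}"
      then have "merge_at G i xs \<in> tuples G n" using T(4) by blast
      from fc[OF this] s show "f (merge_at G i xs) s \<in> carrier M" by auto
    qed
  qed simp
  finally have 1: "finprod ?A ?p {..<n} s = \<dots>" .
  have 2: "?\<psi> (hd xs) (f (tl xs)) s = \<phi> (hd xs) (f (tl xs) (\<sigma> (inv\<^bsub>G\<^esub> (hd xs)) s))"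
    by (rule fun_action_apply[OF _ s]) (use fc[OF T(2)] in simp)
  show ?thesis
    unfolding coboundary_apply[OF xs]
    using s 1 2 pw[OF fc[OF T(3)]] by (simp del: power_Suc)
qed

text \<open>In homogeneous coordinates this puts the vertex \<open>r s\<close> in front of the given
  ones. Translating the first vertex back to the neutral element produces the entry
  \<open>inv (r s)\<close>, the shifted point and the outer \<open>\<phi> (r s)\<close>.\<close>

definition contraction ::
    "'g monoid \<Rightarrow> 's set \<Rightarrow> ('g \<Rightarrow> 's \<Rightarrow> 's) \<Rightarrow> ('g \<Rightarrow> 'm \<Rightarrow> 'm) \<Rightarrow> ('s \<Rightarrow> 'g) \<Rightarrow> nat
      \<Rightarrow> ('g list \<Rightarrow> 's \<Rightarrow> 'm) \<Rightarrow> 'g list \<Rightarrow> 's \<Rightarrow> 'm"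
  where "contraction G S \<sigma> \<phi> r n z = (\<lambda>ys \<in> tuples G n. \<lambda>s \<in> S.
    \<phi> (r s) (z (inv\<^bsub>G\<^esub> (r s) # ys) (\<sigma> (inv\<^bsub>G\<^esub> (r s)) s)))"

lemma contraction_closed:
  assumes M: "g_module G M \<phi>" and S: "g_set G S \<sigma>" and r: "r \<in> S \<rightarrow> carrier G"
    and z: "z \<in> tuples G (Suc n) \<rightarrow>\<^sub>E (S \<rightarrow>\<^sub>E carrier M)"
  shows "contraction G S \<sigma> \<phi> r n z \<in> tuples G n \<rightarrow>\<^sub>E (S \<rightarrow>\<^sub>E carrier M)"
proof -
  note D = g_moduleD[OF M] and E = g_setD[OF S]
  interpret Group.group G by (rule D(1))
  have "\<phi> (r s) (z (inv\<^bsub>G\<^esub> (r s) # ys) (\<sigma> (inv\<^bsub>G\<^esub> (r s)) s)) \<in> carrier M"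
    if "ys \<in> tuples G n" "s \<in> S" for ys s
  proof (rule D(5))
    show rs: "r s \<in> carrier G" using r that by auto
    then have "inv\<^bsub>G\<^esub> (r s) # ys \<in> tuples G (Suc n)" using that by (auto simp: tuples_def)
    then have "z (inv\<^bsub>G\<^esub> (r s) # ys) \<in> S \<rightarrow>\<^sub>E carrier M" using z by auto
    moreover have "\<sigma> (inv\<^bsub>G\<^esub> (r s)) s \<in> S" using E(2) rs that by auto
    ultimately show "z (inv\<^bsub>G\<^esub> (r s) # ys) (\<sigma> (inv\<^bsub>G\<^esub> (r s)) s) \<in> carrier M" by auto
  qed
  then show ?thesis by (auto simp: contraction_def)
qed

lemma merge_at_Cons:
  "merge_at G (Suc i) (g # xs) = g # merge_at G i xs"
  "xs \<noteq> [] \<Longrightarrow> merge_at G 0 (g # xs) = (g \<otimes>\<^bsub>G\<^esub> hd xs) # tl xs"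
  by (auto simp: merge_at_def hd_conv_nth drop_Suc)

lemma (in comm_monoid) finprod_lessThan_Suc_shift:
  assumes "f \<in> {..<Suc n} \<rightarrow> carrier G"
  shows "(\<Otimes>i\<in>{..<Suc n}. f i) = f 0 \<otimes> (\<Otimes>i\<in>{..<n}. f (Suc i))"
proof -
  have "(\<Otimes>i\<in>{..<Suc n}. f i) = f 0 \<otimes> (\<Otimes>i\<in>Suc ` {..<n}. f i)"
    unfolding lessThan_Suc_eq_insert_0 by (rule finprod_insert) (use assms in auto)
  also have "(\<Otimes>i\<in>Suc ` {..<n}. f i) = (\<Otimes>i\<in>{..<n}. f (Suc i))"
    by (rule finprod_reindex) (use assms in auto)
  finally show ?thesis .
qed

text \<open>This is the cone with apex \<open>r s\<close>: among the faces of the enlarged simplex,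
  the one that omits the apex gives back z, and the others cancel against the faces of xs, whose
  positions, and therefore signs, are shifted by one.\<close>

lemma contraction_homotopy:
  assumes M: "g_module G M \<phi>" and S: "g_set G S \<sigma>" and r: "r \<in> S \<rightarrow> carrier G"
    and req: "\<And>g s. g \<in> carrier G \<Longrightarrow> s \<in> S \<Longrightarrow> r (\<sigma> g s) = g \<otimes>\<^bsub>G\<^esub> r s"
    and z: "z \<in> tuples G (Suc k) \<rightarrow>\<^sub>E (S \<rightarrow>\<^sub>E carrier M)"
    and xs: "xs \<in> tuples G (Suc k)" and s: "s \<in> S"
  defines "A \<equiv> fun_module S M" and "\<psi> \<equiv> fun_action G S \<sigma> M \<phi>"
  shows "coboundary G A \<psi> k (contraction G S \<sigma> \<phi> r k z) xs s
     \<otimes>\<^bsub>M\<^esub> contraction G S \<sigma> \<phi> r (Suc k) (coboundary G A \<psi> (Suc k) z) xs s = z xs s"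
proof -
  note D = g_moduleD[OF M] and E = g_setD[OF S]
  interpret Group.group G by (rule D(1))
  interpret M: comm_group M by (rule D(2))
  note T = tuples_simps[OF D(1) xs]
  define q where "q = inv\<^bsub>G\<^esub> (r s)"
  define s' where "s' = \<sigma> q s"
  define h where "h = contraction G S \<sigma> \<phi> r k z"
  have rs: "r s \<in> carrier G" using r s by auto
  have q: "q \<in> carrier G" "inv\<^bsub>G\<^esub> q = r s" using rs by (auto simp: q_def)
  have s': "s' \<in> S" "\<sigma> (r s) s' = s" using E(2,5) q rs s by (auto simp: s'_def q_def)
  have qT: "q # ys \<in> tuples G (Suc n)" if "ys \<in> tuples G n" for ys n
    using that q by (auto simp: tuples_def)
  have zc: "z ys t \<in> carrier M" if "ys \<in> tuples G (Suc k)" "t \<in> S" for ys t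
    using z that by (meson PiE_mem)
  have xsne: "xs \<noteq> []" using xs by (auto simp: tuples_def)
  let ?f = "\<phi> (r s)"
  have fh: "?f \<in> hom M M" by (rule D(4)[OF rs])
  have pw: "?f (u [^]\<^bsub>M\<^esub> (j::int)) = ?f u [^]\<^bsub>M\<^esub> j" if "u \<in> carrier M" for u j
    using hom_int_pow[OF fh that] M.is_group by blast
  have fc: "?f u \<in> carrier M" if "u \<in> carrier M" for u by (rule D(5)[OF rs that])
  \<comment> \<open>These are the faces that keep the apex: a merges its entry q with the first
    entry of xs, \<open>b i\<close> merges the entries i and i + 1 of xs, and c drops the last
    entry.\<close>
  define a where "a = ?f (z ((q \<otimes>\<^bsub>G\<^esub> hd xs) # tl xs) s')"
  define b where "b = (\<lambda>i. ?f (z (q # merge_at G i xs) s'))"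
  define c where "c = ?f (z (q # butlast xs) s')"
  define B where "B = (\<Otimes>\<^bsub>M\<^esub>i\<in>{..<k}. b i [^]\<^bsub>M\<^esub> ((- 1) ^ Suc i :: int))"
  have aT: "(q \<otimes>\<^bsub>G\<^esub> hd xs) # tl xs \<in> tuples G (Suc k)" using T q by (auto simp: tuples_def)
  have ac: "a \<in> carrier M" unfolding a_def by (intro fc zc aT s')
  have bc: "b i \<in> carrier M" if "i < k" for i unfolding b_def by (intro fc zc qT T s' that)
  have cc: "c \<in> carrier M" unfolding c_def by (intro fc zc qT T s')
  have Bc: "B \<in> carrier M"
    unfolding B_def by (rule M.finprod_closed, rule Pi_I, rule M.int_pow_closed, rule bc) simp
  have hv: "h ys s = ?f (z (q # ys) s')" if "ys \<in> tuples G k" for ys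
    using that s by (simp add: h_def contraction_def q_def s'_def)
  have 1: "coboundary G A \<psi> k h xs s = a \<otimes>\<^bsub>M\<^esub> B \<otimes>\<^bsub>M\<^esub> c [^]\<^bsub>M\<^esub> ((- 1) ^ Suc k :: int)"
  proof -
    have hC: "h \<in> tuples G k \<rightarrow>\<^sub>E (S \<rightarrow>\<^sub>E carrier M)"
      unfolding h_def by (rule contraction_closed[OF M S r z])
    have hx: "hd xs \<in> carrier G" "inv\<^bsub>G\<^esub> hd xs \<in> carrier G" using T(1) by auto
    \<comment> \<open>Equivariance of r enters here. The first term of the coboundary is evaluated
      at a shifted point, and there the inserted entry is the product of q and \<open>hd xs\<close>,
      as in a.\<close>
    have r': "r (\<sigma> (inv\<^bsub>G\<^esub> hd xs) s) = inv\<^bsub>G\<^esub> hd xs \<otimes>\<^bsub>G\<^esub> r s" by (rule req[OF hx(2) s])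
    have q': "inv\<^bsub>G\<^esub> (inv\<^bsub>G\<^esub> hd xs \<otimes>\<^bsub>G\<^esub> r s) = q \<otimes>\<^bsub>G\<^esub> hd xs"
      using hx rs by (simp add: inv_mult_group q_def)
    have s'': "\<sigma> (q \<otimes>\<^bsub>G\<^esub> hd xs) (\<sigma> (inv\<^bsub>G\<^esub> hd xs) s) = s'"
      using E(2,3,5) hx q s by (simp add: s'_def)
    have "h (tl xs) (\<sigma> (inv\<^bsub>G\<^esub> hd xs) s) = \<phi> (inv\<^bsub>G\<^esub> hd xs \<otimes>\<^bsub>G\<^esub> r s) (z ((q \<otimes>\<^bsub>G\<^esub> hd xs) # tl xs) s')"
      using T(2) E(2)[OF hx(2) s] by (simp add: h_def contraction_def r' q' s'')
    then have "\<phi> (hd xs) (h (tl xs) (\<sigma> (inv\<^bsub>G\<^esub> hd xs) s))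
        = \<phi> (hd xs \<otimes>\<^bsub>G\<^esub> (inv\<^bsub>G\<^esub> hd xs \<otimes>\<^bsub>G\<^esub> r s)) (z ((q \<otimes>\<^bsub>G\<^esub> hd xs) # tl xs) s')"
      using D(7) hx rs zc[OF aT s'(1)] by simp
    also have "\<dots> = a" using hx rs by (simp add: a_def m_assoc[symmetric])
    finally have "\<phi> (hd xs) (h (tl xs) (\<sigma> (inv\<^bsub>G\<^esub> hd xs) s)) = a" .
    moreover have "(\<Otimes>\<^bsub>M\<^esub>i\<in>{..<k}. h (merge_at G i xs) s [^]\<^bsub>M\<^esub> ((- 1) ^ Suc i :: int)) = B"
      unfolding B_def
    proof (rule M.finprod_cong')
      fix i assume "i \<in> {..<k}"
      then show "h (merge_at G i xs) s [^]\<^bsub>M\<^esub> ((- 1) ^ Suc i :: int) = b i [^]\<^bsub>M\<^esub> ((- 1) ^ Suc i :: int)"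
        using hv[OF T(4)] by (simp add: b_def)
    qed (use bc in \<open>auto intro: M.int_pow_closed\<close>)
    ultimately show ?thesis
      unfolding A_def \<psi>_def coboundary_fun_apply[OF M S hC xs s]
      by (simp add: hv[OF T(3)] c_def del: power_Suc)
  qed
  have 2: "contraction G S \<sigma> \<phi> r (Suc k) (coboundary G A \<psi> (Suc k) z) xs s
    = z xs s \<otimes>\<^bsub>M\<^esub> (inv\<^bsub>M\<^esub> a \<otimes>\<^bsub>M\<^esub> inv\<^bsub>M\<^esub> B) \<otimes>\<^bsub>M\<^esub> inv\<^bsub>M\<^esub> (c [^]\<^bsub>M\<^esub> ((- 1) ^ Suc k :: int))"
  proof -
    let ?e = "\<lambda>i. z (merge_at G i (q # xs)) s' [^]\<^bsub>M\<^esub> ((- 1) ^ Suc i :: int)"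
    have mT: "merge_at G i (q # xs) \<in> tuples G (Suc k)" if "i < Suc k" for i
      by (rule tuples_simps(4)[OF D(1) qT[OF xs] that])
    have ec: "?e \<in> {..<Suc k} \<rightarrow> carrier M"
      by (rule Pi_I, rule M.int_pow_closed, rule zc[OF mT s'(1)]) simp
    have d: "coboundary G A \<psi> (Suc k) z (q # xs) s' = \<phi> q (z xs s) \<otimes>\<^bsub>M\<^esub> (\<Otimes>\<^bsub>M\<^esub>i\<in>{..<Suc k}. ?e i)
       \<otimes>\<^bsub>M\<^esub> z (q # butlast xs) s' [^]\<^bsub>M\<^esub> ((- 1) ^ Suc (Suc k) :: int)"
      unfolding A_def \<psi>_def coboundary_fun_apply[OF M S z qT[OF xs] s'(1)]
      using xsne by (simp add: q(2) s'(2) del: power_Suc)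
    have "?f (\<Otimes>\<^bsub>M\<^esub>i\<in>{..<Suc k}. ?e i) = (\<Otimes>\<^bsub>M\<^esub>i\<in>{..<Suc k}. ?f (?e i))"
      by (rule hom_finprod[OF D(2) D(2) fh ec])
    also have "\<dots> = ?f (?e 0) \<otimes>\<^bsub>M\<^esub> (\<Otimes>\<^bsub>M\<^esub>i\<in>{..<k}. ?f (?e (Suc i)))"
      by (rule M.finprod_lessThan_Suc_shift) (use ec fc in blast)
    also have "?f (?e 0) = inv\<^bsub>M\<^esub> a"
      using xsne pw[OF zc[OF aT s'(1)], of "-1"] ac zc[OF aT s'(1)]
      by (simp add: merge_at_Cons a_def M.int_pow_neg M.int_pow_1)
    also have "(\<Otimes>\<^bsub>M\<^esub>i\<in>{..<k}. ?f (?e (Suc i))) = (\<Otimes>\<^bsub>M\<^esub>i\<in>{..<k}. inv\<^bsub>M\<^esub> (b i [^]\<^bsub>M\<^esub> ((- 1) ^ Suc i :: int)))"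
    proof (rule M.finprod_cong')
      fix i assume "i \<in> {..<k}"
      then have i: "i < k" by simp
      have "?f (?e (Suc i)) = b i [^]\<^bsub>M\<^esub> ((- 1) ^ Suc (Suc i) :: int)"
        unfolding merge_at_Cons b_def by (rule pw[OF zc[OF qT[OF T(4)[OF i]] s'(1)]])
      also have "\<dots> = b i [^]\<^bsub>M\<^esub> (- ((- 1) ^ Suc i) :: int)" by simp
      also have "\<dots> = inv\<^bsub>M\<^esub> (b i [^]\<^bsub>M\<^esub> ((- 1) ^ Suc i :: int))"
        by (rule M.int_pow_neg[OF bc[OF i]])
      finally show "?f (?e (Suc i)) = inv\<^bsub>M\<^esub> (b i [^]\<^bsub>M\<^esub> ((- 1) ^ Suc i :: int))" .
    qed (use bc in \<open>auto intro!: M.inv_closed M.int_pow_closed\<close>)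
    also have "\<dots> = inv\<^bsub>M\<^esub> B"
    proof -
      have "(\<lambda>u. inv\<^bsub>M\<^esub> u) \<in> hom M M" by (auto simp: hom_def M.inv_mult)
      moreover have "(\<lambda>i. b i [^]\<^bsub>M\<^esub> ((- 1) ^ Suc i :: int)) \<in> {..<k} \<rightarrow> carrier M"
        using bc by (auto intro: M.int_pow_closed)
      ultimately show ?thesis
        unfolding B_def by (rule hom_finprod[OF D(2) D(2), symmetric])
    qed
    finally have e: "?f (\<Otimes>\<^bsub>M\<^esub>i\<in>{..<Suc k}. ?e i) = inv\<^bsub>M\<^esub> a \<otimes>\<^bsub>M\<^esub> inv\<^bsub>M\<^esub> B" .
    have "?f (z (q # butlast xs) s' [^]\<^bsub>M\<^esub> ((- 1) ^ Suc (Suc k) :: int)) = c [^]\<^bsub>M\<^esub> (- ((- 1) ^ Suc k) :: int)"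
      using pw[OF zc[OF qT[OF T(3)] s'(1)], of "- ((- 1) ^ Suc k)"] by (simp add: c_def)
    also have "\<dots> = inv\<^bsub>M\<^esub> (c [^]\<^bsub>M\<^esub> ((- 1) ^ Suc k :: int))" by (rule M.int_pow_neg[OF cc])
    finally have l: "?f (z (q # butlast xs) s' [^]\<^bsub>M\<^esub> ((- 1) ^ Suc (Suc k) :: int)) = \<dots>" .
    have zx: "z xs s \<in> carrier M" by (rule zc[OF xs s])
    have "\<phi> (r s) (\<phi> q (z xs s)) = z xs s"
      using D(7)[OF rs q(1) zx, symmetric] D(8)[OF zx] rs by (simp add: q_def)
    moreover have "\<phi> q (z xs s) \<in> carrier M" by (rule D(5)[OF q(1) zx])
    moreover have "z (q # butlast xs) s' [^]\<^bsub>M\<^esub> ((- 1) ^ Suc (Suc k) :: int) \<in> carrier M"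
      by (intro M.int_pow_closed zc qT T s')
    moreover have "(\<Otimes>\<^bsub>M\<^esub>i\<in>{..<Suc k}. ?e i) \<in> carrier M" by (rule M.finprod_closed[OF ec])
    ultimately have "?f (coboundary G A \<psi> (Suc k) z (q # xs) s') =
      z xs s \<otimes>\<^bsub>M\<^esub> (inv\<^bsub>M\<^esub> a \<otimes>\<^bsub>M\<^esub> inv\<^bsub>M\<^esub> B) \<otimes>\<^bsub>M\<^esub> inv\<^bsub>M\<^esub> (c [^]\<^bsub>M\<^esub> ((- 1) ^ Suc k :: int))"
      unfolding d by (simp only: D(6)[OF rs] M.m_closed e l)
    then show ?thesis using xs s by (simp add: contraction_def q_def s'_def)
  qed
  define d where "d = c [^]\<^bsub>M\<^esub> ((- 1) ^ Suc k :: int)"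
  have dc: "d \<in> carrier M" unfolding d_def by (rule M.int_pow_closed[OF cc])
  have x: "z xs s \<in> carrier M" by (rule zc[OF xs s])
  have "(a \<otimes>\<^bsub>M\<^esub> B \<otimes>\<^bsub>M\<^esub> d) \<otimes>\<^bsub>M\<^esub> (z xs s \<otimes>\<^bsub>M\<^esub> (inv\<^bsub>M\<^esub> a \<otimes>\<^bsub>M\<^esub> inv\<^bsub>M\<^esub> B) \<otimes>\<^bsub>M\<^esub> inv\<^bsub>M\<^esub> d)
    = z xs s \<otimes>\<^bsub>M\<^esub> ((a \<otimes>\<^bsub>M\<^esub> inv\<^bsub>M\<^esub> a) \<otimes>\<^bsub>M\<^esub> ((B \<otimes>\<^bsub>M\<^esub> inv\<^bsub>M\<^esub> B) \<otimes>\<^bsub>M\<^esub> (d \<otimes>\<^bsub>M\<^esub> inv\<^bsub>M\<^esub> d)))"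
    by (simp only: M.m_ac M.m_closed M.inv_closed ac Bc dc x)
  then show ?thesis
    unfolding h_def[symmetric] 1 2 d_def[symmetric] using ac Bc dc x by simp
qed

lemma coboundary_extensional [simp]: "coboundary G M \<phi> n f \<in> extensional (tuples G (Suc n))"
  by (simp add: coboundary_def)

lemma contraction_homotopy_cochain:
  assumes M: "g_module G M \<phi>" and S: "g_set G S \<sigma>" and r: "r \<in> S \<rightarrow> carrier G"
    and req: "\<And>g s. g \<in> carrier G \<Longrightarrow> s \<in> S \<Longrightarrow> r (\<sigma> g s) = g \<otimes>\<^bsub>G\<^esub> r s"
    and z: "z \<in> tuples G (Suc k) \<rightarrow>\<^sub>E (S \<rightarrow>\<^sub>E carrier M)"
  defines "A \<equiv> fun_module S M" and "\<psi> \<equiv> fun_action G S \<sigma> M \<phi>"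
  shows "coboundary G A \<psi> k (contraction G S \<sigma> \<phi> r k z)
     \<otimes>\<^bsub>cochains G A (Suc k)\<^esub> contraction G S \<sigma> \<phi> r (Suc k) (coboundary G A \<psi> (Suc k) z) = z"
proof -
  have H: "coboundary G A \<psi> k (contraction G S \<sigma> \<phi> r k z) xs s
     \<otimes>\<^bsub>M\<^esub> contraction G S \<sigma> \<phi> r (Suc k) (coboundary G A \<psi> (Suc k) z) xs s = z xs s"
    if "xs \<in> tuples G (Suc k)" "s \<in> S" for xs s
    unfolding A_def \<psi>_def by (rule contraction_homotopy[OF M S r req z that])
  show ?thesis
  proof (rule extensionalityI[of _ "tuples G (Suc k)"])
    fix xs assume xs: "xs \<in> tuples G (Suc k)"
    have "z xs \<in> extensional S" using z xs by (auto simp: PiE_def)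
    then show "(coboundary G A \<psi> k (contraction G S \<sigma> \<phi> r k z)
        \<otimes>\<^bsub>cochains G A (Suc k)\<^esub> contraction G S \<sigma> \<phi> r (Suc k) (coboundary G A \<psi> (Suc k) z)) xs = z xs"
      using xs H[OF xs] by (intro extensionalityI[of _ S]) (simp_all add: A_def)
  qed (use z in \<open>simp_all add: PiE_def\<close>)
qed

section \<open>The square of the coboundary\<close>

lemma coboundary_coboundary_0:
  assumes M: "g_module G M \<phi>" and f: "f \<in> tuples G 0 \<rightarrow>\<^sub>E carrier M"
  shows "coboundary G M \<phi> (Suc 0) (coboundary G M \<phi> 0 f) = \<one>\<^bsub>cochains G M (Suc (Suc 0))\<^esub>"
proof -
  note D = g_moduleD[OF M]
  interpret Group.group G by (rule D(1))
  interpret M: comm_group M by (rule D(2))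
  have fc: "f [] \<in> carrier M" using f by (auto simp: tuples_def)
  have 1: "coboundary G M \<phi> 0 f [x] = \<phi> x (f []) \<otimes>\<^bsub>M\<^esub> inv\<^bsub>M\<^esub> f []" if "x \<in> carrier G" for x
    using that fc D(5)[OF that fc]
    by (subst coboundary_apply) (auto simp: tuples_def M.int_pow_neg M.int_pow_1)
  have "coboundary G M \<phi> (Suc 0) (coboundary G M \<phi> 0 f) [x, y] = \<one>\<^bsub>M\<^esub>"
    if xy: "x \<in> carrier G" "y \<in> carrier G" for x y
  proof -
    have *: "[x, y] \<in> tuples G (Suc (Suc 0))" "x \<otimes>\<^bsub>G\<^esub> y \<in> carrier G" using xy by (auto simp: tuples_def)
    define u where "u = f []"
    define v where "v = \<phi> x u"
    define w where "w = \<phi> x (\<phi> y u)"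
    have c: "u \<in> carrier M" "v \<in> carrier M" "w \<in> carrier M" "\<phi> y u \<in> carrier M"
      using fc D(5) xy by (simp_all add: u_def v_def w_def)
    have "(w \<otimes>\<^bsub>M\<^esub> inv\<^bsub>M\<^esub> v) \<otimes>\<^bsub>M\<^esub> inv\<^bsub>M\<^esub> (w \<otimes>\<^bsub>M\<^esub> inv\<^bsub>M\<^esub> u) \<otimes>\<^bsub>M\<^esub> (v \<otimes>\<^bsub>M\<^esub> inv\<^bsub>M\<^esub> u) = \<one>\<^bsub>M\<^esub>"
    proof -
      have "(w \<otimes>\<^bsub>M\<^esub> inv\<^bsub>M\<^esub> v) \<otimes>\<^bsub>M\<^esub> inv\<^bsub>M\<^esub> (w \<otimes>\<^bsub>M\<^esub> inv\<^bsub>M\<^esub> u) \<otimes>\<^bsub>M\<^esub> (v \<otimes>\<^bsub>M\<^esub> inv\<^bsub>M\<^esub> u)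
        = (w \<otimes>\<^bsub>M\<^esub> inv\<^bsub>M\<^esub> w) \<otimes>\<^bsub>M\<^esub> ((v \<otimes>\<^bsub>M\<^esub> inv\<^bsub>M\<^esub> v) \<otimes>\<^bsub>M\<^esub> (u \<otimes>\<^bsub>M\<^esub> inv\<^bsub>M\<^esub> u))"
        by (simp only: M.inv_mult M.inv_inv M.m_ac M.m_closed M.inv_closed c)
      then show ?thesis using c by simp
    qed
    moreover have "\<phi> x (\<phi> y u \<otimes>\<^bsub>M\<^esub> inv\<^bsub>M\<^esub> u) = w \<otimes>\<^bsub>M\<^esub> inv\<^bsub>M\<^esub> v"
      using c xy by (simp add: D(6) D(10) v_def w_def)
    moreover have "\<phi> (x \<otimes>\<^bsub>G\<^esub> y) u = w" using D(7) xy c by (simp add: w_def)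
    ultimately show ?thesis
      unfolding coboundary_apply[OF *(1)]
      using c xy * by (simp add: lessThan_Suc merge_at_def 1 u_def[symmetric] v_def[symmetric] M.int_pow_neg M.int_pow_1)
  qed
  then have "coboundary G M \<phi> (Suc 0) (coboundary G M \<phi> 0 f) xs = \<one>\<^bsub>M\<^esub>"
    if "xs \<in> tuples G (Suc (Suc 0))" for xs
    using that by (auto simp: tuples_def length_Suc_conv)
  then show ?thesis
    by (intro extensionalityI[of _ "tuples G (Suc (Suc 0))"]) simp_all
qed

text \<open>Write d for the coboundary. If \<open>d d = 0\<close> in degree n, then the homotopy identity, applied to f
  and to \<open>d f\<close>, shows that every contraction kills \<open>d (d f)\<close> in the next degree. The contractions
  along the right translates \<open>r s = s \<otimes> t\<close> detect every value of a cochain.\<close>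

lemma coboundary_coboundary_fun:
  assumes M: "g_module G M \<phi>"
  defines "A \<equiv> fun_module (carrier G) M" and "\<psi> \<equiv> fun_action G (carrier G) (\<otimes>\<^bsub>G\<^esub>) M \<phi>"
  assumes f: "f \<in> carrier (cochains G A n)"
  shows "coboundary G A \<psi> (Suc n) (coboundary G A \<psi> n f) = \<one>\<^bsub>cochains G A (Suc (Suc n))\<^esub>"
  using f
proof (induct n arbitrary: f)
  note D = g_moduleD[OF M]
  interpret Group.group G by (rule D(1))
  have S: "g_set G (carrier G) (\<otimes>\<^bsub>G\<^esub>)" by (auto simp: g_set_def m_assoc)
  have A: "g_module G A \<psi>" unfolding A_def \<psi>_def by (rule g_module_fun[OF M S])
  {
    case 0
    then show ?case using coboundary_coboundary_0[OF A, of f] by simp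
  next
    case (Suc n)
    interpret C: Group.group "cochains G A m" for m using group_cochains g_moduleD(3)[OF A] by blast
    have d_mult: "coboundary G A \<psi> m (u \<otimes>\<^bsub>cochains G A m\<^esub> v)
      = coboundary G A \<psi> m u \<otimes>\<^bsub>cochains G A (Suc m)\<^esub> coboundary G A \<psi> m v"
      if "u \<in> carrier (cochains G A m)" "v \<in> carrier (cochains G A m)" for u v m
      by (rule hom_mult[OF coboundary_hom[OF A] that])
    have dc: "coboundary G A \<psi> m u \<in> carrier (cochains G A (Suc m))"
      if "u \<in> carrier (cochains G A m)" for u m
      by (rule hom_in_carrier[OF coboundary_hom[OF A] that])
    define z where "z = coboundary G A \<psi> (Suc n) f"
    have z: "z \<in> carrier (cochains G A (Suc (Suc n)))" unfolding z_def by (rule dc[OF Suc.prems])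
    have "coboundary G A \<psi> (Suc (Suc n)) z xs u = \<one>\<^bsub>M\<^esub>"
      if xs: "xs \<in> tuples G (Suc (Suc (Suc n)))" and u: "u \<in> carrier G" for xs u
    proof -
      define t where "t = inv\<^bsub>G\<^esub> u"
      define r where "r = (\<lambda>s. s \<otimes>\<^bsub>G\<^esub> t)"
      let ?h = "contraction G (carrier G) (\<otimes>\<^bsub>G\<^esub>) \<phi> r"
      have t: "t \<in> carrier G" using u by (simp add: t_def)
      have r: "r \<in> carrier G \<rightarrow> carrier G" using t by (auto simp: r_def)
      have req: "r (g \<otimes>\<^bsub>G\<^esub> s) = g \<otimes>\<^bsub>G\<^esub> r s" if "g \<in> carrier G" "s \<in> carrier G" for g s
        using that t by (simp add: r_def m_assoc)
      have hc: "?h m v \<in> carrier (cochains G A m)" if "v \<in> carrier (cochains G A (Suc m))" for m v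
        using contraction_closed[OF M S r, of v m] that by (simp add: A_def)
      have hd: "coboundary G A \<psi> m (?h m v) \<otimes>\<^bsub>cochains G A (Suc m)\<^esub> ?h (Suc m) (coboundary G A \<psi> (Suc m) v) = v"
        if "v \<in> carrier (cochains G A (Suc m))" for m v
        using contraction_homotopy_cochain[OF M S r req, of v m] that by (simp add: A_def \<psi>_def)
      have "z = coboundary G A \<psi> (Suc n) (coboundary G A \<psi> n (?h n f) \<otimes>\<^bsub>cochains G A (Suc n)\<^esub> ?h (Suc n) z)"
        using hd[OF Suc.prems] by (simp only: z_def)
      also have "\<dots> = coboundary G A \<psi> (Suc n) (coboundary G A \<psi> n (?h n f))
          \<otimes>\<^bsub>cochains G A (Suc (Suc n))\<^esub> coboundary G A \<psi> (Suc n) (?h (Suc n) z)"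
        by (rule d_mult) (intro dc hc Suc.prems z)+
      also have "coboundary G A \<psi> (Suc n) (coboundary G A \<psi> n (?h n f)) = \<one>\<^bsub>cochains G A (Suc (Suc n))\<^esub>"
        by (rule Suc.hyps[OF hc[OF Suc.prems]])
      also have "\<one>\<^bsub>cochains G A (Suc (Suc n))\<^esub> \<otimes>\<^bsub>cochains G A (Suc (Suc n))\<^esub> coboundary G A \<psi> (Suc n) (?h (Suc n) z)
        = coboundary G A \<psi> (Suc n) (?h (Suc n) z)"
        by (rule C.l_one) (intro dc hc z)
      finally have e: "coboundary G A \<psi> (Suc n) (?h (Suc n) z) = z" by (rule sym)
      have "z \<otimes>\<^bsub>cochains G A (Suc (Suc n))\<^esub> ?h (Suc (Suc n)) (coboundary G A \<psi> (Suc (Suc n)) z) = z"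
        using hd[OF z] unfolding e .
      then have "?h (Suc (Suc n)) (coboundary G A \<psi> (Suc (Suc n)) z) = \<one>\<^bsub>cochains G A (Suc (Suc n))\<^esub>"
        using C.l_cancel_one[OF z hc[OF dc[OF z]]] by (simp only:)
      then have h1: "?h (Suc (Suc n)) (coboundary G A \<psi> (Suc (Suc n)) z) ys s = \<one>\<^bsub>M\<^esub>"
        if "ys \<in> tuples G (Suc (Suc n))" "s \<in> carrier G" for ys s
        using that by (simp add: A_def)
      define g where "g = hd xs"
      define ys where "ys = tl xs"
      \<comment> \<open>For this s the contraction inserts exactly g and evaluates at the point u.
        Its value at ys and s is therefore the wanted value at xs and u, up to the bijection
        \<open>\<phi> (inv g)\<close>.\<close>
      define s where "s = inv\<^bsub>G\<^esub> g \<otimes>\<^bsub>G\<^esub> u"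
      have g: "g \<in> carrier G" and ys: "ys \<in> tuples G (Suc (Suc n))"
        using tuples_simps[OF D(1) xs] by (simp_all add: g_def ys_def)
      have xs': "xs = g # ys" using xs by (cases xs) (auto simp: g_def ys_def tuples_def)
      have s: "s \<in> carrier G" using g u by (simp add: s_def)
      have rs: "r s = inv\<^bsub>G\<^esub> g" using g u by (simp add: r_def s_def t_def m_assoc)
      have gs: "g \<otimes>\<^bsub>G\<^esub> s = u" using g u by (simp add: s_def m_assoc[symmetric])
      have "\<phi> (inv\<^bsub>G\<^esub> g) (coboundary G A \<psi> (Suc (Suc n)) z xs u) = \<one>\<^bsub>M\<^esub>"
        using h1[OF ys s] g ys s by (simp add: contraction_def rs gs xs')
      moreover have "coboundary G A \<psi> (Suc (Suc n)) z xs u \<in> carrier M"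
        using dc[OF z] xs u by (auto simp: A_def PiE_iff)
      ultimately show ?thesis
        using D(7)[of g "inv\<^bsub>G\<^esub> g"] D(8,9) g by (metis inv_closed r_inv)
    qed
    then have *: "coboundary G A \<psi> (Suc (Suc n)) z xs = \<one>\<^bsub>A\<^esub>"
      if "xs \<in> tuples G (Suc (Suc (Suc n)))" for xs
      using that dc[OF z] by (intro extensionalityI[of _ "carrier G"]) (auto simp: A_def PiE_iff)
    show ?case
      unfolding z_def[symmetric] cochains_simps(2)
    proof (rule extensionalityI[of _ "tuples G (Suc (Suc (Suc n)))"])
      show "(\<lambda>xs\<in>tuples G (Suc (Suc (Suc n))). \<one>\<^bsub>A\<^esub>) \<in> extensional (tuples G (Suc (Suc (Suc n))))"
        by (rule restrict_extensional)
    qed (simp_all add: * del: fun_module_simps)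
  }
qed

text \<open>M embeds equivariantly as the constant functions on G, so the identity is inherited from
  the function module; evaluation at the neutral element brings it back.\<close>

lemma coboundary_coboundary:
  assumes M: "g_module G M \<phi>" and f: "f \<in> carrier (cochains G M n)"
  shows "coboundary G M \<phi> (Suc n) (coboundary G M \<phi> n f) = \<one>\<^bsub>cochains G M (Suc (Suc n))\<^esub>"
proof -
  note D = g_moduleD[OF M]
  interpret Group.group G by (rule D(1))
  interpret M: comm_group M by (rule D(2))
  have S: "g_set G (carrier G) (\<otimes>\<^bsub>G\<^esub>)" by (auto simp: g_set_def m_assoc)
  let ?A = "fun_module (carrier G) M" let ?\<psi> = "fun_action G (carrier G) (\<otimes>\<^bsub>G\<^esub>) M \<phi>"
  define j where "j = (\<lambda>m. \<lambda>s\<in>carrier G. m :: 'b)"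
  have A: "g_module G ?A ?\<psi>" by (rule g_module_fun[OF M S])
  have j: "j \<in> hom M ?A" by (auto simp: hom_def j_def)
  have eq: "j (\<phi> g m) = ?\<psi> g (j m)" if "g \<in> carrier G" "m \<in> carrier M" for g m
    using that by (auto simp: j_def fun_action_def intro!: restrict_ext)
  define f1 where "f1 = (\<lambda>ys\<in>tuples G n. j (f ys))"
  have f1: "f1 \<in> carrier (cochains G ?A n)"
    using f hom_in_carrier[OF j] by (auto simp: f1_def simp del: fun_module_simps)
  have fc: "f \<in> tuples G n \<rightarrow> carrier M" using f by (auto simp: PiE_def)
  have dfc: "coboundary G M \<phi> n f \<in> tuples G (Suc n) \<rightarrow> carrier M"
    using hom_in_carrier[OF coboundary_hom[OF M] f] by (auto simp: PiE_def)
  have ddfc: "coboundary G M \<phi> (Suc n) (coboundary G M \<phi> n f) \<in> tuples G (Suc (Suc n)) \<rightarrow>\<^sub>E carrier M"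
    using hom_in_carrier[OF coboundary_hom[OF M] hom_in_carrier[OF coboundary_hom[OF M] f]] by simp
  have n1: "coboundary G ?A ?\<psi> n f1 ys = j (coboundary G M \<phi> n f ys)" if "ys \<in> tuples G (Suc n)" for ys
    by (rule coboundary_natural[OF A M j eq fc that, symmetric]) (simp_all add: f1_def)
  have "j (coboundary G M \<phi> (Suc n) (coboundary G M \<phi> n f) xs)
      = coboundary G ?A ?\<psi> (Suc n) (coboundary G ?A ?\<psi> n f1) xs" if "xs \<in> tuples G (Suc (Suc n))" for xs
    by (rule coboundary_natural[OF A M j eq dfc that n1])
  then have "j (coboundary G M \<phi> (Suc n) (coboundary G M \<phi> n f) xs) \<one>\<^bsub>G\<^esub> = \<one>\<^bsub>M\<^esub>"
    if "xs \<in> tuples G (Suc (Suc n))" for xs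
    using coboundary_coboundary_fun[OF M f1] that by simp
  then show ?thesis
    by (intro extensionalityI[of _ "tuples G (Suc (Suc n))"]) (simp_all add: j_def)
qed

section \<open>Acyclic coefficients and the long exact sequence\<close>

lemma not_nonzero_cohomology_iff:
  assumes M: "g_module G M \<phi>"
  shows "\<not> nonzero_cohomology G M \<phi> (Suc k) \<longleftrightarrow>
    (\<forall>z \<in> carrier (cochains G M (Suc k)). coboundary G M \<phi> (Suc k) z = \<one>\<^bsub>cochains G M (Suc (Suc k))\<^esub> \<longrightarrow>
      (\<exists>b \<in> carrier (cochains G M k). z = coboundary G M \<phi> k b))"
  unfolding nonzero_cohomology_iff[OF M] coboundaries_def cocycles_def kernel_def by auto

text \<open>With an equivariant map to G the functions on S form a coinduced module, as in Shapiro's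
  lemma for the trivial subgroup. For a cocycle the second term of the homotopy formula vanishes,
  and the contraction is an explicit primitive.\<close>

lemma fun_module_acyclic:
  assumes M: "g_module G M \<phi>" and S: "g_set G S \<sigma>" and r: "r \<in> S \<rightarrow> carrier G"
    and req: "\<And>g s. g \<in> carrier G \<Longrightarrow> s \<in> S \<Longrightarrow> r (\<sigma> g s) = g \<otimes>\<^bsub>G\<^esub> r s"
  shows "\<not> nonzero_cohomology G (fun_module S M) (fun_action G S \<sigma> M \<phi>) (Suc k)"
proof -
  let ?A = "fun_module S M" let ?\<psi> = "fun_action G S \<sigma> M \<phi>"
  note D = g_moduleD[OF M] and E = g_setD[OF S]
  interpret Group.group G by (rule D(1))
  have A: "g_module G ?A ?\<psi>" by (rule g_module_fun[OF M S])
  interpret C: Group.group "cochains G ?A m" for m using group_cochains g_moduleD(3)[OF A] by blast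
  have "z = coboundary G ?A ?\<psi> k (contraction G S \<sigma> \<phi> r k z)"
    if z: "z \<in> carrier (cochains G ?A (Suc k))"
      and dz: "coboundary G ?A ?\<psi> (Suc k) z = \<one>\<^bsub>cochains G ?A (Suc (Suc k))\<^esub>" for z
  proof -
    have h: "contraction G S \<sigma> \<phi> r k z \<in> carrier (cochains G ?A k)"
      using contraction_closed[OF M S r, of z k] z by simp
    have "\<phi> (r s) \<one>\<^bsub>M\<^esub> = \<one>\<^bsub>M\<^esub>" "\<sigma> (inv\<^bsub>G\<^esub> (r s)) s \<in> S" "inv\<^bsub>G\<^esub> (r s) \<in> carrier G" if s: "s \<in> S" for s
    proof -
      have "r s \<in> carrier G" using r s by auto
      then show "\<phi> (r s) \<one>\<^bsub>M\<^esub> = \<one>\<^bsub>M\<^esub>" "\<sigma> (inv\<^bsub>G\<^esub> (r s)) s \<in> S" "inv\<^bsub>G\<^esub> (r s) \<in> carrier G"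
        using D(9) E(2) s by simp_all
    qed
    then have "contraction G S \<sigma> \<phi> r (Suc k) \<one>\<^bsub>cochains G ?A (Suc (Suc k))\<^esub> = \<one>\<^bsub>cochains G ?A (Suc k)\<^esub>"
      by (auto simp: contraction_def tuples_def intro!: restrict_ext)
    then have "coboundary G ?A ?\<psi> k (contraction G S \<sigma> \<phi> r k z) \<otimes>\<^bsub>cochains G ?A (Suc k)\<^esub> \<one>\<^bsub>cochains G ?A (Suc k)\<^esub> = z"
      using contraction_homotopy_cochain[OF M S r req, of z k] z dz by (simp del: cochains_simps(2,3))
    then show ?thesis
      using C.r_one[OF hom_in_carrier[OF coboundary_hom[OF A] h]] by (simp only:)
  qed
  then show ?thesis
    unfolding not_nonzero_cohomology_iff[OF A] using contraction_closed[OF M S r, of _ k]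
    by (metis cochains_simps(1) fun_module_simps(1))
qed

text \<open>The diagram chase behind the exact stretch H^(k+1)(B), H^(k+2)(M), H^(k+2)(A). A cocycle
  z of M becomes d a in A; then p a is a cocycle of B, hence of the form d b; subtracting from a the
  coboundary of a lift of b moves it into M and leaves d a unchanged.\<close>

lemma cohomology_long_exact:
  assumes M: "g_module G M \<phi>" and A: "g_module G A \<alpha>" and B: "g_module G B \<beta>"
    and i: "i \<in> hom M A" "inj_on i (carrier M)"
    and ieq: "\<And>g u. g \<in> carrier G \<Longrightarrow> u \<in> carrier M \<Longrightarrow> i (\<phi> g u) = \<alpha> g (i u)"
    and p: "p \<in> hom A B" "p ` carrier A = carrier B"
    and peq: "\<And>g u. g \<in> carrier G \<Longrightarrow> u \<in> carrier A \<Longrightarrow> p (\<alpha> g u) = \<beta> g (p u)"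
    and exact: "kernel A B p = i ` carrier M"
    and HA: "\<not> nonzero_cohomology G A \<alpha> (Suc (Suc k))"
    and HB: "\<not> nonzero_cohomology G B \<beta> (Suc k)"
  shows "\<not> nonzero_cohomology G M \<phi> (Suc (Suc k))"
  unfolding not_nonzero_cohomology_iff[OF M]
proof (intro ballI impI)
  fix z assume z: "z \<in> carrier (cochains G M (Suc (Suc k)))"
    and dz: "coboundary G M \<phi> (Suc (Suc k)) z = \<one>\<^bsub>cochains G M (Suc (Suc (Suc k)))\<^esub>"
  note DM = g_moduleD[OF M] and DA = g_moduleD[OF A] and DB = g_moduleD[OF B]
  interpret A: comm_group A by (rule DA(2))
  interpret B: comm_group B by (rule DB(2))
  interpret CA: Group.group "cochains G A m" for m using group_cochains DA(3) by blast
  interpret CB: Group.group "cochains G B m" for m using group_cochains DB(3) by blast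
  have i1: "i \<one>\<^bsub>M\<^esub> = \<one>\<^bsub>A\<^esub>" by (rule hom_one[OF i(1) DM(3) DA(3)])
  have p1: "p \<one>\<^bsub>A\<^esub> = \<one>\<^bsub>B\<^esub>" by (rule hom_one[OF p(1) DA(3) DB(3)])
  have pi: "p (i u) = \<one>\<^bsub>B\<^esub>" if "u \<in> carrier M" for u
    using exact that by (auto simp: kernel_def)
  have ic: "i u \<in> carrier A" if "u \<in> carrier M" for u using i(1) that by (auto simp: hom_def)
  have pc: "p u \<in> carrier B" if "u \<in> carrier A" for u using p(1) that by (auto simp: hom_def)
  define iz where "iz = (\<lambda>xs\<in>tuples G (Suc (Suc k)). i (z xs))"
  have zc: "z \<in> tuples G (Suc (Suc k)) \<rightarrow> carrier M" using z by (auto simp: PiE_def)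
  have iz: "iz \<in> carrier (cochains G A (Suc (Suc k)))"
    using z ic by (auto simp: iz_def)
  have "coboundary G A \<alpha> (Suc (Suc k)) iz xs = \<one>\<^bsub>A\<^esub>" if xs: "xs \<in> tuples G (Suc (Suc (Suc k)))" for xs
  proof -
    have "i (coboundary G M \<phi> (Suc (Suc k)) z xs) = coboundary G A \<alpha> (Suc (Suc k)) iz xs"
      by (rule coboundary_natural[OF A M i(1) _ zc xs]) (simp_all add: ieq iz_def)
    then show ?thesis using dz xs i1 by simp
  qed
  then have "coboundary G A \<alpha> (Suc (Suc k)) iz = \<one>\<^bsub>cochains G A (Suc (Suc (Suc k)))\<^esub>"
    by (intro extensionalityI[of _ "tuples G (Suc (Suc (Suc k)))"]) simp_all
  then obtain a where a: "a \<in> carrier (cochains G A (Suc k))" and iza: "iz = coboundary G A \<alpha> (Suc k) a"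
    using HA iz unfolding not_nonzero_cohomology_iff[OF A] by blast
  have ac: "a \<in> tuples G (Suc k) \<rightarrow> carrier A" using a by (auto simp: PiE_def)
  define pa where "pa = (\<lambda>xs\<in>tuples G (Suc k). p (a xs))"
  have pa: "pa \<in> carrier (cochains G B (Suc k))" using a pc by (auto simp: pa_def)
  have "coboundary G B \<beta> (Suc k) pa xs = \<one>\<^bsub>B\<^esub>" if xs: "xs \<in> tuples G (Suc (Suc k))" for xs
  proof -
    have "p (coboundary G A \<alpha> (Suc k) a xs) = coboundary G B \<beta> (Suc k) pa xs"
      by (rule coboundary_natural[OF B A p(1) _ ac xs]) (simp_all add: peq pa_def)
    moreover have "z xs \<in> carrier M" using zc xs by blast
    ultimately show ?thesis using xs pi by (simp flip: iza add: iz_def)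
  qed
  then have "coboundary G B \<beta> (Suc k) pa = \<one>\<^bsub>cochains G B (Suc (Suc k))\<^esub>"
    by (intro extensionalityI[of _ "tuples G (Suc (Suc k))"]) simp_all
  then obtain b where b: "b \<in> carrier (cochains G B k)" and pab: "pa = coboundary G B \<beta> k b"
    using HB pa unfolding not_nonzero_cohomology_iff[OF B] by blast
  \<comment> \<open>Cochains are arbitrary functions on tuples, so a pointwise choice of preimages
    under p is a legitimate lift.\<close>
  define b' where "b' = (\<lambda>xs\<in>tuples G k. inv_into (carrier A) p (b xs))"
  have bc: "b xs \<in> p ` carrier A" if "xs \<in> tuples G k" for xs using b that p(2) by auto
  have b': "b' \<in> carrier (cochains G A k)"
    using bc by (auto simp: b'_def intro: inv_into_into)
  have b'c: "b' \<in> tuples G k \<rightarrow> carrier A" using b' by (auto simp: PiE_def)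
  have pb': "b xs = p (b' xs)" if "xs \<in> tuples G k" for xs
    using that bc by (simp add: b'_def f_inv_into_f)
  define db where "db = coboundary G A \<alpha> k b'"
  have db: "db \<in> carrier (cochains G A (Suc k))"
    unfolding db_def by (rule hom_in_carrier[OF coboundary_hom[OF A] b'])
  define c where "c = a \<otimes>\<^bsub>cochains G A (Suc k)\<^esub> inv\<^bsub>cochains G A (Suc k)\<^esub> db"
  have cC: "c \<in> carrier (cochains G A (Suc k))" unfolding c_def using a db by (intro CA.m_closed CA.inv_closed)
  have cdb: "a = c \<otimes>\<^bsub>cochains G A (Suc k)\<^esub> db"
    unfolding c_def using a db by (metis CA.inv_solve_right' CA.m_closed CA.inv_closed)
  have "c xs \<in> i ` carrier M" if xs: "xs \<in> tuples G (Suc k)" for xs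
  proof -
    have cx: "c xs \<in> carrier A" "db xs \<in> carrier A" using cC db xs by auto
    have "a xs = c xs \<otimes>\<^bsub>A\<^esub> db xs" using cdb xs by simp
    then have "p (a xs) = p (c xs) \<otimes>\<^bsub>B\<^esub> p (db xs)" using hom_mult[OF p(1)] cx by simp
    moreover have "p (db xs) = p (a xs)"
    proof -
      have "p (coboundary G A \<alpha> k b' xs) = coboundary G B \<beta> k b xs"
        by (rule coboundary_natural[OF B A p(1) _ b'c xs]) (simp_all add: peq pb')
      then show ?thesis using xs by (simp add: db_def pab[symmetric] pa_def)
    qed
    ultimately have "p (c xs) = \<one>\<^bsub>B\<^esub>" using cx pc by (metis B.r_cancel_one)
    then show ?thesis using exact cx by (auto simp: kernel_def)
  qed
  define m where "m = (\<lambda>xs\<in>tuples G (Suc k). inv_into (carrier M) i (c xs))"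
  have im: "c xs = i (m xs)" "m xs \<in> carrier M" if "xs \<in> tuples G (Suc k)" for xs
    using that \<open>\<And>xs. xs \<in> tuples G (Suc k) \<Longrightarrow> c xs \<in> i ` carrier M\<close>
    by (simp_all add: m_def f_inv_into_f inv_into_into)
  have mC: "m \<in> carrier (cochains G M (Suc k))" using im(2) by (auto simp: m_def)
  have mc: "m \<in> tuples G (Suc k) \<rightarrow> carrier M" using im(2) by auto
  \<comment> \<open>Since a and c differ by a coboundary, they have the same coboundary.\<close>
  have dc: "iz = coboundary G A \<alpha> (Suc k) c"
  proof -
    have "iz = coboundary G A \<alpha> (Suc k) c \<otimes>\<^bsub>cochains G A (Suc (Suc k))\<^esub> coboundary G A \<alpha> (Suc k) db"
      unfolding iza by (subst cdb) (rule hom_mult[OF coboundary_hom[OF A] cC db])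
    also have "coboundary G A \<alpha> (Suc k) db = \<one>\<^bsub>cochains G A (Suc (Suc k))\<^esub>"
      unfolding db_def by (rule coboundary_coboundary[OF A b'])
    finally show ?thesis
      using CA.r_one[OF hom_in_carrier[OF coboundary_hom[OF A] cC]] by (simp only:)
  qed
  have "z xs = coboundary G M \<phi> (Suc k) m xs" if xs: "xs \<in> tuples G (Suc (Suc k))" for xs
  proof -
    have "i (coboundary G M \<phi> (Suc k) m xs) = coboundary G A \<alpha> (Suc k) c xs"
      by (rule coboundary_natural[OF A M i(1) _ mc xs]) (simp_all add: ieq im(1))
    also have "\<dots> = i (z xs)" using xs by (simp flip: dc add: iz_def)
    finally have "i (coboundary G M \<phi> (Suc k) m xs) = i (z xs)" .
    moreover have "coboundary G M \<phi> (Suc k) m xs \<in> carrier M"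
      using hom_in_carrier[OF coboundary_hom[OF M] mC] xs by auto
    moreover have "z xs \<in> carrier M" using zc xs by blast
    ultimately show ?thesis using i(2) by (metis inj_onD)
  qed
  then have "z = coboundary G M \<phi> (Suc k) m"
    using z by (intro extensionalityI[of _ "tuples G (Suc (Suc k))"]) (simp_all add: PiE_def)
  with mC show "\<exists>b \<in> carrier (cochains G M (Suc k)). z = coboundary G M \<phi> (Suc k) b" by blast
qed

section \<open>Free groups\<close>

text \<open>A pair with second component \<open>True\<close> stands for a generator, and with
  \<open>False\<close> for its inverse.\<close>

definition flip :: "'a \<times> bool \<Rightarrow> 'a \<times> bool"
  where "flip l = (fst l, \<not> snd l)"

fun push :: "'a \<times> bool \<Rightarrow> ('a \<times> bool) list \<Rightarrow> ('a \<times> bool) list"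
  where "push l [] = [l]"
  | "push l (m # w) = (if m = flip l then w else l # m # w)"

fun reduced :: "('a \<times> bool) list \<Rightarrow> bool"
  where "reduced [] \<longleftrightarrow> True"
  | "reduced [l] \<longleftrightarrow> True"
  | "reduced (l # m # w) \<longleftrightarrow> m \<noteq> flip l \<and> reduced (m # w)"

definition free_group :: "('a \<times> bool) list monoid"
  where "free_group = \<lparr>carrier = {w. reduced w}, monoid.mult = foldr push, one = []\<rparr>"

definition letter :: "'a \<Rightarrow> ('a \<times> bool) list"
  where "letter a = [(a, True)]"

lemma flip_flip [simp]: "flip (flip l) = l" "flip (a, b) = (a, \<not> b)"
  by (simp_all add: flip_def)

lemma reduced_ConsD: "reduced (l # w) \<Longrightarrow> reduced w"
  by (cases w) auto

lemma reduced_push: "reduced w \<Longrightarrow> reduced (push l w)"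
  by (cases w) (auto dest: reduced_ConsD)

text \<open>Reducedness matters when the first push cancels: the letter that it uncovers is then
  different from l, so the second push cannot cancel again and puts \<open>flip l\<close>
  back.\<close>

lemma push_flip_push: "reduced w \<Longrightarrow> push (flip l) (push l w) = w"
  by (cases w rule: reduced.cases) (auto simp: flip_def prod_eq_iff)

lemma push_push_flip: "reduced w \<Longrightarrow> push l (push (flip l) w) = w"
  using push_flip_push[of w "flip l"] by simp

lemma reduced_foldr_push: "reduced v \<Longrightarrow> reduced (foldr push u v)"
  by (induct u) (auto simp: reduced_push)

lemma push_Cons: "reduced (l # w) \<Longrightarrow> push l w = l # w"
  by (cases w) auto


text \<open>Van der Waerden's argument: words act on reduced words letter by letter, and a
  cancellation in the acting word does not change its action. Associativity follows without a
  comparison of the cancellations in iterated products.\<close>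

lemma foldr_push_push:
  assumes "reduced v" shows "foldr push (push l u) v = push l (foldr push u v)"
proof (cases u)
  case (Cons m w)
  then show ?thesis
    using push_push_flip[OF reduced_foldr_push[OF assms], of l w] by auto
qed simp

lemma foldr_push_assoc:
  assumes "reduced w" shows "foldr push (foldr push u v) w = foldr push u (foldr push v w)"
  using assms by (induct u) (simp_all add: foldr_push_push)

lemma free_group_simps [simp]:
  "carrier free_group = {w. reduced w}" "\<one>\<^bsub>free_group\<^esub> = []" "u \<otimes>\<^bsub>free_group\<^esub> v = foldr push u v"
  by (simp_all add: free_group_def)

lemma group_free_group: "Group.group free_group"
proof (rule groupI)
  fix u :: "('a \<times> bool) list" assume "u \<in> carrier free_group"
  then have "reduced u" by simp
  then have "\<exists>v. reduced v \<and> foldr push v u = []"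
  proof (induct u)
    case (Cons l u)
    then obtain v where v: "reduced v" "foldr push v u = []" by (auto dest: reduced_ConsD)
    have r: "reduced u" using Cons by (auto dest: reduced_ConsD)
    have "foldr push (foldr push v [flip l]) (l # u) = foldr push v (push (flip l) (push l u))"
      using Cons.prems foldr_push_assoc[OF Cons.prems, of v "[flip l]"] by (simp add: push_Cons)
    then have "foldr push (foldr push v [flip l]) (l # u) = []"
      using v r by (simp add: push_flip_push)
    moreover have "reduced (foldr push v [flip l])" by (rule reduced_foldr_push) simp
    ultimately show ?case by blast
  qed (auto intro: exI[of _ "[]"])
  then show "\<exists>v \<in> carrier free_group. v \<otimes>\<^bsub>free_group\<^esub> u = \<one>\<^bsub>free_group\<^esub>" by auto
qed (auto simp: reduced_foldr_push foldr_push_assoc)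

interpretation free_group: Group.group free_group
  by (rule group_free_group)

lemma letter_closed [simp]: "reduced (letter a)"
  by (simp add: letter_def)

lemma inv_letter: "inv\<^bsub>free_group\<^esub> (letter a) = [(a, False)]"
  by (rule free_group.inv_equality) (auto simp: letter_def)

text \<open>Later this serves as the induction principle for free groups: a property of words is
  shown to define a subgroup that contains the letters.\<close>

lemma free_group_subgroup_eq:
  assumes K: "subgroup K free_group" and g: "range letter \<subseteq> K"
  shows "K = carrier free_group"
proof -
  have l: "[l] \<in> K" for l
  proof (cases l)
    case (Pair a b)
    have "letter a \<in> K" using g by auto
    then show ?thesis
      using subgroup.m_inv_closed[OF K, of "letter a"] Pair by (cases b) (simp_all add: inv_letter, simp add: letter_def)
  qed
  have "w \<in> K" if "reduced w" for w
    using that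
  proof (induct w)
    case Nil
    then show ?case using subgroup.one_closed[OF K] by simp
  next
    case (Cons l w)
    then have "w \<in> K" by (auto dest: reduced_ConsD)
    then have "[l] \<otimes>\<^bsub>free_group\<^esub> w \<in> K" by (intro subgroup.m_closed[OF K] l)
    then show ?case using Cons.prems by (simp add: push_Cons)
  qed
  then show ?thesis using subgroup.subset[OF K] by auto
qed

lemma generate_letters: "generate free_group (range letter) = carrier free_group"
proof (rule free_group_subgroup_eq)
  show "subgroup (generate free_group (range letter)) free_group"
    by (rule free_group.generate_is_subgroup) auto
qed (blast intro: generate.incl)

definition free_hom :: "('h, 'c) monoid_scheme \<Rightarrow> ('a \<Rightarrow> 'h) \<Rightarrow> ('a \<times> bool) list \<Rightarrow> 'h"
  where "free_hom H f w = foldr (\<lambda>l h. (if snd l then f (fst l) else inv\<^bsub>H\<^esub> (f (fst l))) \<otimes>\<^bsub>H\<^esub> h) w \<one>\<^bsub>H\<^esub>"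

text \<open>The fold makes sense on words that are not reduced as well, and its compatibility with
  \<open>push\<close> holds for all of them; multiplicativity is then an induction on the left
  factor.\<close>

lemma free_hom:
  assumes "Group.group H" and f: "\<And>a. f a \<in> carrier H"
  shows "free_hom H f \<in> hom free_group H" "free_hom H f (letter a) = f a"
proof -
  interpret H: Group.group H by fact
  define e where "e = (\<lambda>l. if snd l then f (fst l) else inv\<^bsub>H\<^esub> (f (fst l)))"
  have e: "e l \<in> carrier H" for l using f by (simp add: e_def)
  have ef: "e l \<otimes>\<^bsub>H\<^esub> (e (flip l) \<otimes>\<^bsub>H\<^esub> x) = x" if "x \<in> carrier H" for l x
    using f that by (simp add: e_def flip_def H.m_assoc[symmetric])
  have simps: "free_hom H f [] = \<one>\<^bsub>H\<^esub>" "free_hom H f (l # w) = e l \<otimes>\<^bsub>H\<^esub> free_hom H f w" for l w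
    by (simp_all add: free_hom_def e_def)
  have c: "free_hom H f w \<in> carrier H" for w by (induct w) (simp_all add: simps e)
  have p: "free_hom H f (push l w) = e l \<otimes>\<^bsub>H\<^esub> free_hom H f w" for l w
  proof (cases w)
    case (Cons m v)
    then show ?thesis using ef[OF c, of l v] by (auto simp: simps)
  qed (simp add: simps)
  have "free_hom H f (foldr push u v) = free_hom H f u \<otimes>\<^bsub>H\<^esub> free_hom H f v" for u v
    by (induct u) (simp_all add: simps p c e H.m_assoc)
  then show "free_hom H f \<in> hom free_group H" using c by (auto simp: hom_def)
  show "free_hom H f (letter a) = f a" by (simp add: letter_def simps e_def f)
qed

section \<open>Residual finiteness of free groups\<close>

lemma extend_inj_to_bij:
  assumes "finite B" "D \<subseteq> B" "inj_on p D" "p ` D \<subseteq> B"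
  shows "\<exists>q. bij_betw q B B \<and> (\<forall>x \<in> D. q x = p x)"
proof -
  have D: "finite D" using assms(1,2) by (rule rev_finite_subset)
  \<comment> \<open>The complements of the domain and of the image have the same size, so any
    bijection between them completes p to a permutation.\<close>
  have "card (B - D) = card (B - p ` D)"
    using assms D by (simp add: card_Diff_subset card_image)
  then obtain h where h: "bij_betw h (B - D) (B - p ` D)"
    using assms(1) by (meson finite_Diff finite_same_card_bij)
  define q where "q = (\<lambda>x. if x \<in> D then p x else h x)"
  have "bij_betw q D (p ` D)" using assms(3) by (simp add: q_def bij_betw_def inj_on_def)
  moreover have "bij_betw q (B - D) (B - p ` D)"
    using h by (rule bij_betw_cong[THEN iffD1, rotated]) (simp add: q_def)
  ultimately have "bij_betw q (D \<union> (B - D)) (p ` D \<union> (B - p ` D))"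
    by (rule bij_betw_combine) auto
  moreover have "D \<union> (B - D) = B" "p ` D \<union> (B - p ` D) = B" using assms by auto
  ultimately show ?thesis by (intro exI[of _ q]) (simp add: q_def)
qed

lemma finite_BijGroup:
  assumes "finite B" shows "finite (carrier (BijGroup B))"
proof (rule finite_subset)
  show "carrier (BijGroup B) \<subseteq> B \<rightarrow>\<^sub>E B"
    by (auto simp: BijGroup_def Bij_def bij_betw_def PiE_def)
  show "finite (B \<rightarrow>\<^sub>E B)" using assms by (intro finite_PiE) auto
qed

lemma BijGroup_mult_apply:
  assumes "f \<in> carrier (BijGroup B)" "g \<in> carrier (BijGroup B)" "x \<in> B"
  shows "(f \<otimes>\<^bsub>BijGroup B\<^esub> g) x = f (g x)"
  using assms by (simp add: BijGroup_def compose_def)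

lemma BijGroup_one_apply: "x \<in> B \<Longrightarrow> \<one>\<^bsub>BijGroup B\<^esub> x = x"
  by (simp add: BijGroup_def)

lemma inv_BijGroup_apply:
  assumes f: "f \<in> carrier (BijGroup B)" and x: "x \<in> B"
  shows "(inv\<^bsub>BijGroup B\<^esub> f) (f x) = x" "f ((inv\<^bsub>BijGroup B\<^esub> f) x) = x"
proof -
  interpret Group.group "BijGroup B" by (rule group_BijGroup)
  show "(inv\<^bsub>BijGroup B\<^esub> f) (f x) = x"
    using BijGroup_mult_apply[OF inv_closed[OF f] f x] BijGroup_one_apply[OF x] l_inv[OF f] by simp
  show "f ((inv\<^bsub>BijGroup B\<^esub> f) x) = x"
    using BijGroup_mult_apply[OF f inv_closed[OF f] x] BijGroup_one_apply[OF x] r_inv[OF f] by simp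
qed

text \<open>A word w of length n moves the empty word in any action on the finite set of reduced words of
  length at most n in which each letter acts by left multiplication as long as it stays in that set.\<close>

lemma free_group_finite_quotient:
  fixes w :: "('a :: finite \<times> bool) list"
  assumes w: "reduced w" "w \<noteq> []"
  shows "\<exists>(H :: (('a \<times> bool) list \<Rightarrow> ('a \<times> bool) list) monoid) h.
    Group.group H \<and> finite (carrier H) \<and> h \<in> hom free_group H \<and> h w \<noteq> \<one>\<^bsub>H\<^esub>"
proof -
  define B where "B = {u :: ('a \<times> bool) list. reduced u \<and> length u \<le> length w}"
  have "B \<subseteq> {u. set u \<subseteq> UNIV \<and> length u \<le> length w}" by (auto simp: B_def)
  then have B: "finite B" by (rule finite_subset) (rule finite_lists_length_le, simp)
  define D where "D = (\<lambda>a. {u \<in> B. push (a, True) u \<in> B})"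
  have "\<exists>q. bij_betw q B B \<and> (\<forall>u \<in> D a. q u = push (a, True) u)" for a
  proof (rule extend_inj_to_bij[OF B])
    show "inj_on (push (a, True)) (D a)"
      by (rule inj_on_inverseI[of _ "push (flip (a, True))"]) (simp add: D_def B_def push_flip_push del: flip_flip)
  qed (auto simp: D_def)
  then obtain q where q: "\<And>a. bij_betw (q a) B B" "\<And>a u. u \<in> D a \<Longrightarrow> q a u = push (a, True) u" by metis
  define H where "H = BijGroup B"
  define f where "f = (\<lambda>a. restrict (q a) B)"
  have fB: "f a \<in> carrier H" for a
    using q(1)[of a] by (auto simp: H_def f_def BijGroup_def Bij_def intro: bij_betw_cong[THEN iffD1, rotated])
  have H: "Group.group H" unfolding H_def by (rule group_BijGroup)
  interpret H: Group.group H by (rule H)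
  have h: "free_hom H f \<in> hom free_group H" by (rule free_hom(1)[OF H fB])
  have hB: "free_hom H f u \<in> carrier H" if "reduced u" for u
    using hom_in_carrier[OF h] that by simp
  \<comment> \<open>All suffixes of a word in B lie in B, so while the image of the empty word is
    computed every letter acts by honest left multiplication. For an inverse letter the permutation
    of its generator is read backwards.\<close>
  have "free_hom H f u [] = u" if "reduced u" "length u \<le> length w" for u
    using that
  proof (induct u)
    case Nil
    then show ?case by (simp add: free_hom_def H_def BijGroup_def B_def)
  next
    case (Cons l u)
    have r: "reduced u" using Cons.prems by (auto dest: reduced_ConsD)
    define e where "e = (if snd l then f (fst l) else inv\<^bsub>H\<^esub> (f (fst l)))"
    have e: "e \<in> carrier H" using fB by (simp add: e_def)
    have lu: "l # u \<in> B" "u \<in> B" using Cons.prems r by (auto simp: B_def)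
    have "free_hom H f (l # u) = e \<otimes>\<^bsub>H\<^esub> free_hom H f u" by (simp add: free_hom_def e_def)
    then have "free_hom H f (l # u) [] = e (free_hom H f u [])"
      using e hB[OF r] by (simp add: H_def BijGroup_def compose_def B_def)
    also have "free_hom H f u [] = u" using Cons r by simp
    also have "e u = l # u"
    proof (cases "snd l")
      case True
      then have l: "l = (fst l, True)" by (simp add: prod_eq_iff)
      have p: "push (fst l, True) u = l # u" using push_Cons[OF Cons.prems(1)] l by simp
      then have "u \<in> D (fst l)" using lu by (simp add: D_def)
      then show ?thesis using q(2) p True lu by (simp add: e_def f_def)
    next
      case False
      then have l: "l = flip (fst l, True)" by (simp add: prod_eq_iff)
      have p: "push (fst l, True) (l # u) = u" using l by (simp del: flip_flip)
      then have "l # u \<in> D (fst l)" using lu by (simp add: D_def)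
      then have "f (fst l) (l # u) = u" using q(2) p lu by (simp add: f_def)
      then show ?thesis
        using inv_BijGroup_apply(1)[of "f (fst l)" B "l # u"] fB lu False by (simp add: e_def H_def)
    qed
    finally show ?case .
  qed
  then have "free_hom H f w [] \<noteq> []" using w by simp
  moreover have "\<one>\<^bsub>H\<^esub> [] = []" by (simp add: H_def BijGroup_def B_def)
  ultimately have "free_hom H f w \<noteq> \<one>\<^bsub>H\<^esub>" by auto
  moreover have "finite (carrier H)" unfolding H_def by (rule finite_BijGroup[OF B])
  ultimately show ?thesis using H h by blast
qed

section \<open>Groups acting freely on a product of two trees\<close>

lemma free_g_set_equivariant_map:
  assumes S: "g_set G S \<sigma>" and free: "\<And>g s. g \<in> carrier G \<Longrightarrow> s \<in> S \<Longrightarrow> \<sigma> g s = s \<Longrightarrow> g = \<one>\<^bsub>G\<^esub>"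
  shows "\<exists>r \<in> S \<rightarrow> carrier G. \<forall>g \<in> carrier G. \<forall>s \<in> S. r (\<sigma> g s) = g \<otimes>\<^bsub>G\<^esub> r s"
proof -
  note E = g_setD[OF S]
  interpret Group.group G by (rule E(1))
  \<comment> \<open>The base point is chosen from the orbit as a set, so it is literally the same
    for all points of an orbit. The element that carries the base point to s is unique because
    stabilizers are trivial, and uniqueness makes it equivariant in s.\<close>
  define orb where "orb = (\<lambda>s. (\<lambda>g. \<sigma> g s) ` carrier G)"
  define b where "b = (\<lambda>s. SOME t. t \<in> orb s)"
  have orb: "orb (\<sigma> g s) = orb s" if g: "g \<in> carrier G" and s: "s \<in> S" for g s
  proof -
    have "\<sigma> h (\<sigma> g s) \<in> orb s" if "h \<in> carrier G" for h
      using that g s E(3)[of h g s] unfolding orb_def by (metis imageI m_closed)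
    moreover have "\<sigma> h s \<in> orb (\<sigma> g s)" if "h \<in> carrier G" for h
    proof -
      have "\<sigma> h s = \<sigma> (h \<otimes>\<^bsub>G\<^esub> inv\<^bsub>G\<^esub> g) (\<sigma> g s)"
        using that g s E(2)[OF g s] by (simp add: E(3,6))
      then show ?thesis using that g by (auto simp: orb_def)
    qed
    ultimately show ?thesis unfolding orb_def by blast
  qed
  have "s \<in> orb s" if "s \<in> S" for s using E(4)[OF that] unfolding orb_def by force
  then have b: "b s \<in> orb s" if "s \<in> S" for s using someI[of "\<lambda>t. t \<in> orb s" s] that by (simp add: b_def)
  have "\<exists>g. g \<in> carrier G \<and> s = \<sigma> g (b s)" if s: "s \<in> S" for s
  proof -
    obtain h where h: "h \<in> carrier G" "b s = \<sigma> h s" using b[OF s] by (auto simp: orb_def)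
    then show ?thesis using E(6)[OF h(1) s] by (metis inv_closed)
  qed
  then obtain r where r: "\<And>s. s \<in> S \<Longrightarrow> r s \<in> carrier G \<and> s = \<sigma> (r s) (b s)" by metis
  have "r (\<sigma> g s) = g \<otimes>\<^bsub>G\<^esub> r s" if g: "g \<in> carrier G" and s: "s \<in> S" for g s
  proof -
    define t where "t = b s"
    have gs: "\<sigma> g s \<in> S" by (rule E(2)[OF g s])
    have bt: "b (\<sigma> g s) = t" unfolding t_def b_def by (simp add: orb[OF g s])
    have tS: "t \<in> S" using b[OF s] E(2) s by (auto simp: t_def orb_def)
    define u where "u = r (\<sigma> g s)"
    define v where "v = g \<otimes>\<^bsub>G\<^esub> r s"
    have uv: "u \<in> carrier G" "v \<in> carrier G" using r s gs g by (auto simp: u_def v_def)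
    have "\<sigma> u t = \<sigma> g s" using r[OF gs] bt by (simp add: u_def)
    also have "\<dots> = \<sigma> v t" using r[OF s] g tS E(3) by (simp add: v_def t_def)
    finally have "\<sigma> (inv\<^bsub>G\<^esub> v \<otimes>\<^bsub>G\<^esub> u) t = t" using uv tS by (simp add: E(3,6))
    then have "inv\<^bsub>G\<^esub> v \<otimes>\<^bsub>G\<^esub> u = \<one>\<^bsub>G\<^esub>" using uv tS by (intro free) auto
    moreover have "u = v \<otimes>\<^bsub>G\<^esub> (inv\<^bsub>G\<^esub> v \<otimes>\<^bsub>G\<^esub> u)" using uv by (simp add: m_assoc[symmetric])
    ultimately show ?thesis using uv unfolding u_def[symmetric] v_def[symmetric] by simp
  qed
  then show ?thesis using r by blast
qed

text \<open>The group acts on the Cayley graph of the free group: the vertices are the reduced words, and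
  \<open>(v, a)\<close> is the edge from v to \<open>a v\<close>.\<close>

definition vertex_action ::
    "('g \<Rightarrow> ('a \<times> bool) list) \<Rightarrow> ('g \<Rightarrow> 's \<Rightarrow> 's) \<Rightarrow> 'g \<Rightarrow> 's \<times> ('a \<times> bool) list \<Rightarrow> 's \<times> ('a \<times> bool) list"
  where "vertex_action q \<sigma> g = (\<lambda>(s, v). (\<sigma> g s, v \<otimes>\<^bsub>free_group\<^esub> inv\<^bsub>free_group\<^esub> (q g)))"

definition edge_action ::
    "('g \<Rightarrow> ('a \<times> bool) list) \<Rightarrow> ('g \<Rightarrow> 's \<Rightarrow> 's) \<Rightarrow> 'g \<Rightarrow> 's \<times> ('a \<times> bool) list \<times> 'a \<Rightarrow> 's \<times> ('a \<times> bool) list \<times> 'a"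
  where "edge_action q \<sigma> g = (\<lambda>(s, v, a). (\<sigma> g s, v \<otimes>\<^bsub>free_group\<^esub> inv\<^bsub>free_group\<^esub> (q g), a))"

definition vertices :: "'s set \<Rightarrow> ('s \<times> ('a \<times> bool) list) set"
  where "vertices S = S \<times> carrier free_group"

definition edges :: "'s set \<Rightarrow> ('s \<times> ('a \<times> bool) list \<times> 'a) set"
  where "edges S = S \<times> carrier free_group \<times> UNIV"

text \<open>Right translation by inverses is a left action, and it commutes with left multiplication
  by letters, so it maps edges to edges. The factor S makes it possible to put a second tree on top
  of a first one.\<close>

lemma g_set_tree:
  assumes S: "g_set G S \<sigma>" and q: "q \<in> hom G free_group"
  shows "g_set G (vertices S) (vertex_action q \<sigma>)" "g_set G (edges S) (edge_action q \<sigma>)"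
proof -
  note E = g_setD[OF S]
  interpret Group.group G by (rule E(1))
  define \<rho> where "\<rho> = (\<lambda>g v. v \<otimes>\<^bsub>free_group\<^esub> inv\<^bsub>free_group\<^esub> (q g))"
  have qc: "q g \<in> carrier free_group" if "g \<in> carrier G" for g by (rule hom_in_carrier[OF q that])
  have 1: "\<rho> g v \<in> carrier free_group" if "g \<in> carrier G" "v \<in> carrier free_group" for g v
    unfolding \<rho>_def by (intro free_group.m_closed free_group.inv_closed qc that)
  have 2: "\<rho> (g \<otimes>\<^bsub>G\<^esub> h) v = \<rho> g (\<rho> h v)"
    if "g \<in> carrier G" "h \<in> carrier G" "v \<in> carrier free_group" for g h v
    unfolding \<rho>_def hom_mult[OF q that(1,2)]
    by (simp only: free_group.inv_mult_group free_group.m_assoc free_group.inv_closed free_group.m_closed qc that)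
  have 3: "\<rho> \<one>\<^bsub>G\<^esub> v = v" if "v \<in> carrier free_group" for v
    unfolding \<rho>_def hom_one[OF q is_group group_free_group]
    by (simp only: free_group.inv_one free_group.r_one that)
  show "g_set G (vertices S) (vertex_action q \<sigma>)" "g_set G (edges S) (edge_action q \<sigma>)"
    unfolding g_set_def vertices_def edges_def vertex_action_def edge_action_def
    using 1[unfolded \<rho>_def] 2[unfolded \<rho>_def] 3[unfolded \<rho>_def] E by (auto simp del: free_group_simps)
qed

text \<open>In additive terms this sums e along the path from the empty word to the given vertex of
  the Cayley tree. An inverse letter traverses its edge backwards, and that edge starts at the later
  vertex \<open>l # w\<close>, hence the different argument of e.\<close>

primrec integral :: "'m monoid \<Rightarrow> (('a \<times> bool) list \<Rightarrow> 'a \<Rightarrow> 'm) \<Rightarrow> ('a \<times> bool) list \<Rightarrow> 'm"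
  where "integral M e [] = \<one>\<^bsub>M\<^esub>"
  | "integral M e (l # w) =
      (if snd l then e w (fst l) else inv\<^bsub>M\<^esub> (e (l # w) (fst l))) \<otimes>\<^bsub>M\<^esub> integral M e w"

text \<open>The edge from w either prolongs the path to w or, if w begins with the inverse of a, is
  the last edge of that path, traversed backwards; in the latter case the two contributions
  cancel.\<close>

lemma integral:
  assumes "Group.group M" and e: "\<And>w a. reduced w \<Longrightarrow> e w a \<in> carrier M" and w: "reduced w"
  shows "integral M e w \<in> carrier M"
    "integral M e (push (a, True) w) = e w a \<otimes>\<^bsub>M\<^esub> integral M e w"
proof -
  interpret Group.group M by fact
  have c: "integral M e w \<in> carrier M" if "reduced w" for w
    using that
  proof (induct w)
    case (Cons l w)
    then have "reduced w" by (blast dest: reduced_ConsD)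
    with Cons show ?case by (auto simp: e)
  qed simp
  show "integral M e w \<in> carrier M" by (rule c[OF w])
  show "integral M e (push (a, True) w) = e w a \<otimes>\<^bsub>M\<^esub> integral M e w"
  proof (cases "\<exists>u. w = (a, False) # u")
    case True
    then obtain u where u: "w = (a, False) # u" by blast
    then have "integral M e u \<in> carrier M" "e w a \<in> carrier M"
      using w c[OF reduced_ConsD] e by blast+
    then show ?thesis by (simp add: u m_assoc[symmetric])
  next
    case False
    then have "push (a, True) w = (a, True) # w" by (cases w) auto
    then show ?thesis by simp
  qed
qed

text \<open>The cochain complex of a tree, taken over each point of S, is a short exact sequence
  with the functions on S, on the vertices and on the edges. A function without differences along
  edges is constant because the tree is connected, and each function on edges has an integral
  because there are no cycles. In the long exact sequence the edges enter one degree lower.\<close>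

lemma tree_cohomology:
  fixes G :: "'g monoid" and M :: "'m monoid" and S :: "'s set" and q :: "'g \<Rightarrow> ('a \<times> bool) list"
  assumes M: "g_module G M \<phi>" and S: "g_set G S \<sigma>" and q: "q \<in> hom G free_group"
    and HV: "\<not> nonzero_cohomology G (fun_module (vertices S) M)
      (fun_action G (vertices S) (vertex_action q \<sigma>) M \<phi>) (Suc (Suc k))"
    and HE: "\<not> nonzero_cohomology G (fun_module (edges S) M)
      (fun_action G (edges S) (edge_action q \<sigma>) M \<phi>) (Suc k)"
  shows "\<not> nonzero_cohomology G (fun_module S M) (fun_action G S \<sigma> M \<phi>) (Suc (Suc k))"
proof -
  note D = g_moduleD[OF M] and E = g_setD[OF S]
  interpret Group.group G by (rule E(1))
  interpret M: comm_group M by (rule D(2))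
  let ?V = "vertices S :: ('s \<times> ('a \<times> bool) list) set" let ?E = "edges S :: ('s \<times> ('a \<times> bool) list \<times> 'a) set"
  let ?\<alpha> = "fun_action G ?V (vertex_action q \<sigma>) M \<phi>"
  let ?\<beta> = "fun_action G ?E (edge_action q \<sigma>) M \<phi>"
  note V = g_setD[OF g_set_tree(1)[OF S q]] and E' = g_setD[OF g_set_tree(2)[OF S q]]
  define i where "i = (\<lambda>f :: 's \<Rightarrow> 'm. \<lambda>(s, v)\<in>?V. f s)"
  define p where "p = (\<lambda>f. \<lambda>(s, v, a)\<in>?E. f (s, push (a, True) v) \<otimes>\<^bsub>M\<^esub> inv\<^bsub>M\<^esub> (f (s, v)))"
  have iv: "i f (s, v) = f s" if "s \<in> S" "reduced v" for f s v
    using that by (simp add: i_def vertices_def)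
  have pv: "p f (s, v, a) = f (s, push (a, True) v) \<otimes>\<^bsub>M\<^esub> inv\<^bsub>M\<^esub> (f (s, v))" if "s \<in> S" "reduced v" for f s v a
    using that by (simp add: p_def edges_def)
  have iext: "i f \<in> extensional ?V" and pext: "p f' \<in> extensional ?E" for f f'
    by (simp_all add: i_def p_def)
  have fV: "f (s, v) \<in> carrier M" if "f \<in> ?V \<rightarrow>\<^sub>E carrier M" "s \<in> S" "reduced v" for f s v
    using that by (auto simp: vertices_def PiE_iff)
  have eqV: "f = f'" if "f \<in> extensional ?V" "f' \<in> extensional ?V"
    "\<And>s v. s \<in> S \<Longrightarrow> reduced v \<Longrightarrow> f (s, v) = f' (s, v)" for f f' :: "_ \<Rightarrow> 'm"
    by (rule extensionalityI[OF that(1,2)]) (use that(3) in \<open>auto simp: vertices_def\<close>)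
  have eqE: "f = f'" if "f \<in> extensional ?E" "f' \<in> extensional ?E"
    "\<And>s v a. s \<in> S \<Longrightarrow> reduced v \<Longrightarrow> f (s, v, a) = f' (s, v, a)" for f f' :: "_ \<Rightarrow> 'm"
    by (rule extensionalityI[OF that(1,2)]) (use that(3) in \<open>auto simp: edges_def\<close>)
  have ic: "i f \<in> ?V \<rightarrow>\<^sub>E carrier M" if "f \<in> S \<rightarrow>\<^sub>E carrier M" for f
    using that by (auto simp: i_def vertices_def PiE_iff)
  have pc: "p f \<in> ?E \<rightarrow>\<^sub>E carrier M" if "f \<in> ?V \<rightarrow>\<^sub>E carrier M" for f
    using fV[OF that] by (auto simp: p_def edges_def reduced_push)
  have qr: "reduced (inv\<^bsub>free_group\<^esub> (q g))" "reduced (inv\<^bsub>free_group\<^esub> (q (inv\<^bsub>G\<^esub> g)))" if "g \<in> carrier G" for g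
    using free_group.inv_closed[OF hom_in_carrier[OF q that]]
      free_group.inv_closed[OF hom_in_carrier[OF q inv_closed[OF that]]] by simp_all
  have va: "vertex_action q \<sigma> (inv\<^bsub>G\<^esub> g) (s, v) = (\<sigma> (inv\<^bsub>G\<^esub> g) s, foldr push v (inv\<^bsub>free_group\<^esub> (q (inv\<^bsub>G\<^esub> g))))"
    and ea: "edge_action q \<sigma> (inv\<^bsub>G\<^esub> g) (s, v, a) = (\<sigma> (inv\<^bsub>G\<^esub> g) s, foldr push v (inv\<^bsub>free_group\<^esub> (q (inv\<^bsub>G\<^esub> g))), a)"
    for g s v a by (simp_all add: vertex_action_def edge_action_def)
  show ?thesis
  proof (rule cohomology_long_exact[OF g_module_fun[OF M S] g_module_fun[OF M g_set_tree(1)[OF S q]]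
        g_module_fun[OF M g_set_tree(2)[OF S q]] _ _ _ _ _ _ _ HV HE])
    show "i \<in> hom (fun_module S M) (fun_module ?V M)"
    proof (rule homI)
      fix f f' assume "f \<in> carrier (fun_module S M)" "f' \<in> carrier (fun_module S M)"
      show "i (f \<otimes>\<^bsub>fun_module S M\<^esub> f') = i f \<otimes>\<^bsub>fun_module ?V M\<^esub> i f'"
        by (rule eqV) (simp_all add: iext iv, simp add: vertices_def iv)
    qed (use ic in simp)
    show "inj_on i (carrier (fun_module S M))"
    proof (rule inj_onI)
      fix f f' assume f: "f \<in> carrier (fun_module S M)" "f' \<in> carrier (fun_module S M)" and eq: "i f = i f'"
      show "f = f'"
      proof (rule extensionalityI[of _ S])
        fix s assume "s \<in> S"
        then show "f s = f' s" using iv[of s "[]" f] iv[of s "[]" f'] eq by simp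
      qed (use f in \<open>simp_all add: PiE_def\<close>)
    qed
    show "i (fun_action G S \<sigma> M \<phi> g f) = ?\<alpha> g (i f)" if "g \<in> carrier G" "f \<in> carrier (fun_module S M)" for g f
    proof (rule eqV)
      fix s and v :: "('a \<times> bool) list" assume s: "s \<in> S" and v: "reduced v"
      have "\<sigma> (inv\<^bsub>G\<^esub> g) s \<in> S" using E(2) that s by simp
      then show "i (fun_action G S \<sigma> M \<phi> g f) (s, v) = ?\<alpha> g (i f) (s, v)"
        using that s v ic[of f] qr(2)[OF that(1)]
        by (simp add: iv fun_action_apply vertices_def va reduced_foldr_push)
    qed (use that ic in \<open>auto simp: iext fun_action_def\<close>)
    show "p \<in> hom (fun_module ?V M) (fun_module ?E M)"
    proof (rule homI)
      fix f f' assume f: "f \<in> carrier (fun_module ?V M)" "f' \<in> carrier (fun_module ?V M)"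
      show "p (f \<otimes>\<^bsub>fun_module ?V M\<^esub> f') = p f \<otimes>\<^bsub>fun_module ?E M\<^esub> p f'"
      proof (rule eqE)
        fix s and v :: "('a \<times> bool) list" and a assume s: "s \<in> S" and v: "reduced v"
        define w where "w = push (a, True) v"
        have w: "reduced w" by (simp add: w_def reduced_push v)
        have c: "f (s, v) \<in> carrier M" "f (s, w) \<in> carrier M" "f' (s, v) \<in> carrier M" "f' (s, w) \<in> carrier M"
          using f fV s v w by simp_all
        have "f (s, w) \<otimes>\<^bsub>M\<^esub> f' (s, w) \<otimes>\<^bsub>M\<^esub> inv\<^bsub>M\<^esub> (f (s, v) \<otimes>\<^bsub>M\<^esub> f' (s, v)) =
            f (s, w) \<otimes>\<^bsub>M\<^esub> inv\<^bsub>M\<^esub> (f (s, v)) \<otimes>\<^bsub>M\<^esub> (f' (s, w) \<otimes>\<^bsub>M\<^esub> inv\<^bsub>M\<^esub> (f' (s, v)))"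
          by (simp only: M.inv_mult M.m_ac M.m_closed M.inv_closed c)
        then show "p (f \<otimes>\<^bsub>fun_module ?V M\<^esub> f') (s, v, a) = (p f \<otimes>\<^bsub>fun_module ?E M\<^esub> p f') (s, v, a)"
          using s v w by (simp add: pv w_def[symmetric]) (simp add: vertices_def edges_def pv w_def[symmetric])
      qed (simp_all add: pext)
    qed (use pc in simp)
    show "p ` carrier (fun_module ?V M) = carrier (fun_module ?E M)"
    proof (intro subset_antisym subsetI)
      fix e assume "e \<in> carrier (fun_module ?E M)"
      then have e: "e \<in> ?E \<rightarrow>\<^sub>E carrier M" by simp
      define f where "f = (\<lambda>(s, v)\<in>?V. integral M (\<lambda>w a. e (s, w, a)) v)"
      have ec: "e (s, w, a) \<in> carrier M" if "s \<in> S" "reduced w" for s w a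
        using e that by (auto simp: edges_def PiE_iff)
      have fv: "f (s, v) = integral M (\<lambda>w a. e (s, w, a)) v" if "s \<in> S" "reduced v" for s v
        using that by (simp add: f_def vertices_def)
      note I = integral[OF M.is_group, of "\<lambda>w a. e (s, w, a)" for s]
      have f: "f \<in> ?V \<rightarrow>\<^sub>E carrier M"
        using I(1) ec by (auto simp: f_def vertices_def)
      have "p f = e"
      proof (rule eqE)
        fix s and v :: "('a \<times> bool) list" and a assume s: "s \<in> S" and v: "reduced v"
        then show "p f (s, v, a) = e (s, v, a)"
          using I(1)[OF ec[OF s] v] I(2)[OF ec[OF s] v] ec[OF s v]
          by (simp add: pv fv reduced_push M.m_assoc)
      qed (use e in \<open>auto simp: pext PiE_def\<close>)
      then show "e \<in> p ` carrier (fun_module ?V M)" using f by auto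
    qed (use pc in auto)
    show "p (?\<alpha> g f) = ?\<beta> g (p f)" if g: "g \<in> carrier G" and f: "f \<in> carrier (fun_module ?V M)" for g f
    proof (rule eqE)
      fix s and v :: "('a \<times> bool) list" and a assume s: "s \<in> S" and v: "reduced v"
      define u where "u = inv\<^bsub>free_group\<^esub> (q (inv\<^bsub>G\<^esub> g))"
      have u: "reduced u" using qr(2)[OF g] by (simp add: u_def)
      have s': "\<sigma> (inv\<^bsub>G\<^esub> g) s \<in> S" using E(2) g s by simp
      have f': "f \<in> ?V \<rightarrow>\<^sub>E carrier M" using f by simp
      have c: "f (\<sigma> (inv\<^bsub>G\<^esub> g) s, foldr push v u) \<in> carrier M"
        "f (\<sigma> (inv\<^bsub>G\<^esub> g) s, push (a, True) (foldr push v u)) \<in> carrier M"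
        using fV[OF f' s'] u by (simp_all add: reduced_foldr_push reduced_push)
      have av: "?\<alpha> g f (s, w) = \<phi> g (f (\<sigma> (inv\<^bsub>G\<^esub> g) s, foldr push w u))" if "reduced w" for w
        using s that f' by (simp add: fun_action_apply vertices_def va u_def)
      have "?\<beta> g (p f) (s, v, a) = \<phi> g (p f (\<sigma> (inv\<^bsub>G\<^esub> g) s, foldr push v u, a))"
        using s v pc[OF f'] by (simp add: fun_action_apply edges_def ea u_def)
      then show "p (?\<alpha> g f) (s, v, a) = ?\<beta> g (p f) (s, v, a)"
        using s s' v u c g by (simp add: pv av reduced_push reduced_foldr_push foldr_push_push D(6,10))
    qed (use f pc in \<open>auto simp: pext fun_action_def\<close>)
    show "kernel (fun_module ?V M) (fun_module ?E M) p = i ` carrier (fun_module S M)"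
    proof (intro subset_antisym subsetI)
      fix f assume "f \<in> kernel (fun_module ?V M) (fun_module ?E M) p"
      then have f: "f \<in> ?V \<rightarrow>\<^sub>E carrier M" and pf: "p f = (\<lambda>x\<in>?E. \<one>\<^bsub>M\<^esub>)" by (auto simp: kernel_def)
      have step: "f (s, push (a, True) v) = f (s, v)" if "s \<in> S" "reduced v"
        for s and v :: "('a \<times> bool) list" and a
      proof -
        have "f (s, push (a, True) v) \<otimes>\<^bsub>M\<^esub> inv\<^bsub>M\<^esub> f (s, v) = \<one>\<^bsub>M\<^esub>"
          using fun_cong[OF pf, of "(s, v, a)"] that by (simp add: pv) (simp add: edges_def)
        then show ?thesis
          using fV[OF f that(1)] that(2) by (metis M.inv_closed M.inv_equality M.inv_inv reduced_push)
      qed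
      have const: "f (s, v) = f (s, [])" if s: "s \<in> S" and v: "reduced v"
        for s and v :: "('a \<times> bool) list"
        using v
      proof (induct v)
        case (Cons l v)
        have r: "reduced v" using Cons.prems by (rule reduced_ConsD)
        have "f (s, l # v) = f (s, v)"
        proof (cases "snd l")
          case True
          then have "push (fst l, True) v = l # v" using push_Cons[OF Cons.prems] by (metis prod.collapse)
          then show ?thesis using step[OF s r, of "fst l"] by simp
        next
          case False
          then have "push (fst l, True) (l # v) = v" by (cases l) simp
          then show ?thesis using step[OF s Cons.prems, of "fst l"] by simp
        qed
        then show ?case using Cons r by simp
      qed simp
      have "f = i (\<lambda>s\<in>S. f (s, []))"
      proof (rule eqV)
        fix s and v :: "('a \<times> bool) list" assume s: "s \<in> S" and v: "reduced v"
        then show "f (s, v) = i (\<lambda>s\<in>S. f (s, [])) (s, v)" using const[OF s v] by (simp add: iv)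
      qed (use f in \<open>simp_all add: iext PiE_def\<close>)
      moreover have "(\<lambda>s\<in>S. f (s, [])) \<in> carrier (fun_module S M)" using fV[OF f] by auto
      ultimately show "f \<in> i ` carrier (fun_module S M)" by blast
    next
      fix f assume "f \<in> i ` carrier (fun_module S M)"
      then obtain f' where f': "f' \<in> S \<rightarrow>\<^sub>E carrier M" "f = i f'" by auto
      have "p f = (\<lambda>x\<in>?E. \<one>\<^bsub>M\<^esub>)"
      proof (rule eqE)
        fix s and v :: "('a \<times> bool) list" and a assume s: "s \<in> S" and v: "reduced v"
        then have "f' s \<in> carrier M" "(s, v, a) \<in> ?E" using f' by (auto simp: edges_def)
        then show "p f (s, v, a) = (\<lambda>x\<in>?E. \<one>\<^bsub>M\<^esub>) (s, v, a)"
          using s v by (simp add: f'(2) pv iv reduced_push)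
      qed (simp_all add: pext)
      then show "f \<in> kernel (fun_module ?V M) (fun_module ?E M) p"
        using ic[OF f'(1)] f'(2) by (simp add: kernel_def)
    qed
  qed
qed

lemma free_fun_module_acyclic:
  assumes M: "g_module G M \<phi>" and T: "g_set G T \<tau>"
    and free: "\<And>g s. g \<in> carrier G \<Longrightarrow> s \<in> T \<Longrightarrow> \<tau> g s = s \<Longrightarrow> g = \<one>\<^bsub>G\<^esub>"
  shows "\<not> nonzero_cohomology G (fun_module T M) (fun_action G T \<tau> M \<phi>) (Suc j)"
proof -
  have "\<exists>r \<in> T \<rightarrow> carrier G. \<forall>g \<in> carrier G. \<forall>s \<in> T. r (\<tau> g s) = g \<otimes>\<^bsub>G\<^esub> r s"
    by (rule free_g_set_equivariant_map[OF T]) (rule free)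
  then obtain r where r: "r \<in> T \<rightarrow> carrier G" "\<And>g s. g \<in> carrier G \<Longrightarrow> s \<in> T \<Longrightarrow> r (\<tau> g s) = g \<otimes>\<^bsub>G\<^esub> r s"
    by blast
  show ?thesis by (rule fun_module_acyclic[OF M T r])
qed

lemma free_group_r_translation_trivial:
  assumes "foldr push v (inv\<^bsub>free_group\<^esub> w) = v" "reduced v" "reduced w"
  shows "w = []"
proof -
  have vw: "v \<in> carrier free_group" "w \<in> carrier free_group" using assms by simp_all
  have "v \<otimes>\<^bsub>free_group\<^esub> inv\<^bsub>free_group\<^esub> w = v" using assms(1) by simp
  then have "inv\<^bsub>free_group\<^esub> w = \<one>\<^bsub>free_group\<^esub>"
    using free_group.l_cancel_one[OF vw(1) free_group.inv_closed[OF vw(2)]] by blast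
  then have "w = \<one>\<^bsub>free_group\<^esub>" using free_group.inv_eq_1_iff[OF vw(2)] by blast
  then show ?thesis by simp
qed

text \<open>G acts freely on all four products of vertices or edges of the two trees, because p and
  q are jointly injective. Functions on these products are therefore acyclic in positive degrees.
  Removing the tree of q gives vanishing from degree 2 on for functions on the vertices or edges of
  the tree of p, and removing the latter gives vanishing from degree 3 on for M.\<close>

lemma two_trees_cohomology:
  fixes G :: "'g monoid" and M :: "'m monoid"
    and p :: "'g \<Rightarrow> ('a \<times> bool) list" and q :: "'g \<Rightarrow> ('b \<times> bool) list"
  assumes M: "g_module G M \<phi>" and p: "p \<in> hom G free_group" and q: "q \<in> hom G free_group"
    and inj: "\<And>g. g \<in> carrier G \<Longrightarrow> p g = [] \<Longrightarrow> q g = [] \<Longrightarrow> g = \<one>\<^bsub>G\<^esub>"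
  shows "\<not> nonzero_cohomology G M \<phi> (Suc (Suc (Suc k)))"
proof
  note D = g_moduleD[OF M]
  interpret Group.group G by (rule D(1))
  \<comment> \<open>The one-point set is the bottom of the tower, so that one lemma serves for both
    trees; functions on the point are M again.\<close>
  define \<sigma> where "\<sigma> = (\<lambda>(g :: 'g) (s :: unit). s)"
  have S: "g_set G {()} \<sigma>" by (simp add: g_set_def D(1) \<sigma>_def)
  note trivial = free_group_r_translation_trivial
  have rp: "reduced (p g)" "reduced (q g)" if "g \<in> carrier G" for g
    using hom_in_carrier[OF p that] hom_in_carrier[OF q that] by simp_all
  let ?V = "vertices {()} :: (unit \<times> ('a \<times> bool) list) set" and ?E = "edges {()} :: (unit \<times> ('a \<times> bool) list \<times> 'a) set"
  let ?va = "vertex_action p \<sigma>" and ?ea = "edge_action p \<sigma>"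
  note V = g_set_tree(1)[OF S p] and E = g_set_tree(2)[OF S p]
  note acyclic = free_fun_module_acyclic[OF M]
  have HV: "\<not> nonzero_cohomology G (fun_module ?V M) (fun_action G ?V ?va M \<phi>) (Suc (Suc j))" for j
  proof (rule tree_cohomology[OF M V q])
    show "\<not> nonzero_cohomology G (fun_module (vertices ?V) M)
      (fun_action G (vertices ?V) (vertex_action q ?va) M \<phi>) (Suc (Suc j))"
      by (rule acyclic[OF g_set_tree(1)[OF V q]])
        (auto simp: vertices_def vertex_action_def intro!: inj dest!: trivial simp: rp)
    show "\<not> nonzero_cohomology G (fun_module (edges ?V) M)
      (fun_action G (edges ?V) (edge_action q ?va) M \<phi>) (Suc j)"
      by (rule acyclic[OF g_set_tree(2)[OF V q]])
        (auto simp: vertices_def edges_def vertex_action_def edge_action_def intro!: inj dest!: trivial simp: rp)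
  qed
  have HE: "\<not> nonzero_cohomology G (fun_module ?E M) (fun_action G ?E ?ea M \<phi>) (Suc (Suc j))" for j
  proof (rule tree_cohomology[OF M E q])
    show "\<not> nonzero_cohomology G (fun_module (vertices ?E) M)
      (fun_action G (vertices ?E) (vertex_action q ?ea) M \<phi>) (Suc (Suc j))"
      by (rule acyclic[OF g_set_tree(1)[OF E q]])
        (auto simp: edges_def vertices_def vertex_action_def edge_action_def intro!: inj dest!: trivial simp: rp)
    show "\<not> nonzero_cohomology G (fun_module (edges ?E) M)
      (fun_action G (edges ?E) (edge_action q ?ea) M \<phi>) (Suc j)"
      by (rule acyclic[OF g_set_tree(2)[OF E q]])
        (auto simp: edges_def edge_action_def intro!: inj dest!: trivial simp: rp)
  qed
  have H: "\<not> nonzero_cohomology G (fun_module {()} M) (fun_action G {()} \<sigma> M \<phi>) (Suc (Suc (Suc k)))"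
    by (rule tree_cohomology[OF M S p HV HE])
  assume "nonzero_cohomology G M \<phi> (Suc (Suc (Suc k)))"
  then obtain z where z: "z \<in> cocycles G M \<phi> (Suc (Suc (Suc k)))" "z \<notin> coboundaries G M \<phi> (Suc (Suc (Suc k)))"
    using nonzero_cohomology_iff[OF M] by blast
  have zc: "z xs \<in> carrier M" if "xs \<in> tuples G (Suc (Suc (Suc k)))" for xs
    using z(1) that by (auto simp: cocycles_def kernel_def)
  have "nonzero_cohomology G (fun_module {()} M) (fun_action G {()} \<sigma> M \<phi>) (Suc (Suc (Suc k)))"
  proof (rule nonzero_cohomology_transfer[OF M g_module_fun[OF M S] eval_hom _ _ z])
    show "inj_on (\<lambda>f. f ()) (carrier (fun_module {()} M))" by (auto simp: inj_on_def)
    show "(\<lambda>f. f ()) (fun_action G {()} \<sigma> M \<phi> g u) = \<phi> g ((\<lambda>f. f ()) u)"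
      if "g \<in> carrier G" "u \<in> carrier (fun_module {()} M)" for g u
      using that by (simp add: fun_action_def \<sigma>_def)
    show "z ` tuples G (Suc (Suc (Suc k))) \<subseteq> (\<lambda>f. f ()) ` carrier (fun_module {()} M)"
    proof
      fix m assume "m \<in> z ` tuples G (Suc (Suc (Suc k)))"
      then have "m \<in> carrier M" using zc by auto
      then show "m \<in> (\<lambda>f. f ()) ` carrier (fun_module {()} M)"
        by (intro image_eqI[of _ _ "\<lambda>_. m"]) (auto simp: PiE_def extensional_def)
    qed
  qed simp
  with H show False by blast
qed

lemma cohomological_dimension_le_2:
  assumes "p \<in> hom G free_group" "q \<in> hom G free_group"
    and "\<And>g. g \<in> carrier G \<Longrightarrow> p g = [] \<Longrightarrow> q g = [] \<Longrightarrow> g = \<one>\<^bsub>G\<^esub>"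
  shows "cohomological_dimension G \<le> 2"
  unfolding cohomological_dimension_def
proof (rule Sup_least, clarify)
  fix n and M :: "('a list \<Rightarrow> int) monoid" and \<phi>
  assume M: "g_module G M \<phi>" and n: "nonzero_cohomology G M \<phi> n"
  have "n \<le> 2"
  proof (rule ccontr)
    assume "\<not> n \<le> 2"
    then have "n = Suc (Suc (Suc (n - 3)))" by arith
    then obtain k where "n = Suc (Suc (Suc k))" by blast
    moreover have "\<not> nonzero_cohomology G M \<phi> (Suc (Suc (Suc k)))"
      by (rule two_trees_cohomology[OF M assms(1,2)]) (rule assms(3))
    ultimately show False using n by blast
  qed
  then show "enat n \<le> 2" by (simp add: numeral_eq_enat)
qed

section \<open>A class of degree three\<close>

lemma finprod_integer_group: "finprod integer_group f A = sum f A"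
proof -
  interpret comm_group integer_group by (rule abelian_integer_group)
  show ?thesis by (induct A rule: infinite_finite_induct) auto
qed

text \<open>The triple product of three homomorphisms is a 3-cocycle. It is not a coboundary because its
  alternating sum over the orderings of three commuting elements is not zero.\<close>

lemma cohomological_dimension_ge_3:
  fixes G :: "'g monoid"
  assumes G: "Group.group G"
    and hom: "a \<in> hom G integer_group" "b \<in> hom G integer_group" "c \<in> hom G integer_group"
    and x: "x \<in> carrier G" "a x = 1" "b x = 0" "c x = 0"
    and y: "y \<in> carrier G" "a y = 0" "b y = 1" "c y = 0"
    and z: "z \<in> carrier G" "a z = 0" "b z = 0" "c z = 1"
    and comm: "x \<otimes>\<^bsub>G\<^esub> y = y \<otimes>\<^bsub>G\<^esub> x" "x \<otimes>\<^bsub>G\<^esub> z = z \<otimes>\<^bsub>G\<^esub> x" "y \<otimes>\<^bsub>G\<^esub> z = z \<otimes>\<^bsub>G\<^esub> y"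
  shows "3 \<le> cohomological_dimension G"
proof -
  interpret Group.group G by (rule G)
  define \<phi> where "\<phi> = (\<lambda>g :: 'g. \<lambda>m :: int. m)"
  have M: "g_module G integer_group \<phi>"
    by (rule g_moduleI[OF G abelian_integer_group]) (auto simp: \<phi>_def)
  define f where "f = (\<lambda>xs\<in>tuples G 3. a (xs ! 0) * b (xs ! 1) * c (xs ! 2))"
  have h: "a (u \<otimes>\<^bsub>G\<^esub> v) = a u + a v" "b (u \<otimes>\<^bsub>G\<^esub> v) = b u + b v" "c (u \<otimes>\<^bsub>G\<^esub> v) = c u + c v"
    if "u \<in> carrier G" "v \<in> carrier G" for u v
    using hom that by (auto simp: hom_def)
  have d3: "coboundary G integer_group \<phi> 3 f xs = 0" if "xs \<in> tuples G (Suc 3)" for xs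
  proof -
    have "length xs = Suc (Suc (Suc (Suc 0)))" using that by (simp add: tuples_def)
    then obtain p q r s where xs: "xs = [p, q, r, s]" by (auto simp: length_Suc_conv)
    have c: "p \<in> carrier G" "q \<in> carrier G" "r \<in> carrier G" "s \<in> carrier G"
      using that by (auto simp: tuples_def xs)
    have fv: "f [u, v, w] = a u * b v * c w" if "u \<in> carrier G" "v \<in> carrier G" "w \<in> carrier G" for u v w
      using that by (simp add: f_def tuples_def)
    show ?thesis
      unfolding coboundary_def restrict_apply'[OF that]
      using c h by (simp add: xs \<phi>_def finprod_integer_group numeral_eq_Suc lessThan_Suc merge_at_def fv algebra_simps)
  qed
  have "f \<in> cocycles G integer_group \<phi> 3"
    unfolding cocycles_def kernel_def
  proof (intro CollectI conjI)
    show "f \<in> carrier (cochains G integer_group 3)" by (auto simp: f_def)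
    show "coboundary G integer_group \<phi> 3 f = \<one>\<^bsub>cochains G integer_group (Suc 3)\<^esub>"
      by (rule extensionalityI[of _ "tuples G (Suc 3)"]) (use d3 in \<open>auto simp: coboundary_def\<close>)
  qed
  moreover have "f \<notin> coboundaries G integer_group \<phi> 3"
  proof
    assume "f \<in> coboundaries G integer_group \<phi> 3"
    then obtain e where fe: "f = coboundary G integer_group \<phi> 2 e"
      by (auto simp: coboundaries_def numeral_eq_Suc)
    have d2: "a u * b v * c w = e [v, w] - e [u \<otimes>\<^bsub>G\<^esub> v, w] + e [u, v \<otimes>\<^bsub>G\<^esub> w] - e [u, v]"
      if "u \<in> carrier G" "v \<in> carrier G" "w \<in> carrier G" for u v w
    proof -
      have t: "[u, v, w] \<in> tuples G (Suc 2)" using that by (simp add: tuples_def)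
      have "coboundary G integer_group \<phi> 2 e [u, v, w] = e [v, w] - e [u \<otimes>\<^bsub>G\<^esub> v, w] + e [u, v \<otimes>\<^bsub>G\<^esub> w] - e [u, v]"
        unfolding coboundary_def restrict_apply'[OF t]
        by (simp add: \<phi>_def finprod_integer_group numeral_eq_Suc lessThan_Suc merge_at_def)
      moreover have "f [u, v, w] = a u * b v * c w" using t by (simp add: f_def numeral_eq_Suc)
      ultimately show ?thesis using fe by simp
    qed
    \<comment> \<open>Of the six left sides only the one for (x, y, z) is not zero. In the
      alternating sum of the right sides, the terms with a product cancel since the elements
      commute, and the others since a cyclic shift is an even permutation.\<close>
    show False
      using d2[OF x(1) y(1) z(1)] d2[OF y(1) x(1) z(1)] d2[OF y(1) z(1) x(1)]
        d2[OF z(1) y(1) x(1)] d2[OF z(1) x(1) y(1)] d2[OF x(1) z(1) y(1)]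
      unfolding x y z comm by simp
  qed
  ultimately have "nonzero_cohomology G integer_group \<phi> 3"
    using nonzero_cohomology_iff[OF M] by blast
  from le_cohomological_dimension[OF M this] show ?thesis by (simp add: numeral_eq_enat)
qed

section \<open>Subgroups of finite index and profinite completions\<close>

lemma (in group) r_coset_eq_iff:
  assumes "subgroup N G" "g \<in> carrier G" "h \<in> carrier G"
  shows "N #> g = N #> h \<longleftrightarrow> g \<otimes> inv h \<in> N"
proof
  assume "N #> g = N #> h"
  then have "g \<in> N #> h" using rcos_self[OF assms(2,1)] by simp
  then obtain n where "n \<in> N" "g = n \<otimes> h" by (auto simp: r_coset_def)
  then show "g \<otimes> inv h \<in> N" using assms subgroup.mem_carrier[OF assms(1)] by (simp add: m_assoc)
next
  assume "g \<otimes> inv h \<in> N"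
  then have "(g \<otimes> inv h) \<otimes> h \<in> N #> h" by (rule rcosI) (use assms subgroup.subset in auto)
  then have "g \<in> N #> h" using assms by (simp add: m_assoc)
  then show "N #> g = N #> h" using repr_independence[OF _ assms(3,1)] by simp
qed

lemma finite_index_normalD:
  assumes "N \<in> finite_index_normal G"
  shows "N \<lhd> G" "subgroup N G" "finite ((\<lambda>g. N #>\<^bsub>G\<^esub> g) ` carrier G)"
  using assms by (auto simp: finite_index_normal_def carrier_FactGroup normal_imp_subgroup)

text \<open>The function f need not be a homomorphism: finitely many values, with each fibre inside
  a single coset, already bound the index.\<close>

lemma finite_index_normalI:
  assumes N: "N \<lhd> G" and fin: "finite (f ` carrier G)"
    and f: "\<And>g h. g \<in> carrier G \<Longrightarrow> h \<in> carrier G \<Longrightarrow> f g = f h \<Longrightarrow> g \<otimes>\<^bsub>G\<^esub> inv\<^bsub>G\<^esub> h \<in> N"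
  shows "N \<in> finite_index_normal G"
proof -
  interpret normal N G by (rule N)
  have "N #>\<^bsub>G\<^esub> g = N #>\<^bsub>G\<^esub> inv_into (carrier G) f (f g)" if g: "g \<in> carrier G" for g
  proof -
    have "inv_into (carrier G) f (f g) \<in> carrier G" "f (inv_into (carrier G) f (f g)) = f g"
      using g by (simp_all add: inv_into_into f_inv_into_f)
    then show ?thesis using f[OF g] r_coset_eq_iff[OF subgroup_axioms g] by simp
  qed
  then have "(\<lambda>g. N #>\<^bsub>G\<^esub> g) ` carrier G \<subseteq> (\<lambda>a. N #>\<^bsub>G\<^esub> inv_into (carrier G) f a) ` f ` carrier G"
    by auto
  then have "finite ((\<lambda>g. N #>\<^bsub>G\<^esub> g) ` carrier G)" using fin by (meson finite_imageI finite_subset)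
  then show ?thesis using N by (simp add: finite_index_normal_def carrier_FactGroup)
qed

lemma finite_index_normal_Int:
  assumes G: "Group.group G" and N: "N \<in> finite_index_normal G" and K: "K \<in> finite_index_normal G"
  shows "N \<inter> K \<in> finite_index_normal G"
proof -
  interpret Group.group G by (rule G)
  note N = finite_index_normalD[OF N] and K = finite_index_normalD[OF K]
  let ?f = "\<lambda>g. (N #>\<^bsub>G\<^esub> g, K #>\<^bsub>G\<^esub> g)"
  show ?thesis
  proof (rule finite_index_normalI[where f = ?f])
    show "N \<inter> K \<lhd> G" by (rule normal_subgroup_intersect[OF N(1) K(1)])
    show "finite (?f ` carrier G)"
      by (rule finite_subset[OF _ finite_cartesian_product[OF N(3) K(3)]]) auto
  qed (simp add: r_coset_eq_iff N(2) K(2))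
qed

lemma finite_index_normal_vimage:
  assumes f: "f \<in> hom G H" and G: "Group.group G" and H: "Group.group H"
    and K: "K \<in> finite_index_normal H"
  shows "{g \<in> carrier G. f g \<in> K} \<in> finite_index_normal G"
proof -
  interpret f: group_hom G H f using f G H by (simp add: group_hom_def group_hom_axioms_def)
  note K = finite_index_normalD[OF K]
  let ?N = "{g \<in> carrier G. f g \<in> K}"
  have "subgroup ?N G"
    by (rule f.G.subgroupI)
      (auto simp: subgroup.one_closed[OF K(2)] subgroup.m_closed[OF K(2)] subgroup.m_inv_closed[OF K(2)] intro!: exI[of _ "\<one>\<^bsub>G\<^esub>"])
  then have "?N \<lhd> G"
    unfolding f.G.normal_inv_iff using K(1) f.H.normal_inv_iff[of K] by auto
  then show ?thesis
  proof (rule finite_index_normalI[where f = "\<lambda>g. K #>\<^bsub>H\<^esub> f g"])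
    show "finite ((\<lambda>g. K #>\<^bsub>H\<^esub> f g) ` carrier G)"
      by (rule finite_subset[OF _ K(3)]) auto
  qed (auto simp: f.H.r_coset_eq_iff[OF K(2)])
qed

lemma finite_index_normal_kernel:
  assumes f: "f \<in> hom G H" and G: "Group.group G" and H: "Group.group H" and fin: "finite (carrier H)"
  shows "kernel G H f \<in> finite_index_normal G"
proof -
  interpret f: group_hom G H f using f G H by (simp add: group_hom_def group_hom_axioms_def)
  show ?thesis
  proof (rule finite_index_normalI[where f = f, OF f.normal_kernel])
    show "finite (f ` carrier G)" by (rule finite_subset[OF _ fin]) auto
  qed (simp add: kernel_def)
qed

lemma residually_finiteI:
  assumes G: "Group.group G"
    and "\<And>g. g \<in> carrier G \<Longrightarrow> g \<noteq> \<one>\<^bsub>G\<^esub> \<Longrightarrow> \<exists>N \<in> finite_index_normal G. g \<notin> N"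
  shows "residually_finite G"
  using assms by (simp add: residually_finite_def)

lemma residually_finite_inj_hom:
  assumes G: "Group.group G" and H: "Group.group H" and f: "f \<in> hom G H"
    and inj: "\<And>g. g \<in> carrier G \<Longrightarrow> f g = \<one>\<^bsub>H\<^esub> \<Longrightarrow> g = \<one>\<^bsub>G\<^esub>" and RF: "residually_finite H"
  shows "residually_finite G"
proof (rule residually_finiteI[OF G])
  fix g assume g: "g \<in> carrier G" "g \<noteq> \<one>\<^bsub>G\<^esub>"
  then have "f g \<noteq> \<one>\<^bsub>H\<^esub>" "f g \<in> carrier H" using inj hom_in_carrier[OF f] by auto
  then obtain K where K: "K \<in> finite_index_normal H" "f g \<notin> K" using RF by (auto simp: residually_finite_def)
  then show "\<exists>N \<in> finite_index_normal G. g \<notin> N"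
    by (intro bexI[OF _ finite_index_normal_vimage[OF f G H K(1)]]) simp
qed

lemma residually_finite_DirProd:
  assumes G: "Group.group G" "residually_finite G" and H: "Group.group H" "residually_finite H"
  shows "residually_finite (G \<times>\<times> H)"
proof (rule residually_finiteI[OF DirProd_group[OF G(1) H(1)]])
  have f: "fst \<in> hom (G \<times>\<times> H) G" and s: "snd \<in> hom (G \<times>\<times> H) H" by (auto simp: hom_def)
  fix x assume x: "x \<in> carrier (G \<times>\<times> H)" "x \<noteq> \<one>\<^bsub>G \<times>\<times> H\<^esub>"
  then consider "fst x \<noteq> \<one>\<^bsub>G\<^esub>" "fst x \<in> carrier G" | "snd x \<noteq> \<one>\<^bsub>H\<^esub>" "snd x \<in> carrier H"
    by (cases x) auto
  then show "\<exists>N \<in> finite_index_normal (G \<times>\<times> H). x \<notin> N"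
  proof cases
    case 1
    then obtain K where K: "K \<in> finite_index_normal G" "fst x \<notin> K" using G by (auto simp: residually_finite_def)
    then show ?thesis
      by (intro bexI[OF _ finite_index_normal_vimage[OF f DirProd_group[OF G(1) H(1)] G(1) K(1)]]) simp
  next
    case 2
    then obtain K where K: "K \<in> finite_index_normal H" "snd x \<notin> K" using H by (auto simp: residually_finite_def)
    then show ?thesis
      by (intro bexI[OF _ finite_index_normal_vimage[OF s DirProd_group[OF G(1) H(1)] H(1) K(1)]]) simp
  qed
qed

section \<open>An isomorphism criterion for profinite completions\<close>

lemma profinite_completion_simps:
  "carrier (profinite_completion G) = {x \<in> (\<Pi>\<^sub>E N\<in>finite_index_normal G. carrier (G Mod N)).
     \<forall>N \<in> finite_index_normal G. \<forall>K \<in> finite_index_normal G. N \<subseteq> K \<longrightarrow> x N \<subseteq> x K}"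
  "x \<otimes>\<^bsub>profinite_completion G\<^esub> y = (\<lambda>N\<in>finite_index_normal G. x N <#>\<^bsub>G\<^esub> y N)"
  by (simp_all add: profinite_completion_def)

text \<open>An element of the completion is a function that looks like an element of the group at any two
  subgroups of finite index.\<close>

lemma profinite_completion_iff:
  assumes G: "Group.group G"
  shows "x \<in> carrier (profinite_completion G) \<longleftrightarrow> x \<in> extensional (finite_index_normal G) \<and>
    (\<forall>N \<in> finite_index_normal G. \<forall>K \<in> finite_index_normal G. \<exists>g \<in> carrier G. x N = N #>\<^bsub>G\<^esub> g \<and> x K = K #>\<^bsub>G\<^esub> g)"
    (is "?l \<longleftrightarrow> ?e \<and> ?r")
proof (intro iffI conjI)
  interpret Group.group G by (rule G)
  assume l: ?l
  then show ?e by (auto simp: profinite_completion_simps PiE_def)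
  show ?r
  proof (intro ballI)
    fix N K assume N: "N \<in> finite_index_normal G" and K: "K \<in> finite_index_normal G"
    \<comment> \<open>A group element that represents x at the intersection represents it at both
      subgroups, by compatibility of the family.\<close>
    note NK = finite_index_normal_Int[OF G N K]
    from l have c: "\<And>M. M \<in> finite_index_normal G \<Longrightarrow> x M \<in> (\<lambda>g. M #>\<^bsub>G\<^esub> g) ` carrier G"
      by (auto simp: profinite_completion_simps PiE_iff carrier_FactGroup)
    obtain g where g: "g \<in> carrier G" "x (N \<inter> K) = (N \<inter> K) #>\<^bsub>G\<^esub> g" using c[OF NK] by auto
    have "g \<in> x (N \<inter> K)" using g rcos_self finite_index_normalD(2)[OF NK] by simp
    moreover have "x (N \<inter> K) \<subseteq> x N" "x (N \<inter> K) \<subseteq> x K"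
      using l N K NK by (auto simp: profinite_completion_simps)
    ultimately have "g \<in> x N" "g \<in> x K" by auto
    then have "x N = N #>\<^bsub>G\<^esub> g" "x K = K #>\<^bsub>G\<^esub> g"
      using c[OF N] c[OF K] repr_independence finite_index_normalD(2)[OF N] finite_index_normalD(2)[OF K] by auto
    then show "\<exists>g \<in> carrier G. x N = N #>\<^bsub>G\<^esub> g \<and> x K = K #>\<^bsub>G\<^esub> g" using g by blast
  qed
next
  interpret Group.group G by (rule G)
  assume r: "?e \<and> ?r"
  have "x N \<subseteq> x K" if NK: "N \<in> finite_index_normal G" "K \<in> finite_index_normal G" "N \<subseteq> K" for N K
  proof -
    obtain g where "x N = N #>\<^bsub>G\<^esub> g" "x K = K #>\<^bsub>G\<^esub> g"
      using r[THEN conjunct2, rule_format, OF NK(1,2)] by auto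
    then show ?thesis using NK(3) by (simp add: r_coset_def) blast
  qed
  moreover have "x N \<in> carrier (G Mod N)" if "N \<in> finite_index_normal G" for N
    using r[THEN conjunct2, rule_format, OF that that] by (auto simp: carrier_FactGroup)
  ultimately show ?l using r by (auto simp: profinite_completion_simps PiE_iff)
qed

lemma profinite_completion_approx:
  assumes "Group.group G" "x \<in> carrier (profinite_completion G)"
    "N \<in> finite_index_normal G" "K \<in> finite_index_normal G"
  shows "\<exists>g \<in> carrier G. x N = N #>\<^bsub>G\<^esub> g \<and> x K = K #>\<^bsub>G\<^esub> g"
  using assms by (simp add: profinite_completion_iff)

lemma topspace_profinite_topology: "topspace (profinite_topology G) = carrier (profinite_completion G)"
  by (auto simp: profinite_topology_def profinite_completion_simps)

text \<open>Each coordinate of \<open>F x\<close> depends on a single coordinate of x, and every map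
  between discrete spaces is continuous.\<close>

lemma continuous_map_profinite_topology:
  assumes F: "\<And>x. x \<in> carrier (profinite_completion G) \<Longrightarrow> F x \<in> carrier (profinite_completion H)"
    and k: "\<And>K. K \<in> finite_index_normal H \<Longrightarrow> k K \<in> finite_index_normal G"
    and F_eq: "\<And>x K. x \<in> carrier (profinite_completion G) \<Longrightarrow> K \<in> finite_index_normal H \<Longrightarrow> F x K = e K (x (k K))"
    and e: "\<And>K c. K \<in> finite_index_normal H \<Longrightarrow> c \<in> carrier (G Mod k K) \<Longrightarrow> e K c \<in> carrier (H Mod K)"
  shows "continuous_map (profinite_topology G) (profinite_topology H) F"
proof -
  have "continuous_map (profinite_topology G) (discrete_topology (carrier (H Mod K))) (\<lambda>x. F x K)"
    if K: "K \<in> finite_index_normal H" for K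
  proof -
    have 1: "continuous_map (profinite_topology G) (discrete_topology (carrier (G Mod k K))) (\<lambda>x. x (k K))"
      unfolding profinite_topology_def
      by (intro continuous_map_from_subtopology continuous_map_product_projection
          [of "k K" _ "\<lambda>N. discrete_topology (carrier (G Mod N))"] k K)
    have 2: "continuous_map (discrete_topology (carrier (G Mod k K))) (discrete_topology (carrier (H Mod K))) (e K)"
      using e[OF K] by auto
    have "continuous_map (profinite_topology G) (discrete_topology (carrier (H Mod K))) (\<lambda>x. e K (x (k K)))"
      using continuous_map_compose[OF 1 2] by (simp add: o_def)
    then show ?thesis
      by (rule continuous_map_eq) (simp add: topspace_profinite_topology F_eq K)
  qed
  moreover have "F x \<in> extensional (finite_index_normal H)" if "x \<in> carrier (profinite_completion G)" for x
    using F[OF that] by (auto simp: profinite_completion_simps PiE_def)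
  ultimately show ?thesis
    unfolding profinite_topology_def[of H] continuous_map_in_subtopology continuous_map_componentwise
    using F by (auto simp: topspace_profinite_topology)
qed

text \<open>The two hypotheses are surjectivity and injectivity of the map induced on the completions.\<close>

lemma isomorphic_profinite_completionsI:
  fixes G :: "'g monoid" and H :: "'h monoid"
  assumes G: "Group.group G" and H: "Group.group H" and f: "f \<in> hom G H"
    and dense: "\<And>K h. K \<in> finite_index_normal H \<Longrightarrow> h \<in> carrier H \<Longrightarrow> \<exists>g \<in> carrier G. f g \<in> K #>\<^bsub>H\<^esub> h"
    and sep: "\<And>N. N \<in> finite_index_normal G \<Longrightarrow> \<exists>K \<in> finite_index_normal H. \<forall>g \<in> carrier G. f g \<in> K \<longrightarrow> g \<in> N"
  shows "isomorphic_profinite_completions G H"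
proof -
  interpret f: group_hom G H f using f G H by (simp add: group_hom_def group_hom_axioms_def)
  define pre where "pre = (\<lambda>K. {g \<in> carrier G. f g \<in> K})"
  have pre: "pre K \<in> finite_index_normal G" if "K \<in> finite_index_normal H" for K
    unfolding pre_def by (rule finite_index_normal_vimage[OF f G H that])
  obtain \<kappa> where \<kappa>: "\<And>N. N \<in> finite_index_normal G \<Longrightarrow> \<kappa> N \<in> finite_index_normal H"
    "\<And>N g. N \<in> finite_index_normal G \<Longrightarrow> g \<in> carrier G \<Longrightarrow> f g \<in> \<kappa> N \<Longrightarrow> g \<in> N"
    using sep by metis
  \<comment> \<open>Cosets are transported through chosen representatives; for p a representative
    exists by density. The inverse \<Psi> reads y at a subgroup \<open>\<kappa> N\<close> that is
    fine enough to determine the coset of N. Being explicit, it is seen to be continuous directly,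
    with no appeal to compactness.\<close>
  define t where "t = (\<lambda>K c. K #>\<^bsub>H\<^esub> f (SOME g. g \<in> c))"
  define p where "p = (\<lambda>N c. N #>\<^bsub>G\<^esub> (SOME g. g \<in> carrier G \<and> f g \<in> c))"
  define \<Theta> where "\<Theta> = (\<lambda>x. \<lambda>K\<in>finite_index_normal H. t K (x (pre K)))"
  define \<Psi> where "\<Psi> = (\<lambda>y. \<lambda>N\<in>finite_index_normal G. p N (y (\<kappa> N)))"
  have t: "t K (pre K #>\<^bsub>G\<^esub> g) = K #>\<^bsub>H\<^esub> f g" if K: "K \<in> finite_index_normal H" and g: "g \<in> carrier G" for K g
  proof -
    define g' where "g' = (SOME g'. g' \<in> pre K #>\<^bsub>G\<^esub> g)"
    have s: "subgroup (pre K) G" by (rule finite_index_normalD(2)[OF pre[OF K]])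
    have "g \<in> pre K #>\<^bsub>G\<^esub> g" by (rule f.G.rcos_self[OF g s])
    then have g': "g' \<in> pre K #>\<^bsub>G\<^esub> g" unfolding g'_def by (rule someI)
    then obtain n where n: "n \<in> pre K" "g' = n \<otimes>\<^bsub>G\<^esub> g" by (auto simp: r_coset_def)
    then have "f g' = f n \<otimes>\<^bsub>H\<^esub> f g" "f n \<in> K" using g by (auto simp: pre_def)
    then have "f g' \<in> K #>\<^bsub>H\<^esub> f g" by (auto simp: r_coset_def)
    then have "K #>\<^bsub>H\<^esub> f g' = K #>\<^bsub>H\<^esub> f g"
      using f.H.repr_independence[of "f g'" K "f g"] g finite_index_normalD(2)[OF K] by simp
    then show ?thesis by (simp add: t_def g'_def)
  qed
  have p: "p N (\<kappa> N #>\<^bsub>H\<^esub> f g) = N #>\<^bsub>G\<^esub> g" if N: "N \<in> finite_index_normal G" and g: "g \<in> carrier G" for N g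
  proof -
    define g' where "g' = (SOME g'. g' \<in> carrier G \<and> f g' \<in> \<kappa> N #>\<^bsub>H\<^esub> f g)"
    have s: "subgroup (\<kappa> N) H" by (rule finite_index_normalD(2)[OF \<kappa>(1)[OF N]])
    have "g \<in> carrier G \<and> f g \<in> \<kappa> N #>\<^bsub>H\<^esub> f g" using g s f.H.rcos_self by simp
    then have "g' \<in> carrier G \<and> f g' \<in> \<kappa> N #>\<^bsub>H\<^esub> f g" unfolding g'_def by (rule someI)
    then have g': "g' \<in> carrier G" "f g' \<in> \<kappa> N #>\<^bsub>H\<^esub> f g" by simp_all
    then have "\<kappa> N #>\<^bsub>H\<^esub> f g' = \<kappa> N #>\<^bsub>H\<^esub> f g"
      using f.H.repr_independence[of "f g'" "\<kappa> N" "f g"] g s by simp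
    then have "f g' \<otimes>\<^bsub>H\<^esub> inv\<^bsub>H\<^esub> f g \<in> \<kappa> N" using f.H.r_coset_eq_iff[OF s] g g' by simp
    then have "f (g' \<otimes>\<^bsub>G\<^esub> inv\<^bsub>G\<^esub> g) \<in> \<kappa> N" using g g' by simp
    then have "g' \<otimes>\<^bsub>G\<^esub> inv\<^bsub>G\<^esub> g \<in> N" using \<kappa>(2)[OF N] g g' by simp
    then have "N #>\<^bsub>G\<^esub> g' = N #>\<^bsub>G\<^esub> g"
      using f.G.r_coset_eq_iff[OF finite_index_normalD(2)[OF N]] g g' by simp
    then show ?thesis by (simp add: p_def g'_def)
  qed
  have \<Theta>_eq: "\<Theta> x K = K #>\<^bsub>H\<^esub> f g"
    if "K \<in> finite_index_normal H" "g \<in> carrier G" "x (pre K) = pre K #>\<^bsub>G\<^esub> g" for x K g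
    using that t by (simp add: \<Theta>_def)
  have \<Psi>_eq: "\<Psi> y N = N #>\<^bsub>G\<^esub> g"
    if "N \<in> finite_index_normal G" "g \<in> carrier G" "y (\<kappa> N) = \<kappa> N #>\<^bsub>H\<^esub> f g" for y N g
    using that p by (simp add: \<Psi>_def)
  note iffG = profinite_completion_iff[OF G] and iffH = profinite_completion_iff[OF H]
  \<comment> \<open>Density, applied at the intersection of the two subgroups, replaces the
    approximating element of H by an element of the image of f.\<close>
  have approx: "\<exists>g \<in> carrier G. y K = K #>\<^bsub>H\<^esub> f g \<and> y K' = K' #>\<^bsub>H\<^esub> f g"
    if y: "y \<in> carrier (profinite_completion H)" and K: "K \<in> finite_index_normal H" and K': "K' \<in> finite_index_normal H" for y K K'
  proof -
    obtain h where h: "h \<in> carrier H" "y K = K #>\<^bsub>H\<^esub> h" "y K' = K' #>\<^bsub>H\<^esub> h" using profinite_completion_approx[OF H y K K'] by blast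
    obtain g where g: "g \<in> carrier G" "f g \<in> (K \<inter> K') #>\<^bsub>H\<^esub> h"
      using dense[OF finite_index_normal_Int[OF H K K'] h(1)] by blast
    then have "f g \<in> K #>\<^bsub>H\<^esub> h" "f g \<in> K' #>\<^bsub>H\<^esub> h" by (auto simp: r_coset_def)
    then show ?thesis
      using g(1) h f.H.repr_independence[OF _ h(1) finite_index_normalD(2)[OF K]]
        f.H.repr_independence[OF _ h(1) finite_index_normalD(2)[OF K']] by (intro bexI[of _ g]) simp_all
  qed
  have \<Theta>c: "\<Theta> x \<in> carrier (profinite_completion H)" if x: "x \<in> carrier (profinite_completion G)" for x
    unfolding iffH
  proof (intro conjI ballI)
    fix K K' assume K: "K \<in> finite_index_normal H" "K' \<in> finite_index_normal H"
    obtain g where "g \<in> carrier G" "x (pre K) = pre K #>\<^bsub>G\<^esub> g" "x (pre K') = pre K' #>\<^bsub>G\<^esub> g"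
      using profinite_completion_approx[OF G x pre[OF K(1)] pre[OF K(2)]] by blast
    then show "\<exists>h \<in> carrier H. \<Theta> x K = K #>\<^bsub>H\<^esub> h \<and> \<Theta> x K' = K' #>\<^bsub>H\<^esub> h"
      using \<Theta>_eq K by (intro bexI[of _ "f g"]) auto
  qed (simp add: \<Theta>_def)
  have \<Psi>c: "\<Psi> y \<in> carrier (profinite_completion G)" if y: "y \<in> carrier (profinite_completion H)" for y
    unfolding iffG
  proof (intro conjI ballI)
    fix N N' assume N: "N \<in> finite_index_normal G" "N' \<in> finite_index_normal G"
    obtain g where "g \<in> carrier G" "y (\<kappa> N) = \<kappa> N #>\<^bsub>H\<^esub> f g" "y (\<kappa> N') = \<kappa> N' #>\<^bsub>H\<^esub> f g"
      using approx[OF y \<kappa>(1)[OF N(1)] \<kappa>(1)[OF N(2)]] by blast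
    then show "\<exists>g \<in> carrier G. \<Psi> y N = N #>\<^bsub>G\<^esub> g \<and> \<Psi> y N' = N' #>\<^bsub>G\<^esub> g"
      using \<Psi>_eq N by (intro bexI[of _ g]) auto
  qed (simp add: \<Psi>_def)
  have \<Psi>\<Theta>: "\<Psi> (\<Theta> x) = x" if x: "x \<in> carrier (profinite_completion G)" for x
  proof (rule extensionalityI[of _ "finite_index_normal G"])
    fix N assume N: "N \<in> finite_index_normal G"
    obtain g where g: "g \<in> carrier G" "x N = N #>\<^bsub>G\<^esub> g" "x (pre (\<kappa> N)) = pre (\<kappa> N) #>\<^bsub>G\<^esub> g"
      using profinite_completion_approx[OF G x N pre[OF \<kappa>(1)[OF N]]] by blast
    then show "\<Psi> (\<Theta> x) N = x N" using \<Psi>_eq[OF N g(1)] \<Theta>_eq[OF \<kappa>(1)[OF N] g(1)] by simp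
  qed (use x iffG in \<open>auto simp: \<Psi>_def\<close>)
  have \<Theta>\<Psi>: "\<Theta> (\<Psi> y) = y" if y: "y \<in> carrier (profinite_completion H)" for y
  proof (rule extensionalityI[of _ "finite_index_normal H"])
    fix K assume K: "K \<in> finite_index_normal H"
    obtain g where g: "g \<in> carrier G" "y K = K #>\<^bsub>H\<^esub> f g" "y (\<kappa> (pre K)) = \<kappa> (pre K) #>\<^bsub>H\<^esub> f g"
      using approx[OF y K \<kappa>(1)[OF pre[OF K]]] by blast
    then show "\<Theta> (\<Psi> y) K = y K" using \<Theta>_eq[OF K g(1)] \<Psi>_eq[OF pre[OF K] g(1)] by simp
  qed (use y iffH in \<open>auto simp: \<Theta>_def\<close>)
  have bij: "bij_betw \<Theta> (carrier (profinite_completion G)) (carrier (profinite_completion H))"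
    by (rule bij_betwI[where g = \<Psi>]) (auto simp: \<Theta>c \<Psi>c \<Psi>\<Theta> \<Theta>\<Psi>)
  have mult: "\<Theta> (x \<otimes>\<^bsub>profinite_completion G\<^esub> y) = \<Theta> x \<otimes>\<^bsub>profinite_completion H\<^esub> \<Theta> y"
    if x: "x \<in> carrier (profinite_completion G)" and y: "y \<in> carrier (profinite_completion G)" for x y
  proof (rule extensionalityI[of _ "finite_index_normal H"])
    fix K assume K: "K \<in> finite_index_normal H"
    obtain g where g: "g \<in> carrier G" "x (pre K) = pre K #>\<^bsub>G\<^esub> g" using profinite_completion_approx[OF G x pre[OF K] pre[OF K]] by blast
    obtain g' where g': "g' \<in> carrier G" "y (pre K) = pre K #>\<^bsub>G\<^esub> g'" using profinite_completion_approx[OF G y pre[OF K] pre[OF K]] by blast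
    have "(x \<otimes>\<^bsub>profinite_completion G\<^esub> y) (pre K) = pre K #>\<^bsub>G\<^esub> (g \<otimes>\<^bsub>G\<^esub> g')"
      using pre[OF K] normal.rcos_sum[OF finite_index_normalD(1)[OF pre[OF K]] g(1) g'(1)]
      by (simp add: profinite_completion_simps g g')
    then have "\<Theta> (x \<otimes>\<^bsub>profinite_completion G\<^esub> y) K = K #>\<^bsub>H\<^esub> (f g \<otimes>\<^bsub>H\<^esub> f g')"
      using \<Theta>_eq[OF K, of "g \<otimes>\<^bsub>G\<^esub> g'"] g g' by simp
    also have "\<dots> = (K #>\<^bsub>H\<^esub> f g) <#>\<^bsub>H\<^esub> (K #>\<^bsub>H\<^esub> f g')"
      using normal.rcos_sum[OF finite_index_normalD(1)[OF K]] g g' by simp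
    finally show "\<Theta> (x \<otimes>\<^bsub>profinite_completion G\<^esub> y) K = (\<Theta> x \<otimes>\<^bsub>profinite_completion H\<^esub> \<Theta> y) K"
      using K \<Theta>_eq[OF K] g g' by (simp add: profinite_completion_simps)
  qed (simp_all add: \<Theta>_def profinite_completion_simps)
  have "\<Theta> \<in> iso (profinite_completion G) (profinite_completion H)"
    using bij mult \<Theta>c by (auto simp: iso_def hom_def)
  moreover have "homeomorphic_map (profinite_topology G) (profinite_topology H) \<Theta>"
    unfolding homeomorphic_map_maps homeomorphic_maps_def
  proof (intro exI[of _ \<Psi>] conjI)
    show "continuous_map (profinite_topology G) (profinite_topology H) \<Theta>"
    proof (rule continuous_map_profinite_topology[OF \<Theta>c pre])
      fix K c assume K: "K \<in> finite_index_normal H" and "c \<in> carrier (G Mod pre K)"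
      then obtain g where "g \<in> carrier G" "c = pre K #>\<^bsub>G\<^esub> g" by (auto simp: carrier_FactGroup)
      then show "t K c \<in> carrier (H Mod K)" using t[OF K] by (auto simp: carrier_FactGroup)
    qed (simp_all add: \<Theta>_def)
    show "continuous_map (profinite_topology H) (profinite_topology G) \<Psi>"
    proof (rule continuous_map_profinite_topology[OF \<Psi>c \<kappa>(1)])
      fix N c assume N: "N \<in> finite_index_normal G" and "c \<in> carrier (H Mod \<kappa> N)"
      then obtain h where h: "h \<in> carrier H" "c = \<kappa> N #>\<^bsub>H\<^esub> h" by (auto simp: carrier_FactGroup)
      obtain g where g: "g \<in> carrier G" "f g \<in> \<kappa> N #>\<^bsub>H\<^esub> h" using dense[OF \<kappa>(1)[OF N] h(1)] by blast
      then have "c = \<kappa> N #>\<^bsub>H\<^esub> f g"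
        using f.H.repr_independence[OF g(2) h(1) finite_index_normalD(2)[OF \<kappa>(1)[OF N]]] h(2) by simp
      then show "p N c \<in> carrier (G Mod N)" using p[OF N g(1)] g by (auto simp: carrier_FactGroup)
    qed (simp_all add: \<Psi>_def)
  qed (auto simp: topspace_profinite_topology \<Psi>\<Theta> \<Theta>\<Psi>)
  ultimately show ?thesis unfolding isomorphic_profinite_completions_def by blast
qed

section \<open>Fibre products\<close>

lemma finite_image_factor:
  assumes "finite (f ` A)" and "\<And>x y. x \<in> A \<Longrightarrow> y \<in> A \<Longrightarrow> f x = f y \<Longrightarrow> g x = g y"
  shows "finite (g ` A)"
proof (rule finite_subset)
  show "finite ((\<lambda>a. g (inv_into A f a)) ` f ` A)" using assms(1) by (rule finite_imageI)
  show "g ` A \<subseteq> (\<lambda>a. g (inv_into A f a)) ` f ` A"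
  proof
    fix y assume "y \<in> g ` A"
    then obtain x where x: "x \<in> A" "y = g x" by blast
    have "g (inv_into A f (f x)) = g x"
      by (rule assms(2)) (use x in \<open>simp_all add: inv_into_into f_inv_into_f\<close>)
    then show "y \<in> (\<lambda>a. g (inv_into A f a)) ` f ` A" using x by force
  qed
qed

lemma (in group) finite_index_normal_mono:
  assumes "N \<in> finite_index_normal G" "K \<lhd> G" "N \<subseteq> K"
  shows "K \<in> finite_index_normal G"
proof (rule finite_index_normalI[where f = "\<lambda>g. N #> g"])
  show "finite ((\<lambda>g. N #> g) ` carrier G)" by (rule finite_index_normalD(3)[OF assms(1)])
  show "g \<otimes> inv h \<in> K" if "g \<in> carrier G" "h \<in> carrier G" "N #> g = N #> h" for g h
    using that r_coset_eq_iff[OF finite_index_normalD(2)[OF assms(1)]] assms(3) by auto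
qed (rule assms(2))

lemma (in group) normal_set_mult:
  assumes "N \<lhd> G" "K \<lhd> G" shows "N <#> K \<lhd> G"
proof (rule normal_invI)
  show "subgroup (N <#> K) G" by (rule mult_norm_subgroup[OF assms(1) normal_imp_subgroup[OF assms(2)]])
  fix x h assume x: "x \<in> carrier G" and "h \<in> N <#> K"
  then obtain n k where nk: "n \<in> N" "k \<in> K" "h = n \<otimes> k" by (auto simp: set_mult_def)
  have c: "n \<in> carrier G" "k \<in> carrier G"
    using subgroup.mem_carrier[OF normal_imp_subgroup[OF assms(1)] nk(1)]
      subgroup.mem_carrier[OF normal_imp_subgroup[OF assms(2)] nk(2)] by simp_all
  have "x \<otimes> h \<otimes> inv x = (x \<otimes> n \<otimes> inv x) \<otimes> (x \<otimes> k \<otimes> inv x)"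
    using x c by (simp add: nk m_assoc inv_solve_left)
  moreover have "x \<otimes> n \<otimes> inv x \<in> N" "x \<otimes> k \<otimes> inv x \<in> K"
    using normal.inv_op_closed2[OF assms(1) x nk(1)] normal.inv_op_closed2[OF assms(2) x nk(2)] by auto
  ultimately show "x \<otimes> h \<otimes> inv x \<in> N <#> K" unfolding set_mult_def by blast
qed

locale fibre_pair = F: Group.group F + Q: Group.group Q
  for F :: "'f monoid" and Q :: "'q monoid" +
  fixes \<pi> :: "'f \<Rightarrow> 'q" and z :: 'q
  assumes pi_hom: "\<pi> \<in> hom F Q" and pi_surj: "\<pi> ` carrier F = carrier Q"
    and z_closed: "z \<in> carrier Q"
    and z_central: "\<And>q. q \<in> carrier Q \<Longrightarrow> z \<otimes>\<^bsub>Q\<^esub> q = q \<otimes>\<^bsub>Q\<^esub> z"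
begin

sublocale pi: group_hom F Q \<pi>
  by unfold_locales (rule pi_hom)

abbreviation ker_pi :: "'f set"
  where "ker_pi \<equiv> kernel F Q \<pi>"

definition ambient :: "('f \<times> 'f \<times> int) monoid"
  where "ambient = F \<times>\<times> F \<times>\<times> integer_group"

definition fibre :: "('f \<times> 'f \<times> int) set"
  where "fibre = {(x, y, j). x \<in> carrier F \<and> y \<in> carrier F \<and> \<pi> y = \<pi> x \<otimes>\<^bsub>Q\<^esub> z [^]\<^bsub>Q\<^esub> j}"

definition fibre_group :: "('f \<times> 'f \<times> int) monoid"
  where "fibre_group = ambient\<lparr>carrier := fibre\<rparr>"

lemma group_ambient: "Group.group ambient"
  unfolding ambient_def by (intro DirProd_group F.is_group group_integer_group)

sublocale A: Group.group ambient
  by (rule group_ambient)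

lemma ambient_simps [simp]:
  "(x, y, j) \<in> carrier ambient \<longleftrightarrow> x \<in> carrier F \<and> y \<in> carrier F"
  "\<one>\<^bsub>ambient\<^esub> = (\<one>\<^bsub>F\<^esub>, \<one>\<^bsub>F\<^esub>, 0)"
  "(x, y, j) \<otimes>\<^bsub>ambient\<^esub> (x', y', j') = (x \<otimes>\<^bsub>F\<^esub> x', y \<otimes>\<^bsub>F\<^esub> y', j + j')"
  by (simp_all add: ambient_def)

lemma ambient_inv [simp]:
  assumes "x \<in> carrier F" "y \<in> carrier F"
  shows "inv\<^bsub>ambient\<^esub> (x, y, j) = (inv\<^bsub>F\<^esub> x, inv\<^bsub>F\<^esub> y, - j)"
  by (rule A.inv_equality) (use assms in simp_all)

lemma z_pow_closed [simp]: "z [^]\<^bsub>Q\<^esub> (j :: int) \<in> carrier Q"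
  using z_closed by simp

text \<open>Conjugation by q is an endomorphism that fixes z, hence it fixes the powers of
  z.\<close>

lemma z_pow_central: "q \<in> carrier Q \<Longrightarrow> z [^]\<^bsub>Q\<^esub> (j :: int) \<otimes>\<^bsub>Q\<^esub> q = q \<otimes>\<^bsub>Q\<^esub> z [^]\<^bsub>Q\<^esub> j"
proof -
  assume q: "q \<in> carrier Q"
  have conj: "(\<lambda>u. inv\<^bsub>Q\<^esub> q \<otimes>\<^bsub>Q\<^esub> u \<otimes>\<^bsub>Q\<^esub> q) \<in> hom Q Q"
    using q by (auto simp: hom_def Q.m_assoc) (simp add: Q.m_assoc[symmetric])
  have "inv\<^bsub>Q\<^esub> q \<otimes>\<^bsub>Q\<^esub> z [^]\<^bsub>Q\<^esub> j \<otimes>\<^bsub>Q\<^esub> q = (inv\<^bsub>Q\<^esub> q \<otimes>\<^bsub>Q\<^esub> z \<otimes>\<^bsub>Q\<^esub> q) [^]\<^bsub>Q\<^esub> j"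
    using hom_int_pow[OF conj z_closed Q.is_group Q.is_group] by simp
  also have "inv\<^bsub>Q\<^esub> q \<otimes>\<^bsub>Q\<^esub> z \<otimes>\<^bsub>Q\<^esub> q = inv\<^bsub>Q\<^esub> q \<otimes>\<^bsub>Q\<^esub> (q \<otimes>\<^bsub>Q\<^esub> z)"
    using q z_closed by (simp add: Q.m_assoc z_central)
  also have "\<dots> = z" using q z_closed by (simp add: Q.m_assoc[symmetric])
  finally show ?thesis using q by (simp add: Q.m_assoc Q.inv_solve_left')
qed

lemma fibre_iff: "(x, y, j) \<in> fibre \<longleftrightarrow> x \<in> carrier F \<and> y \<in> carrier F \<and> \<pi> y = \<pi> x \<otimes>\<^bsub>Q\<^esub> z [^]\<^bsub>Q\<^esub> j"
  by (simp add: fibre_def)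

lemma subgroup_fibre: "subgroup fibre ambient"
proof (rule A.subgroupI)
  show "fibre \<noteq> {}" using z_closed by (auto simp: fibre_def intro!: exI[of _ "\<one>\<^bsub>F\<^esub>"] exI[of _ "0::int"])
  fix p assume "p \<in> fibre"
  then obtain x y j where p: "p = (x, y, j)" "x \<in> carrier F" "y \<in> carrier F" "\<pi> y = \<pi> x \<otimes>\<^bsub>Q\<^esub> z [^]\<^bsub>Q\<^esub> j"
    by (auto simp: fibre_def)
  then have "inv\<^bsub>Q\<^esub> \<pi> y = inv\<^bsub>Q\<^esub> \<pi> x \<otimes>\<^bsub>Q\<^esub> z [^]\<^bsub>Q\<^esub> (- j)"
    using z_closed z_pow_central[of "inv\<^bsub>Q\<^esub> \<pi> x" "- j"] by (simp add: Q.inv_mult_group Q.int_pow_neg)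
  then show "inv\<^bsub>ambient\<^esub> p \<in> fibre" using p by (simp add: fibre_iff)
  fix p' assume "p' \<in> fibre"
  then obtain x' y' j' where p': "p' = (x', y', j')" "x' \<in> carrier F" "y' \<in> carrier F" "\<pi> y' = \<pi> x' \<otimes>\<^bsub>Q\<^esub> z [^]\<^bsub>Q\<^esub> j'"
    by (auto simp: fibre_def)
  have "z [^]\<^bsub>Q\<^esub> j \<otimes>\<^bsub>Q\<^esub> (\<pi> x' \<otimes>\<^bsub>Q\<^esub> z [^]\<^bsub>Q\<^esub> j') = \<pi> x' \<otimes>\<^bsub>Q\<^esub> z [^]\<^bsub>Q\<^esub> (j + j')"
    using p' z_closed z_pow_central[of "\<pi> x'" j] by (simp add: Q.int_pow_mult Q.m_assoc[symmetric])
  then show "p \<otimes>\<^bsub>ambient\<^esub> p' \<in> fibre"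
    using p p' by (simp add: fibre_iff Q.m_assoc)
next
  show "fibre \<subseteq> carrier ambient"
  proof
    fix p assume "p \<in> fibre"
    then show "p \<in> carrier ambient" by (cases p) (simp add: fibre_iff)
  qed
qed

sublocale P: Group.group fibre_group
  unfolding fibre_group_def by (rule A.subgroup_imp_group[OF subgroup_fibre])

lemma fibre_group_simps [simp]:
  "carrier fibre_group = fibre" "\<one>\<^bsub>fibre_group\<^esub> = (\<one>\<^bsub>F\<^esub>, \<one>\<^bsub>F\<^esub>, 0)"
  "(x, y, j) \<otimes>\<^bsub>fibre_group\<^esub> (x', y', j') = (x \<otimes>\<^bsub>F\<^esub> x', y \<otimes>\<^bsub>F\<^esub> y', j + j')"
  by (simp_all add: fibre_group_def ambient_def)

lemma fibre_group_inv [simp]: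
  assumes "(x, y, j) \<in> fibre"
  shows "inv\<^bsub>fibre_group\<^esub> (x, y, j) = (inv\<^bsub>F\<^esub> x, inv\<^bsub>F\<^esub> y, - j)"
  using A.m_inv_consistent[OF subgroup_fibre assms] assms by (simp add: fibre_group_def fibre_iff)

lemma incl_hom: "(\<lambda>p. p) \<in> hom fibre_group ambient"
  using subgroup.subset[OF subgroup_fibre] by (auto simp: hom_def fibre_group_def)

lemma ker_piD: "n \<in> ker_pi \<Longrightarrow> n \<in> carrier F" "n \<in> ker_pi \<Longrightarrow> \<pi> n = \<one>\<^bsub>Q\<^esub>"
  by (simp_all add: kernel_def)

lemma fibre_diag: "g \<in> carrier F \<Longrightarrow> (g, g, 0) \<in> fibre"
  and fibre_ker_left: "n \<in> ker_pi \<Longrightarrow> (n, \<one>\<^bsub>F\<^esub>, 0) \<in> fibre"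
  and fibre_ker_right: "n \<in> ker_pi \<Longrightarrow> (\<one>\<^bsub>F\<^esub>, n, 0) \<in> fibre"
  by (simp_all add: fibre_iff kernel_def)

lemma pi_int_pow: "g \<in> carrier F \<Longrightarrow> \<pi> (g [^]\<^bsub>F\<^esub> (j :: int)) = \<pi> g [^]\<^bsub>Q\<^esub> j"
  using hom_int_pow[OF pi_hom _ F.is_group Q.is_group] by blast

text \<open>Conjugation by diagonal elements realizes the action of F on the kernel in the first
  factor, so normal generators of the kernel are enough there. One further generator, with a lift c
  of z in the second factor, accounts for the integer coordinate.\<close>

lemma finitely_generated_fibre_group:
  assumes S: "finite S" "S \<subseteq> carrier F" "generate F S = carrier F"
    and T: "finite T" "T \<subseteq> ker_pi" "\<And>K. K \<lhd> F \<Longrightarrow> T \<subseteq> K \<Longrightarrow> ker_pi \<subseteq> K"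
  shows "finitely_generated fibre_group"
proof -
  obtain c where c: "c \<in> carrier F" "\<pi> c = z" using z_closed pi_surj by (metis imageE)
  define X where "X = (\<lambda>g. (g, g, 0)) ` S \<union> (\<lambda>t. (t, \<one>\<^bsub>F\<^esub>, 0)) ` T \<union> {(\<one>\<^bsub>F\<^esub>, c, 1 :: int)}"
  have c1: "(\<one>\<^bsub>F\<^esub>, c, 1) \<in> fibre" using c z_closed by (simp add: fibre_iff Q.int_pow_1)
  have XP: "X \<subseteq> carrier fibre_group"
    unfolding X_def fibre_group_simps using S(2) T(2) c1 fibre_diag fibre_ker_left by blast
  define H where "H = generate fibre_group X"
  have H: "subgroup H fibre_group" unfolding H_def by (rule P.generate_is_subgroup[OF XP])
  have HP: "H \<subseteq> fibre" using subgroup.subset[OF H] by simp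
  note Hm = subgroup.m_closed[OF H] and Hi = subgroup.m_inv_closed[OF H]
  have X: "x \<in> H" if "x \<in> X" for x unfolding H_def by (rule generate.incl[OF that])
  have diag: "(g, g, 0) \<in> H" if g: "g \<in> carrier F" for g
  proof -
    have "g \<in> generate F S" using S(3) g by simp
    then show ?thesis
    proof (induct rule: generate.induct)
      case one
      then show ?case using subgroup.one_closed[OF H] by simp
    next
      case (incl h)
      then show ?case by (intro X) (simp add: X_def)
    next
      case (inv h)
      then have "(h, h, 0) \<in> H" "(h, h, 0) \<in> fibre" using S(2) by (auto intro!: X fibre_diag simp: X_def)
      then show ?case using Hi[of "(h, h, 0)"] by simp
    next
      case (eng h k)
      then show ?case using Hm[of "(h, h, 0)" "(k, k, 0)"] by simp
    qed
  qed
  define K where "K = {n \<in> ker_pi. (n, \<one>\<^bsub>F\<^esub>, 0) \<in> H}"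
  have "K \<lhd> F"
  proof (rule F.normal_invI)
    have "subgroup ker_pi F" by (rule normal_imp_subgroup[OF pi.normal_kernel])
    note k1 = subgroup.m_closed[OF this] and k2 = subgroup.m_inv_closed[OF this] and k3 = subgroup.one_closed[OF this]
    show "subgroup K F"
    proof (rule F.subgroupI)
      show "K \<subseteq> carrier F" by (auto simp: K_def dest: ker_piD)
      show "K \<noteq> {}" using k3 diag[of "\<one>\<^bsub>F\<^esub>"] by (auto simp: K_def)
      fix m assume m: "m \<in> K"
      then show "inv\<^bsub>F\<^esub> m \<in> K"
        using Hi[of "(m, \<one>\<^bsub>F\<^esub>, 0)"] k2 fibre_ker_left by (auto simp: K_def)
      fix n assume "n \<in> K"
      then show "m \<otimes>\<^bsub>F\<^esub> n \<in> K"
        using m Hm[of "(m, \<one>\<^bsub>F\<^esub>, 0)" "(n, \<one>\<^bsub>F\<^esub>, 0)"] k1 by (auto simp: K_def)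
    qed
    fix x h assume x: "x \<in> carrier F" and h: "h \<in> K"
    have "x \<otimes>\<^bsub>F\<^esub> h \<otimes>\<^bsub>F\<^esub> inv\<^bsub>F\<^esub> x \<in> ker_pi"
      using normal.inv_op_closed2[OF pi.normal_kernel x] h by (auto simp: K_def)
    moreover have "(x, x, 0) \<otimes>\<^bsub>fibre_group\<^esub> (h, \<one>\<^bsub>F\<^esub>, 0) \<otimes>\<^bsub>fibre_group\<^esub> (inv\<^bsub>F\<^esub> x, inv\<^bsub>F\<^esub> x, 0) \<in> H"
      using h x by (intro Hm diag) (auto simp: K_def)
    ultimately show "x \<otimes>\<^bsub>F\<^esub> h \<otimes>\<^bsub>F\<^esub> inv\<^bsub>F\<^esub> x \<in> K" using x by (simp add: K_def)
  qed
  moreover have "T \<subseteq> K" using T(2) by (auto simp: K_def X_def intro!: X)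
  ultimately have kerK: "ker_pi \<subseteq> K" by (rule T(3))
  have cp: "(\<one>\<^bsub>F\<^esub>, c [^]\<^bsub>F\<^esub> j, j) \<in> H" for j :: int
  proof -
    have "(\<lambda>k. (\<one>\<^bsub>F\<^esub>, c [^]\<^bsub>F\<^esub> k, k)) \<in> hom integer_group ambient"
      using c by (auto simp: hom_def F.int_pow_mult)
    from hom_int_pow[OF this, of 1 j]
    have "(\<one>\<^bsub>F\<^esub>, c, 1) [^]\<^bsub>ambient\<^esub> j = (\<one>\<^bsub>F\<^esub>, c [^]\<^bsub>F\<^esub> j, j)"
      using c group_ambient by (simp add: F.int_pow_1)
    moreover have "subgroup H ambient"
      using H A.incl_subgroup[OF subgroup_fibre] by (simp add: fibre_group_def)
    then have "(\<one>\<^bsub>F\<^esub>, c, 1) [^]\<^bsub>ambient\<^esub> j \<in> H"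
      by (rule A.subgroup_int_pow_closed) (simp add: X X_def)
    ultimately show ?thesis by simp
  qed
  have "fibre \<subseteq> H"
  proof
    fix p assume "p \<in> fibre"
    then obtain x y j where p: "p = (x, y, j)" "x \<in> carrier F" "y \<in> carrier F" "\<pi> y = \<pi> x \<otimes>\<^bsub>Q\<^esub> z [^]\<^bsub>Q\<^esub> j"
      by (auto simp: fibre_def)
    \<comment> \<open>This is the w for which (x, y, j) is the product of \<open>(x, x, 0)\<close>,
      \<open>(inv w, 1, 0)\<close>, \<open>(w, w, 0)\<close> and \<open>(1, c^j, j)\<close>.\<close>
    define w where "w = inv\<^bsub>F\<^esub> x \<otimes>\<^bsub>F\<^esub> y \<otimes>\<^bsub>F\<^esub> c [^]\<^bsub>F\<^esub> (- j)"
    have cj: "c [^]\<^bsub>F\<^esub> (- j) \<in> carrier F" "c [^]\<^bsub>F\<^esub> (- j) \<otimes>\<^bsub>F\<^esub> c [^]\<^bsub>F\<^esub> j = \<one>\<^bsub>F\<^esub>"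
      using c by (simp_all add: F.int_pow_mult[symmetric])
    have wF: "w \<in> carrier F" using p c by (simp add: w_def)
    have "\<pi> w = \<one>\<^bsub>Q\<^esub>"
      using p c z_closed by (simp add: w_def pi_int_pow Q.m_assoc[symmetric] Q.int_pow_mult[symmetric])
    then have w: "w \<in> ker_pi" "inv\<^bsub>F\<^esub> w \<in> ker_pi" using wF by (simp_all add: kernel_def)
    then have "(x, x, 0) \<otimes>\<^bsub>fibre_group\<^esub> ((inv\<^bsub>F\<^esub> w, \<one>\<^bsub>F\<^esub>, 0) \<otimes>\<^bsub>fibre_group\<^esub> (w, w, 0))
      \<otimes>\<^bsub>fibre_group\<^esub> (\<one>\<^bsub>F\<^esub>, c [^]\<^bsub>F\<^esub> j, j) \<in> H"
      using kerK wF p by (intro Hm diag cp) (auto simp: K_def)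
    moreover have "x \<otimes>\<^bsub>F\<^esub> w \<otimes>\<^bsub>F\<^esub> c [^]\<^bsub>F\<^esub> j = y"
      using p c cj by (simp add: w_def F.m_assoc) (simp add: F.m_assoc[symmetric])
    ultimately show "p \<in> H" using p wF c by (simp add: F.m_assoc)
  qed
  then have "H = carrier fibre_group" using HP by auto
  moreover have "finite X" using S(1) T(1) by (simp add: X_def)
  ultimately show ?thesis unfolding finitely_generated_def H_def using XP by blast
qed

text \<open>The product of K and the kernel is normal of finite index and contains the kernel, so it
  is all of F. In this form the absence of finite quotients is used from here on: lifts of elements
  of Q can be taken in any given K.\<close>

lemma ker_set_mult:
  assumes noq: "\<And>K. K \<in> finite_index_normal F \<Longrightarrow> ker_pi \<subseteq> K \<Longrightarrow> K = carrier F"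
    and K: "K \<in> finite_index_normal F" and g: "g \<in> carrier F"
  shows "\<exists>k \<in> K. \<pi> k = \<pi> g"
proof -
  note K' = finite_index_normalD[OF K]
  have "K <#>\<^bsub>F\<^esub> ker_pi \<in> finite_index_normal F"
  proof (rule F.finite_index_normal_mono[OF K F.normal_set_mult[OF K'(1) pi.normal_kernel]])
    show "K \<subseteq> K <#>\<^bsub>F\<^esub> ker_pi"
    proof
      fix k assume k: "k \<in> K"
      then have "k = k \<otimes>\<^bsub>F\<^esub> \<one>\<^bsub>F\<^esub>" using subgroup.mem_carrier[OF K'(2)] by simp
      moreover have "\<one>\<^bsub>F\<^esub> \<in> ker_pi" by (simp add: kernel_def)
      ultimately show "k \<in> K <#>\<^bsub>F\<^esub> ker_pi" using k unfolding set_mult_def by blast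
    qed
  qed
  moreover have "ker_pi \<subseteq> K <#>\<^bsub>F\<^esub> ker_pi"
  proof
    fix n assume n: "n \<in> ker_pi"
    then have "n = \<one>\<^bsub>F\<^esub> \<otimes>\<^bsub>F\<^esub> n" by (simp add: kernel_def)
    then show "n \<in> K <#>\<^bsub>F\<^esub> ker_pi"
      using n subgroup.one_closed[OF K'(2)] unfolding set_mult_def by blast
  qed
  ultimately have "K <#>\<^bsub>F\<^esub> ker_pi = carrier F" by (rule noq)
  then obtain k n where k: "k \<in> K" and n: "n \<in> ker_pi" and gk: "g = k \<otimes>\<^bsub>F\<^esub> n"
    using g unfolding set_mult_def by blast
  have "\<pi> g = \<pi> k"
    using ker_piD[OF n] subgroup.mem_carrier[OF K'(2) k] by (simp add: gk)
  then show ?thesis using k by (intro bexI[of _ k]) simp_all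
qed

text \<open>Let H be the product of K and the fibre group. Its part in the first factor is normal in
  F, since H contains the diagonal; it has finite index and contains the kernel, hence it is F. The
  fibre group itself already projects onto the last two coordinates, so H is everything.\<close>

lemma fibre_dense:
  assumes noq: "\<And>K. K \<in> finite_index_normal F \<Longrightarrow> ker_pi \<subseteq> K \<Longrightarrow> K = carrier F"
    and K: "K \<in> finite_index_normal ambient" and h: "h \<in> carrier ambient"
  shows "\<exists>p \<in> fibre. p \<in> K #>\<^bsub>ambient\<^esub> h"
proof -
  note K' = finite_index_normalD[OF K]
  obtain c where c: "c \<in> carrier F" "\<pi> c = z" using z_closed pi_surj by (metis imageE)
  define H where "H = K <#>\<^bsub>ambient\<^esub> fibre"
  have H: "subgroup H ambient" unfolding H_def by (rule A.mult_norm_subgroup[OF K'(1) subgroup_fibre])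
  have KH: "K \<subseteq> H"
  proof
    fix k assume k: "k \<in> K"
    then have "k = k \<otimes>\<^bsub>ambient\<^esub> \<one>\<^bsub>ambient\<^esub>"
      using A.r_one[OF subgroup.mem_carrier[OF K'(2) k]] by simp
    then show "k \<in> H" unfolding H_def set_mult_def using k subgroup.one_closed[OF subgroup_fibre] by blast
  qed
  have fH: "p \<in> H" if p: "p \<in> fibre" for p
  proof -
    have "p = \<one>\<^bsub>ambient\<^esub> \<otimes>\<^bsub>ambient\<^esub> p" using A.l_one[OF subgroup.mem_carrier[OF subgroup_fibre p]] by simp
    then show ?thesis unfolding H_def set_mult_def using p subgroup.one_closed[OF K'(2)] by blast
  qed
  define i where "i = (\<lambda>x :: 'f. (x, \<one>\<^bsub>F\<^esub>, 0 :: int))"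
  have i: "i \<in> hom F ambient" by (auto simp: hom_def i_def)
  define H1 where "H1 = {x \<in> carrier F. i x \<in> H}"
  have "H1 \<lhd> F"
  proof (rule F.normal_invI)
    show "subgroup H1 F"
    proof (rule F.subgroupI)
      show "H1 \<noteq> {}" using subgroup.one_closed[OF H] by (auto simp: H1_def i_def intro!: exI[of _ "\<one>\<^bsub>F\<^esub>"])
      fix m assume m: "m \<in> H1"
      then show "inv\<^bsub>F\<^esub> m \<in> H1" using subgroup.m_inv_closed[OF H, of "i m"] by (simp add: H1_def i_def)
      fix n assume "n \<in> H1"
      then show "m \<otimes>\<^bsub>F\<^esub> n \<in> H1" using m subgroup.m_closed[OF H, of "i m" "i n"] by (simp add: H1_def i_def)
    qed (auto simp: H1_def)
    fix x h assume x: "x \<in> carrier F" and h: "h \<in> H1"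
    have "(x, x, 0) \<otimes>\<^bsub>ambient\<^esub> i h \<otimes>\<^bsub>ambient\<^esub> (inv\<^bsub>F\<^esub> x, inv\<^bsub>F\<^esub> x, 0) \<in> H"
      using x h by (intro subgroup.m_closed[OF H] fH[OF fibre_diag]) (simp_all add: H1_def)
    then show "x \<otimes>\<^bsub>F\<^esub> h \<otimes>\<^bsub>F\<^esub> inv\<^bsub>F\<^esub> x \<in> H1" using x h by (simp add: H1_def i_def)
  qed
  then have "H1 \<in> finite_index_normal F"
  proof (rule F.finite_index_normal_mono[OF finite_index_normal_vimage[OF i F.is_group A.is_group K]])
    show "{g \<in> carrier F. i g \<in> K} \<subseteq> H1" using KH by (auto simp: H1_def)
  qed
  moreover have "ker_pi \<subseteq> H1"
  proof
    fix n assume n: "n \<in> ker_pi"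
    show "n \<in> H1" using fH[OF fibre_ker_left[OF n]] ker_piD(1)[OF n] by (simp add: H1_def i_def)
  qed
  ultimately have H1: "H1 = carrier F" by (rule noq)
  obtain x y m where hxy: "h = (x, y, m)" "x \<in> carrier F" "y \<in> carrier F" using h by (cases h) auto
  \<comment> \<open>This solves the equation of the fibre group for the first coordinate, the other
    two being given.\<close>
  define x' where "x' = y \<otimes>\<^bsub>F\<^esub> c [^]\<^bsub>F\<^esub> (- m)"
  have x': "x' \<in> carrier F" using hxy c by (simp add: x'_def)
  have "(x', y, m) \<in> fibre"
    using hxy c x' z_closed by (simp add: fibre_iff x'_def pi_int_pow Q.m_assoc Q.int_pow_mult[symmetric])
  then have "i (x \<otimes>\<^bsub>F\<^esub> inv\<^bsub>F\<^esub> x') \<otimes>\<^bsub>ambient\<^esub> (x', y, m) \<in> H"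
    using H1 hxy x' by (intro subgroup.m_closed[OF H _ fH]) (auto simp: H1_def)
  moreover have "i (x \<otimes>\<^bsub>F\<^esub> inv\<^bsub>F\<^esub> x') \<otimes>\<^bsub>ambient\<^esub> (x', y, m) = h"
    using hxy x' by (simp add: i_def F.m_assoc)
  ultimately have "h \<in> H" by simp
  then obtain k p where k: "k \<in> K" and p: "p \<in> fibre" and hk: "h = k \<otimes>\<^bsub>ambient\<^esub> p"
    unfolding H_def set_mult_def by blast
  have c: "k \<in> carrier ambient" "p \<in> carrier ambient"
    using subgroup.mem_carrier[OF K'(2) k] subgroup.mem_carrier[OF subgroup_fibre p] by simp_all
  have "inv\<^bsub>ambient\<^esub> k \<otimes>\<^bsub>ambient\<^esub> h \<in> K #>\<^bsub>ambient\<^esub> h"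
    by (rule A.rcosI[OF subgroup.m_inv_closed[OF K'(2) k] subgroup.subset[OF K'(2)] h])
  moreover have "inv\<^bsub>ambient\<^esub> k \<otimes>\<^bsub>ambient\<^esub> h = p"
    unfolding hk A.m_assoc[OF A.inv_closed[OF c(1)] c, symmetric] A.l_inv[OF c(1)] by (rule A.l_one[OF c(2)])
  ultimately show ?thesis using p by auto
qed

text \<open>The two copies of the kernel meet L in subgroups that are cut out by some K1 and K2. It
  remains to exclude that L meets the fibre product of K1 and K2 over Q in a proper part: the
  elements of F over which it contains a pair form a normal subgroup of finite index that contains
  the kernel, so they are all of F. The integer coordinate is split off along a lift of z in
  K2.\<close>

lemma fibre_separated:
  assumes noq: "\<And>K. K \<in> finite_index_normal F \<Longrightarrow> ker_pi \<subseteq> K \<Longrightarrow> K = carrier F"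
    and split: "\<And>L. L \<lhd> F \<Longrightarrow> L \<subseteq> ker_pi \<Longrightarrow> finite ((\<lambda>n. L #>\<^bsub>F\<^esub> n) ` ker_pi)
      \<Longrightarrow> \<exists>K \<in> finite_index_normal F. K \<inter> ker_pi = L"
    and L: "L \<in> finite_index_normal fibre_group"
  shows "\<exists>K \<in> finite_index_normal ambient. \<forall>p \<in> fibre. p \<in> K \<longrightarrow> p \<in> L"
proof -
  note L' = finite_index_normalD[OF L]
  note Lm = subgroup.m_closed[OF L'(2)] and Li = subgroup.m_inv_closed[OF L'(2)] and L1 = subgroup.one_closed[OF L'(2)]
  have Lf: "p \<in> fibre" if "p \<in> L" for p using subgroup.mem_carrier[OF L'(2) that] by simp
  have Lc: "q \<otimes>\<^bsub>fibre_group\<^esub> p \<otimes>\<^bsub>fibre_group\<^esub> inv\<^bsub>fibre_group\<^esub> q \<in> L" if "p \<in> L" "q \<in> fibre" for p q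
    using normal.inv_op_closed2[OF L'(1) _ that(1), of q] that(2) by simp
  have ker: "subgroup ker_pi F" by (rule normal_imp_subgroup[OF pi.normal_kernel])
  \<comment> \<open>Stated for an embedding i of the kernel, so that it serves for both factors; the
    last condition says that conjugation in F becomes conjugation by diagonal elements.\<close>
  have part: "\<exists>K \<in> finite_index_normal F. K \<inter> ker_pi = {n \<in> ker_pi. i n \<in> L}"
    if i: "\<And>n. n \<in> ker_pi \<Longrightarrow> i n \<in> fibre"
      "\<And>m n. m \<in> ker_pi \<Longrightarrow> n \<in> ker_pi \<Longrightarrow> i (m \<otimes>\<^bsub>F\<^esub> n) = i m \<otimes>\<^bsub>fibre_group\<^esub> i n"
      "\<And>n. n \<in> ker_pi \<Longrightarrow> i (inv\<^bsub>F\<^esub> n) = inv\<^bsub>fibre_group\<^esub> i n"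
      "i \<one>\<^bsub>F\<^esub> = \<one>\<^bsub>fibre_group\<^esub>"
      "\<And>g n. g \<in> carrier F \<Longrightarrow> n \<in> ker_pi \<Longrightarrow>
        i (g \<otimes>\<^bsub>F\<^esub> n \<otimes>\<^bsub>F\<^esub> inv\<^bsub>F\<^esub> g) = (g, g, 0) \<otimes>\<^bsub>fibre_group\<^esub> i n \<otimes>\<^bsub>fibre_group\<^esub> inv\<^bsub>fibre_group\<^esub> (g, g, 0)"
    for i
  proof -
    let ?L = "{n \<in> ker_pi. i n \<in> L}"
    have Ls: "subgroup ?L F"
    proof (rule F.subgroupI)
      show "?L \<subseteq> carrier F" using ker_piD(1) by blast
      show "?L \<noteq> {}" using subgroup.one_closed[OF ker] L1 i(4) by auto
      fix m assume m: "m \<in> ?L"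
      then show "inv\<^bsub>F\<^esub> m \<in> ?L" using subgroup.m_inv_closed[OF ker, of m] Li[of "i m"] i(3)[of m] by simp
      fix n assume "n \<in> ?L"
      then show "m \<otimes>\<^bsub>F\<^esub> n \<in> ?L"
        using m subgroup.m_closed[OF ker, of m n] Lm[of "i m" "i n"] i(2)[of m n] by simp
    qed
    show ?thesis
    proof -
      have "?L \<lhd> F"
      proof (rule F.normal_invI[OF Ls])
        fix x h assume x: "x \<in> carrier F" and h: "h \<in> ?L"
        then have h': "h \<in> ker_pi" "i h \<in> L" by simp_all
        have "x \<otimes>\<^bsub>F\<^esub> h \<otimes>\<^bsub>F\<^esub> inv\<^bsub>F\<^esub> x \<in> ker_pi" by (rule normal.inv_op_closed2[OF pi.normal_kernel x h'(1)])
        moreover have "i (x \<otimes>\<^bsub>F\<^esub> h \<otimes>\<^bsub>F\<^esub> inv\<^bsub>F\<^esub> x) \<in> L"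
          unfolding i(5)[OF x h'(1)] by (rule Lc[OF h'(2) fibre_diag[OF x]])
        ultimately show "x \<otimes>\<^bsub>F\<^esub> h \<otimes>\<^bsub>F\<^esub> inv\<^bsub>F\<^esub> x \<in> ?L" by simp
      qed
      moreover have "finite ((\<lambda>n. ?L #>\<^bsub>F\<^esub> n) ` ker_pi)"
      proof -
        have "finite ((\<lambda>n. L #>\<^bsub>fibre_group\<^esub> i n) ` ker_pi)"
          by (rule finite_subset[OF _ L'(3)]) (use i(1) in auto)
        moreover have "?L #>\<^bsub>F\<^esub> m = ?L #>\<^bsub>F\<^esub> n"
          if mn: "m \<in> ker_pi" "n \<in> ker_pi" and eq: "L #>\<^bsub>fibre_group\<^esub> i m = L #>\<^bsub>fibre_group\<^esub> i n" for m n
        proof -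
          have "i m \<otimes>\<^bsub>fibre_group\<^esub> inv\<^bsub>fibre_group\<^esub> i n \<in> L"
            using eq P.r_coset_eq_iff[OF L'(2), of "i m" "i n"] i(1)[OF mn(1)] i(1)[OF mn(2)] by simp
          then have "i (m \<otimes>\<^bsub>F\<^esub> inv\<^bsub>F\<^esub> n) \<in> L"
            using i(2)[OF mn(1) subgroup.m_inv_closed[OF ker mn(2)]] i(3)[OF mn(2)] by simp
          then have "m \<otimes>\<^bsub>F\<^esub> inv\<^bsub>F\<^esub> n \<in> ?L"
            using subgroup.m_closed[OF ker mn(1) subgroup.m_inv_closed[OF ker mn(2)]] by simp
          then show ?thesis
            using F.r_coset_eq_iff[OF Ls ker_piD(1)[OF mn(1)] ker_piD(1)[OF mn(2)]] by blast
        qed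
        ultimately show ?thesis by (rule finite_image_factor)
      qed
      moreover have "?L \<subseteq> ker_pi" by (rule Collect_restrict)
      ultimately show ?thesis by (intro split)
    qed
  qed
  have "\<exists>K \<in> finite_index_normal F. K \<inter> ker_pi = {n \<in> ker_pi. (n, \<one>\<^bsub>F\<^esub>, 0) \<in> L}"
    by (rule part) (simp_all add: fibre_ker_left fibre_diag kernel_def)
  then obtain K1 where K1: "K1 \<in> finite_index_normal F" "K1 \<inter> ker_pi = {n \<in> ker_pi. (n, \<one>\<^bsub>F\<^esub>, 0) \<in> L}" by blast
  have "\<exists>K \<in> finite_index_normal F. K \<inter> ker_pi = {n \<in> ker_pi. (\<one>\<^bsub>F\<^esub>, n, 0) \<in> L}"
    by (rule part) (simp_all add: fibre_ker_right fibre_diag kernel_def)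
  then obtain K2 where K2: "K2 \<in> finite_index_normal F" "K2 \<inter> ker_pi = {n \<in> ker_pi. (\<one>\<^bsub>F\<^esub>, n, 0) \<in> L}" by blast
  note K1' = finite_index_normalD[OF K1(1)] and K2' = finite_index_normalD[OF K2(1)]
  have KF: "k \<in> K1 \<Longrightarrow> k \<in> carrier F" "k \<in> K2 \<Longrightarrow> k \<in> carrier F" for k
    using subgroup.mem_carrier[OF K1'(2)] subgroup.mem_carrier[OF K2'(2)] by auto
  \<comment> \<open>Two pairs over the same element of Q, with entries in K1 and K2, differ by
    elements of \<open>K1 \<inter> ker_pi\<close> and \<open>K2 \<inter> ker_pi\<close>, and these
    belong to L in their factors. So a single pair in L over x forces all pairs over x into L; this
    is the argument for \<open>P0\<close> below.\<close>
  define D where "D = {x \<in> carrier F. \<exists>u \<in> K1. \<exists>v \<in> K2. \<pi> u = \<pi> x \<and> \<pi> v = \<pi> x \<and> (u, v, 0) \<in> L}"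
  have "D \<lhd> F"
  proof (rule F.normal_invI)
    show "subgroup D F"
    proof (rule F.subgroupI)
      show "D \<noteq> {}"
        using L1 subgroup.one_closed[OF K1'(2)] subgroup.one_closed[OF K2'(2)] by (auto simp: D_def intro!: exI[of _ "\<one>\<^bsub>F\<^esub>"])
      fix m assume "m \<in> D"
      then obtain u v where m: "m \<in> carrier F" "u \<in> K1" "v \<in> K2" "\<pi> u = \<pi> m" "\<pi> v = \<pi> m" "(u, v, 0) \<in> L"
        by (auto simp: D_def)
      then have "(inv\<^bsub>F\<^esub> u, inv\<^bsub>F\<^esub> v, 0) \<in> L" using Li[of "(u, v, 0)"] Lf by simp
      then show "inv\<^bsub>F\<^esub> m \<in> D"
        unfolding D_def using m subgroup.m_inv_closed[OF K1'(2), of u] subgroup.m_inv_closed[OF K2'(2), of v] KF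
        by (intro CollectI conjI bexI[of _ "inv\<^bsub>F\<^esub> u"] bexI[of _ "inv\<^bsub>F\<^esub> v"]) simp_all
      fix n assume "n \<in> D"
      then obtain u' v' where n: "n \<in> carrier F" "u' \<in> K1" "v' \<in> K2" "\<pi> u' = \<pi> n" "\<pi> v' = \<pi> n" "(u', v', 0) \<in> L"
        by (auto simp: D_def)
      have "(u \<otimes>\<^bsub>F\<^esub> u', v \<otimes>\<^bsub>F\<^esub> v', 0) \<in> L" using Lm[OF m(6) n(6)] by simp
      then show "m \<otimes>\<^bsub>F\<^esub> n \<in> D"
        unfolding D_def using m n subgroup.m_closed[OF K1'(2), of u u'] subgroup.m_closed[OF K2'(2), of v v'] KF
        by (intro CollectI conjI bexI[of _ "u \<otimes>\<^bsub>F\<^esub> u'"] bexI[of _ "v \<otimes>\<^bsub>F\<^esub> v'"]) simp_all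
    qed (auto simp: D_def)
    fix g m assume g: "g \<in> carrier F" and "m \<in> D"
    then obtain u v where m: "m \<in> carrier F" "u \<in> K1" "v \<in> K2" "\<pi> u = \<pi> m" "\<pi> v = \<pi> m" "(u, v, 0) \<in> L"
      by (auto simp: D_def)
    have "(g \<otimes>\<^bsub>F\<^esub> u \<otimes>\<^bsub>F\<^esub> inv\<^bsub>F\<^esub> g, g \<otimes>\<^bsub>F\<^esub> v \<otimes>\<^bsub>F\<^esub> inv\<^bsub>F\<^esub> g, 0) \<in> L"
      using Lc[OF m(6) fibre_diag[OF g]] fibre_diag[OF g] by simp
    then show "g \<otimes>\<^bsub>F\<^esub> m \<otimes>\<^bsub>F\<^esub> inv\<^bsub>F\<^esub> g \<in> D"
      unfolding D_def using m g normal.inv_op_closed2[OF K1'(1) g m(2)] normal.inv_op_closed2[OF K2'(1) g m(3)] KF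
      by (intro CollectI conjI bexI[of _ "g \<otimes>\<^bsub>F\<^esub> u \<otimes>\<^bsub>F\<^esub> inv\<^bsub>F\<^esub> g"] bexI[of _ "g \<otimes>\<^bsub>F\<^esub> v \<otimes>\<^bsub>F\<^esub> inv\<^bsub>F\<^esub> g"]) simp_all
  qed
  moreover have "\<exists>u v. u \<in> K1 \<and> v \<in> K2 \<and> \<pi> u = \<pi> x \<and> \<pi> v = \<pi> x" if "x \<in> carrier F" for x
    using ker_set_mult[OF noq K1(1) that] ker_set_mult[OF noq K2(1) that] by blast
  then obtain u v where uv: "\<And>x. x \<in> carrier F \<Longrightarrow> u x \<in> K1 \<and> v x \<in> K2 \<and> \<pi> (u x) = \<pi> x \<and> \<pi> (v x) = \<pi> x"
    by metis
  have uvf: "(u x, v x, 0) \<in> fibre" if "x \<in> carrier F" for x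
    using uv[OF that] KF that by (simp add: fibre_iff)
  have "D \<in> finite_index_normal F"
  proof (rule finite_index_normalI[where f = "\<lambda>x. L #>\<^bsub>fibre_group\<^esub> (u x, v x, 0)"])
    show "D \<lhd> F" by fact
    show "finite ((\<lambda>x. L #>\<^bsub>fibre_group\<^esub> (u x, v x, 0)) ` carrier F)"
      by (rule finite_subset[OF _ L'(3)]) (use uvf in auto)
    fix g h assume g: "g \<in> carrier F" and h: "h \<in> carrier F"
      and "L #>\<^bsub>fibre_group\<^esub> (u g, v g, 0) = L #>\<^bsub>fibre_group\<^esub> (u h, v h, 0)"
    then have "(u g \<otimes>\<^bsub>F\<^esub> inv\<^bsub>F\<^esub> u h, v g \<otimes>\<^bsub>F\<^esub> inv\<^bsub>F\<^esub> v h, 0) \<in> L"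
      using P.r_coset_eq_iff[OF L'(2), of "(u g, v g, 0)" "(u h, v h, 0)"] uvf by simp
    then show "g \<otimes>\<^bsub>F\<^esub> inv\<^bsub>F\<^esub> h \<in> D"
      unfolding D_def using g h uv[OF g] uv[OF h] KF
        subgroup.m_closed[OF K1'(2) _ subgroup.m_inv_closed[OF K1'(2)], of "u g" "u h"]
        subgroup.m_closed[OF K2'(2) _ subgroup.m_inv_closed[OF K2'(2)], of "v g" "v h"]
      by (intro CollectI conjI bexI[of _ "u g \<otimes>\<^bsub>F\<^esub> inv\<^bsub>F\<^esub> u h"] bexI[of _ "v g \<otimes>\<^bsub>F\<^esub> inv\<^bsub>F\<^esub> v h"]) simp_all
  qed
  moreover have "ker_pi \<subseteq> D"
  proof
    fix n assume "n \<in> ker_pi"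
    then show "n \<in> D"
      using L1 subgroup.one_closed[OF K1'(2)] subgroup.one_closed[OF K2'(2)]
      unfolding D_def by (intro CollectI conjI bexI[of _ "\<one>\<^bsub>F\<^esub>"]) (simp_all add: kernel_def)
  qed
  ultimately have D: "D = carrier F" by (intro noq)
  have P0: "(x, y, 0) \<in> L" if x: "x \<in> K1" and y: "y \<in> K2" and xy: "\<pi> x = \<pi> y" for x y
  proof -
    have xyF: "x \<in> carrier F" "y \<in> carrier F" using KF x y by auto
    have "x \<in> D" using D xyF by simp
    then obtain u v where uv: "u \<in> K1" "v \<in> K2" "\<pi> u = \<pi> x" "\<pi> v = \<pi> x" "(u, v, 0) \<in> L" by (auto simp: D_def)
    have uvF: "u \<in> carrier F" "v \<in> carrier F" using KF uv by auto
    have "inv\<^bsub>F\<^esub> u \<otimes>\<^bsub>F\<^esub> x \<in> K1 \<inter> ker_pi"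
      using subgroup.m_closed[OF K1'(2) subgroup.m_inv_closed[OF K1'(2) uv(1)] x] uv xyF uvF by (simp add: kernel_def)
    then have 1: "(inv\<^bsub>F\<^esub> u \<otimes>\<^bsub>F\<^esub> x, \<one>\<^bsub>F\<^esub>, 0) \<in> L" unfolding K1(2) by simp
    have "inv\<^bsub>F\<^esub> v \<otimes>\<^bsub>F\<^esub> y \<in> K2 \<inter> ker_pi"
      using subgroup.m_closed[OF K2'(2) subgroup.m_inv_closed[OF K2'(2) uv(2)] y] uv xyF uvF xy by (simp add: kernel_def)
    then have 2: "(\<one>\<^bsub>F\<^esub>, inv\<^bsub>F\<^esub> v \<otimes>\<^bsub>F\<^esub> y, 0) \<in> L" unfolding K2(2) by simp
    have "(u, v, 0) \<otimes>\<^bsub>fibre_group\<^esub> (inv\<^bsub>F\<^esub> u \<otimes>\<^bsub>F\<^esub> x, \<one>\<^bsub>F\<^esub>, 0) \<otimes>\<^bsub>fibre_group\<^esub> (\<one>\<^bsub>F\<^esub>, inv\<^bsub>F\<^esub> v \<otimes>\<^bsub>F\<^esub> y, 0) \<in> L"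
      by (intro Lm uv 1 2)
    then show ?thesis using xyF uvF by (simp add: F.m_assoc[symmetric])
  qed
  obtain c where c: "c \<in> carrier F" "\<pi> c = z" using z_closed pi_surj by (metis imageE)
  \<comment> \<open>With a lift of z inside K2, the correction of y by powers of k stays in
    K2.\<close>
  obtain k where k: "k \<in> K2" "\<pi> k = z" using ker_set_mult[OF noq K2(1) c(1)] c(2) by auto
  have kF: "k \<in> carrier F" using KF k by simp
  define e where "e = (\<lambda>j :: int. (\<one>\<^bsub>F\<^esub>, k [^]\<^bsub>F\<^esub> j, j))"
  have ef: "e j \<in> fibre" for j using kF k by (simp add: e_def fibre_iff pi_int_pow)
  have e: "e \<in> hom integer_group fibre_group"
    using ef kF by (auto simp: hom_def) (simp add: e_def F.int_pow_mult)
  define J where "J = {j \<in> carrier integer_group. e j \<in> L}"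
  have J: "J \<in> finite_index_normal integer_group"
    unfolding J_def by (rule finite_index_normal_vimage[OF e group_integer_group P.is_group L])
  have p1: "(\<lambda>p. fst p) \<in> hom ambient F" and p2: "(\<lambda>p. fst (snd p)) \<in> hom ambient F"
    and p3: "(\<lambda>p. snd (snd p)) \<in> hom ambient integer_group"
    by (auto simp: hom_def ambient_def)
  define K where "K = {p \<in> carrier ambient. fst p \<in> K1} \<inter> ({p \<in> carrier ambient. fst (snd p) \<in> K2} \<inter>
    {p \<in> carrier ambient. snd (snd p) \<in> J})"
  have "K \<in> finite_index_normal ambient"
    unfolding K_def by (intro finite_index_normal_Int A.is_group
      finite_index_normal_vimage[OF p1 A.is_group F.is_group K1(1)]
      finite_index_normal_vimage[OF p2 A.is_group F.is_group K2(1)]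
      finite_index_normal_vimage[OF p3 A.is_group group_integer_group J])
  moreover have "p \<in> L" if p: "p \<in> fibre" and pK: "p \<in> K" for p
  proof -
    obtain x y j where xyj: "p = (x, y, j)" by (cases p)
    have xy: "x \<in> K1" "y \<in> K2" "e j \<in> L" "\<pi> y = \<pi> x \<otimes>\<^bsub>Q\<^esub> z [^]\<^bsub>Q\<^esub> j"
      using p pK by (simp_all add: xyj K_def J_def fibre_iff)
    have xyF: "x \<in> carrier F" "y \<in> carrier F" using KF xy by auto
    have kj: "k [^]\<^bsub>F\<^esub> (- j) \<in> K2" by (rule F.subgroup_int_pow_closed[OF K2'(2) k(1)])
    have "(x, y \<otimes>\<^bsub>F\<^esub> k [^]\<^bsub>F\<^esub> (- j), 0) \<in> L"
    proof (rule P0[OF xy(1) subgroup.m_closed[OF K2'(2) xy(2) kj]])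
      show "\<pi> x = \<pi> (y \<otimes>\<^bsub>F\<^esub> k [^]\<^bsub>F\<^esub> (- j))"
        using xyF kF k xy(4) z_closed by (simp add: pi_int_pow Q.m_assoc Q.int_pow_mult[symmetric])
    qed
    then have "(x, y \<otimes>\<^bsub>F\<^esub> k [^]\<^bsub>F\<^esub> (- j), 0) \<otimes>\<^bsub>fibre_group\<^esub> e j \<in> L" by (rule Lm[OF _ xy(3)])
    then show ?thesis using xyF kF by (simp add: xyj e_def F.m_assoc F.int_pow_mult[symmetric])
  qed
  ultimately show ?thesis by blast
qed

lemma isomorphic_profinite_completions_fibre_group:
  assumes noq: "\<And>K. K \<in> finite_index_normal F \<Longrightarrow> ker_pi \<subseteq> K \<Longrightarrow> K = carrier F"
    and split: "\<And>L. L \<lhd> F \<Longrightarrow> L \<subseteq> ker_pi \<Longrightarrow> finite ((\<lambda>n. L #>\<^bsub>F\<^esub> n) ` ker_pi)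
      \<Longrightarrow> \<exists>K \<in> finite_index_normal F. K \<inter> ker_pi = L"
  shows "isomorphic_profinite_completions fibre_group ambient"
proof (rule isomorphic_profinite_completionsI[OF P.is_group A.is_group incl_hom])
  show "\<exists>p \<in> carrier fibre_group. p \<in> K #>\<^bsub>ambient\<^esub> h"
    if "K \<in> finite_index_normal ambient" "h \<in> carrier ambient" for K h
    using fibre_dense[OF noq that] by simp
  show "\<exists>K \<in> finite_index_normal ambient. \<forall>p \<in> carrier fibre_group. p \<in> K \<longrightarrow> p \<in> L"
    if "L \<in> finite_index_normal fibre_group" for L
    using fibre_separated[OF noq split that] by simp
qed

end

section \<open>Groups without finite quotients\<close>

definition comm :: "('g, 'b) monoid_scheme \<Rightarrow> 'g \<Rightarrow> 'g \<Rightarrow> 'g"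
  where "comm G g h = g \<otimes>\<^bsub>G\<^esub> h \<otimes>\<^bsub>G\<^esub> inv\<^bsub>G\<^esub> g \<otimes>\<^bsub>G\<^esub> inv\<^bsub>G\<^esub> h"

context group
begin

lemma comm_closed [simp]: "g \<in> carrier G \<Longrightarrow> h \<in> carrier G \<Longrightarrow> comm G g h \<in> carrier G"
  by (simp add: comm_def)

lemma cancel_left:
  assumes "g \<in> carrier G" "h \<in> carrier G"
  shows "inv g \<otimes> (g \<otimes> h) = h" "g \<otimes> (inv g \<otimes> h) = h"
  using assms by (simp_all add: m_assoc[symmetric])

lemma comm_eq:
  assumes "g \<in> carrier G" "h \<in> carrier G"
  shows "comm G g h = (g \<otimes> h) \<otimes> inv (h \<otimes> g)"
  using assms by (simp add: comm_def inv_mult_group m_assoc)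

lemma mult_inv_eq_one_iff:
  assumes "g \<in> carrier G" "h \<in> carrier G" shows "g \<otimes> inv h = \<one> \<longleftrightarrow> g = h"
proof
  assume "g \<otimes> inv h = \<one>"
  then have "g \<otimes> inv h \<otimes> h = h" using assms by simp
  then show "g = h" using assms by (simp add: m_assoc)
qed (use assms in simp)

lemma comm_eq_one_iff:
  assumes "g \<in> carrier G" "h \<in> carrier G"
  shows "comm G g h = \<one> \<longleftrightarrow> g \<otimes> h = h \<otimes> g"
  using assms by (simp add: comm_eq mult_inv_eq_one_iff)

lemma subgroup_comm_closed:
  assumes "subgroup K G" "g \<in> K" "h \<in> K" shows "comm G g h \<in> K"
  using assms by (simp add: comm_def subgroup.m_closed subgroup.m_inv_closed)

lemma subgroup_cancel:
  assumes "subgroup K G" "g \<in> carrier G" "h \<in> K" "inv g \<otimes> h \<in> K"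
  shows "g \<in> K"
proof -
  have "h \<otimes> inv (inv g \<otimes> h) \<in> K" by (intro subgroup.m_closed subgroup.m_inv_closed assms)
  then show ?thesis
    using assms(2) subgroup.mem_carrier[OF assms(1,3)] by (simp add: inv_mult_group cancel_left)
qed

lemma normal_comm_closed:
  assumes "K \<lhd> G" "g \<in> K" "h \<in> carrier G" shows "comm G g h \<in> K" "comm G h g \<in> K"
proof -
  note K = normal_imp_subgroup[OF assms(1)]
  have g: "g \<in> carrier G" by (rule subgroup.mem_carrier[OF K assms(2)])
  have "comm G g h = g \<otimes> (h \<otimes> inv g \<otimes> inv h)" using g assms(3) by (simp add: comm_def m_assoc)
  then show "comm G g h \<in> K"
    using normal.inv_op_closed2[OF assms(1,3) subgroup.m_inv_closed[OF K assms(2)]]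
    by (simp add: subgroup.m_closed[OF K assms(2)])
  show "comm G h g \<in> K"
    unfolding comm_def
    by (intro subgroup.m_closed[OF K normal.inv_op_closed2[OF assms(1,3,2)] subgroup.m_inv_closed[OF K assms(2)]])
qed

lemma commutes_mult:
  assumes "x \<in> carrier G" "y \<in> carrier G" "w \<in> carrier G"
    and "x \<otimes> w = w \<otimes> x" "y \<otimes> w = w \<otimes> y"
  shows "(x \<otimes> y) \<otimes> w = w \<otimes> (x \<otimes> y)"
proof -
  have "(x \<otimes> y) \<otimes> w = x \<otimes> (w \<otimes> y)" using assms by (simp add: m_assoc)
  also have "\<dots> = w \<otimes> (x \<otimes> y)" using assms by (simp add: m_assoc[symmetric])
  finally show ?thesis .
qed

lemma commutes_inv:
  assumes "x \<in> carrier G" "w \<in> carrier G" "x \<otimes> w = w \<otimes> x"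
  shows "inv x \<otimes> w = w \<otimes> inv x"
proof -
  have "inv x \<otimes> w = inv x \<otimes> (w \<otimes> x) \<otimes> inv x" using assms(1,2) by (simp add: m_assoc)
  also have "\<dots> = w \<otimes> inv x" using assms(1,2) by (simp add: assms(3)[symmetric] cancel_left)
  finally show ?thesis .
qed

text \<open>Commutators of lifts do not depend on the lifts when the ambiguities u and v are central
  enough. This is how relations between letters carry over to their lifts in
  \<open>finite_extension_splits\<close>.\<close>

lemma comm_mult_central:
  assumes c: "x \<in> carrier G" "y \<in> carrier G" "u \<in> carrier G" "v \<in> carrier G"
    and uv: "u \<otimes> y = y \<otimes> u" "v \<otimes> x = x \<otimes> v" "u \<otimes> v = v \<otimes> u"
  shows "comm G (x \<otimes> u) (y \<otimes> v) = comm G x y"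
proof -
  have "(x \<otimes> u) \<otimes> (y \<otimes> v) = x \<otimes> (u \<otimes> y) \<otimes> v" using c by (simp add: m_assoc)
  then have 1: "(x \<otimes> u) \<otimes> (y \<otimes> v) = (x \<otimes> y) \<otimes> (u \<otimes> v)" using c by (simp add: uv(1) m_assoc)
  have "(y \<otimes> v) \<otimes> (x \<otimes> u) = y \<otimes> (v \<otimes> x) \<otimes> u" using c by (simp add: m_assoc)
  then have 2: "(y \<otimes> v) \<otimes> (x \<otimes> u) = (y \<otimes> x) \<otimes> (u \<otimes> v)" using c by (simp add: uv(2,3) m_assoc)
  show ?thesis
    using c by (simp add: comm_eq 1 2 inv_mult_group m_assoc cancel_left)
qed

text \<open>The hypothesis covers the situation in which commutators with r are central; taking the
  commutator with r is then a homomorphism.\<close>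

lemma comm_mult_right:
  assumes "r \<in> carrier G" "x \<in> carrier G" "y \<in> carrier G"
    and "comm G r y \<otimes> x = x \<otimes> comm G r y"
  shows "comm G r (x \<otimes> y) = comm G r x \<otimes> comm G r y"
proof -
  have "comm G r (x \<otimes> y) = comm G r x \<otimes> (x \<otimes> comm G r y \<otimes> inv x)"
    using assms(1-3) by (simp add: comm_def inv_mult_group m_assoc cancel_left)
  also have "x \<otimes> comm G r y \<otimes> inv x = comm G r y"
    using assms(1-3) by (simp add: assms(4)[symmetric] m_assoc)
  finally show ?thesis .
qed

lemma quotient_hom:
  assumes "K \<lhd> G"
  obtains E :: "'a set monoid" and \<nu> where "group_hom G E \<nu>" "\<nu> ` carrier G = carrier E"
    "\<And>g. g \<in> carrier G \<Longrightarrow> \<nu> g = \<one>\<^bsub>E\<^esub> \<longleftrightarrow> g \<in> K"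
    "\<And>g h. g \<in> carrier G \<Longrightarrow> h \<in> carrier G \<Longrightarrow> \<nu> g = \<nu> h \<longleftrightarrow> g \<otimes> inv h \<in> K"
proof (rule that[of "G Mod K" "\<lambda>g. K #> g"])
  interpret normal K G by (rule assms)
  show "group_hom G (G Mod K) (\<lambda>g. K #> g)"
    by (simp add: group_hom_def group_hom_axioms_def is_group factorgroup_is_group r_coset_hom_Mod)
  show "(\<lambda>g. K #> g) ` carrier G = carrier (G Mod K)" by (simp add: carrier_FactGroup)
  show "K #> g = \<one>\<^bsub>G Mod K\<^esub> \<longleftrightarrow> g \<in> K" if "g \<in> carrier G" for g
    using coset_join1[OF _ that subgroup_axioms] coset_join2[OF that subgroup_axioms] subset by auto
  show "K #> g = K #> h \<longleftrightarrow> g \<otimes> inv h \<in> K" if "g \<in> carrier G" "h \<in> carrier G" for g h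
    by (rule r_coset_eq_iff[OF subgroup_axioms that])
qed

end

lemma (in group_hom) hom_comm:
  assumes "g \<in> carrier G" "k \<in> carrier G" shows "h (comm G g k) = comm H (h g) (h k)"
  using assms by (simp add: comm_def)

lemma (in group_hom) comm_kernel_iff:
  assumes "g \<in> carrier G" "k \<in> carrier G"
  shows "h (comm G g k) = \<one>\<^bsub>H\<^esub> \<longleftrightarrow> h g \<otimes>\<^bsub>H\<^esub> h k = h k \<otimes>\<^bsub>H\<^esub> h g"
  using assms by (simp add: hom_comm H.comm_eq_one_iff)

text \<open>The set is the preimage of the centre of the quotient by K.\<close>

lemma (in group) centralizing_normal:
  assumes K: "K \<lhd> G" shows "{g \<in> carrier G. \<forall>h \<in> carrier G. comm G g h \<in> K} \<lhd> G"
proof -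
  obtain E :: "'a set monoid" and \<nu> where \<nu>: "group_hom G E \<nu>"
    and \<nu>1: "\<And>g. g \<in> carrier G \<Longrightarrow> \<nu> g = \<one>\<^bsub>E\<^esub> \<longleftrightarrow> g \<in> K"
    using quotient_hom[OF K] by metis
  interpret n: group_hom G E \<nu> by (rule \<nu>)
  let ?Z = "{g \<in> carrier G. \<forall>h \<in> carrier G. comm G g h \<in> K}"
  have comm_K: "comm G g h \<in> K \<longleftrightarrow> \<nu> g \<otimes>\<^bsub>E\<^esub> \<nu> h = \<nu> h \<otimes>\<^bsub>E\<^esub> \<nu> g" if "g \<in> carrier G" "h \<in> carrier G" for g h
    using \<nu>1[OF comm_closed[OF that]] n.comm_kernel_iff[OF that] by simp
  have Z: "g \<in> ?Z \<longleftrightarrow> g \<in> carrier G \<and> (\<forall>h \<in> carrier G. \<nu> g \<otimes>\<^bsub>E\<^esub> \<nu> h = \<nu> h \<otimes>\<^bsub>E\<^esub> \<nu> g)" for g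
    by (simp add: comm_K cong: conj_cong)
  show ?thesis
  proof (rule normal_invI)
    show "subgroup ?Z G"
    proof (rule subgroupI)
      show "?Z \<noteq> {}" using Z[of \<one>] by auto
      show "inv g \<in> ?Z" if "g \<in> ?Z" for g
        using that unfolding Z by (simp add: n.H.commutes_inv)
      show "g \<otimes> g' \<in> ?Z" if g: "g \<in> ?Z" and g': "g' \<in> ?Z" for g g'
        unfolding Z
      proof (intro conjI ballI)
        fix h assume h: "h \<in> carrier G"
        have c: "\<nu> g \<in> carrier E" "\<nu> g' \<in> carrier E" "\<nu> h \<in> carrier E" using g g' h by auto
        have "\<nu> g \<otimes>\<^bsub>E\<^esub> \<nu> h = \<nu> h \<otimes>\<^bsub>E\<^esub> \<nu> g" "\<nu> g' \<otimes>\<^bsub>E\<^esub> \<nu> h = \<nu> h \<otimes>\<^bsub>E\<^esub> \<nu> g'"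
          using g g' h unfolding Z by blast+
        then show "\<nu> (g \<otimes> g') \<otimes>\<^bsub>E\<^esub> \<nu> h = \<nu> h \<otimes>\<^bsub>E\<^esub> \<nu> (g \<otimes> g')"
          using n.H.commutes_mult[OF c] g g' by simp
      qed (use g g' in simp)
    qed auto
    fix x g assume x: "x \<in> carrier G" and g: "g \<in> ?Z"
    then have "\<nu> x \<otimes>\<^bsub>E\<^esub> \<nu> g = \<nu> g \<otimes>\<^bsub>E\<^esub> \<nu> x" using Z[of g] by metis
    then have "\<nu> x \<otimes>\<^bsub>E\<^esub> \<nu> g \<otimes>\<^bsub>E\<^esub> inv\<^bsub>E\<^esub> \<nu> x = \<nu> g"
      using x g by (simp add: n.H.m_assoc)
    then show "x \<otimes> g \<otimes> inv x \<in> ?Z"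
      using g x unfolding Z by simp
  qed
qed

text \<open>The set is the preimage of the centralizer of the image of r in the quotient by
  K.\<close>

lemma (in group) commuting_subgroup:
  assumes K: "K \<lhd> G" and r: "r \<in> carrier G" shows "subgroup {h \<in> carrier G. comm G r h \<in> K} G"
proof -
  obtain E :: "'a set monoid" and \<nu> where \<nu>: "group_hom G E \<nu>"
    and \<nu>1: "\<And>g. g \<in> carrier G \<Longrightarrow> \<nu> g = \<one>\<^bsub>E\<^esub> \<longleftrightarrow> g \<in> K"
    using quotient_hom[OF K] by metis
  interpret n: group_hom G E \<nu> by (rule \<nu>)
  let ?Z = "{h \<in> carrier G. comm G r h \<in> K}"
  have comm_K: "comm G r h \<in> K \<longleftrightarrow> \<nu> h \<otimes>\<^bsub>E\<^esub> \<nu> r = \<nu> r \<otimes>\<^bsub>E\<^esub> \<nu> h" if "h \<in> carrier G" for h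
    using \<nu>1[OF comm_closed[OF r that]] n.comm_kernel_iff[OF r that] by (simp add: eq_commute)
  have Z: "h \<in> ?Z \<longleftrightarrow> h \<in> carrier G \<and> \<nu> h \<otimes>\<^bsub>E\<^esub> \<nu> r = \<nu> r \<otimes>\<^bsub>E\<^esub> \<nu> h" for h
    by (simp add: comm_K cong: conj_cong)
  show ?thesis
  proof (rule subgroupI)
    show "?Z \<noteq> {}" using Z[of \<one>] r by auto
    show "inv g \<in> ?Z" if "g \<in> ?Z" for g
      using that r unfolding Z by (simp add: n.H.commutes_inv)
    show "g \<otimes> g' \<in> ?Z" if "g \<in> ?Z" "g' \<in> ?Z" for g g'
      using that r unfolding Z by (simp add: n.H.commutes_mult)
  qed auto
qed

lemma normal_Inter:
  assumes "Group.group G" "\<And>K. K \<in> A \<Longrightarrow> K \<lhd> G" "A \<noteq> {}"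
  shows "\<Inter> A \<lhd> G"
proof -
  interpret Group.group G by fact
  have "subgroup (\<Inter> A) G"
    by (rule subgroups_Inter) (use assms normal_imp_subgroup in auto)
  then show ?thesis
  proof (rule normal_invI)
    fix x h assume x: "x \<in> carrier G" and h: "h \<in> \<Inter> A"
    show "x \<otimes>\<^bsub>G\<^esub> h \<otimes>\<^bsub>G\<^esub> inv\<^bsub>G\<^esub> x \<in> \<Inter> A"
    proof
      fix K assume "K \<in> A"
      then show "x \<otimes>\<^bsub>G\<^esub> h \<otimes>\<^bsub>G\<^esub> inv\<^bsub>G\<^esub> x \<in> K"
        using normal.inv_op_closed2[OF assms(2) x] h by blast
    qed
  qed
qed

section \<open>Presentations with central words\<close>

lemma free_hom_unique:
  assumes H: "Group.group H" and f: "f \<in> hom free_group H" and g: "g \<in> hom free_group H"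
    and eq: "\<And>a. f (letter a) = g (letter a)" and w: "w \<in> carrier free_group"
  shows "f w = g w"
proof -
  interpret f: group_hom free_group H f
    using f group_free_group H by (simp add: group_hom_def group_hom_axioms_def)
  interpret g: group_hom free_group H g
    using g group_free_group H by (simp add: group_hom_def group_hom_axioms_def)
  let ?K = "{w \<in> carrier free_group. f w = g w}"
  have "subgroup ?K free_group"
  proof (rule free_group.subgroupI)
    show "?K \<noteq> {}" using f.hom_one g.hom_one by (metis (mono_tags, lifting) empty_iff free_group.one_closed mem_Collect_eq)
  qed (auto simp del: free_group_simps)
  then have "?K = carrier free_group"
    by (rule free_group_subgroup_eq) (use eq in auto)
  then show ?thesis using w by blast
qed

text \<open>The assumption \<open>trivial\<close> concerns the group in which the words of R are
  killed. The group presented below is a central extension of it, in which they are only made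
  central.\<close>

locale perfect_presentation =
  fixes p q :: "'a \<Rightarrow> 'a" and R :: "('a \<times> bool) list set" and c :: "('a \<times> bool) list"
  assumes R_closed: "R \<subseteq> carrier free_group" and c_R: "c \<in> R"
    and trivial: "\<And>K. K \<in> finite_index_normal free_group \<Longrightarrow> R \<subseteq> K \<Longrightarrow>
      (\<And>a. inv\<^bsub>free_group\<^esub> letter a \<otimes>\<^bsub>free_group\<^esub> comm free_group (letter (p a)) (letter (q a)) \<in> K) \<Longrightarrow>
      K = carrier free_group"
begin

abbreviation F :: "('a \<times> bool) list monoid"
  where "F \<equiv> free_group"

definition S :: "('a \<times> bool) list set"
  where "S = range (\<lambda>a. inv\<^bsub>F\<^esub> letter a \<otimes>\<^bsub>F\<^esub> comm F (letter (p a)) (letter (q a)))"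

definition T :: "('a \<times> bool) list set"
  where "T = S \<union> (\<lambda>(r, a). comm F r (letter a)) ` (R \<times> UNIV)"

definition N :: "('a \<times> bool) list set"
  where "N = \<Inter> {K. K \<lhd> F \<and> T \<subseteq> K}"

lemma letter_F: "letter a \<in> carrier F"
  by simp

lemma T_closed: "T \<subseteq> carrier F"
  using R_closed letter_F unfolding T_def S_def
  by (auto simp del: free_group_simps intro!: free_group.m_closed free_group.inv_closed free_group.comm_closed)

lemma carrier_normal: "carrier F \<lhd> F"
  by (rule free_group.normal_invI[OF free_group.subgroup_self])
    (intro free_group.m_closed free_group.inv_closed; assumption)

lemma N_normal: "N \<lhd> F"
  unfolding N_def by (rule normal_Inter[OF group_free_group]) (use carrier_normal T_closed in auto)

lemma N_least: "K \<lhd> F \<Longrightarrow> T \<subseteq> K \<Longrightarrow> N \<subseteq> K"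
  by (auto simp: N_def)

lemma T_N: "T \<subseteq> N"
  by (auto simp: N_def)

text \<open>Modulo the central elements of R there are no finite quotients, so a finite quotient is
  abelian; but it is perfect as well.\<close>

lemma no_finite_quotient:
  assumes K: "K \<in> finite_index_normal F" and NK: "N \<subseteq> K"
  shows "K = carrier F"
proof -
  note K' = finite_index_normalD[OF K]
  have TK: "T \<subseteq> K" using T_N NK by blast
  define K1 where "K1 = \<Inter> {M. M \<lhd> F \<and> K \<union> R \<subseteq> M}"
  have K1: "K1 \<lhd> F"
    unfolding K1_def
    by (rule normal_Inter[OF group_free_group]) (use carrier_normal subgroup.subset[OF K'(2)] R_closed in auto)
  have KK1: "K \<subseteq> K1" "R \<subseteq> K1" by (auto simp: K1_def)
  have "K1 = carrier F"
  proof (rule trivial)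
    show "K1 \<in> finite_index_normal F" by (rule free_group.finite_index_normal_mono[OF K K1 KK1(1)])
    show "R \<subseteq> K1" by (rule KK1(2))
    show "inv\<^bsub>F\<^esub> letter a \<otimes>\<^bsub>F\<^esub> comm F (letter (p a)) (letter (q a)) \<in> K1" for a
      using TK KK1(1) unfolding T_def S_def by blast
  qed
  define Z where "Z = {g \<in> carrier F. \<forall>h \<in> carrier F. comm F g h \<in> K}"
  have "Z \<lhd> F" unfolding Z_def by (rule free_group.centralizing_normal[OF K'(1)])
  moreover have "K \<subseteq> Z"
    unfolding Z_def using free_group.normal_comm_closed(1)[OF K'(1)] subgroup.subset[OF K'(2)] by blast
  moreover have "R \<subseteq> Z"
  proof
    fix r assume r: "r \<in> R"
    then have rF: "r \<in> carrier F" using R_closed by blast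
    have "{h \<in> carrier F. comm F r h \<in> K} = carrier F"
    proof (rule free_group_subgroup_eq[OF free_group.commuting_subgroup[OF K'(1) rF]])
      have "comm F r (letter a) \<in> K" for a using TK r unfolding T_def by force
      then show "range letter \<subseteq> {h \<in> carrier F. comm F r h \<in> K}" using letter_F by blast
    qed
    then have "comm F r h \<in> K" if "h \<in> carrier F" for h using that by blast
    then show "r \<in> Z" using rF by (simp add: Z_def)
  qed
  ultimately have "K1 \<subseteq> Z" unfolding K1_def by blast
  then have "comm F g h \<in> K" if "g \<in> carrier F" "h \<in> carrier F" for g h
    using \<open>K1 = carrier F\<close> that unfolding Z_def by blast
  then have "comm F (letter (p a)) (letter (q a)) \<in> K" for a using letter_F by blast
  moreover have "inv\<^bsub>F\<^esub> letter a \<otimes>\<^bsub>F\<^esub> comm F (letter (p a)) (letter (q a)) \<in> K" for a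
    using TK unfolding T_def S_def by blast
  ultimately have "letter a \<in> K" for a
    by (intro free_group.subgroup_cancel[OF K'(2) letter_F])
  then show ?thesis by (intro free_group_subgroup_eq[OF K'(2)]) auto
qed

end

section \<open>Splitting of finite extensions\<close>

lemma (in group) conj_eqD:
  assumes "g \<in> carrier G" "h \<in> carrier G" "a \<in> carrier G" and eq: "inv g \<otimes> a \<otimes> g = inv h \<otimes> a \<otimes> h"
  shows "(g \<otimes> inv h) \<otimes> a = a \<otimes> (g \<otimes> inv h)"
proof -
  have "a \<otimes> (g \<otimes> inv h) = g \<otimes> (inv g \<otimes> a \<otimes> g) \<otimes> inv h"
    using assms(1-3) by (simp add: m_assoc cancel_left)
  also have "\<dots> = (g \<otimes> inv h) \<otimes> a"
    unfolding eq using assms(1-3) by (simp add: m_assoc)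
  finally show ?thesis by simp
qed

lemma (in group) inv_mult_eq_oneD:
  assumes "inv g \<otimes> h = \<one>" "g \<in> carrier G" "h \<in> carrier G" shows "h = g"
  using cancel_left(2)[OF assms(2,3)] assms by simp

context perfect_presentation
begin

lemma commutes_mod_N:
  assumes "r \<in> R" "g \<in> carrier F" shows "comm F r g \<in> N"
proof -
  have r: "r \<in> carrier F" using assms(1) R_closed by blast
  have "{h \<in> carrier F. comm F r h \<in> N} = carrier F"
  proof (rule free_group_subgroup_eq[OF free_group.commuting_subgroup[OF N_normal r]])
    have "comm F r (letter a) \<in> N" for a using T_N assms(1) unfolding T_def by force
    then show "range letter \<subseteq> {h \<in> carrier F. comm F r h \<in> N}" using letter_F by blast
  qed
  then show ?thesis using assms(2) by blast
qed

text \<open>Lift the letters to elements that centralize \<open>N/L\<close> and take the commutators of these lifts, as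
  in the construction of a universal central extension.\<close>

lemma finite_extension_splits:
  assumes L: "L \<lhd> F" and LN: "L \<subseteq> N" and fin: "finite ((\<lambda>n. L #>\<^bsub>F\<^esub> n) ` N)"
  shows "\<exists>K \<in> finite_index_normal F. K \<inter> N = L"
proof -
  obtain E :: "('a \<times> bool) list set monoid" and \<nu> where \<nu>: "group_hom F E \<nu>"
    and \<nu>1: "\<And>g. g \<in> carrier F \<Longrightarrow> \<nu> g = \<one>\<^bsub>E\<^esub> \<longleftrightarrow> g \<in> L"
    and \<nu>2: "\<And>g h. g \<in> carrier F \<Longrightarrow> h \<in> carrier F \<Longrightarrow> \<nu> g = \<nu> h \<longleftrightarrow> g \<otimes>\<^bsub>F\<^esub> inv\<^bsub>F\<^esub> h \<in> L"
    using free_group.quotient_hom[OF L] by metis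
  obtain Q :: "('a \<times> bool) list set monoid" and \<pi> where \<pi>: "group_hom F Q \<pi>" "\<pi> ` carrier F = carrier Q"
    and \<pi>1: "\<And>g. g \<in> carrier F \<Longrightarrow> \<pi> g = \<one>\<^bsub>Q\<^esub> \<longleftrightarrow> g \<in> N"
    and \<pi>2: "\<And>g h. g \<in> carrier F \<Longrightarrow> h \<in> carrier F \<Longrightarrow> \<pi> g = \<pi> h \<longleftrightarrow> g \<otimes>\<^bsub>F\<^esub> inv\<^bsub>F\<^esub> h \<in> N"
    using free_group.quotient_hom[OF N_normal] by metis
  interpret n: group_hom F E \<nu> by (rule \<nu>)
  interpret p: group_hom F Q \<pi> by (rule \<pi>(1))
  \<comment> \<open>The instance with the neutral element for z gives access to
    \<open>ker_set_mult\<close>.\<close>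
  interpret fp: fibre_pair F Q \<pi> "\<one>\<^bsub>Q\<^esub>"
    by unfold_locales (use \<pi> p.homh in auto)
  have ker: "kernel F Q \<pi> = N"
    using \<pi>1 subgroup.subset[OF normal_imp_subgroup[OF N_normal]] by (auto simp: kernel_def simp del: free_group_simps)
  note Ns = normal_imp_subgroup[OF N_normal]
  note NF = subgroup.mem_carrier[OF Ns]
  \<comment> \<open>The centralizer of N/L, that is, the kernel of the conjugation action on a
    finite group. So it has finite index, and as F/N has no finite quotients, Z still maps onto
    F/N.\<close>
  define Z where "Z = {g \<in> carrier F. \<forall>n \<in> N. \<nu> g \<otimes>\<^bsub>E\<^esub> \<nu> n = \<nu> n \<otimes>\<^bsub>E\<^esub> \<nu> g}"
  have ZF: "g \<in> carrier F" if "g \<in> Z" for g using that by (simp add: Z_def)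
  have Zc: "\<nu> g \<otimes>\<^bsub>E\<^esub> \<nu> n = \<nu> n \<otimes>\<^bsub>E\<^esub> \<nu> g" if "g \<in> Z" "n \<in> N" for g n using that by (simp add: Z_def)
  have Zs: "subgroup Z F"
  proof (rule free_group.subgroupI)
    have "\<one>\<^bsub>F\<^esub> \<in> Z" using NF by (simp add: Z_def del: free_group_simps)
    then show "Z \<noteq> {}" by blast
    show "Z \<subseteq> carrier F" using ZF by blast
    fix g assume g: "g \<in> Z"
    show "inv\<^bsub>F\<^esub> g \<in> Z"
      unfolding Z_def
      using n.H.commutes_inv[OF n.hom_closed[OF ZF[OF g]] n.hom_closed[OF NF] Zc[OF g]] ZF[OF g]
      by (simp del: free_group_simps)
    fix h assume h: "h \<in> Z"
    show "g \<otimes>\<^bsub>F\<^esub> h \<in> Z"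
      unfolding Z_def
    proof (intro CollectI conjI ballI)
      fix n assume n: "n \<in> N"
      show "\<nu> (g \<otimes>\<^bsub>F\<^esub> h) \<otimes>\<^bsub>E\<^esub> \<nu> n = \<nu> n \<otimes>\<^bsub>E\<^esub> \<nu> (g \<otimes>\<^bsub>F\<^esub> h)"
        using n.H.commutes_mult[OF n.hom_closed[OF ZF[OF g]] n.hom_closed[OF ZF[OF h]] n.hom_closed[OF NF[OF n]] Zc[OF g n] Zc[OF h n]]
        by (simp only: n.hom_mult[OF ZF[OF g] ZF[OF h]])
    qed (rule free_group.m_closed[OF ZF[OF g] ZF[OF h]])
  qed
  have Zn: "Z \<lhd> F"
  proof (rule free_group.normal_invI[OF Zs])
    fix x g assume x: "x \<in> carrier F" and g: "g \<in> Z"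
    have gF: "g \<in> carrier F" by (rule ZF[OF g])
    have "\<nu> (x \<otimes>\<^bsub>F\<^esub> g \<otimes>\<^bsub>F\<^esub> inv\<^bsub>F\<^esub> x) \<otimes>\<^bsub>E\<^esub> \<nu> n = \<nu> n \<otimes>\<^bsub>E\<^esub> \<nu> (x \<otimes>\<^bsub>F\<^esub> g \<otimes>\<^bsub>F\<^esub> inv\<^bsub>F\<^esub> x)" if n: "n \<in> N" for n
    proof -
      define m where "m = inv\<^bsub>F\<^esub> x \<otimes>\<^bsub>F\<^esub> n \<otimes>\<^bsub>F\<^esub> x"
      have m: "m \<in> N" unfolding m_def by (rule normal.inv_op_closed1[OF N_normal x n])
      have c: "\<nu> x \<in> carrier E" "\<nu> g \<in> carrier E" "\<nu> n \<in> carrier E" "\<nu> m \<in> carrier E"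
        by (rule n.hom_closed[OF x] n.hom_closed[OF gF] n.hom_closed[OF NF[OF n]] n.hom_closed[OF NF[OF m]])+
      have \<nu>m: "\<nu> m = inv\<^bsub>E\<^esub> \<nu> x \<otimes>\<^bsub>E\<^esub> \<nu> n \<otimes>\<^bsub>E\<^esub> \<nu> x"
        unfolding m_def using x NF[OF n] by (simp del: free_group_simps)
      have xn: "\<nu> n \<otimes>\<^bsub>E\<^esub> \<nu> x = \<nu> x \<otimes>\<^bsub>E\<^esub> \<nu> m"
        using c by (simp add: \<nu>m n.H.m_assoc n.H.cancel_left)
      have xn': "inv\<^bsub>E\<^esub> \<nu> x \<otimes>\<^bsub>E\<^esub> \<nu> n = \<nu> m \<otimes>\<^bsub>E\<^esub> inv\<^bsub>E\<^esub> \<nu> x"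
        using c by (simp add: \<nu>m n.H.m_assoc)
      have "\<nu> (x \<otimes>\<^bsub>F\<^esub> g \<otimes>\<^bsub>F\<^esub> inv\<^bsub>F\<^esub> x) = \<nu> x \<otimes>\<^bsub>E\<^esub> \<nu> g \<otimes>\<^bsub>E\<^esub> inv\<^bsub>E\<^esub> \<nu> x"
        using x gF by (simp del: free_group_simps)
      moreover have "(\<nu> x \<otimes>\<^bsub>E\<^esub> \<nu> g \<otimes>\<^bsub>E\<^esub> inv\<^bsub>E\<^esub> \<nu> x) \<otimes>\<^bsub>E\<^esub> \<nu> n = \<nu> x \<otimes>\<^bsub>E\<^esub> (\<nu> g \<otimes>\<^bsub>E\<^esub> \<nu> m) \<otimes>\<^bsub>E\<^esub> inv\<^bsub>E\<^esub> \<nu> x"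
        using c by (simp add: n.H.m_assoc xn')
      moreover have "\<nu> x \<otimes>\<^bsub>E\<^esub> (\<nu> m \<otimes>\<^bsub>E\<^esub> \<nu> g) \<otimes>\<^bsub>E\<^esub> inv\<^bsub>E\<^esub> \<nu> x = \<nu> n \<otimes>\<^bsub>E\<^esub> (\<nu> x \<otimes>\<^bsub>E\<^esub> \<nu> g \<otimes>\<^bsub>E\<^esub> inv\<^bsub>E\<^esub> \<nu> x)"
        using c by (simp add: n.H.m_assoc[symmetric] xn[symmetric])
      ultimately show ?thesis using Zc[OF g m] by simp
    qed
    then show "x \<otimes>\<^bsub>F\<^esub> g \<otimes>\<^bsub>F\<^esub> inv\<^bsub>F\<^esub> x \<in> Z"
      unfolding Z_def using x gF by (simp del: free_group_simps)
  qed
  define A where "A = \<nu> ` N"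
  have finA: "finite A"
    unfolding A_def
  proof (rule finite_image_factor[OF fin])
    fix m n assume "m \<in> N" "n \<in> N" "L #>\<^bsub>F\<^esub> m = L #>\<^bsub>F\<^esub> n"
    then show "\<nu> m = \<nu> n"
      using \<nu>2[OF NF NF] group.r_coset_eq_iff[OF group_free_group normal_imp_subgroup[OF L] NF NF] by blast
  qed
  have A_iff: "\<nu> g \<in> A \<longleftrightarrow> g \<in> N" if g: "g \<in> carrier F" for g
  proof
    assume "\<nu> g \<in> A"
    then obtain n where n: "n \<in> N" "\<nu> g = \<nu> n" by (auto simp: A_def)
    then have "g \<otimes>\<^bsub>F\<^esub> inv\<^bsub>F\<^esub> n \<in> N" using \<nu>2[OF g NF] LN by blast
    then have "(g \<otimes>\<^bsub>F\<^esub> inv\<^bsub>F\<^esub> n) \<otimes>\<^bsub>F\<^esub> n \<in> N" using n(1) subgroup.m_closed[OF Ns] by blast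
    then show "g \<in> N" using g NF[OF n(1)] by (simp add: free_group.m_assoc del: free_group_simps)
  qed (simp add: A_def)
  have Zfin: "Z \<in> finite_index_normal F"
  proof (rule finite_index_normalI[OF Zn, where f = "\<lambda>g. \<lambda>a\<in>A. inv\<^bsub>E\<^esub> \<nu> g \<otimes>\<^bsub>E\<^esub> a \<otimes>\<^bsub>E\<^esub> \<nu> g"])
    have "inv\<^bsub>E\<^esub> \<nu> g \<otimes>\<^bsub>E\<^esub> a \<otimes>\<^bsub>E\<^esub> \<nu> g \<in> A" if g: "g \<in> carrier F" and a: "a \<in> A" for g a
    proof -
      obtain n where n: "n \<in> N" "a = \<nu> n" using a by (auto simp: A_def)
      then have "inv\<^bsub>E\<^esub> \<nu> g \<otimes>\<^bsub>E\<^esub> a \<otimes>\<^bsub>E\<^esub> \<nu> g = \<nu> (inv\<^bsub>F\<^esub> g \<otimes>\<^bsub>F\<^esub> n \<otimes>\<^bsub>F\<^esub> g)"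
        using g NF[OF n(1)] by (simp del: free_group_simps)
      then show ?thesis using normal.inv_op_closed1[OF N_normal g n(1)] by (simp add: A_def)
    qed
    then have "(\<lambda>g. \<lambda>a\<in>A. inv\<^bsub>E\<^esub> \<nu> g \<otimes>\<^bsub>E\<^esub> a \<otimes>\<^bsub>E\<^esub> \<nu> g) ` carrier F \<subseteq> A \<rightarrow>\<^sub>E A" by auto
    then show "finite ((\<lambda>g. \<lambda>a\<in>A. inv\<^bsub>E\<^esub> \<nu> g \<otimes>\<^bsub>E\<^esub> a \<otimes>\<^bsub>E\<^esub> \<nu> g) ` carrier F)"
      by (rule finite_subset) (rule finite_PiE[OF finA finA])
    fix g h assume g: "g \<in> carrier F" and h: "h \<in> carrier F"
      and eq: "(\<lambda>a\<in>A. inv\<^bsub>E\<^esub> \<nu> g \<otimes>\<^bsub>E\<^esub> a \<otimes>\<^bsub>E\<^esub> \<nu> g) = (\<lambda>a\<in>A. inv\<^bsub>E\<^esub> \<nu> h \<otimes>\<^bsub>E\<^esub> a \<otimes>\<^bsub>E\<^esub> \<nu> h)"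
    have "(\<nu> g \<otimes>\<^bsub>E\<^esub> inv\<^bsub>E\<^esub> \<nu> h) \<otimes>\<^bsub>E\<^esub> \<nu> n = \<nu> n \<otimes>\<^bsub>E\<^esub> (\<nu> g \<otimes>\<^bsub>E\<^esub> inv\<^bsub>E\<^esub> \<nu> h)" if n: "n \<in> N" for n
      using fun_cong[OF eq, of "\<nu> n"] n
      by (intro n.H.conj_eqD n.hom_closed g h NF[OF n]) (simp add: A_def)
    then show "g \<otimes>\<^bsub>F\<^esub> inv\<^bsub>F\<^esub> h \<in> Z"
      using g h by (simp add: Z_def del: free_group_simps)
  qed
  have "\<exists>k \<in> Z. \<pi> k = \<pi> (letter a)" for a
    by (rule fp.ker_set_mult[OF _ Zfin letter_F]) (use no_finite_quotient in \<open>simp add: ker\<close>)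
  then obtain k where k: "\<And>a. k a \<in> Z" "\<And>a. \<pi> (k a) = \<pi> (letter a)" by metis
  have kF: "k a \<in> carrier F" for a by (rule ZF[OF k(1)])
  \<comment> \<open>Modulo N the letter a is the commutator of the letters \<open>p a\<close> and
    \<open>q a\<close>, so \<psi> induces the identity on F/N, while all its values lie in
    Z.\<close>
  define \<psi> where "\<psi> = free_hom F (\<lambda>a. comm F (k (p a)) (k (q a)))"
  have kk: "comm F (k (p a)) (k (q a)) \<in> carrier F" for a by (rule free_group.comm_closed[OF kF kF])
  have \<psi>h: "\<psi> \<in> hom F F" unfolding \<psi>_def by (rule free_hom(1)[OF group_free_group kk])
  have \<psi>l: "\<psi> (letter a) = comm F (k (p a)) (k (q a))" for a
    unfolding \<psi>_def by (rule free_hom(2)[OF group_free_group kk])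
  interpret s: group_hom F F \<psi>
    using \<psi>h group_free_group by (simp add: group_hom_def group_hom_axioms_def)
  have \<pi>S: "\<pi> (comm F (letter (p a)) (letter (q a))) = \<pi> (letter a)" for a
  proof -
    have "inv\<^bsub>F\<^esub> letter a \<otimes>\<^bsub>F\<^esub> comm F (letter (p a)) (letter (q a)) \<in> N" using T_N unfolding T_def S_def by blast
    then have "\<pi> (inv\<^bsub>F\<^esub> letter a \<otimes>\<^bsub>F\<^esub> comm F (letter (p a)) (letter (q a))) = \<one>\<^bsub>Q\<^esub>" using \<pi>1 NF by blast
    then have "inv\<^bsub>Q\<^esub> \<pi> (letter a) \<otimes>\<^bsub>Q\<^esub> \<pi> (comm F (letter (p a)) (letter (q a))) = \<one>\<^bsub>Q\<^esub>"
      using letter_F free_group.comm_closed[OF letter_F letter_F] by (simp del: free_group_simps)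
    then show ?thesis
      by (rule p.H.inv_mult_eq_oneD[OF _ p.hom_closed[OF letter_F] p.hom_closed[OF free_group.comm_closed[OF letter_F letter_F]]])
  qed
  have \<pi>\<psi>: "\<pi> (\<psi> g) = \<pi> g" if g: "g \<in> carrier F" for g
  proof -
    have "(\<lambda>g. \<pi> (\<psi> g)) \<in> hom F Q" using hom_compose[OF \<psi>h p.homh] by (simp add: o_def)
    then show ?thesis
    proof (rule free_hom_unique[OF p.H.is_group _ p.homh _ g])
      fix a
      show "\<pi> (\<psi> (letter a)) = \<pi> (letter a)"
        unfolding \<psi>l p.hom_comm[OF kF kF] k(2) p.hom_comm[OF letter_F letter_F, symmetric] by (rule \<pi>S)
    qed
  qed
  have \<psi>Z: "\<psi> g \<in> Z" if g: "g \<in> carrier F" for g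
  proof -
    have "subgroup {g \<in> carrier F. \<psi> g \<in> Z} F"
    proof (rule free_group.subgroupI)
      have "\<one>\<^bsub>F\<^esub> \<in> {g \<in> carrier F. \<psi> g \<in> Z}" using subgroup.one_closed[OF Zs] s.hom_one by simp
      then show "{g \<in> carrier F. \<psi> g \<in> Z} \<noteq> {}" by blast
    qed (auto simp: subgroup.m_closed[OF Zs] subgroup.m_inv_closed[OF Zs] simp del: free_group_simps)
    then have "{g \<in> carrier F. \<psi> g \<in> Z} = carrier F"
    proof (rule free_group_subgroup_eq)
      show "range letter \<subseteq> {g \<in> carrier F. \<psi> g \<in> Z}"
        using letter_F \<psi>l free_group.subgroup_comm_closed[OF Zs k(1) k(1)] by auto
    qed
    then show ?thesis using g by blast
  qed
  \<comment> \<open>The aim is that \<theta> kills N. Then it induces a section of F/L \<rightarrow>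
    F/N whose image commutes with N/L.\<close>
  define \<theta> where "\<theta> = (\<lambda>g. \<nu> (\<psi> g))"
  have \<theta>h: "\<theta> \<in> hom F E" using hom_compose[OF \<psi>h n.homh] by (simp add: o_def \<theta>_def)
  interpret t: group_hom F E \<theta>
    using \<theta>h group_free_group by (simp add: group_hom_def group_hom_axioms_def)
  have \<theta>c: "\<theta> g \<otimes>\<^bsub>E\<^esub> \<nu> n = \<nu> n \<otimes>\<^bsub>E\<^esub> \<theta> g" if "g \<in> carrier F" "n \<in> N" for g n
    unfolding \<theta>_def by (rule Zc[OF \<psi>Z[OF that(1)] that(2)])
  have \<theta>S: "\<theta> (letter a) = \<theta> (comm F (letter (p a)) (letter (q a)))" for a
  proof -
    \<comment> \<open>Both \<open>k b\<close> and \<open>\<psi> (letter b)\<close> are lifts in Z of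
      the same element of F/N. Their quotient lies in N and in Z, so modulo L it commutes with the
      images of Z and does not affect commutators of such lifts.\<close>
    define \<zeta> where "\<zeta> = (\<lambda>b. inv\<^bsub>F\<^esub> (k b) \<otimes>\<^bsub>F\<^esub> \<psi> (letter b))"
    have \<psi>F: "\<psi> (letter b) \<in> carrier F" for b by (rule s.hom_closed[OF letter_F])
    have \<zeta>Z: "\<zeta> b \<in> Z" for b
      unfolding \<zeta>_def by (intro subgroup.m_closed[OF Zs] subgroup.m_inv_closed[OF Zs] k(1) \<psi>Z letter_F)
    have \<zeta>N: "\<zeta> b \<in> N" for b
    proof -
      have "\<pi> (\<zeta> b) = \<one>\<^bsub>Q\<^esub>"
        unfolding \<zeta>_def using kF \<psi>F k(2) \<pi>\<psi>[OF letter_F] p.hom_closed[OF letter_F] by (simp del: free_group_simps)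
      then show ?thesis using \<pi>1[OF ZF[OF \<zeta>Z]] by blast
    qed
    have \<psi>\<zeta>: "\<theta> (letter b) = \<nu> (k b) \<otimes>\<^bsub>E\<^esub> \<nu> (\<zeta> b)" for b
    proof -
      have "k b \<otimes>\<^bsub>F\<^esub> \<zeta> b = \<psi> (letter b)"
        unfolding \<zeta>_def by (rule free_group.cancel_left(2)[OF kF \<psi>F])
      then show ?thesis unfolding \<theta>_def using n.hom_mult[OF kF ZF[OF \<zeta>Z]] by metis
    qed
    have "\<theta> (comm F (letter (p a)) (letter (q a))) = comm E (\<theta> (letter (p a))) (\<theta> (letter (q a)))"
      by (rule t.hom_comm[OF letter_F letter_F])
    also have "\<dots> = comm E (\<nu> (k (p a))) (\<nu> (k (q a)))"
      unfolding \<psi>\<zeta>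
      by (rule n.H.comm_mult_central) (intro n.hom_closed kF ZF[OF \<zeta>Z] Zc[OF k(1) \<zeta>N] Zc[OF \<zeta>Z \<zeta>N] Zc[OF k(1) \<zeta>N, symmetric])+
    also have "\<dots> = \<theta> (letter a)"
      unfolding \<theta>_def \<psi>l by (rule n.hom_comm[OF kF kF, symmetric])
    finally show ?thesis by simp
  qed
  have \<theta>R: "\<theta> (comm F r (letter a)) = \<one>\<^bsub>E\<^esub>" if r: "r \<in> R" for r a
  proof -
    have rF: "r \<in> carrier F" using r R_closed by blast
    \<comment> \<open>Modulo N the word r is central, so \<rho> takes values in N/L, which commutes
      with the image of \<theta>. This makes \<rho> a homomorphism, and its values commute with each
      other. Since \<theta> respects the expression of a letter as a commutator, \<rho> maps the
      letter to a commutator of two such values.\<close>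
    define \<rho> where "\<rho> = (\<lambda>g. comm E (\<theta> r) (\<theta> g))"
    have \<rho>\<nu>: "\<rho> g = \<nu> (\<psi> (comm F r g))" if "g \<in> carrier F" for g
      unfolding \<rho>_def using t.hom_comm[OF rF that] by (simp add: \<theta>_def)
    have \<psi>N: "\<psi> (comm F r g) \<in> N" if "g \<in> carrier F" for g
    proof -
      have c: "comm F r g \<in> carrier F" by (rule free_group.comm_closed[OF rF that])
      have "\<pi> (\<psi> (comm F r g)) = \<one>\<^bsub>Q\<^esub>" using \<pi>\<psi>[OF c] \<pi>1[OF c] commutes_mod_N[OF r that] by simp
      then show ?thesis using \<pi>1[OF s.hom_closed[OF c]] by blast
    qed
    have \<rho>c: "\<rho> g \<otimes>\<^bsub>E\<^esub> \<theta> h = \<theta> h \<otimes>\<^bsub>E\<^esub> \<rho> g" if "g \<in> carrier F" "h \<in> carrier F" for g h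
      unfolding \<rho>\<nu>[OF that(1)] by (rule \<theta>c[OF that(2) \<psi>N[OF that(1)], symmetric])
    have \<rho>cl: "\<rho> g \<in> carrier E" if "g \<in> carrier F" for g
      unfolding \<rho>_def by (rule n.H.comm_closed[OF t.hom_closed[OF rF] t.hom_closed[OF that]])
    have "\<rho> \<in> hom F E"
    proof (rule homI)
      fix g h assume g: "g \<in> carrier F" and h: "h \<in> carrier F"
      show "\<rho> (g \<otimes>\<^bsub>F\<^esub> h) = \<rho> g \<otimes>\<^bsub>E\<^esub> \<rho> h"
        unfolding \<rho>_def t.hom_mult[OF g h]
        by (rule n.H.comm_mult_right[OF t.hom_closed[OF rF] t.hom_closed[OF g] t.hom_closed[OF h] \<rho>c[OF h g, unfolded \<rho>_def]])
    qed (rule \<rho>cl)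
    then interpret \<rho>: group_hom F E \<rho>
      using group_free_group by (simp add: group_hom_def group_hom_axioms_def)
    have "\<rho> (letter a) = \<rho> (comm F (letter (p a)) (letter (q a)))"
      unfolding \<rho>_def by (simp only: \<theta>S[of a])
    also have "\<dots> = comm E (\<rho> (letter (p a))) (\<rho> (letter (q a)))" by (rule \<rho>.hom_comm[OF letter_F letter_F])
    also have "\<dots> = \<one>\<^bsub>E\<^esub>"
      unfolding n.H.comm_eq_one_iff[OF \<rho>cl[OF letter_F] \<rho>cl[OF letter_F]]
      unfolding \<rho>\<nu>[OF letter_F]
      by (rule Zc[OF \<psi>Z[OF free_group.comm_closed[OF rF letter_F]] \<psi>N[OF letter_F]])
    finally show ?thesis unfolding \<rho>_def t.hom_comm[OF rF letter_F] .
  qed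
  have "N \<subseteq> kernel F E \<theta>"
  proof (rule N_least[OF t.normal_kernel])
    show "T \<subseteq> kernel F E \<theta>"
    proof
      fix w assume w: "w \<in> T"
      then have wF: "w \<in> carrier F" using T_closed by blast
      from w consider a where "w = inv\<^bsub>F\<^esub> letter a \<otimes>\<^bsub>F\<^esub> comm F (letter (p a)) (letter (q a))"
        | r a where "r \<in> R" "w = comm F r (letter a)"
        unfolding T_def S_def by (fastforce simp del: free_group_simps)
      then have "\<theta> w = \<one>\<^bsub>E\<^esub>"
      proof cases
        case 1
        have "\<theta> w = inv\<^bsub>E\<^esub> \<theta> (letter a) \<otimes>\<^bsub>E\<^esub> \<theta> (comm F (letter (p a)) (letter (q a)))"
          unfolding 1 using letter_F free_group.comm_closed[OF letter_F letter_F] by (simp del: free_group_simps)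
        then show ?thesis unfolding \<theta>S[symmetric] using n.H.l_inv[OF t.hom_closed[OF letter_F]] by simp
      next
        case 2
        then show ?thesis using \<theta>R by simp
      qed
      then show "w \<in> kernel F E \<theta>" using wF by (simp add: kernel_def)
    qed
  qed
  then have \<theta>N: "\<theta> n = \<one>\<^bsub>E\<^esub>" if "n \<in> N" for n using that by (auto simp: kernel_def)
  have \<theta>A: "inv\<^bsub>E\<^esub> \<nu> g \<otimes>\<^bsub>E\<^esub> \<theta> g \<in> A" if g: "g \<in> carrier F" for g
  proof -
    have c: "\<psi> g \<in> carrier F" by (rule s.hom_closed[OF g])
    have "\<pi> (inv\<^bsub>F\<^esub> g \<otimes>\<^bsub>F\<^esub> \<psi> g) = \<one>\<^bsub>Q\<^esub>" using g c \<pi>\<psi>[OF g] by (simp del: free_group_simps)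
    then have "inv\<^bsub>F\<^esub> g \<otimes>\<^bsub>F\<^esub> \<psi> g \<in> N" using \<pi>1[OF free_group.m_closed[OF free_group.inv_closed[OF g] c]] by blast
    then have "\<nu> (inv\<^bsub>F\<^esub> g \<otimes>\<^bsub>F\<^esub> \<psi> g) \<in> A" by (simp add: A_def)
    then show ?thesis using g c by (simp add: \<theta>_def del: free_group_simps)
  qed
  \<comment> \<open>Modulo L this is the image of \<theta>, a complement of N/L. It is normal
    because it commutes with N/L and the two together generate F/L; its index is at most the order
    of N/L.\<close>
  define K where "K = {g \<in> carrier F. \<nu> g \<in> \<theta> ` carrier F}"
  have \<theta>s: "subgroup (\<theta> ` carrier F) E" by (rule t.img_is_subgroup)
  have Ks: "subgroup K F"
  proof (rule free_group.subgroupI)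
    have "\<one>\<^bsub>F\<^esub> \<in> K" using subgroup.one_closed[OF \<theta>s] n.hom_one by (simp add: K_def)
    then show "K \<noteq> {}" by blast
  qed (auto simp: K_def subgroup.m_closed[OF \<theta>s] subgroup.m_inv_closed[OF \<theta>s] simp del: free_group_simps)
  have "K \<lhd> F"
  proof (rule free_group.normal_invI[OF Ks])
    fix x g assume x: "x \<in> carrier F" and g: "g \<in> K"
    then obtain h where h: "h \<in> carrier F" "\<nu> g = \<theta> h" and gF: "g \<in> carrier F" by (auto simp: K_def)
    obtain n where n: "n \<in> N" "inv\<^bsub>E\<^esub> \<nu> x \<otimes>\<^bsub>E\<^esub> \<theta> x = \<nu> n" using \<theta>A[OF x] by (auto simp: A_def)
    have c: "\<nu> x \<in> carrier E" "\<theta> x \<in> carrier E" "\<theta> h \<in> carrier E" "\<nu> n \<in> carrier E"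
      by (rule n.hom_closed[OF x] t.hom_closed[OF x] t.hom_closed[OF h(1)] n.hom_closed[OF NF[OF n(1)]])+
    have xt: "\<theta> x = \<nu> x \<otimes>\<^bsub>E\<^esub> \<nu> n" using n(2)[symmetric] c by (simp add: n.H.cancel_left)
    have "\<theta> (x \<otimes>\<^bsub>F\<^esub> h \<otimes>\<^bsub>F\<^esub> inv\<^bsub>F\<^esub> x) = \<nu> x \<otimes>\<^bsub>E\<^esub> (\<nu> n \<otimes>\<^bsub>E\<^esub> \<theta> h) \<otimes>\<^bsub>E\<^esub> (inv\<^bsub>E\<^esub> \<nu> n \<otimes>\<^bsub>E\<^esub> inv\<^bsub>E\<^esub> \<nu> x)"
      using x h c by (simp add: xt n.H.inv_mult_group n.H.m_assoc del: free_group_simps)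
    also have "\<nu> n \<otimes>\<^bsub>E\<^esub> \<theta> h = \<theta> h \<otimes>\<^bsub>E\<^esub> \<nu> n" by (rule \<theta>c[OF h(1) n(1), symmetric])
    also have "\<nu> x \<otimes>\<^bsub>E\<^esub> (\<theta> h \<otimes>\<^bsub>E\<^esub> \<nu> n) \<otimes>\<^bsub>E\<^esub> (inv\<^bsub>E\<^esub> \<nu> n \<otimes>\<^bsub>E\<^esub> inv\<^bsub>E\<^esub> \<nu> x) = \<nu> x \<otimes>\<^bsub>E\<^esub> \<theta> h \<otimes>\<^bsub>E\<^esub> inv\<^bsub>E\<^esub> \<nu> x"
      using c by (simp add: n.H.m_assoc n.H.cancel_left)
    also have "\<dots> = \<nu> (x \<otimes>\<^bsub>F\<^esub> g \<otimes>\<^bsub>F\<^esub> inv\<^bsub>F\<^esub> x)"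
      using x gF h by (simp del: free_group_simps)
    finally have "\<nu> (x \<otimes>\<^bsub>F\<^esub> g \<otimes>\<^bsub>F\<^esub> inv\<^bsub>F\<^esub> x) = \<theta> (x \<otimes>\<^bsub>F\<^esub> h \<otimes>\<^bsub>F\<^esub> inv\<^bsub>F\<^esub> x)" by (rule sym)
    moreover have "x \<otimes>\<^bsub>F\<^esub> h \<otimes>\<^bsub>F\<^esub> inv\<^bsub>F\<^esub> x \<in> carrier F" "x \<otimes>\<^bsub>F\<^esub> g \<otimes>\<^bsub>F\<^esub> inv\<^bsub>F\<^esub> x \<in> carrier F"
      by (intro free_group.m_closed free_group.inv_closed x h gF)+
    ultimately show "x \<otimes>\<^bsub>F\<^esub> g \<otimes>\<^bsub>F\<^esub> inv\<^bsub>F\<^esub> x \<in> K" unfolding K_def by blast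
  qed
  then have "K \<in> finite_index_normal F"
  proof (rule finite_index_normalI[where f = "\<lambda>g. inv\<^bsub>E\<^esub> \<nu> g \<otimes>\<^bsub>E\<^esub> \<theta> g"])
    show "finite ((\<lambda>g. inv\<^bsub>E\<^esub> \<nu> g \<otimes>\<^bsub>E\<^esub> \<theta> g) ` carrier F)"
      by (rule finite_subset[OF _ finA]) (use \<theta>A in blast)
    fix g h assume g: "g \<in> carrier F" and h: "h \<in> carrier F" and eq: "inv\<^bsub>E\<^esub> \<nu> g \<otimes>\<^bsub>E\<^esub> \<theta> g = inv\<^bsub>E\<^esub> \<nu> h \<otimes>\<^bsub>E\<^esub> \<theta> h"
    have c: "\<nu> g \<in> carrier E" "\<theta> g \<in> carrier E" "\<nu> h \<in> carrier E" "\<theta> h \<in> carrier E"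
      by (rule n.hom_closed[OF g] t.hom_closed[OF g] n.hom_closed[OF h] t.hom_closed[OF h])+
    have "\<theta> g \<otimes>\<^bsub>E\<^esub> inv\<^bsub>E\<^esub> \<theta> h = \<nu> g \<otimes>\<^bsub>E\<^esub> (inv\<^bsub>E\<^esub> \<nu> g \<otimes>\<^bsub>E\<^esub> \<theta> g) \<otimes>\<^bsub>E\<^esub> inv\<^bsub>E\<^esub> \<theta> h"
      using c by (simp add: n.H.cancel_left)
    also have "\<dots> = \<nu> g \<otimes>\<^bsub>E\<^esub> inv\<^bsub>E\<^esub> \<nu> h" unfolding eq using c by (simp add: n.H.m_assoc)
    finally have "\<nu> (g \<otimes>\<^bsub>F\<^esub> inv\<^bsub>F\<^esub> h) = \<theta> (g \<otimes>\<^bsub>F\<^esub> inv\<^bsub>F\<^esub> h)" using g h by (simp del: free_group_simps)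
    moreover have "g \<otimes>\<^bsub>F\<^esub> inv\<^bsub>F\<^esub> h \<in> carrier F" by (intro free_group.m_closed free_group.inv_closed g h)
    ultimately show "g \<otimes>\<^bsub>F\<^esub> inv\<^bsub>F\<^esub> h \<in> K" unfolding K_def by blast
  qed
  moreover have "K \<inter> N = L"
  proof (intro subset_antisym subsetI)
    fix g assume "g \<in> K \<inter> N"
    then obtain h where gN: "g \<in> N" and h: "h \<in> carrier F" "\<nu> g = \<theta> h" by (auto simp: K_def)
    obtain n where n: "n \<in> N" "inv\<^bsub>E\<^esub> \<nu> h \<otimes>\<^bsub>E\<^esub> \<theta> h = \<nu> n" using \<theta>A[OF h(1)] by (auto simp: A_def)
    have c: "\<nu> h \<in> carrier E" "\<theta> h \<in> carrier E" "\<nu> n \<in> carrier E"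
      by (rule n.hom_closed[OF h(1)] t.hom_closed[OF h(1)] n.hom_closed[OF NF[OF n(1)]])+
    have "\<theta> h = \<nu> h \<otimes>\<^bsub>E\<^esub> \<nu> n" using n(2)[symmetric] c by (simp add: n.H.cancel_left)
    then have "\<nu> h = \<nu> g \<otimes>\<^bsub>E\<^esub> inv\<^bsub>E\<^esub> \<nu> n" using c h(2) by (simp add: n.H.m_assoc)
    also have "\<dots> = \<nu> (g \<otimes>\<^bsub>F\<^esub> inv\<^bsub>F\<^esub> n)" using NF[OF gN] NF[OF n(1)] by (simp del: free_group_simps)
    finally have "\<nu> h \<in> A"
      using subgroup.m_closed[OF Ns gN subgroup.m_inv_closed[OF Ns n(1)]] by (simp add: A_def)
    then have "h \<in> N" using A_iff[OF h(1)] by simp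
    then have "\<nu> g = \<one>\<^bsub>E\<^esub>" using \<theta>N h(2) by simp
    then show "g \<in> L" using \<nu>1[OF NF[OF gN]] by simp
  next
    fix g assume g: "g \<in> L"
    then have gF: "g \<in> carrier F" using LN NF by blast
    have "\<nu> g = \<theta> \<one>\<^bsub>F\<^esub>" using \<nu>1[OF gF] g t.hom_one by simp
    then show "g \<in> K \<inter> N" using g gF LN free_group.one_closed unfolding K_def by blast
  qed
  ultimately show ?thesis by blast
qed

end

section \<open>A perfect group with a central element of infinite order\<close>

datatype root = E12 | E13 | E21 | E23 | E31 | E32

text \<open>For the position ij these two functions give the positions ik and kj, where k is the
  third index.\<close>

fun left_root :: "root \<Rightarrow> root"
  where "left_root E12 = E13" | "left_root E13 = E12" | "left_root E21 = E23"
  | "left_root E23 = E21" | "left_root E31 = E32" | "left_root E32 = E31"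

fun right_root :: "root \<Rightarrow> root"
  where "right_root E12 = E32" | "right_root E13 = E23" | "right_root E21 = E31"
  | "right_root E23 = E13" | "right_root E31 = E21" | "right_root E32 = E12"

instance root :: finite
proof
  have "r \<in> {E12, E13, E21, E23, E31, E32}" for r by (cases r) auto
  then have "(UNIV :: root set) = {E12, E13, E21, E23, E31, E32}" by blast
  then show "finite (UNIV :: root set)" by (rule finite_subset[OF equalityD1]) simp
qed

text \<open>For elementary matrices this is the monomial matrix that exchanges the indices 2 and 3
  up to a sign. It conjugates e_12 and e_13 into each other, which gives them the same order in
  every quotient.\<close>

definition weyl :: "('g, 'b) monoid_scheme \<Rightarrow> (root \<Rightarrow> 'g) \<Rightarrow> 'g"
  where "weyl G f = f E23 \<otimes>\<^bsub>G\<^esub> inv\<^bsub>G\<^esub> f E32 \<otimes>\<^bsub>G\<^esub> f E23"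

text \<open>Some relations between the elementary \<open>3 \<times> 3\<close> matrices: \<open>e\<^sub>i\<^sub>j = [e\<^sub>i\<^sub>k, e\<^sub>k\<^sub>j]\<close>, and \<open>e\<^sub>1\<^sub>2\<close> is
  conjugate to \<open>e\<^sub>1\<^sub>3\<close>.\<close>

definition elementary_relations :: "('g, 'b) monoid_scheme \<Rightarrow> (root \<Rightarrow> 'g) \<Rightarrow> bool"
  where "elementary_relations G f \<longleftrightarrow>
    (\<forall>r. f r \<in> carrier G \<and> comm G (f (left_root r)) (f (right_root r)) = f r) \<and>
    f E12 \<otimes>\<^bsub>G\<^esub> weyl G f = weyl G f \<otimes>\<^bsub>G\<^esub> f E13"

lemma (in group) weyl_closed: "(\<And>r. f r \<in> carrier G) \<Longrightarrow> weyl G f \<in> carrier G"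
  by (simp add: weyl_def)

lemma (in group_hom) hom_weyl:
  "(\<And>r. f r \<in> carrier G) \<Longrightarrow> h (weyl G f) = weyl H (\<lambda>r. h (f r))"
  by (simp add: weyl_def)

lemma (in group_hom) elementary_relations_hom:
  assumes "elementary_relations G f" shows "elementary_relations H (\<lambda>r. h (f r))"
proof -
  have f: "f r \<in> carrier G" for r using assms by (simp add: elementary_relations_def)
  have w: "weyl G f \<in> carrier G" by (rule G.weyl_closed[OF f])
  have "comm H (h (f (left_root r))) (h (f (right_root r))) = h (f r)" for r
    using assms hom_comm[OF f[of "left_root r"] f[of "right_root r"]] by (simp add: elementary_relations_def)
  moreover have "h (f E12) \<otimes>\<^bsub>H\<^esub> weyl H (\<lambda>r. h (f r)) = weyl H (\<lambda>r. h (f r)) \<otimes>\<^bsub>H\<^esub> h (f E13)"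
    using hom_mult[OF f w, of E12] hom_mult[OF w f, of E13] hom_weyl[of f, OF f] assms
    unfolding elementary_relations_def by metis
  ultimately show ?thesis using f by (simp add: elementary_relations_def)
qed

section \<open>Elementary and Baumslag relations in finite groups\<close>

context group
begin

text \<open>Triviality spreads along the commutator relations, from E12 to E13 and E32, from these
  to E23 and E31, and from there to E21.\<close>

lemma elementary_relations_trivial:
  assumes "elementary_relations G f" "f E12 = \<one>" shows "f r = \<one>"
proof -
  have f: "f r \<in> carrier G" and c: "comm G (f (left_root r)) (f (right_root r)) = f r" for r
    using assms by (simp_all add: elementary_relations_def)
  have 1: "comm G \<one> x = \<one>" "comm G x \<one> = \<one>" if "x \<in> carrier G" for x
    using that by (simp_all add: comm_eq_one_iff)
  have 13: "f E13 = \<one>" using c[of E13] 1 f assms(2) by simp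
  have 32: "f E32 = \<one>" using c[of E32] 1 f assms(2) by simp
  have 23: "f E23 = \<one>" using c[of E23] 1 f 13 by simp
  have 31: "f E31 = \<one>" using c[of E31] 1 f 32 by simp
  have 21: "f E21 = \<one>" using c[of E21] 1 f 31 by simp
  show ?thesis by (cases r) (simp_all add: assms 13 32 23 31 21)
qed

lemma conj_pow:
  assumes "x \<in> carrier G" "y \<in> carrier G" "w \<in> carrier G" and "x \<otimes> w = w \<otimes> y"
  shows "x [^] (n :: nat) \<otimes> w = w \<otimes> y [^] n"
proof (induct n)
  case (Suc n)
  have "x [^] Suc n \<otimes> w = x [^] n \<otimes> w \<otimes> y" using assms by (simp add: m_assoc)
  also have "\<dots> = w \<otimes> y [^] Suc n" using assms by (simp add: Suc m_assoc)
  finally show ?case .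
qed (use assms in simp)

lemma conj_pow_one:
  assumes "x \<in> carrier G" "y \<in> carrier G" "w \<in> carrier G" and "x \<otimes> w = w \<otimes> y"
  shows "x [^] (n :: nat) = \<one> \<longleftrightarrow> y [^] n = \<one>"
proof -
  have "x [^] n = \<one> \<longleftrightarrow> x [^] n \<otimes> w = w" using assms(1,3) by (simp add: r_cancel_one)
  also have "\<dots> \<longleftrightarrow> w \<otimes> y [^] n = w" by (simp add: conj_pow[OF assms])
  also have "\<dots> \<longleftrightarrow> y [^] n = \<one>" using assms(2,3) by (simp add: l_cancel_one)
  finally show ?thesis .
qed

end

text \<open>Let p be the least prime factor of n. Modulo p, the n-th power of 2 is 1, and so is the
  (p - 1)-th by Fermat. The two exponents are coprime, as every prime factor of p - 1 is less than
  p. Hence 2 would be 1 modulo p.\<close>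

lemma dvd_two_power_minus_one:
  assumes "n dvd 2 ^ n - 1" "n > 0" shows "n = (1 :: nat)"
proof (rule ccontr)
  assume "n \<noteq> 1"
  define p where "p = (LEAST p. prime p \<and> p dvd n)"
  have ex: "\<exists>p. prime p \<and> p dvd n" using \<open>n \<noteq> 1\<close> by (rule prime_factor_nat)
  then have p: "prime p" "p dvd n" unfolding p_def by (metis (mono_tags, lifting) LeastI)+
  have least: "p \<le> r" if "prime r" "r dvd n" for r unfolding p_def by (rule Least_le) (use that in simp)
  have p2: "p dvd 2 ^ n - 1" using p(2) assms(1) by (rule dvd_trans)
  then have n1: "[2 ^ n = 1] (mod p)" by (subst cong_altdef_nat) simp_all
  have "odd p"
  proof
    assume "even p"
    then have "even ((2 :: nat) ^ n - 1)" using p2 dvd_trans by blast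
    then show False using assms(2) by simp
  qed
  then have "\<not> p dvd 2" using p(1) by (metis dvd_refl primes_dvd_imp_eq two_is_prime_nat)
  then have fermat: "[2 ^ (p - 1) = 1] (mod p)" by (rule fermat_theorem[OF p(1)])
  have "coprime n (p - 1)"
  proof (rule ccontr)
    assume "\<not> coprime n (p - 1)"
    then obtain r where r: "prime r" "r dvd n" "r dvd p - 1" 
      using prime_factor_nat[of "gcd n (p - 1)"] by (auto simp: coprime_iff_gcd_eq_1)
    then have "r \<le> p - 1" using p(1) by (intro dvd_imp_le) (auto simp: prime_gt_Suc_0_nat)
    then show False using least[OF r(1,2)] prime_gt_1_nat[OF p(1)] by simp
  qed
  then obtain x y where xy: "n * x = (p - 1) * y + 1"
    using bezout_nat[of n "p - 1"] assms(2) by (auto simp: coprime_iff_gcd_eq_1)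
  have "[1 = 2 ^ (n * x)] (mod p)" using cong_pow[OF n1, of x] by (simp add: power_mult cong_sym_eq)
  also have "2 ^ (n * x) = 2 ^ ((p - 1) * y) * (2 :: nat)" by (simp add: xy)
  also have "[2 ^ ((p - 1) * y) * 2 = 1 * 2] (mod p)"
    using cong_pow[OF fermat, of y] by (intro cong_mult) (simp_all add: power_mult)
  finally have "[1 = 2] (mod p)" by simp
  then show False using prime_gt_1_nat[OF p(1)] \<open>odd p\<close>
    by (cases "p = 2") (auto simp: cong_def)
qed

text \<open>Both \<open>a = f E13\<close> and \<open>v = g E13\<close> are conjugate to \<open>f E12\<close>, so they have the same order n, and
  the relation \<open>a v = v a\<^sup>2\<close> gives \<open>a = a\<^bsup>2^n\<^esup>\<close>.\<close>

lemma (in group) baumslag_trivial: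
  assumes fin: "finite (carrier G)"
    and f: "elementary_relations G f" and g: "elementary_relations G g" and fg: "f E12 = g E12"
    and av: "f E13 \<otimes> g E13 = g E13 \<otimes> (f E13 \<otimes> f E13)"
  shows "f r = \<one>" "g r = \<one>"
proof -
  define a v z n where "a = f E13" "v = g E13" "z = f E12" "n = ord z"
  note d = this
  have c: "f r \<in> carrier G" "g r \<in> carrier G" for r
    using f g by (simp_all add: elementary_relations_def)
  then have cl: "a \<in> carrier G" "v \<in> carrier G" "z \<in> carrier G" by (simp_all add: d)
  have za: "z [^] (k :: nat) = \<one> \<longleftrightarrow> a [^] k = \<one>" for k
    unfolding d by (rule conj_pow_one[OF c(1) c(1) weyl_closed[of f, OF c(1)]])
      (use f in \<open>simp add: elementary_relations_def\<close>)
  have zv: "z [^] (k :: nat) = \<one> \<longleftrightarrow> v [^] k = \<one>" for k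
    unfolding d fg by (rule conj_pow_one[OF c(2) c(2) weyl_closed[of g, OF c(2)]])
      (use g in \<open>simp add: elementary_relations_def\<close>)
  have av': "a [^] (k * 2 ^ m) \<otimes> v = v \<otimes> a [^] (k * 2 ^ Suc m)" for k m :: nat
    using conj_pow[of a "a \<otimes> a" v "k * 2 ^ m"] av cl
    by (simp add: d(1,2)[symmetric] pow_mult_distrib nat_pow_mult mult_2[symmetric] mult.left_commute)
  have "a \<otimes> v [^] m = v [^] m \<otimes> a [^] (2 ^ m :: nat)" for m :: nat
  proof (induct m)
    case (Suc m)
    have "a \<otimes> v [^] Suc m = v [^] m \<otimes> (a [^] (2 ^ m :: nat) \<otimes> v)" using cl Suc by (simp add: m_assoc[symmetric])
    also have "\<dots> = v [^] Suc m \<otimes> a [^] (2 ^ Suc m :: nat)"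
      using av'[of 1 m] cl by (simp add: m_assoc)
    finally show ?case .
  qed (use cl in simp)
  moreover have zn: "z [^] n = \<one>" using cl by (simp add: d)
  moreover have "v [^] n = \<one>" using zn zv by simp
  \<comment> \<open>For m = n, conjugation by the power of v is trivial, but it also raises a to the
    power 2^n.\<close>
  ultimately have an: "a = a [^] (2 ^ n :: nat)" using cl by (metis l_one nat_pow_closed r_one)
  have "a [^] (2 ^ n - 1 :: nat) \<otimes> a = a [^] (2 ^ n :: nat)"
    using nat_pow_Suc[of a "2 ^ n - 1"] by (simp del: nat_pow_Suc)
  then have "a [^] (2 ^ n - 1 :: nat) = \<one>" using an cl by (simp add: r_cancel_one)
  then have "n dvd 2 ^ n - 1" using za cl(3) by (simp add: d pow_eq_id)
  moreover have "n > 0" using ord_ge_1[OF fin cl(3)] by (simp add: d)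
  ultimately have "n = 1" by (rule dvd_two_power_minus_one)
  then have "z = \<one>" using zn cl by simp
  then show "f r = \<one>" "g r = \<one>" using elementary_relations_trivial f g fg by (simp_all add: d)
qed

section \<open>The presentation from two copies of the elementary relations\<close>

type_synonym copy_letter = "bool \<times> root"

type_synonym copy_word = "(copy_letter \<times> bool) list"

definition copy :: "bool \<Rightarrow> root \<Rightarrow> copy_word"
  where "copy l r = letter (l, r)"

abbreviation FG :: "copy_word monoid"
  where "FG \<equiv> free_group"

text \<open>This is the defect in the identification of the two copies of e_12. Killing it would
  amalgamate them; made central, it becomes z.\<close>

definition central_word :: copy_word
  where "central_word = inv\<^bsub>FG\<^esub> copy False E12 \<otimes>\<^bsub>FG\<^esub> copy True E12"

definition weyl_word :: "bool \<Rightarrow> copy_word"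
  where "weyl_word l = inv\<^bsub>FG\<^esub> (weyl FG (copy l) \<otimes>\<^bsub>FG\<^esub> copy l E13) \<otimes>\<^bsub>FG\<^esub> (copy l E12 \<otimes>\<^bsub>FG\<^esub> weyl FG (copy l))"

definition baumslag_word :: copy_word
  where "baumslag_word =
    inv\<^bsub>FG\<^esub> (copy True E13 \<otimes>\<^bsub>FG\<^esub> (copy False E13 \<otimes>\<^bsub>FG\<^esub> copy False E13)) \<otimes>\<^bsub>FG\<^esub>
    (copy False E13 \<otimes>\<^bsub>FG\<^esub> copy True E13)"

text \<open>The presentation admits a relator outright only if it expresses a letter as a
  commutator. The Weyl and Baumslag relations do not have this form, so they too are imposed only up
  to central elements.\<close>

definition central_words :: "copy_word set"
  where "central_words = {central_word, baumslag_word} \<union> range weyl_word"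

lemma finite_central_words: "finite central_words"
  by (simp add: central_words_def)

lemma copy_closed: "copy l r \<in> carrier FG"
  by (simp add: copy_def)

lemma words_closed:
  "central_word \<in> carrier FG" "baumslag_word \<in> carrier FG" "weyl_word l \<in> carrier FG"
  unfolding central_word_def baumslag_word_def weyl_word_def
  by (intro free_group.m_closed free_group.inv_closed copy_closed free_group.weyl_closed)+

lemma (in group) inv_mult_eq_one_iff:
  assumes "x \<in> carrier G" "y \<in> carrier G" shows "inv x \<otimes> y = \<one> \<longleftrightarrow> y = x"
  using inv_mult_eq_oneD[OF _ assms] assms by auto

lemma words_hom:
  assumes "group_hom FG H \<nu>"
  shows "\<nu> central_word = inv\<^bsub>H\<^esub> \<nu> (copy False E12) \<otimes>\<^bsub>H\<^esub> \<nu> (copy True E12)"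
    "\<nu> baumslag_word = \<one>\<^bsub>H\<^esub> \<longleftrightarrow> \<nu> (copy False E13) \<otimes>\<^bsub>H\<^esub> \<nu> (copy True E13) =
       \<nu> (copy True E13) \<otimes>\<^bsub>H\<^esub> (\<nu> (copy False E13) \<otimes>\<^bsub>H\<^esub> \<nu> (copy False E13))"
    "\<nu> (weyl_word l) = \<one>\<^bsub>H\<^esub> \<longleftrightarrow> \<nu> (copy l E12) \<otimes>\<^bsub>H\<^esub> weyl H (\<lambda>r. \<nu> (copy l r)) =
       weyl H (\<lambda>r. \<nu> (copy l r)) \<otimes>\<^bsub>H\<^esub> \<nu> (copy l E13)"
proof -
  interpret n: group_hom FG H \<nu> by fact
  note c = copy_closed free_group.m_closed free_group.inv_closed
  have h: "\<nu> (inv\<^bsub>FG\<^esub> x \<otimes>\<^bsub>FG\<^esub> y) = inv\<^bsub>H\<^esub> \<nu> x \<otimes>\<^bsub>H\<^esub> \<nu> y" if "x \<in> carrier FG" "y \<in> carrier FG" for x y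
    using n.hom_mult[OF free_group.inv_closed[OF that(1)] that(2)] n.hom_inv[OF that(1)] by simp
  have e: "\<nu> (inv\<^bsub>FG\<^esub> x \<otimes>\<^bsub>FG\<^esub> y) = \<one>\<^bsub>H\<^esub> \<longleftrightarrow> \<nu> y = \<nu> x" if "x \<in> carrier FG" "y \<in> carrier FG" for x y
    unfolding h[OF that] by (rule n.H.inv_mult_eq_one_iff) (use that n.hom_closed in blast)+
  show "\<nu> central_word = inv\<^bsub>H\<^esub> \<nu> (copy False E12) \<otimes>\<^bsub>H\<^esub> \<nu> (copy True E12)"
    unfolding central_word_def by (rule h[OF copy_closed copy_closed])
  have aa: "copy False E13 \<otimes>\<^bsub>FG\<^esub> copy False E13 \<in> carrier FG"
    by (rule free_group.m_closed[OF copy_closed copy_closed])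
  show "\<nu> baumslag_word = \<one>\<^bsub>H\<^esub> \<longleftrightarrow> \<nu> (copy False E13) \<otimes>\<^bsub>H\<^esub> \<nu> (copy True E13) =
       \<nu> (copy True E13) \<otimes>\<^bsub>H\<^esub> (\<nu> (copy False E13) \<otimes>\<^bsub>H\<^esub> \<nu> (copy False E13))"
    unfolding baumslag_word_def e[OF free_group.m_closed[OF copy_closed aa] free_group.m_closed[OF copy_closed copy_closed]]
      n.hom_mult[OF copy_closed aa] n.hom_mult[OF copy_closed copy_closed] by (rule refl)
  have w: "weyl FG (copy l) \<in> carrier FG" by (rule free_group.weyl_closed[OF copy_closed])
  show "\<nu> (weyl_word l) = \<one>\<^bsub>H\<^esub> \<longleftrightarrow> \<nu> (copy l E12) \<otimes>\<^bsub>H\<^esub> weyl H (\<lambda>r. \<nu> (copy l r)) =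
       weyl H (\<lambda>r. \<nu> (copy l r)) \<otimes>\<^bsub>H\<^esub> \<nu> (copy l E13)"
    unfolding weyl_word_def e[OF free_group.m_closed[OF w copy_closed] free_group.m_closed[OF copy_closed w]]
      n.hom_mult[OF w copy_closed] n.hom_mult[OF copy_closed w] n.hom_weyl[of "copy l", OF copy_closed] by (rule refl)
qed

definition left_letter :: "copy_letter \<Rightarrow> copy_letter"
  where "left_letter a = (fst a, left_root (snd a))"

definition right_letter :: "copy_letter \<Rightarrow> copy_letter"
  where "right_letter a = (fst a, right_root (snd a))"

lemma presentation_trivial:
  assumes K: "K \<in> finite_index_normal FG" and R: "central_words \<subseteq> K"
    and S: "\<And>a. inv\<^bsub>FG\<^esub> letter a \<otimes>\<^bsub>FG\<^esub> comm FG (letter (left_letter a)) (letter (right_letter a)) \<in> K"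
  shows "K = carrier FG"
proof -
  note K' = finite_index_normalD[OF K]
  define E \<nu> where "E = FG Mod K" and "\<nu> = (\<lambda>g. K #>\<^bsub>FG\<^esub> g)"
  have finE: "finite (carrier E)" using K by (simp add: E_def finite_index_normal_def)
  have \<nu>: "group_hom FG E \<nu>"
    using K'(1) group_free_group normal.factorgroup_is_group normal.r_coset_hom_Mod
    unfolding group_hom_def group_hom_axioms_def E_def \<nu>_def by blast
  interpret n: group_hom FG E \<nu> by fact
  have \<nu>1: "\<nu> g = \<one>\<^bsub>E\<^esub> \<longleftrightarrow> g \<in> K" if "g \<in> carrier FG" for g
    using free_group.coset_join1[OF _ that K'(2)] free_group.coset_join2[OF that K'(2)] subgroup.subset[OF K'(2)]
    unfolding E_def \<nu>_def FactGroup_def by auto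
  have nc: "\<nu> (copy l r) \<in> carrier E" for l r by (rule n.hom_closed[OF copy_closed])
  have el: "elementary_relations E (\<lambda>r. \<nu> (copy l r))" for l
    unfolding elementary_relations_def
  proof (intro conjI allI)
    fix r
    show "\<nu> (copy l r) \<in> carrier E" by (rule nc)
    have c: "comm FG (copy l (left_root r)) (copy l (right_root r)) \<in> carrier FG"
      by (rule free_group.comm_closed[OF copy_closed copy_closed])
    have "\<nu> (inv\<^bsub>FG\<^esub> copy l r \<otimes>\<^bsub>FG\<^esub> comm FG (copy l (left_root r)) (copy l (right_root r))) = \<one>\<^bsub>E\<^esub>"
      using S[of "(l, r)"] \<nu>1[OF free_group.m_closed[OF free_group.inv_closed[OF copy_closed] c]]
      by (simp add: left_letter_def right_letter_def copy_def del: free_group_simps)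
    then have "inv\<^bsub>E\<^esub> \<nu> (copy l r) \<otimes>\<^bsub>E\<^esub> \<nu> (comm FG (copy l (left_root r)) (copy l (right_root r))) = \<one>\<^bsub>E\<^esub>"
      using n.hom_mult[OF free_group.inv_closed[OF copy_closed] c] n.hom_inv[OF copy_closed] by simp
    then show "comm E (\<nu> (copy l (left_root r))) (\<nu> (copy l (right_root r))) = \<nu> (copy l r)"
      using n.H.inv_mult_eq_one_iff[OF nc n.hom_closed[OF c]] n.hom_comm[OF copy_closed copy_closed] by simp
  next
    show "\<nu> (copy l E12) \<otimes>\<^bsub>E\<^esub> weyl E (\<lambda>r. \<nu> (copy l r)) = weyl E (\<lambda>r. \<nu> (copy l r)) \<otimes>\<^bsub>E\<^esub> \<nu> (copy l E13)"
      using words_hom(3)[OF \<nu>, of l] \<nu>1[OF words_closed(3), of l] R by (auto simp: central_words_def)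
  qed
  have "inv\<^bsub>E\<^esub> \<nu> (copy False E12) \<otimes>\<^bsub>E\<^esub> \<nu> (copy True E12) = \<one>\<^bsub>E\<^esub>"
    using words_hom(1)[OF \<nu>] \<nu>1[OF words_closed(1)] R by (auto simp: central_words_def)
  then have z: "\<nu> (copy False E12) = \<nu> (copy True E12)"
    using n.H.inv_mult_eq_one_iff[OF nc nc] by simp
  have bs: "\<nu> (copy False E13) \<otimes>\<^bsub>E\<^esub> \<nu> (copy True E13) =
       \<nu> (copy True E13) \<otimes>\<^bsub>E\<^esub> (\<nu> (copy False E13) \<otimes>\<^bsub>E\<^esub> \<nu> (copy False E13))"
    using words_hom(2)[OF \<nu>] \<nu>1[OF words_closed(2)] R by (auto simp: central_words_def)
  have "\<nu> (copy l r) = \<one>\<^bsub>E\<^esub>" for l r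
    using n.H.baumslag_trivial[OF finE el el z bs, of r] by (cases l) auto
  then have "range letter \<subseteq> K"
    using \<nu>1[OF copy_closed] by (auto simp: copy_def)
  then show ?thesis by (rule free_group_subgroup_eq[OF K'(2)])
qed

interpretation presentation: perfect_presentation left_letter right_letter central_words central_word
proof
  show "central_words \<subseteq> carrier FG" using words_closed by (auto simp: central_words_def)
  show "central_word \<in> central_words" by (simp add: central_words_def)
qed (rule presentation_trivial)

text \<open>This reduces the order of z to a model. The two copies are interpreted by f and g, for
  which all relations hold exactly, except that the images of e_12 differ by an element t that
  commutes with everything. The induced homomorphism then kills N and maps
  \<open>central_word\<close> to t.\<close>

lemma central_word_int_pow:
  fixes f g :: "root \<Rightarrow> 'h"
  assumes H: "Group.group H" and f: "elementary_relations H f" and g: "elementary_relations H g"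
    and bs: "f E13 \<otimes>\<^bsub>H\<^esub> g E13 = g E13 \<otimes>\<^bsub>H\<^esub> (f E13 \<otimes>\<^bsub>H\<^esub> f E13)"
    and t: "t \<in> carrier H" "g E12 = f E12 \<otimes>\<^bsub>H\<^esub> t"
    and tf: "\<And>r. t \<otimes>\<^bsub>H\<^esub> f r = f r \<otimes>\<^bsub>H\<^esub> t" and tg: "\<And>r. t \<otimes>\<^bsub>H\<^esub> g r = g r \<otimes>\<^bsub>H\<^esub> t"
    and j: "central_word [^]\<^bsub>FG\<^esub> (j :: int) \<in> presentation.N"
  shows "t [^]\<^bsub>H\<^esub> j = \<one>\<^bsub>H\<^esub>"
proof -
  interpret H: Group.group H by fact
  define k where "k = (\<lambda>a :: copy_letter. if fst a then g (snd a) else f (snd a))"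
  have kH: "k a \<in> carrier H" for a using f g by (simp add: k_def elementary_relations_def)
  define \<mu> where "\<mu> = free_hom H k"
  have "\<mu> \<in> hom FG H" unfolding \<mu>_def by (rule free_hom(1)[OF H kH])
  then have \<mu>: "group_hom FG H \<mu>" using H group_free_group by (simp add: group_hom_def group_hom_axioms_def)
  interpret m: group_hom FG H \<mu> by fact
  have \<mu>l: "\<mu> (letter a) = k a" for a unfolding \<mu>_def by (rule free_hom(2)[OF H kH])
  have \<mu>c: "\<mu> (copy False r) = f r" "\<mu> (copy True r) = g r" for r by (simp_all add: copy_def \<mu>l k_def)
  have fg: "f r \<in> carrier H" "g r \<in> carrier H" for r using f g by (simp_all add: elementary_relations_def)
  have c: "\<mu> central_word = t" unfolding words_hom(1)[OF \<mu>] \<mu>c t(2) by (rule H.cancel_left(1)[OF fg(1) t(1)])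
  have b: "\<mu> baumslag_word = \<one>\<^bsub>H\<^esub>" unfolding words_hom(2)[OF \<mu>] \<mu>c by (rule bs)
  have w: "\<mu> (weyl_word l) = \<one>\<^bsub>H\<^esub>" for l
    unfolding words_hom(3)[OF \<mu>] using f g by (cases l) (simp_all add: \<mu>c elementary_relations_def)
  have kt: "t \<otimes>\<^bsub>H\<^esub> k a = k a \<otimes>\<^bsub>H\<^esub> t" for a using tf tg by (simp add: k_def)
  have r: "\<mu> (comm FG r (letter a)) = \<one>\<^bsub>H\<^esub>" if "r \<in> central_words" for r a
  proof -
    have rF: "r \<in> carrier FG" using that words_closed by (auto simp: central_words_def)
    have "\<mu> r = t \<or> \<mu> r = \<one>\<^bsub>H\<^esub>" using that c b w by (auto simp: central_words_def)
    then have "\<mu> r \<otimes>\<^bsub>H\<^esub> k a = k a \<otimes>\<^bsub>H\<^esub> \<mu> r" using kt[of a] kH[of a] by (elim disjE) simp_all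
    then show ?thesis using m.comm_kernel_iff[OF rF presentation.letter_F] by (simp add: \<mu>l)
  qed
  have s: "\<mu> (inv\<^bsub>FG\<^esub> letter a \<otimes>\<^bsub>FG\<^esub> comm FG (letter (left_letter a)) (letter (right_letter a))) = \<one>\<^bsub>H\<^esub>" for a
  proof -
    have c: "comm FG (letter (left_letter a)) (letter (right_letter a)) \<in> carrier FG"
      by (rule free_group.comm_closed[OF presentation.letter_F presentation.letter_F])
    have "comm H (k (left_letter a)) (k (right_letter a)) = k a"
      using f g by (simp add: k_def left_letter_def right_letter_def elementary_relations_def)
    then show ?thesis
      unfolding m.hom_mult[OF free_group.inv_closed[OF presentation.letter_F] c] m.hom_inv[OF presentation.letter_F]
        m.hom_comm[OF presentation.letter_F presentation.letter_F] \<mu>l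
      using kH by simp
  qed
  have "presentation.N \<subseteq> kernel FG H \<mu>"
  proof (rule presentation.N_least[OF m.normal_kernel])
    have "\<mu> u = \<one>\<^bsub>H\<^esub>" if "u \<in> presentation.T" for u
      using that r s unfolding presentation.T_def presentation.S_def by (fastforce simp del: free_group_simps)
    then show "presentation.T \<subseteq> kernel FG H \<mu>"
      using presentation.T_closed unfolding kernel_def by blast
  qed
  then have "\<mu> (central_word [^]\<^bsub>FG\<^esub> j) = \<one>\<^bsub>H\<^esub>" using j by (auto simp: kernel_def)
  then show ?thesis using m.hom_int_pow[OF words_closed(1)] c by simp
qed

section \<open>Free actions of abelian groups on countable sets\<close>

definition free_action :: "('u :: ab_group_add \<Rightarrow> 's \<Rightarrow> 's) \<Rightarrow> 's set \<Rightarrow> bool"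
  where "free_action \<alpha> S \<longleftrightarrow>
    (\<forall>s \<in> S. \<alpha> 0 s = s \<and> (\<forall>u. \<alpha> u s \<in> S \<and> (\<alpha> u s = s \<longrightarrow> u = 0) \<and> (\<forall>v. \<alpha> (u + v) s = \<alpha> u (\<alpha> v s))))"

text \<open>Taking the product with the natural numbers makes the number of orbits infinite, so that any
  two free actions become isomorphic.\<close>

lemma free_action_coordinates:
  fixes \<alpha> :: "'u :: ab_group_add \<Rightarrow> 's \<Rightarrow> 's"
  assumes \<alpha>: "free_action \<alpha> S" and S: "countable S" "S \<noteq> {}"
  obtains h :: "'u \<times> nat \<Rightarrow> 's \<times> nat" where "bij_betw h UNIV (S \<times> UNIV)"
    "\<And>u v n. h (u + v, n) = (\<alpha> u (fst (h (v, n))), snd (h (v, n)))"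
proof -
  have a0: "\<alpha> 0 s = s" and ac: "\<alpha> u s \<in> S" and af: "\<alpha> u s = s \<Longrightarrow> u = 0"
    and ap: "\<alpha> (u + v) s = \<alpha> u (\<alpha> v s)" if "s \<in> S" for s u v
    using \<alpha> that by (auto simp: free_action_def)
  define orb where "orb = (\<lambda>s. range (\<lambda>u. \<alpha> u s))"
  have orb_act: "orb (\<alpha> u s) = orb s" if "s \<in> S" for u s
  proof -
    have "\<alpha> v (\<alpha> u s) = \<alpha> (v + u) s" "\<alpha> v s = \<alpha> (v - u) (\<alpha> u s)" for v
      using ap[OF that, of v u] ap[OF that, of "v - u" u] by simp_all
    then show ?thesis unfolding orb_def by (intro subset_antisym image_subsetI range_eqI)
  qed
  define rep where "rep = (\<lambda>s. SOME t. t \<in> orb s)"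
  have "rep s \<in> orb s" for s unfolding rep_def by (rule someI[of _ "\<alpha> 0 s"]) (simp add: orb_def)
  then have rep: "\<exists>u. rep s = \<alpha> u s" for s by (auto simp: orb_def)
  have rep_act: "rep (\<alpha> u s) = rep s" if "s \<in> S" for u s by (simp add: rep_def orb_act[OF that])
  have rep_rep: "rep (rep s) = rep s" if "s \<in> S" for s using rep[of s] rep_act[OF that] by metis
  have repS: "rep s \<in> S" if "s \<in> S" for s using rep[of s] ac[OF that] by metis
  define e where "e = from_nat_into (rep ` S \<times> (UNIV :: nat set))"
  have e: "bij_betw e UNIV (rep ` S \<times> UNIV)"
    unfolding e_def using S by (intro bij_betw_from_nat_into) (auto simp: finite_cartesian_product_iff)
  define h where "h = (\<lambda>(u, n). (\<alpha> u (fst (e n)), snd (e n)))"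
  have eS: "fst (e n) \<in> rep ` S" for n using bij_betw_apply[OF e, of n] by auto
  then have eS': "fst (e n) \<in> S" "rep (fst (e n)) = fst (e n)" for n
    using repS rep_rep by (metis imageE)+
  have "inj h"
  proof (rule injI, clarify)
    fix u n v m assume "h (u, n) = h (v, m)"
    then have eq: "\<alpha> u (fst (e n)) = \<alpha> v (fst (e m))" "snd (e n) = snd (e m)" by (simp_all add: h_def)
    then have "fst (e n) = fst (e m)" using rep_act[OF eS'(1)] eS'(2) by metis
    then have "e n = e m" using eq(2) by (simp add: prod_eq_iff)
    then have "n = m" using e by (auto simp: bij_betw_def inj_on_def)
    moreover have "\<alpha> (v - u) (\<alpha> u (fst (e n))) = \<alpha> u (fst (e n))"
      using ap[OF eS'(1), of "v - u" u n] eq(1) \<open>e n = e m\<close> by simp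
    then have "v - u = 0" by (rule af[OF ac[OF eS'(1)]])
    ultimately show "u = v \<and> n = m" by simp
  qed
  moreover have "range h = S \<times> UNIV"
  proof (intro subset_antisym subsetI)
    fix p assume "p \<in> range h"
    then show "p \<in> S \<times> UNIV" using ac eS'(1) by (auto simp: h_def)
  next
    fix p assume "p \<in> S \<times> (UNIV :: nat set)"
    then obtain s k where p: "p = (s, k)" "s \<in> S" by auto
    obtain u where u: "rep s = \<alpha> u s" using rep by blast
    have "(rep s, k) \<in> range e" using e p(2) by (auto simp: bij_betw_def)
    then obtain n where n: "e n = (rep s, k)" by (metis imageE)
    have "\<alpha> (- u) (\<alpha> u s) = s" using ap[OF p(2), of "- u" u] a0[OF p(2)] by simp
    then have "h (- u, n) = p" by (simp add: h_def n u p(1))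
    then show "p \<in> range h" by blast
  qed
  ultimately have "bij_betw h UNIV (S \<times> UNIV)" by (simp add: bij_betw_def)
  moreover have "h (u + v, n) = (\<alpha> u (fst (h (v, n))), snd (h (v, n)))" for u v n
    using ap[OF eS'(1)] by (simp add: h_def)
  ultimately show ?thesis by (rule that)
qed

text \<open>Both actions are compared with the same standard one, the translations on countably many
  copies of the acting group.\<close>

lemma free_actions_isomorphic:
  fixes \<alpha> :: "'u :: ab_group_add \<Rightarrow> 's \<Rightarrow> 's" and \<beta> :: "'u \<Rightarrow> 't \<Rightarrow> 't"
  assumes \<alpha>: "free_action \<alpha> S" "countable S" "S \<noteq> {}" and \<beta>: "free_action \<beta> T" "countable T" "T \<noteq> {}"
  obtains g :: "'s \<times> nat \<Rightarrow> 't \<times> nat" where "bij_betw g (S \<times> UNIV) (T \<times> UNIV)"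
    "\<And>u s n. s \<in> S \<Longrightarrow> g (\<alpha> u s, n) = (\<beta> u (fst (g (s, n))), snd (g (s, n)))"
proof -
  obtain h :: "'u \<times> nat \<Rightarrow> 's \<times> nat" where h: "bij_betw h UNIV (S \<times> UNIV)"
    "\<And>u v n. h (u + v, n) = (\<alpha> u (fst (h (v, n))), snd (h (v, n)))"
    using free_action_coordinates[OF \<alpha>] by blast
  obtain k :: "'u \<times> nat \<Rightarrow> 't \<times> nat" where k: "bij_betw k UNIV (T \<times> UNIV)"
    "\<And>u v n. k (u + v, n) = (\<beta> u (fst (k (v, n))), snd (k (v, n)))"
    using free_action_coordinates[OF \<beta>] by blast
  define g where "g = k \<circ> inv_into UNIV h"
  have inj: "inj h" using h(1) by (simp add: bij_betw_def)
  show ?thesis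
  proof (rule that[of g])
    show "bij_betw g (S \<times> UNIV) (T \<times> UNIV)"
      unfolding g_def by (rule bij_betw_trans[OF bij_betw_inv_into[OF h(1)] k(1)])
    fix u s n assume "s \<in> S"
    then have "(s, n) \<in> range h" using h(1) by (auto simp: bij_betw_def)
    then obtain v m where v: "(s, n) = h (v, m)" by (metis imageE surj_pair)
    then have "(\<alpha> u s, n) = h (u + v, m)" by (simp add: h(2) flip: v)
    then have "g (\<alpha> u s, n) = k (u + v, m)" by (simp only: g_def o_apply inv_f_f[OF inj])
    moreover have "g (s, n) = k (v, m)" by (simp only: v g_def o_apply inv_f_f[OF inj])
    ultimately show "g (\<alpha> u s, n) = (\<beta> u (fst (g (s, n))), snd (g (s, n)))" by (simp add: k(2))
  qed
qed

lemma BijGroup_eqI: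
  assumes "f \<in> carrier (BijGroup B)" "g \<in> carrier (BijGroup B)" "\<And>x. x \<in> B \<Longrightarrow> f x = g x"
  shows "f = g"
  by (rule extensionalityI[of _ B]) (use assms in \<open>auto simp: BijGroup_def Bij_def\<close>)

lemma BijGroup_conj:
  assumes g: "bij_betw g B C"
  shows "group_hom (BijGroup C) (BijGroup B) (\<lambda>f. \<lambda>x\<in>B. inv_into B g (f (g x)))"
proof -
  have c: "(\<lambda>x\<in>B. inv_into B g (f (g x))) \<in> carrier (BijGroup B)" if "f \<in> carrier (BijGroup C)" for f
  proof -
    have "bij_betw f C C" using that by (simp add: BijGroup_def Bij_def)
    then have "bij_betw (inv_into B g \<circ> (f \<circ> g)) B B"
      by (intro bij_betw_trans[OF bij_betw_trans[OF g] bij_betw_inv_into[OF g]])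
    then show ?thesis by (simp add: BijGroup_def Bij_def o_def)
  qed
  have "(\<lambda>f. \<lambda>x\<in>B. inv_into B g (f (g x))) \<in> hom (BijGroup C) (BijGroup B)"
  proof (rule homI[OF c], assumption, rule BijGroup_eqI)
    fix f f' assume f: "f \<in> carrier (BijGroup C)" and f': "f' \<in> carrier (BijGroup C)"
    interpret C: Group.group "BijGroup C" by (rule group_BijGroup)
    interpret B: Group.group "BijGroup B" by (rule group_BijGroup)
    show "(\<lambda>x\<in>B. inv_into B g ((f \<otimes>\<^bsub>BijGroup C\<^esub> f') (g x))) \<in> carrier (BijGroup B)"
      by (rule c[OF C.m_closed[OF f f']])
    show "(\<lambda>x\<in>B. inv_into B g (f (g x))) \<otimes>\<^bsub>BijGroup B\<^esub> (\<lambda>x\<in>B. inv_into B g (f' (g x))) \<in> carrier (BijGroup B)"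
      by (rule B.m_closed[OF c[OF f] c[OF f']])
    fix x assume x: "x \<in> B"
    then have gx: "g x \<in> C" using g by (auto simp: bij_betw_def)
    then have fgx: "f' (g x) \<in> C" using f' by (auto simp: BijGroup_def Bij_def bij_betw_def)
    then have "inv_into B g (f' (g x)) \<in> B" "g (inv_into B g (f' (g x))) = f' (g x)"
      using g by (auto simp: bij_betw_def inv_into_into f_inv_into_f)
    then show "(\<lambda>x\<in>B. inv_into B g ((f \<otimes>\<^bsub>BijGroup C\<^esub> f') (g x))) x =
        ((\<lambda>x\<in>B. inv_into B g (f (g x))) \<otimes>\<^bsub>BijGroup B\<^esub> (\<lambda>x\<in>B. inv_into B g (f' (g x)))) x"
      using x by (simp add: BijGroup_mult_apply[OF c[OF f] c[OF f'] x] BijGroup_mult_apply[OF f f' gx])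
  qed
  then show ?thesis by (simp add: group_hom_def group_hom_axioms_def group_BijGroup)
qed

section \<open>Elementary row operations on frames\<close>

type_synonym row = "int \<times> int \<times> int"

definition scale :: "int \<Rightarrow> row \<Rightarrow> row"
  where "scale s x = (s * fst x, s * fst (snd x), s * snd (snd x))"

lemma scale_simps [simp]:
  "scale 0 x = 0" "scale 1 x = x" "scale s (x + y) = scale s x + scale s y"
  "scale s (scale t x) = scale (s * t) x"
  by (simp_all add: scale_def prod_eq_iff algebra_simps)

lemma scale_add: "scale (s + t) x = scale s x + scale t x"
  by (simp add: scale_def prod_eq_iff algebra_simps)

lemma scale_minus: "scale (- s) x = - scale s x"
  by (simp add: scale_def prod_eq_iff)

definition independent_rows :: "row \<Rightarrow> row \<Rightarrow> row \<Rightarrow> bool"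
  where "independent_rows x y z \<longleftrightarrow>
    (\<forall>i j k. scale i x + scale j y + scale k z = 0 \<longrightarrow> i = 0 \<and> j = 0 \<and> k = 0)"

lemma independent_rows_perm:
  assumes "independent_rows x y z" shows "independent_rows y z x" "independent_rows y x z"
  using assms by (simp_all add: independent_rows_def add_ac) (metis add.commute add.left_commute)+

lemma independent_rows_add:
  assumes "independent_rows x y z" shows "independent_rows (x + scale s y) y z"
  unfolding independent_rows_def
proof (intro allI impI)
  fix i j k assume "scale i (x + scale s y) + scale j y + scale k z = 0"
  then have "scale i x + scale (i * s + j) y + scale k z = 0"
    by (simp add: scale_add add_ac)
  then have "i = 0 \<and> i * s + j = 0 \<and> k = 0" using assms unfolding independent_rows_def by blast
  then show "i = 0 \<and> j = 0 \<and> k = 0" by auto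
qed

fun elementary :: "root \<Rightarrow> int \<Rightarrow> row \<times> row \<times> row \<Rightarrow> row \<times> row \<times> row"
  where
    "elementary E12 s (x, y, z) = (x + scale s y, y, z)"
  | "elementary E13 s (x, y, z) = (x + scale s z, y, z)"
  | "elementary E21 s (x, y, z) = (x, y + scale s x, z)"
  | "elementary E23 s (x, y, z) = (x, y + scale s z, z)"
  | "elementary E31 s (x, y, z) = (x, y, z + scale s x)"
  | "elementary E32 s (x, y, z) = (x, y, z + scale s y)"

text \<open>Independence is what makes the operations E12 and E13 act freely, and row operations
  preserve it; in this way determinants and matrix products are avoided.\<close>

definition frames :: "(row \<times> row \<times> row) set"
  where "frames = {(x, y, z). independent_rows x y z}"

lemma elementary_frames:
  assumes "t \<in> frames" shows "elementary r s t \<in> frames"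
proof -
  obtain x y z where t: "t = (x, y, z)" "independent_rows x y z" using assms by (auto simp: frames_def)
  note p = independent_rows_perm and a = independent_rows_add[where s = s]
  have "independent_rows (x + scale s y) y z" by (rule a[OF t(2)])
  moreover have "independent_rows (x + scale s z) y z"
    using t(2) p a by meson
  moreover have "independent_rows x (y + scale s x) z" "independent_rows x (y + scale s z) z"
    using t(2) p a by meson+
  moreover have "independent_rows x y (z + scale s x)" "independent_rows x y (z + scale s y)"
    using t(2) p a by meson+
  ultimately show ?thesis by (cases r) (simp_all add: t(1) frames_def)
qed

lemma elementary_add: "elementary r (s + s') t = elementary r s (elementary r s' t)"
  by (cases t; cases r) (simp_all add: scale_add add_ac)

lemma elementary_0: "elementary r 0 t = t"
  by (cases t; cases r) simp_all

lemma elementary_comm: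
  "elementary (left_root r) 1 (elementary (right_root r) 1 t) =
    elementary r 1 (elementary (right_root r) 1 (elementary (left_root r) 1 t))"
  by (cases t; cases r) (simp_all add: add_ac)

lemma elementary_weyl:
  "elementary E12 1 (elementary E23 1 (elementary E32 (- 1) (elementary E23 1 t))) =
    elementary E23 1 (elementary E32 (- 1) (elementary E23 1 (elementary E13 1 t)))"
  by (cases t) (simp add: scale_minus)


lemma (in group) comm_eqI:
  assumes "x \<in> carrier G" "y \<in> carrier G" "z \<in> carrier G" "x \<otimes> y = z \<otimes> (y \<otimes> x)"
  shows "comm G x y = z"
  using assms(1-3) by (simp add: comm_eq assms(4) m_assoc)

abbreviation frame_space :: "(((row \<times> row \<times> row) \<times> int) \<times> nat) set"
  where "frame_space \<equiv> (frames \<times> UNIV) \<times> UNIV"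

definition elementary_perm :: "root \<Rightarrow> int \<Rightarrow> ((row \<times> row \<times> row) \<times> int) \<times> nat \<Rightarrow> ((row \<times> row \<times> row) \<times> int) \<times> nat"
  where "elementary_perm r s = (\<lambda>((t, m), n)\<in>frame_space. ((elementary r s t, m), n))"

lemma elementary_perm_apply:
  "t \<in> frames \<Longrightarrow> elementary_perm r s ((t, m), n) = ((elementary r s t, m), n)"
  by (simp add: elementary_perm_def)

lemma elementary_perm_closed: "elementary_perm r s \<in> carrier (BijGroup frame_space)"
proof -
  have inv: "elementary r (- s) (elementary r s t) = t" "elementary r s (elementary r (- s) t) = t" for s t
    using elementary_add[of r "- s" s t] elementary_add[of r s "- s" t] by (simp_all add: elementary_0)
  have "bij_betw (elementary_perm r s) frame_space frame_space"
    by (rule bij_betw_byWitness[where f' = "elementary_perm r (- s)"])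
      (auto simp: elementary_perm_apply elementary_frames inv)
  then show ?thesis by (simp add: BijGroup_def Bij_def elementary_perm_def)
qed

lemma elementary_relations_perm: "elementary_relations (BijGroup frame_space) (\<lambda>r. elementary_perm r 1)"
proof -
  interpret Group.group "BijGroup frame_space" by (rule group_BijGroup)
  note c = elementary_perm_closed
  note ap = BijGroup_mult_apply elementary_perm_apply elementary_frames c m_closed
  have "comm (BijGroup frame_space) (elementary_perm (left_root r) 1) (elementary_perm (right_root r) 1)
      = elementary_perm r 1" for r
  proof (rule comm_eqI[OF c c c], rule BijGroup_eqI)
    fix y assume "y \<in> frame_space"
    then obtain t m n where y: "y = ((t, m), n)" "t \<in> frames" by auto
    then show "(elementary_perm (left_root r) 1 \<otimes>\<^bsub>BijGroup frame_space\<^esub> elementary_perm (right_root r) 1) y =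
      (elementary_perm r 1 \<otimes>\<^bsub>BijGroup frame_space\<^esub>
        (elementary_perm (right_root r) 1 \<otimes>\<^bsub>BijGroup frame_space\<^esub> elementary_perm (left_root r) 1)) y"
      by (simp add: ap elementary_comm)
  qed (intro m_closed c)+
  moreover have "inv\<^bsub>BijGroup frame_space\<^esub> elementary_perm E32 1 = elementary_perm E32 (- 1)"
  proof (rule inv_equality[OF _ c c], rule BijGroup_eqI)
    fix y assume "y \<in> frame_space"
    then obtain t m n where y: "y = ((t, m), n)" "t \<in> frames" by auto
    then show "(elementary_perm E32 (- 1) \<otimes>\<^bsub>BijGroup frame_space\<^esub> elementary_perm E32 1) y = \<one>\<^bsub>BijGroup frame_space\<^esub> y"
      using elementary_add[of E32 "- 1" 1 t] by (simp add: ap BijGroup_one_apply elementary_0)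
  qed (intro m_closed c one_closed)+
  then have w: "weyl (BijGroup frame_space) (\<lambda>r. elementary_perm r 1) = elementary_perm E23 1
      \<otimes>\<^bsub>BijGroup frame_space\<^esub> elementary_perm E32 (- 1) \<otimes>\<^bsub>BijGroup frame_space\<^esub> elementary_perm E23 1"
    by (simp add: weyl_def)
  have "elementary_perm E12 1 \<otimes>\<^bsub>BijGroup frame_space\<^esub> weyl (BijGroup frame_space) (\<lambda>r. elementary_perm r 1) =
      weyl (BijGroup frame_space) (\<lambda>r. elementary_perm r 1) \<otimes>\<^bsub>BijGroup frame_space\<^esub> elementary_perm E13 1"
    unfolding w
  proof (rule BijGroup_eqI)
    fix y assume "y \<in> frame_space"
    then obtain t m n where y: "y = ((t, m), n)" "t \<in> frames" by auto
    then show "(elementary_perm E12 1 \<otimes>\<^bsub>BijGroup frame_space\<^esub> (elementary_perm E23 1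
        \<otimes>\<^bsub>BijGroup frame_space\<^esub> elementary_perm E32 (- 1) \<otimes>\<^bsub>BijGroup frame_space\<^esub> elementary_perm E23 1)) y =
      (elementary_perm E23 1 \<otimes>\<^bsub>BijGroup frame_space\<^esub> elementary_perm E32 (- 1)
        \<otimes>\<^bsub>BijGroup frame_space\<^esub> elementary_perm E23 1 \<otimes>\<^bsub>BijGroup frame_space\<^esub> elementary_perm E13 1) y"
      by (simp add: ap elementary_weyl)
  qed (intro m_closed c)+
  ultimately show ?thesis by (simp add: elementary_relations_def c)
qed

text \<open>The first two coordinates act by the commuting row operations E12 and E13. The third
  shifts an additional integer that row operations leave alone, so it commutes with all of
  them.\<close>

definition frame_action :: "int \<times> int \<times> int \<Rightarrow> (row \<times> row \<times> row) \<times> int \<Rightarrow> (row \<times> row \<times> row) \<times> int"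
  where "frame_action = (\<lambda>(i, j, k) (t, m). (elementary E12 i (elementary E13 j t), m + k))"

lemma elementary_E12_E13: "elementary E13 j (elementary E12 i t) = elementary E12 i (elementary E13 j t)"
  by (cases t) (simp add: add_ac)

lemma free_action_frames: "free_action frame_action (frames \<times> UNIV)"
  unfolding free_action_def
proof (intro ballI conjI allI impI)
  fix s and u v :: "int \<times> int \<times> int" assume s: "s \<in> frames \<times> (UNIV :: int set)"
  obtain x y z m where xyz: "s = ((x, y, z), m)" "independent_rows x y z" using s by (auto simp: frames_def)
  obtain i j k where u: "u = (i, j, k)" by (cases u) auto
  obtain i' j' k' where v: "v = (i', j', k')" by (cases v) auto
  show "frame_action 0 s = s" by (simp add: frame_action_def zero_prod_def xyz(1))
  show "frame_action u s \<in> frames \<times> UNIV" using s by (cases s) (simp add: frame_action_def u elementary_frames)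
  show "frame_action (u + v) s = frame_action u (frame_action v s)"
    by (cases s) (simp add: frame_action_def u v elementary_add elementary_E12_E13)
  assume "frame_action u s = s"
  then have "k = 0" "scale i y + scale j z = 0" by (simp_all add: frame_action_def u xyz(1) add_ac)
  then show "u = 0" using xyz(2) unfolding independent_rows_def u
    by (metis add_0 scale_simps(1) zero_prod_def)
qed

lemma frames_nonempty: "frames \<noteq> {}"
proof -
  have "((1, 0, 0), (0, 1, 0), (0, 0, 1)) \<in> frames"
    by (simp add: frames_def independent_rows_def scale_def zero_prod_def)
  then show ?thesis by blast
qed

section \<open>Extension of free actions to the elementary relations\<close>

definition product_perm :: "('u \<Rightarrow> 's \<Rightarrow> 's) \<Rightarrow> 'u \<Rightarrow> 's \<times> nat \<Rightarrow> 's \<times> nat"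
  where "product_perm \<alpha> u = (\<lambda>(s, n). (\<alpha> u s, n))"

lemma product_perm_closed:
  assumes "free_action \<alpha> UNIV" shows "product_perm \<alpha> u \<in> carrier (BijGroup UNIV)"
proof -
  have "\<alpha> (- u) (\<alpha> u s) = s" "\<alpha> u (\<alpha> (- u) s) = s" for s
    using assms unfolding free_action_def by (metis UNIV_I add.left_inverse, metis UNIV_I add.right_inverse)
  then have "bij_betw (product_perm \<alpha> u) UNIV UNIV"
    by (intro bij_betw_byWitness[where f' = "product_perm \<alpha> (- u)"]) (auto simp: product_perm_def)
  then show ?thesis by (simp add: BijGroup_def Bij_def)
qed

text \<open>After multiplication with the natural numbers the given action is isomorphic to that on
  frames, where permutations for all six roots are at hand; conjugation carries them over. This does
  the work of an embedding theorem for amalgams: both copies can be realized on the same set with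
  prescribed E12 and E13.\<close>

lemma elementary_action_extends:
  fixes \<alpha> :: "int \<times> int \<times> int \<Rightarrow> 's :: countable \<Rightarrow> 's"
  assumes \<alpha>: "free_action \<alpha> UNIV"
  obtains f where "elementary_relations (BijGroup UNIV) f"
    "f E12 = product_perm \<alpha> (1, 0, 0)" "f E13 = product_perm \<alpha> (0, 1, 0)"
    "\<And>r. product_perm \<alpha> (0, 0, 1) \<otimes>\<^bsub>BijGroup UNIV\<^esub> f r = f r \<otimes>\<^bsub>BijGroup UNIV\<^esub> product_perm \<alpha> (0, 0, 1)"
proof -
  obtain g :: "'s \<times> nat \<Rightarrow> ((row \<times> row \<times> row) \<times> int) \<times> nat" where g: "bij_betw g (UNIV \<times> UNIV) frame_space"
    and eq: "\<And>u s n. s \<in> UNIV \<Longrightarrow> g (\<alpha> u s, n) = (frame_action u (fst (g (s, n))), snd (g (s, n)))"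
    using free_actions_isomorphic[OF \<alpha> countableI_type _ free_action_frames countableI_type] frames_nonempty by auto
  have gb: "bij_betw g UNIV frame_space" using g by simp
  have gi: "inv_into UNIV g (g x) = x" "g x \<in> frame_space" for x
    using gb by (auto simp: bij_betw_def inv_f_f)
  have gi': "g (inv_into UNIV g y) = y" if "y \<in> frame_space" for y
    using gb that by (simp add: bij_betw_def f_inv_into_f)
  define c where "c = (\<lambda>f. \<lambda>x\<in>UNIV. inv_into UNIV g (f (g x)))"
  interpret c: group_hom "BijGroup frame_space" "BijGroup (UNIV :: ('s \<times> nat) set)" c
    unfolding c_def by (rule BijGroup_conj[OF gb])
  have c_apply: "c f x = inv_into UNIV g (f (g x))" for f x by (simp add: c_def)
  define f where "f = (\<lambda>r. c (elementary_perm r 1))"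
  have f: "elementary_relations (BijGroup UNIV) f"
    unfolding f_def by (rule c.elementary_relations_hom[OF elementary_relations_perm])
  have fc: "f r \<in> carrier (BijGroup UNIV)" for r using f by (simp add: elementary_relations_def)
  have pg: "product_perm \<alpha> u x = inv_into UNIV g (frame_action u (fst (g x)), snd (g x))" for u x
    using gi(1)[of "product_perm \<alpha> u x"] eq[of "fst x" u "snd x"]
    by (simp add: product_perm_def case_prod_beta)
  have fx: "f r x = inv_into UNIV g (elementary_perm r 1 (g x))" for r x
    by (simp add: f_def c_apply)
  have split: "\<exists>t m n. g x = ((t, m), n) \<and> t \<in> frames" for x using gi(2)[of x] by auto
  have 1: "f E12 x = product_perm \<alpha> (1, 0, 0) x" "f E13 x = product_perm \<alpha> (0, 1, 0) x" for x
    using split[of x] by (auto simp: fx pg frame_action_def elementary_perm_apply elementary_0)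
  have 2: "product_perm \<alpha> (0, 0, 1) (f r x) = f r (product_perm \<alpha> (0, 0, 1) x)" for r x
  proof -
    obtain t m n where y: "g x = ((t, m), n)" "t \<in> frames" using split by blast
    have "g (f r x) = ((elementary r 1 t, m), n)"
      unfolding fx y(1) elementary_perm_apply[OF y(2)] by (rule gi') (simp add: elementary_frames y(2))
    moreover have "g (product_perm \<alpha> (0, 0, 1) x) = ((t, m + 1), n)"
      unfolding pg y(1) by (simp add: gi' y(2) frame_action_def elementary_0)
    ultimately show ?thesis
      unfolding pg[of _ "f r x"] fx[of _ "product_perm \<alpha> (0, 0, 1) x"]
      by (simp add: elementary_perm_apply y(2) frame_action_def elementary_0)
  qed
  show ?thesis
  proof (rule that[OF f])
    show "f E12 = product_perm \<alpha> (1, 0, 0)" "f E13 = product_perm \<alpha> (0, 1, 0)" using 1 by auto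
    fix r
    show "product_perm \<alpha> (0, 0, 1) \<otimes>\<^bsub>BijGroup UNIV\<^esub> f r = f r \<otimes>\<^bsub>BijGroup UNIV\<^esub> product_perm \<alpha> (0, 0, 1)"
      by (rule BijGroup_eqI[where B = UNIV]; (intro c.H.m_closed fc product_perm_closed[OF \<alpha>])?)
        (simp add: BijGroup_mult_apply fc product_perm_closed[OF \<alpha>] 2)
  qed
qed

text \<open>In both actions the third coordinate of the acting group is the central element t. The second
  coordinate acts on the first component by the affine maps \<open>q \<mapsto> q + 1\<close> and \<open>q \<mapsto> q / 2\<close>,
  respectively, which satisfy the Baumslag relation.\<close>

definition translation_action :: "int \<times> int \<times> int \<Rightarrow> rat \<times> int \<times> int \<times> int \<Rightarrow> rat \<times> int \<times> int \<times> int"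
  where "translation_action = (\<lambda>(i, j, k) (q, d, n, m). (q + of_int j, d, n + i, m + k))"

definition dilation_action :: "int \<times> int \<times> int \<Rightarrow> rat \<times> int \<times> int \<times> int \<Rightarrow> rat \<times> int \<times> int \<times> int"
  where "dilation_action = (\<lambda>(i, j, k) (q, d, n, m). (q * 2 powi (- j), d + j, n + i, m + i + k))"

lemma free_action_translation: "free_action translation_action UNIV"
  unfolding free_action_def by (auto simp: translation_action_def zero_prod_def)

text \<open>Dilations fix the point q = 0, so freeness in j rests on the coordinate d; the
  coordinates n and m take care of i and k.\<close>

lemma free_action_dilation: "free_action dilation_action UNIV"
  unfolding free_action_def
  by (auto simp: dilation_action_def zero_prod_def power_int_add power_int_minus power_int_diff field_simps)

lemma central_word_infinite_order:
  assumes "central_word [^]\<^bsub>FG\<^esub> (j :: int) \<in> presentation.N" shows "j = 0"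
proof -
  define B where "B = BijGroup (UNIV :: ((rat \<times> int \<times> int \<times> int) \<times> nat) set)"
  interpret B: Group.group B unfolding B_def by (rule group_BijGroup)
  define P where "P = product_perm translation_action"
  define D where "D = product_perm dilation_action"
  have c: "P u \<in> carrier B" "D u \<in> carrier B" for u
    unfolding P_def D_def B_def
    by (rule product_perm_closed[OF free_action_translation] product_perm_closed[OF free_action_dilation])+
  obtain f where f: "elementary_relations B f" "f E12 = P (1, 0, 0)" "f E13 = P (0, 1, 0)"
    "\<And>r. P (0, 0, 1) \<otimes>\<^bsub>B\<^esub> f r = f r \<otimes>\<^bsub>B\<^esub> P (0, 0, 1)"
    using elementary_action_extends[OF free_action_translation] unfolding P_def B_def by blast
  obtain g where g: "elementary_relations B g" "g E12 = D (1, 0, 0)" "g E13 = D (0, 1, 0)"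
    "\<And>r. D (0, 0, 1) \<otimes>\<^bsub>B\<^esub> g r = g r \<otimes>\<^bsub>B\<^esub> D (0, 0, 1)"
    using elementary_action_extends[OF free_action_dilation] unfolding D_def B_def by blast
  \<comment> \<open>The third coordinate acts in the same way in both actions, so one and the same t
    commutes with both extensions.\<close>
  have PD: "D (0, 0, k) = P (0, 0, k)" for k
    by (auto simp: P_def D_def product_perm_def translation_action_def dilation_action_def)
  have eqI: "x = y" if "x \<in> carrier B" "y \<in> carrier B" "\<And>s. x s = y s" for x y
    using BijGroup_eqI[of x UNIV y] that by (simp add: B_def)
  have ap: "(x \<otimes>\<^bsub>B\<^esub> y) s = x (y s)" if "x \<in> carrier B" "y \<in> carrier B" for x y s
    using BijGroup_mult_apply[of x UNIV y s] that by (simp add: B_def)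
  note def = P_def D_def product_perm_def translation_action_def dilation_action_def
  have "P (0, 0, 1) [^]\<^bsub>B\<^esub> j = \<one>\<^bsub>B\<^esub>"
  proof (rule central_word_int_pow[OF B.is_group f(1) g(1) _ c(1) _ f(4) g(4)[unfolded PD] assms])
    \<comment> \<open>On the first coordinate this is the identity q/2 + 1 = (q + 2)/2.\<close>
    show "f E13 \<otimes>\<^bsub>B\<^esub> g E13 = g E13 \<otimes>\<^bsub>B\<^esub> (f E13 \<otimes>\<^bsub>B\<^esub> f E13)"
      unfolding f(3) g(3)
      by (rule eqI; (intro B.m_closed c)?) (simp only: ap c B.m_closed, auto simp: def field_simps)
    \<comment> \<open>The summand i in the last coordinate of \<open>dilation_action\<close> is made
      for this equation.\<close>
    show "g E12 = f E12 \<otimes>\<^bsub>B\<^esub> P (0, 0, 1)"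
      unfolding f(2) g(2) by (rule eqI; (intro B.m_closed c)?) (simp only: ap c B.m_closed, auto simp: def)
  qed
  moreover have "P (0, 0, 1) [^]\<^bsub>B\<^esub> j = P (0, 0, j)"
  proof -
    have hom: "(\<lambda>k. P (0, 0, k)) \<in> hom integer_group B"
    proof (rule homI)
      fix k l :: int
      show "P (0, 0, k \<otimes>\<^bsub>integer_group\<^esub> l) = P (0, 0, k) \<otimes>\<^bsub>B\<^esub> P (0, 0, l)"
        by (rule eqI; (intro B.m_closed c)?) (simp only: ap c B.m_closed, auto simp: def)
    qed (rule c)
    interpret h: group_hom integer_group B "\<lambda>k. P (0, 0, k)"
      using hom by (simp add: group_hom_def group_hom_axioms_def B.is_group)
    show ?thesis using h.hom_int_pow[of 1 j] by simp
  qed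
  ultimately have "P (0, 0, j) = \<one>\<^bsub>B\<^esub>" by simp
  then have "P (0, 0, j) ((0, 0, 0, 0), 0) = ((0, 0, 0, 0), 0)"
    by (simp add: B_def BijGroup_one_apply)
  then show ?thesis by (simp add: def)
qed

section \<open>The counterexample\<close>

lemma finitely_generated_surj_hom:
  assumes "Group.group G" "Group.group H" "f \<in> hom G H" "f ` carrier G = carrier H" "finitely_generated G"
  shows "finitely_generated H"
proof -
  interpret f: group_hom G H f using assms by (simp add: group_hom_def group_hom_axioms_def)
  obtain S where S: "finite S" "S \<subseteq> carrier G" "generate G S = carrier G"
    using assms(5) by (auto simp: finitely_generated_def)
  then have "generate H (f ` S) = carrier H" using f.generate_img[OF S(2)] assms(4) by simp
  then show ?thesis using S(1,2) unfolding finitely_generated_def by (intro exI[of _ "f ` S"]) auto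
qed

lemma finitely_generated_DirProd:
  assumes G: "Group.group G" "finitely_generated G" and H: "Group.group H" "finitely_generated H"
  shows "finitely_generated (G \<times>\<times> H)"
proof -
  interpret G: Group.group G by (rule G)
  interpret H: Group.group H by (rule H)
  interpret P: Group.group "G \<times>\<times> H" by (rule DirProd_group[OF G(1) H(1)])
  interpret i: group_hom G "G \<times>\<times> H" "\<lambda>x. (x, \<one>\<^bsub>H\<^esub>)" by unfold_locales (auto simp: hom_def)
  interpret k: group_hom H "G \<times>\<times> H" "\<lambda>y. (\<one>\<^bsub>G\<^esub>, y)" by unfold_locales (auto simp: hom_def)
  obtain S where S: "finite S" "S \<subseteq> carrier G" "generate G S = carrier G"
    using G(2) by (auto simp: finitely_generated_def)
  obtain T where T: "finite T" "T \<subseteq> carrier H" "generate H T = carrier H"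
    using H(2) by (auto simp: finitely_generated_def)
  define U where "U = (\<lambda>x. (x, \<one>\<^bsub>H\<^esub>)) ` S \<union> (\<lambda>y. (\<one>\<^bsub>G\<^esub>, y)) ` T"
  have U: "finite U" "U \<subseteq> carrier (G \<times>\<times> H)" using S T by (auto simp: U_def)
  have sub: "subgroup (generate (G \<times>\<times> H) U) (G \<times>\<times> H)" by (rule P.generate_is_subgroup[OF U(2)])
  have "(x, y) \<in> generate (G \<times>\<times> H) U" if x: "x \<in> carrier G" and y: "y \<in> carrier H" for x y
  proof -
    have "(x, \<one>\<^bsub>H\<^esub>) \<in> generate (G \<times>\<times> H) ((\<lambda>x. (x, \<one>\<^bsub>H\<^esub>)) ` S)"
      using i.generate_img[OF S(2)] x S(3) by simp
    moreover have "(\<one>\<^bsub>G\<^esub>, y) \<in> generate (G \<times>\<times> H) ((\<lambda>y. (\<one>\<^bsub>G\<^esub>, y)) ` T)"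
      using k.generate_img[OF T(2)] y T(3) by simp
    ultimately have "(x, \<one>\<^bsub>H\<^esub>) \<in> generate (G \<times>\<times> H) U" "(\<one>\<^bsub>G\<^esub>, y) \<in> generate (G \<times>\<times> H) U"
      using P.mono_generate[of _ U] unfolding U_def by blast+
    from subgroup.m_closed[OF sub this] show ?thesis using x y by simp
  qed
  then have "generate (G \<times>\<times> H) U = carrier (G \<times>\<times> H)"
    using subgroup.subset[OF sub] by auto
  then show ?thesis using U by (auto simp: finitely_generated_def)
qed

lemma finitely_generated_integer_group: "finitely_generated integer_group"
proof -
  interpret Group.group integer_group by (rule group_integer_group)
  have "k \<in> generate integer_group {1}" for k :: int
    using subgroup_int_pow_closed[OF generate_is_subgroup[of "{1}"] generate.incl[of 1 "{1}"], of k] by simp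
  then have "generate integer_group {1 :: int} = carrier integer_group" by auto
  then show ?thesis unfolding finitely_generated_def by (intro exI[of _ "{1}"]) simp
qed

lemma finitely_generated_free_group: "finitely_generated (free_group :: (('a :: finite) \<times> bool) list monoid)"
  unfolding finitely_generated_def
  by (rule exI[of _ "range letter"]) (auto simp: generate_letters)

lemma residually_finite_free_group: "residually_finite (free_group :: (('a :: finite) \<times> bool) list monoid)"
proof (rule residually_finiteI[OF group_free_group])
  fix w :: "('a \<times> bool) list" assume w: "w \<in> carrier free_group" "w \<noteq> \<one>\<^bsub>free_group\<^esub>"
  then have "reduced w" "w \<noteq> []" by simp_all
  from free_group_finite_quotient[OF this]
  obtain H :: "(('a \<times> bool) list \<Rightarrow> ('a \<times> bool) list) monoid" and h
    where H: "Group.group H" "finite (carrier H)" "h \<in> hom free_group H" "h w \<noteq> \<one>\<^bsub>H\<^esub>" by blast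
  have "w \<notin> kernel free_group H h" using H(4) by (simp add: kernel_def)
  then show "\<exists>N \<in> finite_index_normal free_group. w \<notin> N"
    using finite_index_normal_kernel[OF H(3) group_free_group H(1,2)] by blast
qed

definition exponent_sum :: "('a \<times> bool) list \<Rightarrow> int"
  where "exponent_sum = free_hom integer_group (\<lambda>_. 1)"

lemma exponent_sum: "exponent_sum \<in> hom free_group integer_group" "exponent_sum (letter a) = 1"
  unfolding exponent_sum_def by (rule free_hom; simp add: group_integer_group)+

text \<open>The powers of the letter embed the integers into the free group on one letter; the
  exponent sum shows injectivity.\<close>

lemma residually_finite_integer_group: "residually_finite integer_group"
proof -
  let ?a = "letter () :: (unit \<times> bool) list"
  interpret e: group_hom "free_group :: (unit \<times> bool) list monoid" integer_group exponent_sum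
    using exponent_sum(1) by (simp add: group_hom_def group_hom_axioms_def group_free_group group_integer_group)
  show ?thesis
  proof (rule residually_finite_inj_hom[OF group_integer_group group_free_group _ _ residually_finite_free_group])
    have a: "?a \<in> carrier free_group" by simp
    show "(\<lambda>k. ?a [^]\<^bsub>free_group\<^esub> k) \<in> hom integer_group free_group"
      using group.hom_integer_group_pow[OF group_free_group a] by simp
    fix k :: int assume "?a [^]\<^bsub>free_group\<^esub> k = \<one>\<^bsub>free_group\<^esub>"
    then show "k = \<one>\<^bsub>integer_group\<^esub>"
      using e.hom_int_pow[OF a, of k] e.hom_one exponent_sum(2)[of "()"] by simp
  qed
qed

section \<open>Transport to groups on the natural numbers\<close>

lemma isomorphic_profinite_completions_trans:
  assumes "isomorphic_profinite_completions G H" "isomorphic_profinite_completions H K"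
  shows "isomorphic_profinite_completions G K"
  using assms unfolding isomorphic_profinite_completions_def
  by (meson homeomorphic_map_compose iso_set_trans)

lemma isomorphic_profinite_completions_inverse_homs:
  fixes G :: "'g monoid" and H :: "'h monoid"
  assumes G: "Group.group G" and H: "Group.group H" and f: "f \<in> hom G H" and f': "f' \<in> hom H G"
    and inv: "\<And>g. g \<in> carrier G \<Longrightarrow> f' (f g) = g" "\<And>h. h \<in> carrier H \<Longrightarrow> f (f' h) = h"
  shows "isomorphic_profinite_completions G H"
proof (rule isomorphic_profinite_completionsI[OF G H f])
  fix K h assume K: "K \<in> finite_index_normal H" and h: "h \<in> carrier H"
  have "h \<in> K #>\<^bsub>H\<^esub> h"
    using group.rcos_self[OF H h finite_index_normalD(2)[OF K]] .
  then show "\<exists>g \<in> carrier G. f g \<in> K #>\<^bsub>H\<^esub> h"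
    using inv(2)[OF h] hom_in_carrier[OF f' h] by (intro bexI[of _ "f' h"]) simp_all
next
  fix N assume "N \<in> finite_index_normal G"
  then show "\<exists>K \<in> finite_index_normal H. \<forall>g \<in> carrier G. f g \<in> K \<longrightarrow> g \<in> N"
    by (intro bexI[OF _ finite_index_normal_vimage[OF f' H G]]) (auto simp: inv)
qed

text \<open>This replaces triples of words and integers by a plain type of elements. The dimension
  bounds are proved for the copies themselves, with homomorphisms composed with
  \<open>from_nat\<close>, so the dimension never has to be transported.\<close>

definition nat_copy :: "'g :: countable monoid \<Rightarrow> nat monoid"
  where "nat_copy G = \<lparr>carrier = to_nat ` carrier G,
    monoid.mult = (\<lambda>m n. to_nat (from_nat m \<otimes>\<^bsub>G\<^esub> from_nat n :: 'g)), one = to_nat \<one>\<^bsub>G\<^esub>\<rparr>"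

lemma nat_copy:
  fixes G :: "'g :: countable monoid"
  assumes "Group.group G"
  shows "Group.group (nat_copy G)" "to_nat \<in> hom G (nat_copy G)" "from_nat \<in> hom (nat_copy G) G"
    "to_nat ` carrier G = carrier (nat_copy G)"
    "\<And>m. m \<in> carrier (nat_copy G) \<Longrightarrow> to_nat (from_nat m :: 'g) = m"
proof -
  interpret Group.group G by fact
  show "Group.group (nat_copy G)"
  proof (rule groupI)
    fix m assume "m \<in> carrier (nat_copy G)"
    then obtain g where "g \<in> carrier G" "m = to_nat g" by (auto simp: nat_copy_def)
    then show "\<exists>n \<in> carrier (nat_copy G). n \<otimes>\<^bsub>nat_copy G\<^esub> m = \<one>\<^bsub>nat_copy G\<^esub>"
      by (intro bexI[of _ "to_nat (inv\<^bsub>G\<^esub> g)"]) (simp_all add: nat_copy_def)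
  qed (auto simp: nat_copy_def m_assoc)
qed (auto simp: nat_copy_def hom_def)

lemma nat_copy_isomorphic_profinite_completions:
  fixes G :: "'g :: countable monoid"
  assumes G: "Group.group G"
  shows "isomorphic_profinite_completions G (nat_copy G)" "isomorphic_profinite_completions (nat_copy G) G"
  by (rule isomorphic_profinite_completions_inverse_homs[OF G nat_copy(1)[OF G] nat_copy(2,3)[OF G]]
      isomorphic_profinite_completions_inverse_homs[OF nat_copy(1)[OF G] G nat_copy(3,2)[OF G]];
    simp add: nat_copy(5)[OF G])+

lemma residually_finite_nat_copy:
  assumes G: "Group.group G" "residually_finite G" shows "residually_finite (nat_copy G)"
proof (rule residually_finite_inj_hom[OF nat_copy(1)[OF G(1)] G(1) nat_copy(3)[OF G(1)] _ G(2)])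
  fix m assume "m \<in> carrier (nat_copy G)" "from_nat m = \<one>\<^bsub>G\<^esub>"
  then show "m = \<one>\<^bsub>nat_copy G\<^esub>" by (auto simp: nat_copy_def)
qed

lemma finitely_generated_nat_copy:
  assumes G: "Group.group G" "finitely_generated G" shows "finitely_generated (nat_copy G)"
  by (rule finitely_generated_surj_hom[OF G(1) nat_copy(1,2,4)[OF G(1)] G(2)])

theorem proposition1p6:
  shows "\<exists>(\<Gamma>\<^sub>1 :: nat monoid) (\<Gamma>\<^sub>2 :: nat monoid).
    Group.group \<Gamma>\<^sub>1 \<and> finitely_generated \<Gamma>\<^sub>1 \<and> residually_finite \<Gamma>\<^sub>1 \<and>
    Group.group \<Gamma>\<^sub>2 \<and> finitely_generated \<Gamma>\<^sub>2 \<and> residually_finite \<Gamma>\<^sub>2 \<and>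
    isomorphic_profinite_completions \<Gamma>\<^sub>1 \<Gamma>\<^sub>2 \<and>
    cohomological_dimension \<Gamma>\<^sub>1 \<noteq> cohomological_dimension \<Gamma>\<^sub>2"
proof -
  obtain Q :: "copy_word set monoid" and \<pi>
    where \<pi>: "group_hom FG Q \<pi>" "\<pi> ` carrier FG = carrier Q"
    and \<pi>1: "\<And>g. g \<in> carrier FG \<Longrightarrow> \<pi> g = \<one>\<^bsub>Q\<^esub> \<longleftrightarrow> g \<in> presentation.N"
    using free_group.quotient_hom[OF presentation.N_normal] by metis
  interpret p: group_hom FG Q \<pi> by fact
  have ker: "kernel FG Q \<pi> = presentation.N"
    using \<pi>1 subgroup.subset[OF normal_imp_subgroup[OF presentation.N_normal]] unfolding kernel_def by blast
  have cF: "central_word \<in> carrier FG" by (rule words_closed)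
  interpret fibre_pair FG Q \<pi> "\<pi> central_word"
  proof
    show "\<pi> central_word \<in> carrier Q" by (rule p.hom_closed[OF cF])
    fix u assume "u \<in> carrier Q"
    then obtain g where g: "g \<in> carrier FG" "u = \<pi> g" using \<pi>(2) by blast
    have "comm FG central_word g \<in> presentation.N"
      by (rule presentation.commutes_mod_N[OF _ g(1)]) (simp add: central_words_def)
    then show "\<pi> central_word \<otimes>\<^bsub>Q\<^esub> u = u \<otimes>\<^bsub>Q\<^esub> \<pi> central_word"
      using p.comm_kernel_iff[OF cF g(1)] \<pi>1[OF free_group.comm_closed[OF cF g(1)]] by (simp add: g(2))
  qed (use p.homh \<pi>(2) in blast)+
  have z: "j = 0" if "\<pi> central_word [^]\<^bsub>Q\<^esub> (j :: int) = \<one>\<^bsub>Q\<^esub>" for j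
    using central_word_infinite_order[of j] \<pi>1[OF free_group.int_pow_closed[OF cF]] pi_int_pow[OF cF, of j] that by simp
  note nA = nat_copy[OF group_ambient] and nP = nat_copy[OF P.is_group]
  have RA: "residually_finite ambient"
    unfolding ambient_def
    by (intro residually_finite_DirProd DirProd_group group_free_group group_integer_group
        residually_finite_free_group residually_finite_integer_group)
  have RP: "residually_finite fibre_group"
    by (rule residually_finite_inj_hom[OF P.is_group group_ambient incl_hom _ RA]) simp
  have FA: "finitely_generated ambient"
    unfolding ambient_def
    by (intro finitely_generated_DirProd DirProd_group group_free_group group_integer_group
        finitely_generated_free_group finitely_generated_integer_group)
  have FP: "finitely_generated fibre_group"
  proof (rule finitely_generated_fibre_group)
    show "finite (range letter :: copy_word set)" by simp
    show "range letter \<subseteq> carrier FG" by auto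
    show "generate FG (range letter) = carrier FG" by (rule generate_letters)
    show "finite presentation.T"
      by (simp add: presentation.T_def presentation.S_def finite_central_words del: free_group_simps)
    show "presentation.T \<subseteq> ker_pi" unfolding ker by (rule presentation.T_N)
    show "ker_pi \<subseteq> K" if "K \<lhd> FG" "presentation.T \<subseteq> K" for K
      unfolding ker by (rule presentation.N_least[OF that])
  qed
  have "isomorphic_profinite_completions fibre_group ambient"
    by (rule isomorphic_profinite_completions_fibre_group; unfold ker)
      (rule presentation.no_finite_quotient presentation.finite_extension_splits; assumption)+
  then have iso: "isomorphic_profinite_completions (nat_copy fibre_group) (nat_copy ambient)"
    using isomorphic_profinite_completions_trans nat_copy_isomorphic_profinite_completions group_ambient P.is_group
    by meson
  \<comment> \<open>The homomorphisms are the exponent sums of the two words and the integer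
    coordinate. Dual to them are a letter in either free factor and the generator of the integers,
    which commute as they lie in different factors.\<close>
  have dA: "3 \<le> cohomological_dimension (nat_copy ambient)"
  proof (rule cohomological_dimension_ge_3[OF nA(1)])
    let ?l = "letter (False, E12) :: copy_word"
    have e: "exponent_sum [] = 0"
      using hom_one[OF exponent_sum(1) group_free_group group_integer_group] by simp
    have em: "exponent_sum (u \<otimes>\<^bsub>FG\<^esub> v) = exponent_sum u + exponent_sum v"
      if "u \<in> carrier FG" "v \<in> carrier FG" for u v :: copy_word
      using hom_mult[OF exponent_sum(1) that] by simp
    have "(\<lambda>g. exponent_sum (fst g)) \<in> hom ambient integer_group"
      "(\<lambda>g. exponent_sum (fst (snd g))) \<in> hom ambient integer_group"
      "(\<lambda>g. snd (snd g)) \<in> hom ambient integer_group"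
      by (auto intro!: homI simp: em simp del: free_group_simps)
    from this[THEN hom_compose[OF nA(3)]]
    show "(\<lambda>m. exponent_sum (fst (from_nat m :: copy_word \<times> copy_word \<times> int))) \<in> hom (nat_copy ambient) integer_group"
      "(\<lambda>m. exponent_sum (fst (snd (from_nat m :: copy_word \<times> copy_word \<times> int)))) \<in> hom (nat_copy ambient) integer_group"
      "(\<lambda>m. snd (snd (from_nat m :: copy_word \<times> copy_word \<times> int))) \<in> hom (nat_copy ambient) integer_group"
      by (simp_all add: o_def)
    let ?x = "to_nat (?l, [] :: copy_word, 0 :: int)"
    let ?y = "to_nat ([] :: copy_word, ?l, 0 :: int)"
    let ?z = "to_nat ([] :: copy_word, [] :: copy_word, 1 :: int)"
    show "?x \<in> carrier (nat_copy ambient)" "?y \<in> carrier (nat_copy ambient)" "?z \<in> carrier (nat_copy ambient)"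
      by (simp_all add: nA(4)[symmetric])
    show "?x \<otimes>\<^bsub>nat_copy ambient\<^esub> ?y = ?y \<otimes>\<^bsub>nat_copy ambient\<^esub> ?x"
      "?x \<otimes>\<^bsub>nat_copy ambient\<^esub> ?z = ?z \<otimes>\<^bsub>nat_copy ambient\<^esub> ?x"
      "?y \<otimes>\<^bsub>nat_copy ambient\<^esub> ?z = ?z \<otimes>\<^bsub>nat_copy ambient\<^esub> ?y"
      by (simp_all add: nat_copy_def letter_def)
  qed (simp_all add: exponent_sum(2) hom_one[OF exponent_sum(1) group_free_group group_integer_group, simplified])
  \<comment> \<open>The two projections to free groups are jointly injective because z has infinite
    order: a common kernel element has the form (1, 1, j), and the fibre condition says that the
    j-th power of z is trivial.\<close>
  have dP: "cohomological_dimension (nat_copy fibre_group) \<le> 2"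
  proof (rule cohomological_dimension_le_2)
    have "fst \<in> hom fibre_group FG" "(\<lambda>g. fst (snd g)) \<in> hom fibre_group FG"
      by (auto intro!: homI simp: fibre_iff simp del: free_group_simps)
    from this[THEN hom_compose[OF nP(3)]]
    show "(\<lambda>m. fst (from_nat m :: copy_word \<times> copy_word \<times> int)) \<in> hom (nat_copy fibre_group) FG"
      "(\<lambda>m. fst (snd (from_nat m :: copy_word \<times> copy_word \<times> int))) \<in> hom (nat_copy fibre_group) FG"
      by (simp_all add: o_def)
    fix m assume m: "m \<in> carrier (nat_copy fibre_group)"
      and eq: "fst (from_nat m :: copy_word \<times> copy_word \<times> int) = []"
        "fst (snd (from_nat m :: copy_word \<times> copy_word \<times> int)) = []"
    obtain x y j where xyz: "m = to_nat (x, y, j)" "(x, y, j) \<in> fibre"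
      using m by (auto simp: nat_copy_def)
    then have xy: "x = []" "y = []" using eq by simp_all
    have "\<pi> [] = \<one>\<^bsub>Q\<^esub>" using p.hom_one by simp
    then have "\<pi> central_word [^]\<^bsub>Q\<^esub> j = \<one>\<^bsub>Q\<^esub>"
      using xyz(2) z_pow_closed[of j] by (simp add: fibre_iff xy)
    then have "j = 0" by (rule z)
    then show "m = \<one>\<^bsub>nat_copy fibre_group\<^esub>" by (simp add: nat_copy_def xyz(1) xy)
  qed
  have "(2 :: enat) < 3" by simp
  then have "cohomological_dimension (nat_copy fibre_group) < cohomological_dimension (nat_copy ambient)"
    using dA dP by (meson le_less_trans less_le_trans)
  then have d: "cohomological_dimension (nat_copy fibre_group) \<noteq> cohomological_dimension (nat_copy ambient)" by simp
  show ?thesis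
    by (rule exI[of _ "nat_copy fibre_group"], rule exI[of _ "nat_copy ambient"])
      (use d iso nA(1) nP(1) finitely_generated_nat_copy[OF group_ambient FA] finitely_generated_nat_copy[OF P.is_group FP]
        residually_finite_nat_copy[OF group_ambient RA] residually_finite_nat_copy[OF P.is_group RP] in blast)
qed

end
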